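(* Let $\theta_0$ satisfy Assumption (A), let $\Sigma$ be a symmetric positive definite $k\times k$ matrix, let the radial density $f$ satisfy Assumption (B1), and let the score functions $K_1,K_2$ satisfy Assumption (C). Let $i\ge1$ be a fixed integer and write $$\Gamma^{(n)}_{i;K;\Sigma,f}(\theta_0):=\Sigma'^{-1/2}\Big(\frac1{n-i}\sum_{t=i+1}^nK_1(\tilde F_k(d_t))\,K_2(\tilde F_k(d_{t-i}))\,U_tU_{t-i}'\Big)\Sigma'^{1/2}.$$ Then $\mathrm{vec}\big(\tilde\Gamma^{(n)}_{i;K}(\theta_0)-\Gamma^{(n)}_{i;K;\Sigma,f}(\theta_0)\big)$ is $o_{\mathrm P}(n^{-1/2})$ under $\mathcal{H}^{(n)}(\theta_0,\Sigma,f)$ as $n\to\infty$.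
   Context: Primes denote transposes. **Model.** Fix $k\ge1$ and integers $0\le p_0\le p_1$, $0\le q_0\le q_1$. The VARMA$(p_1,q_1)$ model is $X_t-\sum_{i=1}^{p_1}A_iX_{t-i}=\varepsilon_t+\sum_{i=1}^{q_1}B_i\varepsilon_{t-i}$ with real $k\times k$ matrices and parameter $\theta=((\mathrm{vec}A_1)',\dots,(\mathrm{vec}A_{p_1})',(\mathrm{vec}B_1)',\dots,(\mathrm{vec}B_{q_1})')'$. The value $\theta_0$ is fixed, with $A_i=0$ for $i>p_0$ and $B_i=0$ for $i>q_0$; below $A_i,B_i$ are the matrices of $\theta_0$. Assumption (A): $\det A_{p_0}\ne0\neq\det B_{q_0}$ (void for zero order), all complex roots of $\det(I_k-\sum_{i=1}^{p_0}A_iz^i)$ and of $\det(I_k+\sum_{i=1}^{q_0}B_iz^i)$ lie outside the unit ball, and the greatest common left divisor of these matrix polynomials is $I_k$. **Innovations.** Assumption (B1): $f:(0,\infty)\to[0,\infty)$, $f>0$ a.e., $\mu_{k-1;f}:=\int_0^\infty r^{k-1}f(r)\,dr<\infty$. For $\Sigma$ symmetric positive definite, $\mathcal{H}^{(n)}(\theta,\Sigma,f)$ is the hypothesis under which $(X_1,\dots,X_n)$ is generated by the model with parameter $\theta$ and i.i.d. innovations with density $c_{k,f}(\det\Sigma)^{-1/2}f((z'\Sigma^{-1}z)^{1/2})$, $c_{k,f}$ the normalizing constant. $\tilde F_k$ is the distribution function of the density $\tilde f_k(r)=r^{k-1}f(r)/\mu_{k-1;f}$ on $(0,\infty)$. All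 initial values ($X_t,\varepsilon_t$, $t\le0$) are set to zero. Residuals: $Z_t:=X_t-\sum_{i=1}^{p_0}A_iX_{t-i}-\sum_{i=1}^{q_0}B_iZ_{t-i}$, $t=1,\dots,n$, with $X_t=Z_t=0$ for $t\le0$. $\Sigma^{-1/2}$ is the unique upper triangular matrix with positive diagonal such that $\Sigma^{-1}=(\Sigma^{-1/2})'\Sigma^{-1/2}$; $\Sigma^{1/2}$ is its inverse; $\Sigma'^{\pm1/2}:=(\Sigma^{\pm1/2})'$. Put $d_t:=\|\Sigma^{-1/2}Z_t\|$, $U_t:=\Sigma^{-1/2}Z_t/d_t$. **Scores.** Assumption (C): $K_1,K_2:(0,1)\to\mathbb{R}$ are continuous differences of two monotone increasing functions, with $\int_0^1K_\ell(u)^2du<\infty$, $\ell=1,2$. **Tyler matrix, ranks.** For $n>k(k-1)$, $C^{(n)}_{\rm Tyl}$ is the unique upper triangular $k\times k$ matrix with positive diagonal and upper left entry $1$ such that $\frac1n\sum_{t=1}^n\frac{C^{(n)}_{\rm Tyl}Z_t(C^{(n)}_{\rm Tyl}Z_t)'}{\|C^{(n)}_{\rm Tyl}Z_t\|^2}=\frac1kI_k$. Put $W_t:=C^{(n)}_{\rm Tyl}Z_t/\|C^{(n)}_{\rm Tyl}Z_t\|$ and let $\hat R_t$ be the rank of $\|C^{(n)}_{\rm Tyl}Z_t\|$ among $\|C^{(n)}_{\rm Tyl}Z_1\|,\dots,\|C^{(n)}_{\rm Tyl}Z_n\|$. The $K$-cross-covariance matrix of lag $i$ is $$\tilde\Gamma^{(n)}_{i;K}(\theta_0):=C^{(n)\prime}_{\rm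 Tyl}\Big(\frac1{n-i}\sum_{t=i+1}^nK_1\Big(\frac{\hat R_t}{n+1}\Big)K_2\Big(\frac{\hat R_{t-i}}{n+1}\Big)W_tW_{t-i}'\Big)(C^{(n)\prime}_{\rm Tyl})^{-1}.$$
   Formalization: In Assumption (C) the two monotone increasing functions whose difference is the score are themselves required to be square integrable on (0,1); with only the score square integrable the claim fails, e.g. for k=1, K_2=1 and K_1 with narrow high spikes at the points 1/m. *)

theory Defs
  imports "HOL-Probability.Probability" "HOL-Computational_Algebra.Polynomial"
begin

text \<open>The index type carries its order so that triangular matrices make sense; the least index
  plays the role of the first row or column.\<close>

definition upper_triangular :: "real^'k::{finite,wellorder}^'k::{finite,wellorder} \<Rightarrow> bool" where
  "upper_triangular M \<longleftrightarrow> (\<forall>a b. b < a \<longrightarrow> M $ a $ b = 0)"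

definition sym_pos_def :: "real^'k^'k \<Rightarrow> bool" where
  "sym_pos_def S \<longleftrightarrow> transpose S = S \<and> (\<forall>z. z \<noteq> 0 \<longrightarrow> 0 < z \<bullet> (S *v z))"

definition inv_sqrt_mat ::
    "real^'k::{finite,wellorder}^'k::{finite,wellorder} \<Rightarrow>
     real^'k::{finite,wellorder}^'k::{finite,wellorder}" where
  "inv_sqrt_mat S = (THE T. upper_triangular T \<and> (\<forall>a. 0 < T $ a $ a) \<and>
     matrix_inv S = transpose T ** T)"

definition sqrt_mat ::
    "real^'k::{finite,wellorder}^'k::{finite,wellorder} \<Rightarrow>
     real^'k::{finite,wellorder}^'k::{finite,wellorder}" where
  "sqrt_mat S = matrix_inv (inv_sqrt_mat S)"

definition outer_prod :: "real^'k \<Rightarrow> real^'k \<Rightarrow> real^'k^'k" where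
  "outer_prod x y = (\<chi> a b. x $ a * y $ b)"

text \<open>The stacked columns of a matrix, indexed by pairs (column, row).\<close>

definition vec_mat :: "real^'k^'k \<Rightarrow> real^('k \<times> 'k)" where
  "vec_mat M = (\<chi> c. M $ snd c $ fst c)"

text \<open>The parameter is the pair of coefficient sequences \<open>A, B\<close>, only the entries with indices
  from 1 to the respective order being used.\<close>

definition ar_poly :: "nat \<Rightarrow> (nat \<Rightarrow> real^'k^'k) \<Rightarrow> real poly^'k^'k" where
  "ar_poly p A = mat 1 - (\<Sum>l=1..p. \<chi> a b. monom (A l $ a $ b) l)"

definition ma_poly :: "nat \<Rightarrow> (nat \<Rightarrow> real^'k^'k) \<Rightarrow> real poly^'k^'k" where
  "ma_poly q B = mat 1 + (\<Sum>l=1..q. \<chi> a b. monom (B l $ a $ b) l)"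

definition roots_outside_unit_ball :: "real poly \<Rightarrow> bool" where
  "roots_outside_unit_ball g \<longleftrightarrow>
     (\<forall>z::complex. poly (map_poly complex_of_real g) z = 0 \<longrightarrow> 1 < norm z)"

definition left_divisor :: "real poly^'k^'k \<Rightarrow> real poly^'k^'k \<Rightarrow> bool" where
  "left_divisor D P \<longleftrightarrow> (\<exists>E. P = D ** E)"

definition greatest_common_left_divisor ::
    "real poly^'k^'k \<Rightarrow> real poly^'k^'k \<Rightarrow> real poly^'k^'k \<Rightarrow> bool" where
  "greatest_common_left_divisor D P Q \<longleftrightarrow> left_divisor D P \<and> left_divisor D Q \<and>
     (\<forall>C. left_divisor C P \<and> left_divisor C Q \<longrightarrow> left_divisor C D)"

definition assumption_A ::
    "nat \<Rightarrow> nat \<Rightarrow> (nat \<Rightarrow> real^'k^'k) \<Rightarrow> (nat \<Rightarrow> real^'k^'k) \<Rightarrow> bool" where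
  "assumption_A p0 q0 A B \<longleftrightarrow>
     (0 < p0 \<longrightarrow> det (A p0) \<noteq> 0) \<and> (0 < q0 \<longrightarrow> det (B q0) \<noteq> 0) \<and>
     roots_outside_unit_ball (det (ar_poly p0 A)) \<and>
     roots_outside_unit_ball (det (ma_poly q0 B)) \<and>
     greatest_common_left_divisor (mat 1) (ar_poly p0 A) (ma_poly q0 B)"

text \<open>The value of the series \<open>x\<close> at time \<open>t - l\<close>, all values at nonpositive times being zero.\<close>

definition lagged :: "(nat \<Rightarrow> real^'k) \<Rightarrow> nat \<Rightarrow> nat \<Rightarrow> real^'k" where
  "lagged x t l = (if l < t then x (t - l) else 0)"

definition varma_equation ::
    "nat \<Rightarrow> nat \<Rightarrow> (nat \<Rightarrow> real^'k^'k) \<Rightarrow> (nat \<Rightarrow> real^'k^'k) \<Rightarrow>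
     (nat \<Rightarrow> real^'k) \<Rightarrow> (nat \<Rightarrow> real^'k) \<Rightarrow> nat \<Rightarrow> bool" where
  "varma_equation p q A B e x t \<longleftrightarrow>
     x t - (\<Sum>l=1..p. A l *v lagged x t l) = e t + (\<Sum>l=1..q. B l *v lagged e t l)"

text \<open>The guard \<open>l < t\<close> unfolds \<^const>\<open>lagged\<close> in the recursive call.\<close>

fun residual ::
    "nat \<Rightarrow> nat \<Rightarrow> (nat \<Rightarrow> real^'k^'k) \<Rightarrow> (nat \<Rightarrow> real^'k^'k) \<Rightarrow>
     (nat \<Rightarrow> real^'k) \<Rightarrow> nat \<Rightarrow> real^'k" where
  "residual p q A B x t = (if t = 0 then 0 else
     x t - (\<Sum>l=1..p. A l *v lagged x t l)
         - (\<Sum>l\<in>{1..q}. if l < t then B l *v residual p q A B x (t - l) else 0))"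

declare residual.simps [simp del]

definition radial_moment :: "nat \<Rightarrow> (real \<Rightarrow> real) \<Rightarrow> real" where
  "radial_moment m f = (LBINT r:{0<..}. r ^ m * f r)"

text \<open>Values of \<open>f\<close> outside the positive half-line are irrelevant. Integrability of
  \<open>r ^ (k - 1) * f r\<close> includes the measurability of \<open>f\<close> there.\<close>

definition assumption_B1 :: "nat \<Rightarrow> (real \<Rightarrow> real) \<Rightarrow> bool" where
  "assumption_B1 k f \<longleftrightarrow> (\<forall>r>0. 0 \<le> f r) \<and> (AE r in lborel. 0 < r \<longrightarrow> 0 < f r) \<and>
     set_integrable lborel {0<..} (\<lambda>r. r ^ (k - 1) * f r)"

definition radial_density :: "nat \<Rightarrow> (real \<Rightarrow> real) \<Rightarrow> real \<Rightarrow> real" where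
  "radial_density k f r = (if 0 < r then r ^ (k - 1) * f r / radial_moment (k - 1) f else 0)"

definition radial_cdf :: "nat \<Rightarrow> (real \<Rightarrow> real) \<Rightarrow> real \<Rightarrow> real" where
  "radial_cdf k f = cdf (density lborel (\<lambda>r. ennreal (radial_density k f r)))"

definition elliptical_density :: "real^'k^'k \<Rightarrow> (real \<Rightarrow> real) \<Rightarrow> real^'k \<Rightarrow> real" where
  "elliptical_density S f z =
     inverse (\<integral>y. f (norm (y :: real^'k)) \<partial>lborel) * det S powr (- 1 / 2) *
     f (sqrt (z \<bullet> (matrix_inv S *v z)))"

definition varma_hypothesis ::
    "nat \<Rightarrow> nat \<Rightarrow> (nat \<Rightarrow> real^'k^'k) \<Rightarrow> (nat \<Rightarrow> real^'k^'k) \<Rightarrow> real^'k^'k \<Rightarrow> (real \<Rightarrow> real) \<Rightarrow>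
     nat \<Rightarrow> 'a measure \<Rightarrow> (nat \<Rightarrow> 'a \<Rightarrow> real^'k) \<Rightarrow> bool" where
  "varma_hypothesis p q A B S f n M X \<longleftrightarrow> prob_space M \<and>
     (\<exists>e. prob_space.indep_vars M (\<lambda>_. borel) e {1..n} \<and>
        (\<forall>t\<in>{1..n}. distributed M lborel (e t) (\<lambda>z. ennreal (elliptical_density S f z))) \<and>
        (\<forall>t\<in>{1..n}. \<forall>\<omega>\<in>space M. varma_equation p q A B (\<lambda>s. e s \<omega>) (\<lambda>s. X s \<omega>) t))"

text \<open>The monotone parts are required to be square integrable, as usual for rank scores
  (Hajek and Sidak). Square integrability of the difference alone does not control
  \<open>K (r / (n + 1))\<close>: narrow continuous spikes of \<open>K\<close> at the points \<open>1 / (n + 1)\<close> are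
  compatible with it and with local bounded variation, and may be arbitrarily high.\<close>

definition assumption_C :: "(real \<Rightarrow> real) \<Rightarrow> bool" where
  "assumption_C K \<longleftrightarrow> continuous_on {0<..<1} K \<and>
     (\<exists>G H. mono_on {0<..<1} G \<and> mono_on {0<..<1} H \<and> (\<forall>u\<in>{0<..<1}. K u = G u - H u) \<and>
        set_integrable lborel {0<..<1} (\<lambda>u. (G u)\<^sup>2) \<and>
        set_integrable lborel {0<..<1} (\<lambda>u. (H u)\<^sup>2)) \<and>
     set_integrable lborel {0<..<1} (\<lambda>u. (K u)\<^sup>2)"

text \<open>Signs are \<open>v /\<^sub>R norm v\<close>, that is \<^const>\<open>sgn\<close>. The value of the definite
  description is meaningful for \<open>n > k * (k - 1)\<close> only, and then almost surely.\<close>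

definition tyler_matrix ::
    "nat \<Rightarrow> (nat \<Rightarrow> real^'k::{finite,wellorder}) \<Rightarrow>
     real^'k::{finite,wellorder}^'k::{finite,wellorder}" where
  "tyler_matrix n Z = (THE C. upper_triangular C \<and> (\<forall>a. 0 < C $ a $ a) \<and>
     C $ (LEAST a. True) $ (LEAST a. True) = 1 \<and>
     (1 / real n) *\<^sub>R (\<Sum>t=1..n. outer_prod (sgn (C *v Z t)) (sgn (C *v Z t)))
       = (1 / real CARD('k)) *\<^sub>R mat 1)"

definition rank_among :: "nat \<Rightarrow> (nat \<Rightarrow> real) \<Rightarrow> nat \<Rightarrow> nat" where
  "rank_among n d t = card {s \<in> {1..n}. d s \<le> d t}"

definition rank_cross_cov ::
    "(real \<Rightarrow> real) \<Rightarrow> (real \<Rightarrow> real) \<Rightarrow> nat \<Rightarrow> nat \<Rightarrow> (nat \<Rightarrow> real^'k::{finite,wellorder}) \<Rightarrow>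
     real^'k::{finite,wellorder}^'k::{finite,wellorder}" where
  "rank_cross_cov K1 K2 i n Z =
     (let C = tyler_matrix n Z;
          W = (\<lambda>t. sgn (C *v Z t));
          R = rank_among n (\<lambda>t. norm (C *v Z t))
      in transpose C **
         ((1 / (real n - real i)) *\<^sub>R (\<Sum>t=i+1..n.
            (K1 (real (R t) / (real n + 1)) * K2 (real (R (t - i)) / (real n + 1))) *\<^sub>R
            outer_prod (W t) (W (t - i)))) **
         matrix_inv (transpose C))"

definition elliptical_cross_cov ::
    "(real \<Rightarrow> real) \<Rightarrow> (real \<Rightarrow> real) \<Rightarrow> real^'k::{finite,wellorder}^'k::{finite,wellorder} \<Rightarrow>
     (real \<Rightarrow> real) \<Rightarrow> nat \<Rightarrow> nat \<Rightarrow>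
     (nat \<Rightarrow> real^'k::{finite,wellorder}) \<Rightarrow> real^'k::{finite,wellorder}^'k::{finite,wellorder}" where
  "elliptical_cross_cov K1 K2 S f i n Z =
     (let d = (\<lambda>t. norm (inv_sqrt_mat S *v Z t));
          U = (\<lambda>t. sgn (inv_sqrt_mat S *v Z t));
          F = radial_cdf CARD('k) f
      in transpose (inv_sqrt_mat S) **
         ((1 / (real n - real i)) *\<^sub>R (\<Sum>t=i+1..n.
            (K1 (F (d t)) * K2 (F (d (t - i)))) *\<^sub>R outer_prod (U t) (U (t - i)))) **
         transpose (sqrt_mat S))"

text \<open>Outer measure is used because the measure of a nonmeasurable set is 0 by convention, and
  measurability of \<open>Y n\<close> is not assumed; for measurable \<open>Y n\<close> this is the usual notion.\<close>

definition small_o_prob ::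
    "(nat \<Rightarrow> 'a measure) \<Rightarrow> (nat \<Rightarrow> 'a \<Rightarrow> 'b::real_normed_vector) \<Rightarrow> (nat \<Rightarrow> real) \<Rightarrow> bool" where
  "small_o_prob M Y c \<longleftrightarrow> (\<forall>\<epsilon>>0.
     (\<lambda>n. outer_measure_of (M n) {\<omega> \<in> space (M n). \<epsilon> * c n < norm (Y n \<omega>)}) \<longlonglongrightarrow> 0)"

end

theory Submission
  imports Defs
begin

text \<open>
  \<^bold>\<open>Reduction to spherical samples.\<close> At the true parameter, with zero initial values, the residuals are the
  innovations (\<open>residual_eq_innovation\<close>). Tyler's matrix is equivariant: if \<open>y t = T z t\<close> with \<open>T\<close> upper
  triangular and positive on the diagonal, then the matrices for \<open>z\<close> are those for \<open>y\<close> times \<open>T\<close>, up to a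
  positive factor. The standardized signs and the ranks agree for \<open>y\<close> and \<open>z\<close>, so the rank based
  cross-covariance of \<open>z\<close> is that of \<open>y\<close> conjugated by the transpose of \<open>T\<close>
  (\<open>rank_cross_cov_transform\<close>). The population version transforms in the same way. For
  \<open>T = inv_sqrt_mat Sigma\<close> the sample \<open>y\<close> consists of independent observations with a spherical density
  (\<open>whitened_law\<close>).

  \<^bold>\<open>Consistency without a rate suffices.\<close> For a spherical sample Tyler's matrix and the ranks are invariant
  under reflections of single observations. Hence the difference of the summands of index \<open>t\<close> in the
  two cross-covariances is odd in observation \<open>t\<close> and even in all later ones, and differences of
  different indices are orthogonal. The sum of \<open>n\<close> of them is of order \<open>sqrt n\<close> times the root mean square
  of one (\<open>orthogonal_tail_bound\<close>), and it is enough that the latter tends to 0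
  (\<open>summand_gap_mean_square\<close>). The remaining conjugation by Tyler's matrix multiplies a sum of order
  \<open>sqrt n\<close> by a factor near 1 (\<open>conjugation_near_identity\<close>).

  \<^bold>\<open>Mean squares of the summands.\<close> When Tyler's matrix is near the identity, signs change little and
  normalized ranks are uniformly close to the distribution function of the norm (\<open>rank_close\<close>). Unbounded
  scores are approximated in mean square by bounded uniformly continuous ones
  (\<open>score_approximation\<close>). For scores of ranks the mean square is, by exchangeability, an average over
  pairs of ranks (\<open>exchange_bound\<close>), that is a Riemann sum; monotonicity of the two parts of a score function
  bounds it by an integral over the tails.

  \<^bold>\<open>Tyler's matrix.\<close> Tyler's equation is the critical equation of a function of triangular matrices. Its
  second order expansion at the identity depends on second and fourth moments of the signs only, and is
  positive definite for the moments of the law. When the empirical moments are close to these, as they are with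
  high probability, a minimum is attained near the identity
  (\<open>tyler_solution_near_identity\<close>). Two solutions coincide by a study of the direction in which one stretches
  most relative to the other (\<open>tyler_solution_unique\<close>).
\<close>

section \<open>Triangular matrices\<close>

definition pos_triangular ::
    "real^'k::{finite,wellorder}^'k::{finite,wellorder} \<Rightarrow> bool" where
  "pos_triangular M \<longleftrightarrow> upper_triangular M \<and> (\<forall>a. 0 < M $ a $ a)"

lemma matrix_mult_nth: "(A ** B) $ a $ b = (\<Sum>c\<in>UNIV. A $ a $ c * B $ c $ b)"
  by (simp add: matrix_matrix_mult_def)

lemma matrix_vector_mult_nth: "(A *v x) $ a = (\<Sum>b\<in>UNIV. A $ a $ b * x $ b)"
  by (simp add: matrix_vector_mult_def)

lemma matrix_inv_unique:
  fixes A B :: "real^'n^'n"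
  assumes "A ** B = mat 1" "B ** A = mat 1"
  shows "matrix_inv A = B"
proof -
  have "A ** matrix_inv A = mat 1 \<and> matrix_inv A ** A = mat 1"
    unfolding matrix_inv_def by (rule someI[where x = B]) (simp add: assms)
  then show ?thesis by (metis assms(2) matrix_mul_assoc matrix_mul_lid matrix_mul_rid)
qed

lemma scaleR_matrix_mult: "(c *\<^sub>R A) ** B = c *\<^sub>R (A ** B)"
  for A :: "real^'n^'m"
  by (rule scalar_matrix_assoc[symmetric])

lemma matrix_mult_scaleR: "A ** (c *\<^sub>R B) = c *\<^sub>R (A ** B)"
  for A :: "real^'n^'m"
  by (simp add: matrix_scalar_ac scaleR_matrix_mult)

lemma upper_triangular_mult:
  assumes M: "upper_triangular M" and N: "upper_triangular N"
  shows "upper_triangular (M ** N)" and "(M ** N) $ a $ a = M $ a $ a * N $ a $ a"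
proof -
  have z: "M $ a $ c * N $ c $ b = 0" if "b < a \<or> (b = a \<and> c \<noteq> a)" for a b c
  proof (cases "c < a")
    case True then show ?thesis using M by (auto simp: upper_triangular_def)
  next
    case False
    then have "b < c" using that by auto
    then show ?thesis using N by (auto simp: upper_triangular_def)
  qed
  show "upper_triangular (M ** N)"
    unfolding upper_triangular_def matrix_mult_nth
    by (intro allI impI sum.neutral ballI z) simp
  have "(\<Sum>c\<in>UNIV. M $ a $ c * N $ c $ a) =
        (\<Sum>c\<in>UNIV. if c = a then M $ a $ a * N $ a $ a else 0)"
    by (rule sum.cong) (use z in auto)
  then show "(M ** N) $ a $ a = M $ a $ a * N $ a $ a"
    by (simp add: matrix_mult_nth)
qed

lemma pos_triangular_mult:
  "pos_triangular M \<Longrightarrow> pos_triangular N \<Longrightarrow> pos_triangular (M ** N)"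
  by (simp add: pos_triangular_def upper_triangular_mult)

lemma pos_triangular_scaleR:
  "pos_triangular M \<Longrightarrow> 0 < s \<Longrightarrow> pos_triangular (s *\<^sub>R M)"
  by (simp add: pos_triangular_def upper_triangular_def)

lemma det_pos_triangular:
  "pos_triangular M \<Longrightarrow> det M = (\<Prod>a\<in>UNIV. M $ a $ a)"
  by (rule det_upperdiagonal) (simp add: pos_triangular_def upper_triangular_def)

lemma det_pos_triangular_pos: "pos_triangular M \<Longrightarrow> 0 < det M"
  by (simp add: det_pos_triangular prod_pos pos_triangular_def)

text \<open>If column \<open>b\<close> of the inverse had nonzero entries below the diagonal, the lowest of them, in row
  \<open>m\<close>, would alone contribute to the entry \<open>(m, b)\<close> of the product, which is 0.\<close>

lemma pos_triangular_inverse: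
  assumes M: "pos_triangular M"
  obtains N where "pos_triangular N" "M ** N = mat 1" "N ** M = mat 1" "matrix_inv M = N"
proof -
  have "invertible M"
    using det_pos_triangular_pos[OF M] by (simp add: invertible_det_nz)
  then obtain N where N: "M ** N = mat 1" "N ** M = mat 1" by (auto simp: invertible_def)
  have up: "N $ a $ b = 0" if "b < a" for a b
  proof (rule ccontr)
    define bad where "bad = {c. b < c \<and> N $ c $ b \<noteq> 0}"
    assume "N $ a $ b \<noteq> 0"
    then have "bad \<noteq> {}" "finite bad" using that by (auto simp: bad_def)
    define m where "m = Max bad"
    have m: "b < m" "N $ m $ b \<noteq> 0"
      using Max_in[OF \<open>finite bad\<close> \<open>bad \<noteq> {}\<close>] by (auto simp: m_def bad_def)
    have later: "N $ c $ b = 0" if "m < c" for c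
    proof (rule ccontr)
      assume "N $ c $ b \<noteq> 0"
      then have "c \<in> bad" using that m by (auto simp: bad_def)
      then have "c \<le> m" using \<open>finite bad\<close> by (simp add: m_def)
      then show False using that by simp
    qed
    have "0 = (M ** N) $ m $ b" using m by (simp add: N mat_def)
    also have "\<dots> = (\<Sum>c\<in>UNIV. if c = m then M $ m $ m * N $ m $ b else 0)"
      unfolding matrix_mult_nth
    proof (rule sum.cong)
      fix c
      show "M $ m $ c * N $ c $ b = (if c = m then M $ m $ m * N $ m $ b else 0)"
      proof (cases c m rule: linorder_cases)
        case less
        then have "M $ m $ c = 0" using M by (simp add: pos_triangular_def upper_triangular_def)
        then show ?thesis using less by simp
      next
        case greater
        then show ?thesis using later[of c] by simp
      qed simp
    qed simp
    finally have "M $ m $ m * N $ m $ b = 0" by simp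
    then show False using m M unfolding pos_triangular_def by (metis less_irrefl mult_eq_0_iff)
  qed
  have upN: "upper_triangular N" using up by (simp add: upper_triangular_def)
  have "0 < N $ a $ a" for a
  proof -
    have "M $ a $ a * N $ a $ a = (M ** N) $ a $ a"
      using M upN by (simp add: upper_triangular_mult pos_triangular_def)
    also have "\<dots> = 1" by (simp add: N mat_def)
    finally show ?thesis
      using M by (metis pos_triangular_def zero_less_mult_pos zero_less_one)
  qed
  then have "pos_triangular N" using upN by (simp add: pos_triangular_def)
  then show ?thesis using that N matrix_inv_unique by blast
qed

text \<open>The transpose of \<open>M\<close> is \<open>l\<close> times its inverse, so \<open>M\<close> is both upper and lower triangular.\<close>

lemma pos_triangular_orthogonal:
  assumes M: "pos_triangular M" and eq: "transpose M ** M = l *\<^sub>R mat 1"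
  shows "M = sqrt l *\<^sub>R mat 1"
proof -
  obtain N where N: "pos_triangular N" "M ** N = mat 1" "N ** M = mat 1"
    using pos_triangular_inverse[OF M] by blast
  have "transpose M = transpose M ** (M ** N)" by (simp add: N)
  also have "\<dots> = (l *\<^sub>R mat 1) ** N" by (simp add: matrix_mul_assoc eq)
  also have "\<dots> = l *\<^sub>R N" by (simp add: scaleR_matrix_mult)
  finally have tr: "transpose M = l *\<^sub>R N" .
  have low: "M $ a $ b = 0" if "a \<noteq> b" for a b
  proof (cases "b < a")
    case True then show ?thesis using M by (simp add: pos_triangular_def upper_triangular_def)
  next
    case False
    then have "a < b" using that by simp
    have "M $ a $ b = transpose M $ b $ a" by (simp add: transpose_def)
    also have "\<dots> = 0"
      using N(1) \<open>a < b\<close> unfolding tr by (simp add: pos_triangular_def upper_triangular_def)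
    finally show ?thesis .
  qed
  have diag: "M $ a $ a = sqrt l" for a
  proof -
    have "l = (transpose M ** M) $ a $ a" by (simp add: eq mat_def)
    also have "\<dots> = (\<Sum>c\<in>UNIV. if c = a then M $ a $ a * M $ a $ a else 0)"
      unfolding matrix_mult_nth by (rule sum.cong) (auto simp: transpose_def low)
    also have "\<dots> = (M $ a $ a)\<^sup>2" by (simp add: power2_eq_square)
    finally show ?thesis
      using M by (metis pos_triangular_def real_sqrt_unique less_imp_le)
  qed
  show ?thesis
    by (simp add: vec_eq_iff mat_def low diag)
qed

lemma cholesky_unique:
  assumes M: "pos_triangular M" and N: "pos_triangular N"
    and eq: "transpose M ** M = l *\<^sub>R (transpose N ** N)"
  shows "M = sqrt l *\<^sub>R N"
proof -
  obtain R where R: "pos_triangular R" "N ** R = mat 1" "R ** N = mat 1"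
    using pos_triangular_inverse[OF N] by blast
  have "transpose (M ** R) ** (M ** R) = transpose R ** (transpose M ** M) ** R"
    by (simp add: matrix_transpose_mul matrix_mul_assoc)
  also have "\<dots> = l *\<^sub>R (transpose (N ** R) ** (N ** R))"
    by (simp add: eq matrix_transpose_mul matrix_mul_assoc matrix_mult_scaleR scaleR_matrix_mult)
  also have "\<dots> = l *\<^sub>R mat 1" by (simp add: R transpose_mat)
  finally have "M ** R = sqrt l *\<^sub>R mat 1"
    by (intro pos_triangular_orthogonal pos_triangular_mult M R(1))
  then have "M ** R ** N = sqrt l *\<^sub>R N" by (simp add: scaleR_matrix_mult)
  then show ?thesis by (simp add: matrix_mul_assoc[symmetric] R)
qed

text \<open>Row \<open>a\<close> of the factor is, up to a scalar, the vector that has zero coordinates before \<open>a\<close> and is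
  orthogonal, for the inner product given by \<open>S\<close>, to the coordinate vectors after \<open>a\<close>. It solves a
  linear system that is regular because \<open>S\<close> is positive definite.\<close>

lemma cholesky_exists:
  fixes S :: "real^'k::{finite,wellorder}^'k::{finite,wellorder}"
  assumes S: "sym_pos_def S"
  obtains T where "pos_triangular T" "T ** S ** transpose T = mat 1"
proof -
  have ex: "\<exists>v. (\<forall>b<a. v $ b = 0) \<and> (\<forall>b\<ge>a. (S *v v) $ b = (if b = a then 1 else 0))" for a
  proof -
    define N :: "real^'k::{finite,wellorder}^'k::{finite,wellorder}" where
      "N = (\<chi> b c. if a \<le> b then S $ b $ c else if b = c then 1 else 0)"
    have Nv: "(N *v v) $ b = (if a \<le> b then (S *v v) $ b else v $ b)" for v b
    proof (cases "a \<le> b")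
      case False
      then have "(N *v v) $ b = (\<Sum>c\<in>UNIV. if c = b then v $ b else 0)"
        unfolding matrix_vector_mult_nth by (intro sum.cong) (auto simp: N_def)
      then show ?thesis using False by simp
    qed (simp add: matrix_vector_mult_nth N_def)
    have "v = 0" if "N *v v = 0" for v
    proof (rule ccontr)
      assume "v \<noteq> 0"
      have "v $ b * (S *v v) $ b = 0" for b
        using Nv[of v b] that by (auto split: if_splits)
      then have "v \<bullet> (S *v v) = 0" unfolding inner_vec_def by (intro sum.neutral) simp
      then show False using S \<open>v \<noteq> 0\<close> by (auto simp: sym_pos_def_def)
    qed
    then have "invertible N"
      by (simp add: invertible_left_inverse matrix_left_invertible_ker)
    then obtain v where "N *v v = axis a 1"
      by (metis invertible_def matrix_vector_mul_assoc matrix_vector_mul_lid)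
    then have v: "(if a \<le> b then (S *v v) $ b else v $ b) = (if b = a then 1 else 0)" for b
      using Nv[of v b] by (auto simp: axis_def)
    have "v $ b = 0" if "b < a" for b
      using v[of b] not_le[THEN iffD2, OF that] less_imp_neq[OF that] by simp
    moreover have "(S *v v) $ b = (if b = a then 1 else 0)" if "a \<le> b" for b
      using v[of b] that by auto
    ultimately show ?thesis by blast
  qed
  then obtain v where v0: "\<And>a b. b < a \<Longrightarrow> v a $ b = 0"
    and Sv: "\<And>a b. a \<le> b \<Longrightarrow> (S *v v a) $ b = (if b = a then 1 else 0)" by metis
  have form: "v b \<bullet> (S *v v a) = (if a = b then v a $ a else 0)" if "a \<le> b" for a b
  proof -
    have "v b \<bullet> (S *v v a) = (\<Sum>c\<in>UNIV. if c = a then v b $ a else 0)"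
      unfolding inner_vec_def
    proof (rule sum.cong)
      fix c show "v b $ c \<bullet> (S *v v a) $ c = (if c = a then v b $ a else 0)"
        using v0[of c b] Sv[of a c] that by (cases "c < b") auto
    qed simp
    also have "\<dots> = (if a = b then v a $ a else 0)" using v0[of a b] that by auto
    finally show ?thesis .
  qed
  have sym: "x \<bullet> (S *v y) = y \<bullet> (S *v x)" for x y
    using S by (metis dot_lmul_matrix inner_commute sym_pos_def_def transpose_matrix_vector)
  have pos: "0 < v a $ a" for a
  proof -
    have "v a \<noteq> 0"
      using Sv[of a a] by auto
    then have "0 < v a \<bullet> (S *v v a)" using S by (simp add: sym_pos_def_def)
    then show ?thesis using form[of a a] by simp
  qed
  define T :: "real^'k::{finite,wellorder}^'k::{finite,wellorder}" where "T = (\<chi> a. (1 / sqrt (v a $ a)) *\<^sub>R v a)"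
  have "pos_triangular T"
    using pos v0 by (auto simp: pos_triangular_def upper_triangular_def T_def)
  moreover have "T ** S ** transpose T = mat 1"
  proof -
    have ent: "(T ** S ** transpose T) $ a $ b = T $ b \<bullet> (S *v (T $ a))" for a b
    proof -
      have "(T ** S ** transpose T) $ a $ b = (\<Sum>c\<in>UNIV. (\<Sum>d\<in>UNIV. T $ a $ d * S $ d $ c) * T $ b $ c)"
        by (simp add: matrix_mult_nth transpose_def)
      also have "\<dots> = (\<Sum>c\<in>UNIV. (transpose S *v (T $ a)) $ c * T $ b $ c)"
        by (simp add: matrix_vector_mult_nth transpose_def mult.commute)
      also have "\<dots> = T $ b \<bullet> (S *v (T $ a))"
        using S by (simp add: sym_pos_def_def inner_vec_def mult.commute)
      finally show ?thesis .
    qed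
    have "T $ b \<bullet> (S *v (T $ a)) = (if a = b then 1 else 0)" for a b
    proof -
      have "T $ b \<bullet> (S *v (T $ a)) = (1 / sqrt (v b $ b)) * (1 / sqrt (v a $ a)) * (v b \<bullet> (S *v v a))"
        by (simp add: T_def matrix_vector_mult_scaleR)
      also have "v b \<bullet> (S *v v a) = (if a = b then v a $ a else 0)"
        using form[of a b] form[of b a] sym[of "v a" "v b"] by (cases "a \<le> b") auto
      finally show ?thesis using pos[of a] by auto
    qed
    then show ?thesis by (simp add: vec_eq_iff ent mat_def)
  qed
  ultimately show ?thesis using that by blast
qed

lemma inv_sqrt_mat_properties:
  assumes S: "sym_pos_def S"
  shows "pos_triangular (inv_sqrt_mat S)"
    and "matrix_inv S = transpose (inv_sqrt_mat S) ** inv_sqrt_mat S"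
proof -
  obtain T where T: "pos_triangular T" "T ** S ** transpose T = mat 1"
    using cholesky_exists[OF S] by blast
  obtain N where N: "T ** N = mat 1" "N ** T = mat 1"
    using pos_triangular_inverse[OF T(1)] by blast
  have "S ** transpose T = N"
    by (metis N(2) T(2) matrix_mul_assoc matrix_mul_lid matrix_mul_rid)
  then have "S ** (transpose T ** T) = mat 1" by (simp add: matrix_mul_assoc N)
  moreover from this have "(transpose T ** T) ** S = mat 1"
    using matrix_left_right_inverse by blast
  ultimately have inv: "matrix_inv S = transpose T ** T" by (rule matrix_inv_unique)
  have "inv_sqrt_mat S = T"
    unfolding inv_sqrt_mat_def
  proof (rule the_equality)
    show "upper_triangular T \<and> (\<forall>a. 0 < T $ a $ a) \<and> matrix_inv S = transpose T ** T"
      using T(1) inv unfolding pos_triangular_def by blast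
    fix R assume R: "upper_triangular R \<and> (\<forall>a. 0 < R $ a $ a) \<and> matrix_inv S = transpose R ** R"
    then have "pos_triangular R" by (simp add: pos_triangular_def)
    moreover have "transpose R ** R = 1 *\<^sub>R (transpose T ** T)"
      using R inv by (metis scaleR_one)
    ultimately have "R = sqrt 1 *\<^sub>R T" using T(1) by (intro cholesky_unique)
    then show "R = T" by simp
  qed
  then show "pos_triangular (inv_sqrt_mat S)"
    and "matrix_inv S = transpose (inv_sqrt_mat S) ** inv_sqrt_mat S"
    using T inv by simp_all
qed

section \<open>Frobenius norms\<close>

lemma norm_vec_sq: "(norm (x :: 'a::real_inner^'n))\<^sup>2 = (\<Sum>a\<in>UNIV. (norm (x $ a))\<^sup>2)"
  by (simp add: power2_norm_eq_inner inner_vec_def)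

lemma norm_real_vec_sq: "(norm (x :: real^'n))\<^sup>2 = (\<Sum>a\<in>UNIV. (x $ a)\<^sup>2)"
  by (simp add: norm_vec_sq)

lemma norm_matrix_sq: "(norm (A :: real^'n^'m))\<^sup>2 = (\<Sum>a\<in>UNIV. \<Sum>b\<in>UNIV. (A $ a $ b)\<^sup>2)"
  by (simp add: norm_vec_sq[of A] norm_real_vec_sq)

lemma norm_matrix_vector_mult_le: "norm (A *v x) \<le> norm (A :: real^'n^'m) * norm x"
proof -
  have "(norm (A *v x))\<^sup>2 = (\<Sum>a\<in>UNIV. (A $ a \<bullet> x)\<^sup>2)"
    by (simp add: norm_real_vec_sq inner_vec_def matrix_vector_mult_def)
  also have "\<dots> \<le> (\<Sum>a\<in>UNIV. (norm (A $ a))\<^sup>2 * (norm x)\<^sup>2)"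
    by (intro sum_mono) (metis Cauchy_Schwarz_ineq power2_norm_eq_inner)
  also have "\<dots> = (norm A * norm x)\<^sup>2"
    by (simp only: power_mult_distrib sum_distrib_right[symmetric] norm_vec_sq[of A])
  finally show ?thesis by (rule power2_le_imp_le) simp
qed

lemma norm_transpose: "norm (transpose A) = norm (A :: real^'n^'m)"
proof -
  have "(norm (transpose A))\<^sup>2 = (norm A)\<^sup>2"
    unfolding norm_matrix_sq transpose_def by (simp add: sum.swap[where A = "UNIV :: 'n set"])
  then show ?thesis by (simp add: power2_eq_iff_nonneg)
qed

lemma norm_matrix_mult_le: "norm (A ** B) \<le> norm (A :: real^'n^'m) * norm (B :: real^'p^'n)"
proof -
  have "(A ** B) $ a = transpose B *v (A $ a)" for a
    by (simp add: vec_eq_iff matrix_mult_nth matrix_vector_mult_nth transpose_def mult.commute)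
  then have "(norm (A ** B))\<^sup>2 = (\<Sum>a\<in>UNIV. (norm (transpose B *v (A $ a)))\<^sup>2)"
    by (simp add: norm_vec_sq[of "A ** B"])
  also have "\<dots> \<le> (\<Sum>a\<in>UNIV. (norm B * norm (A $ a))\<^sup>2)"
    using norm_matrix_vector_mult_le[of "transpose B"]
    by (intro sum_mono power_mono) (auto simp: norm_transpose)
  also have "\<dots> = (norm A * norm B)\<^sup>2"
    by (simp add: power_mult_distrib sum_distrib_left[symmetric] mult.commute norm_vec_sq[of A])
  finally show ?thesis by (rule power2_le_imp_le) simp
qed

section \<open>Third order bounds for the logarithm\<close>

text \<open>The cubic remainder has to be explicit because the objective below is expanded uniformly over
  samples and directions. The difference of the two sides is monotone on either side of 0, where it
  vanishes.\<close>

lemma ln_one_plus_lower: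
  fixes x :: real
  assumes "\<bar>x\<bar> \<le> 1/2"
  shows "x - x\<^sup>2 / 2 - \<bar>x\<bar> ^ 3 \<le> ln (1 + x)"
proof (cases "0 \<le> x")
  case True
  have "(\<lambda>x. ln (1 + x) - x + x\<^sup>2 / 2) 0 \<le> (\<lambda>x. ln (1 + x) - x + x\<^sup>2 / 2 :: real) x"
  proof (rule DERIV_nonneg_imp_nondecreasing[OF True])
    fix y :: real assume y: "0 \<le> y" "y \<le> x"
    have d1: "((\<lambda>x. ln (1 + x) - x + x\<^sup>2 / 2) has_real_derivative (1 / (1 + y) - 1 + y)) (at y)"
      using y by - (rule derivative_eq_intros refl | simp)+
    have d2: "1 / (1 + y) - 1 + y = y\<^sup>2 / (1 + y)"
      using y(1) by (simp add: divide_simps) (simp add: power2_eq_square algebra_simps)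
    have d3: "0 \<le> y\<^sup>2 / (1 + y)" using y(1) by simp
    show "\<exists>d. ((\<lambda>x. ln (1 + x) - x + x\<^sup>2 / 2) has_real_derivative d) (at y) \<and> 0 \<le> d"
      by (intro exI conjI, rule d1, simp only: d2, rule d3)
  qed
  then have "0 \<le> (ln (1 + x) - x + x\<^sup>2 / 2)" by simp
  moreover have "0 \<le> \<bar>x\<bar> ^ 3" by simp
  ultimately show ?thesis by linarith
next
  case False
  define y where "y = - x"
  have y: "0 \<le> y" "y \<le> 1/2" using False assms by (auto simp: y_def)
  have "(\<lambda>x. ln (1 - x) + x + x\<^sup>2 / 2 + x ^ 3) 0 \<le> (\<lambda>x. ln (1 - x) + x + x\<^sup>2 / 2 + x ^ 3 :: real) y"
  proof (rule DERIV_nonneg_imp_nondecreasing[OF y(1)])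
    fix w :: real assume "0 \<le> w" "w \<le> y"
    then have w: "0 \<le> w" "w \<le> 1/2" using y by auto
    have d1: "((\<lambda>x. ln (1 - x) + x + x\<^sup>2 / 2 + x ^ 3) has_real_derivative
        (- 1 / (1 - w) + 1 + w + 3 * w\<^sup>2)) (at w)"
      using w by - (rule derivative_eq_intros refl | simp)+
    have d2: "- 1 / (1 - w) + 1 + w + 3 * w\<^sup>2 = w\<^sup>2 * (2 - 3 * w) / (1 - w)"
      using w by (simp add: divide_simps) (simp add: power2_eq_square algebra_simps)
    have d3: "0 \<le> w\<^sup>2 * (2 - 3 * w) / (1 - w)"
      using w by (intro divide_nonneg_nonneg mult_nonneg_nonneg) auto
    show "\<exists>d. ((\<lambda>x. ln (1 - x) + x + x\<^sup>2 / 2 + x ^ 3) has_real_derivative d) (at w) \<and> 0 \<le> d"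
      by (intro exI conjI, rule d1, simp only: d2, rule d3)
  qed
  then show ?thesis using y by (simp add: y_def)
qed

lemma ln_one_plus_upper:
  fixes x :: real
  assumes "\<bar>x\<bar> \<le> 1/2"
  shows "ln (1 + x) \<le> x - x\<^sup>2 / 2 + \<bar>x\<bar> ^ 3"
proof (cases "0 \<le> x")
  case True
  have "(\<lambda>x. x - x\<^sup>2 / 2 + x ^ 3 - ln (1 + x)) 0 \<le> (\<lambda>x. x - x\<^sup>2 / 2 + x ^ 3 - ln (1 + x) :: real) x"
  proof (rule DERIV_nonneg_imp_nondecreasing[OF True])
    fix y :: real assume y: "0 \<le> y" "y \<le> x"
    have d1: "((\<lambda>x. x - x\<^sup>2 / 2 + x ^ 3 - ln (1 + x)) has_real_derivative (1 - y + 3 * y\<^sup>2 - 1 / (1 + y))) (at y)"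
      using y by - (rule derivative_eq_intros refl | simp)+
    have d2: "1 - y + 3 * y\<^sup>2 - 1 / (1 + y) = y\<^sup>2 * (2 + 3 * y) / (1 + y)"
      using y(1) by (simp add: divide_simps) (simp add: power2_eq_square algebra_simps)
    have d3: "0 \<le> y\<^sup>2 * (2 + 3 * y) / (1 + y)"
      using y by (intro divide_nonneg_nonneg mult_nonneg_nonneg) auto
    show "\<exists>d. ((\<lambda>x. x - x\<^sup>2 / 2 + x ^ 3 - ln (1 + x)) has_real_derivative d) (at y) \<and> 0 \<le> d"
      by (intro exI conjI, rule d1, simp only: d2, rule d3)
  qed
  then show ?thesis using True by simp
next
  case False
  define y where "y = - x"
  have y: "0 \<le> y" "y \<le> 1/2" using False assms by (auto simp: y_def)
  have "(\<lambda>x. - x - x\<^sup>2 / 2 - ln (1 - x)) 0 \<le> (\<lambda>x. - x - x\<^sup>2 / 2 - ln (1 - x) :: real) y"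
  proof (rule DERIV_nonneg_imp_nondecreasing[OF y(1)])
    fix w :: real assume "0 \<le> w" "w \<le> y"
    then have w: "0 \<le> w" "w \<le> 1/2" using y by auto
    have d1: "((\<lambda>x. - x - x\<^sup>2 / 2 - ln (1 - x)) has_real_derivative (- 1 - w + 1 / (1 - w))) (at w)"
      using w by - (rule derivative_eq_intros refl | simp)+
    have d2: "- 1 - w + 1 / (1 - w) = w\<^sup>2 / (1 - w)"
      using w by (simp add: divide_simps) (simp add: power2_eq_square algebra_simps)
    have d3: "0 \<le> w\<^sup>2 / (1 - w)" using w by simp
    show "\<exists>d. ((\<lambda>x. - x - x\<^sup>2 / 2 - ln (1 - x)) has_real_derivative d) (at w) \<and> 0 \<le> d"
      by (intro exI conjI, rule d1, simp only: d2, rule d3)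
  qed
  then have "ln (1 + x) \<le> x - x\<^sup>2 / 2" by (simp add: y_def)
  moreover have "0 \<le> \<bar>x\<bar> ^ 3" by simp
  ultimately show ?thesis by linarith
qed

section \<open>Empirical averages and Tyler's equation\<close>

definition avg :: "nat \<Rightarrow> ('b \<Rightarrow> real) \<Rightarrow> (nat \<Rightarrow> 'b) \<Rightarrow> real" where
  "avg n \<phi> z = (\<Sum>t=1..n. \<phi> (z t)) / real n"

lemma avg_add: "avg n (\<lambda>y. \<phi> y + \<psi> y) z = avg n \<phi> z + avg n \<psi> z"
  by (simp add: avg_def sum.distrib add_divide_distrib)

lemma avg_diff: "avg n (\<lambda>y. \<phi> y - \<psi> y) z = avg n \<phi> z - avg n \<psi> z"
  by (simp add: avg_def sum_subtractf diff_divide_distrib)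

lemma avg_cmult: "avg n (\<lambda>y. c * \<phi> y) z = c * avg n \<phi> z"
  by (simp add: avg_def sum_distrib_left)

lemma avg_sum: "avg n (\<lambda>y. \<Sum>i\<in>I. \<phi> i y) z = (\<Sum>i\<in>I. avg n (\<phi> i) z)"
  unfolding avg_def by (simp add: sum_divide_distrib[symmetric] sum.swap[of _ I])

lemma avg_const: "1 \<le> n \<Longrightarrow> avg n (\<lambda>y. c) z = c"
  by (simp add: avg_def)

lemma avg_mono:
  "(\<And>t. t \<in> {1..n} \<Longrightarrow> \<phi> (z t) \<le> \<psi> (z t)) \<Longrightarrow> avg n \<phi> z \<le> avg n \<psi> z"
  unfolding avg_def by (intro divide_right_mono sum_mono) auto

lemma avg_cong:
  "(\<And>t. t \<in> {1..n} \<Longrightarrow> \<phi> (z t) = \<psi> (z t)) \<Longrightarrow> avg n \<phi> z = avg n \<psi> z"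
  unfolding avg_def by (metis (mono_tags, lifting) sum.cong)

text \<open>The position of the diagonal entry by which Tyler's matrix is normalized.\<close>

definition first_index :: "'k::{finite,wellorder}" where
  "first_index = (LEAST a. True)"

lemma mat_1_nth: "mat 1 $ a $ b = (if a = b then 1 else 0)"
  by (simp add: mat_def)

lemma first_index_le: "first_index \<le> (a :: 'k::{finite,wellorder})"
  by (simp add: first_index_def Least_le)

text \<open>The definite description of Tyler's matrix ranges over these matrices. With the equation in terms
  of empirical averages, symmetries of averages carry over to the set of solutions.\<close>

definition tyler_solution ::
    "nat \<Rightarrow> (nat \<Rightarrow> real^'k::{finite,wellorder}) \<Rightarrow>
     real^'k::{finite,wellorder}^'k::{finite,wellorder} \<Rightarrow> bool" where
  "tyler_solution n z C \<longleftrightarrow> pos_triangular C \<and> C $ first_index $ first_index = 1 \<and>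
     (\<forall>a b. avg n (\<lambda>y. sgn (C *v y) $ a * sgn (C *v y) $ b) z =
       (if a = b then 1 / real CARD('k) else 0))"

lemma tyler_matrix_eq:
  fixes z :: "nat \<Rightarrow> real^'k::{finite,wellorder}"
  shows "tyler_matrix n z = (THE C. tyler_solution n z C)"
proof -
  have "((1 / real n) *\<^sub>R (\<Sum>t=1..n. outer_prod (sgn (C *v z t)) (sgn (C *v z t)))
       = (1 / real CARD('k)) *\<^sub>R mat 1) \<longleftrightarrow>
     (\<forall>a b. avg n (\<lambda>y. sgn (C *v y) $ a * sgn (C *v y) $ b) z =
       (if a = b then 1 / real CARD('k) else 0))" (is "?L = ?R \<longleftrightarrow> _")
    for C :: "real^'k::{finite,wellorder}^'k::{finite,wellorder}"
  proof -
    have "?L $ a $ b = avg n (\<lambda>y. sgn (C *v y) $ a * sgn (C *v y) $ b) z" for a b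
      by (simp add: avg_def outer_prod_def)
    moreover have "?R $ a $ b = (if a = b then 1 / real CARD('k) else 0)" for a b
      by (simp add: mat_def)
    ultimately show ?thesis by (simp only: vec_eq_iff)
  qed
  then show ?thesis
    unfolding tyler_matrix_def tyler_solution_def first_index_def pos_triangular_def conj_assoc by presburger
qed

lemma tyler_matrixI:
  assumes "tyler_solution n z C" "\<And>C'. tyler_solution n z C' \<Longrightarrow> C' = C"
  shows "tyler_matrix n z = C"
  unfolding tyler_matrix_eq using assms by (rule the_equality)

lemma sgn_matrix_vector_sgn: "sgn (C *v sgn y) = sgn (C *v (y :: real^'n))"
proof -
  have "sgn (C *v sgn y) = sgn (inverse (norm y) *\<^sub>R (C *v y))"
    by (simp add: sgn_div_norm matrix_vector_mult_scaleR divide_inverse)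
  also have "\<dots> = sgn (C *v y)"
    by (cases "y = 0") (simp_all add: sgn_scaleR)
  finally show ?thesis .
qed

lemma norm_add_scaleR_sq:
  "(norm (p + s *\<^sub>R q))\<^sup>2 = (norm p)\<^sup>2 + 2 * s * (p \<bullet> q) + s\<^sup>2 * (norm q)\<^sup>2"
  for p q :: "'a::real_inner"
  unfolding power2_norm_eq_inner
  by (simp add: inner_add_left inner_add_right inner_commute power2_eq_square)

text \<open>At a maximizer \<open>w\<close> of the quotient \<open>\<bar>D y\<bar>\<^sup>2 / \<bar>y\<bar>\<^sup>2\<close> the derivative in the direction \<open>x\<close> is zero.\<close>

lemma quadratic_max_orthogonality:
  fixes D :: "real^'n^'m"
  assumes le: "\<And>y. (norm (D *v y))\<^sup>2 \<le> l * (norm y)\<^sup>2" and eq: "(norm (D *v w))\<^sup>2 = l * (norm w)\<^sup>2"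
  shows "(D *v w) \<bullet> (D *v x) = l * (w \<bullet> x)"
proof -
  define \<alpha> where "\<alpha> = l * (w \<bullet> x) - (D *v w) \<bullet> (D *v x)"
  define \<beta> where "\<beta> = l * (norm x)\<^sup>2 - (norm (D *v x))\<^sup>2"
  have \<beta>: "0 \<le> \<beta>" using le[of x] by (simp add: \<beta>_def)
  have "0 \<le> 2 * s * \<alpha> + s\<^sup>2 * \<beta>" for s
  proof -
    have "(norm (D *v (w + s *\<^sub>R x)))\<^sup>2 =
        (norm (D *v w))\<^sup>2 + 2 * s * ((D *v w) \<bullet> (D *v x)) + s\<^sup>2 * (norm (D *v x))\<^sup>2"
      by (simp only: matrix_vector_right_distrib matrix_vector_mult_scaleR norm_add_scaleR_sq)
    moreover have "(norm (w + s *\<^sub>R x))\<^sup>2 = (norm w)\<^sup>2 + 2 * s * (w \<bullet> x) + s\<^sup>2 * (norm x)\<^sup>2"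
      by (rule norm_add_scaleR_sq)
    ultimately show ?thesis
      using le[of "w + s *\<^sub>R x"] eq by (simp add: \<alpha>_def \<beta>_def algebra_simps)
  qed
  \<comment> \<open>A parabola through 0 with nonzero slope is negative somewhere near 0, for instance here; adding 1 avoids division by zero.\<close>
  from this[of "- \<alpha> / (\<beta> + 1)"]
  have "0 \<le> 2 * (- \<alpha> / (\<beta> + 1)) * \<alpha> + (- \<alpha> / (\<beta> + 1))\<^sup>2 * \<beta>" .
  also have "\<dots> = - (\<alpha>\<^sup>2 * ((\<beta> + 2) / (\<beta> + 1)\<^sup>2))"
    using \<beta> by (simp add: divide_simps) (simp add: power2_eq_square algebra_simps)
  finally have "\<alpha>\<^sup>2 * ((\<beta> + 2) / (\<beta> + 1)\<^sup>2) \<le> 0" by simp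
  moreover have "0 < (\<beta> + 2) / (\<beta> + 1)\<^sup>2" using \<beta> by (intro divide_pos_pos) auto
  ultimately have "\<alpha>\<^sup>2 \<le> 0" by (meson not_le mult_pos_pos)
  then have "\<alpha> = 0" by simp
  then show ?thesis by (simp add: \<alpha>_def)
qed

lemma avg_quadratic_form:
  fixes w :: "'b \<Rightarrow> real^'n"
  assumes "\<And>a b. avg n (\<lambda>y. w y $ a * w y $ b) z = (if a = b then r else 0)"
  shows "avg n (\<lambda>y. (v \<bullet> w y)\<^sup>2) z = (norm v)\<^sup>2 * r"
proof -
  have "avg n (\<lambda>y. (v \<bullet> w y)\<^sup>2) z =
      avg n (\<lambda>y. \<Sum>a\<in>UNIV. \<Sum>b\<in>UNIV. (v $ a * v $ b) * (w y $ a * w y $ b)) z"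
    by (intro avg_cong) (simp add: inner_vec_def power2_eq_square sum_product mult.assoc mult.left_commute)
  also have "\<dots> = (\<Sum>a\<in>UNIV. \<Sum>b\<in>UNIV. (v $ a * v $ b) * (if a = b then r else 0))"
    by (simp only: avg_sum avg_cmult assms)
  also have "\<dots> = (\<Sum>a\<in>UNIV. (v $ a)\<^sup>2 * r)"
    by (simp add: power2_eq_square if_distrib cong: if_cong)
  also have "\<dots> = (norm v)\<^sup>2 * r"
    by (simp only: norm_real_vec_sq sum_distrib_right)
  finally show ?thesis .
qed

text \<open>Let \<open>D\<close> carry one solution to another. The direction in which \<open>D\<close> stretches most gives, in
  Tyler's equation, an inequality that can be an equality only if each observation is orthogonal to
  a fixed vector or is itself stretched most. Unless \<open>D\<close> is a multiple of the identity, the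
  observations would then lie in two hyperplanes.\<close>

lemma tyler_solution_unique:
  fixes z :: "nat \<Rightarrow> real^'k::{finite,wellorder}"
  assumes n: "1 \<le> n" and C1: "tyler_solution n z C1" and C2: "tyler_solution n z C2"
    and nz: "\<And>t. t \<in> {1..n} \<Longrightarrow> z t \<noteq> 0"
    and nondeg: "\<And>a b. a \<noteq> 0 \<Longrightarrow> b \<noteq> 0 \<Longrightarrow> \<exists>t\<in>{1..n}. (a \<bullet> z t) * (b \<bullet> z t) \<noteq> 0"
  shows "C2 = C1"
proof -
  let ?k = "real CARD('k)"
  let ?\<kappa> = "first_index :: 'k"
  have T1: "pos_triangular C1" "C1 $ ?\<kappa> $ ?\<kappa> = 1"
    and T2: "pos_triangular C2" "C2 $ ?\<kappa> $ ?\<kappa> = 1"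
    using C1 C2 by (auto simp: tyler_solution_def)
  obtain R where R: "pos_triangular R" "C1 ** R = mat 1" "R ** C1 = mat 1"
    using pos_triangular_inverse[OF T1(1)] by blast
  define D where "D = C2 ** R"
  have D: "pos_triangular D" unfolding D_def by (intro pos_triangular_mult T2 R)
  have "R $ ?\<kappa> $ ?\<kappa> * C1 $ ?\<kappa> $ ?\<kappa> = mat 1 $ ?\<kappa> $ ?\<kappa>"
    using upper_triangular_mult(2)[of R C1 ?\<kappa>] T1 R(1) unfolding R(3) pos_triangular_def by metis
  then have R1: "R $ ?\<kappa> $ ?\<kappa> = 1" unfolding T1(2) mat_1_nth by simp
  have D1: "D $ ?\<kappa> $ ?\<kappa> = 1"
    using upper_triangular_mult(2)[of C2 R ?\<kappa>] T2 R(1) R1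
    unfolding D_def pos_triangular_def by simp
  have DC: "D ** C1 = C2" by (simp add: D_def matrix_mul_assoc[symmetric] R)
  have DC': "D *v (C1 *v y) = C2 *v y" for y by (simp add: matrix_vector_mul_assoc DC)
  have injD: "D *v y \<noteq> 0" if "y \<noteq> 0" for y
  proof -
    obtain Q where "Q ** D = mat 1" using pos_triangular_inverse[OF D] by blast
    then have "Q *v (D *v y) = y" by (simp add: matrix_vector_mul_assoc)
    then show ?thesis using that by auto
  qed
  have injC: "C1 *v y \<noteq> 0" if "y \<noteq> 0" for y
  proof -
    have "R *v (C1 *v y) = y" by (simp add: matrix_vector_mul_assoc R)
    then show ?thesis using that by auto
  qed
  have injC': "transpose C1 *v y \<noteq> 0" if "y \<noteq> 0" for y
  proof -
    have "transpose R ** transpose C1 = mat 1"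
      using R by (metis matrix_transpose_mul transpose_mat)
    then have "transpose R *v (transpose C1 *v y) = y"
      by (metis matrix_vector_mul_assoc matrix_vector_mul_lid)
    then show ?thesis using that by (metis matrix_vector_mult_0_right)
  qed
  define w where "w y = sgn (C1 *v y)" for y
  have sw: "sgn (D *v w y) = sgn (C2 *v y)" for y
    by (simp add: w_def sgn_matrix_vector_sgn DC')
  have nw: "norm (w y) = 1" if "y \<noteq> 0" for y
    using injC[OF that] by (simp add: w_def norm_sgn)
  have m1: "avg n (\<lambda>y. (x \<bullet> w y)\<^sup>2) z = (norm x)\<^sup>2 * (1 / ?k)" for x
    using C1 by (intro avg_quadratic_form) (simp add: tyler_solution_def w_def)
  have m2: "avg n (\<lambda>y. (x \<bullet> sgn (D *v w y))\<^sup>2) z = (norm x)\<^sup>2 * (1 / ?k)" for x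
    using C2 by (intro avg_quadratic_form) (simp add: tyler_solution_def sw)
  have "(axis ?\<kappa> 1 :: real^'k::{finite,wellorder}) \<in> sphere 0 1" by (simp add: norm_axis_1)
  then have "sphere (0 :: real^'k::{finite,wellorder}) 1 \<noteq> {}" by blast
  moreover have "continuous_on (sphere 0 1) (\<lambda>y. norm (D *v y))"
    by (intro continuous_on_norm linear_continuous_on matrix_vector_mul_bounded_linear)
  ultimately obtain w0 :: "real^'k::{finite,wellorder}" where w0: "norm w0 = 1"
    and mx: "\<And>y. norm y = 1 \<Longrightarrow> norm (D *v y) \<le> norm (D *v w0)"
    using continuous_attains_sup[of "sphere (0 :: real^'k::{finite,wellorder}) 1" "\<lambda>y. norm (D *v y)"]
    by auto
  define l where "l = (norm (D *v w0))\<^sup>2"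
  have w0nz: "w0 \<noteq> 0" using w0 by auto
  have l: "0 < l" using injD[OF w0nz] by (simp add: l_def)
  have Dle: "(norm (D *v y))\<^sup>2 \<le> l * (norm y)\<^sup>2" for y
  proof (cases "y = 0")
    case False
    have "norm (D *v sgn y) \<le> norm (D *v w0)" by (rule mx) (simp add: norm_sgn False)
    moreover have "D *v y = norm y *\<^sub>R (D *v sgn y)"
      using False by (simp add: sgn_div_norm matrix_vector_mult_scaleR)
    ultimately have "norm (D *v y) \<le> norm y * norm (D *v w0)"
      by (simp add: mult_left_mono)
    then have "(norm (D *v y))\<^sup>2 \<le> (norm y * norm (D *v w0))\<^sup>2" by (intro power_mono) auto
    then show ?thesis by (simp add: l_def power_mult_distrib mult.commute)
  qed simp
  define v where "v = (1 / l) *\<^sub>R (transpose D *v (D *v w0))"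
  have v: "v \<bullet> x = ((D *v w0) \<bullet> (D *v x)) / l" for x
    by (simp add: v_def dot_lmul_matrix)
  have "v \<bullet> w0 = 1" using l by (simp add: v l_def power2_norm_eq_inner)
  then have "1 \<le> norm v" using norm_cauchy_schwarz[of v w0] w0 by simp
  then have v1: "1 \<le> (norm v)\<^sup>2" by (simp add: one_le_power)
  \<comment> \<open>The mean of the nonnegative gaps is a nonpositive number, as \<open>v\<close> has norm at least 1.\<close>
  define gap where "gap y = (v \<bullet> w y)\<^sup>2 * (1 / (norm (D *v w y))\<^sup>2 - 1 / l)" for y
  have wD: "(v \<bullet> w y)\<^sup>2 / (norm (D *v w y))\<^sup>2 = (((D *v w0) \<bullet> sgn (D *v w y)))\<^sup>2 / l\<^sup>2" for y
    by (simp add: v sgn_div_norm power_divide power_mult_distrib divide_simps)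
  have gap0: "0 \<le> gap (z t)" if "t \<in> {1..n}" for t
  proof -
    have "w (z t) \<noteq> 0" using nw[OF nz[OF that]] by auto
    then have "0 < (norm (D *v w (z t)))\<^sup>2" using injD by simp
    moreover have "(norm (D *v w (z t)))\<^sup>2 \<le> l" using Dle[of "w (z t)"] nw[OF nz[OF that]] by simp
    ultimately have "1 / l \<le> 1 / (norm (D *v w (z t)))\<^sup>2" by (simp add: frac_le)
    then show ?thesis by (simp add: gap_def)
  qed
  have "avg n gap z = avg n (\<lambda>y. (1 / l\<^sup>2) * ((D *v w0) \<bullet> sgn (D *v w y))\<^sup>2 - (1 / l) * (v \<bullet> w y)\<^sup>2) z"
    unfolding gap_def by (rule avg_cong) (simp add: right_diff_distrib wD)
  also have "\<dots> = (1 / l\<^sup>2) * (l * (1 / ?k)) - (1 / l) * ((norm v)\<^sup>2 * (1 / ?k))"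
    by (simp only: avg_diff avg_cmult m1 m2 l_def)
  also have "\<dots> = (1 - (norm v)\<^sup>2) / (l * ?k)"
    using l by (simp add: field_simps power2_eq_square)
  also have "\<dots> \<le> 0" using v1 l by (intro divide_nonpos_pos) auto
  finally have "(\<Sum>t=1..n. gap (z t)) \<le> 0" using n by (simp add: avg_def divide_le_0_iff)
  then have "(\<Sum>t=1..n. gap (z t)) = 0" using gap0 by (intro antisym sum_nonneg) auto
  then have gapz: "gap (z t) = 0" if "t \<in> {1..n}" for t
    using that gap0 by (intro sum_nonneg_0[of "{1..n}" "\<lambda>t. gap (z t)"]) auto
  have "transpose D ** D = l *\<^sub>R mat 1"
  proof (rule ccontr)
    assume ne: "transpose D ** D \<noteq> l *\<^sub>R mat 1"
    define M where "M = transpose D ** D - l *\<^sub>R mat 1"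
    obtain a where a: "M $ a \<noteq> 0" using ne by (auto simp: M_def vec_eq_iff)
    have "v \<noteq> 0" using v1 by auto
    obtain t where t: "t \<in> {1..n}"
      and t0: "((transpose C1 *v v) \<bullet> z t) * ((transpose C1 *v (M $ a)) \<bullet> z t) \<noteq> 0"
      using nondeg[OF injC'[OF \<open>v \<noteq> 0\<close>] injC'[OF a]] by blast
    have tr: "(transpose C1 *v x) \<bullet> y = x \<bullet> (C1 *v y)" for x y
      by (metis dot_lmul_matrix transpose_matrix_vector)
    have C1z: "C1 *v z t = norm (C1 *v z t) *\<^sub>R w (z t)"
      using injC[OF nz[OF t]] by (simp add: w_def sgn_div_norm)
    have "v \<bullet> w (z t) \<noteq> 0" "M $ a \<bullet> w (z t) \<noteq> 0"
    proof -
      have "x \<bullet> (C1 *v z t) = norm (C1 *v z t) * (x \<bullet> w (z t))" for x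
        by (subst C1z) (rule inner_scaleR_right)
      then show "v \<bullet> w (z t) \<noteq> 0" "M $ a \<bullet> w (z t) \<noteq> 0" using t0 unfolding tr by auto
    qed
    then have "1 / (norm (D *v w (z t)))\<^sup>2 = 1 / l"
      using gapz[OF t] by (simp add: gap_def)
    then have "(norm (D *v w (z t)))\<^sup>2 = l" using l by (simp add: divide_eq_eq eq_divide_eq split: if_splits)
    then have "(D *v w (z t)) \<bullet> (D *v x) = l * (w (z t) \<bullet> x)" for x
      by (intro quadratic_max_orthogonality Dle) (simp add: nw[OF nz[OF t]])
    then have "(M *v w (z t)) \<bullet> x = 0" for x
      by (simp add: M_def matrix_vector_mult_diff_rdistrib inner_diff_left dot_lmul_matrix
          matrix_vector_mul_assoc[symmetric] scaleR_matrix_vector_assoc[symmetric])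
    then have "M *v w (z t) = 0" by (metis inner_eq_zero_iff)
    moreover have "(M *v w (z t)) $ a = M $ a \<bullet> w (z t)"
      by (simp add: matrix_vector_mult_def inner_vec_def)
    ultimately show False using \<open>M $ a \<bullet> w (z t) \<noteq> 0\<close> by simp
  qed
  then have Ds: "D = sqrt l *\<^sub>R mat 1" by (rule pos_triangular_orthogonal[OF D])
  then have "sqrt l = 1" using D1 by (simp add: mat_1_nth)
  then have "D = mat 1" using Ds by simp
  then show ?thesis using DC by simp
qed

section \<open>Existence of Tyler's matrix near the identity\<close>

lemma component_le_norm_matrix: "\<bar>A $ a $ b\<bar> \<le> norm (A :: real^'n^'m)"
  using component_le_norm_cart[of "A $ a" b] Finite_Cartesian_Product.norm_nth_le[of A a] by linarith

text \<open>Zero diagonal entries are excluded by a radius below 1, which leaves a compact set defined by linear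
  equations and a norm bound.\<close>

definition triangular_nbhd ::
    "real \<Rightarrow> (real^'k::{finite,wellorder}^'k::{finite,wellorder}) set" where
  "triangular_nbhd e = {C. upper_triangular C \<and> C $ first_index $ first_index = 1 \<and>
     norm (C - mat 1) \<le> e}"

lemma closed_triangular_nbhd: "closed (triangular_nbhd e)"
  unfolding triangular_nbhd_def upper_triangular_def
  by (intro closed_Collect_conj closed_Collect_all closed_Collect_imp closed_Collect_eq
      closed_Collect_le open_Collect_const continuous_intros)

lemma compact_triangular_nbhd: "compact (triangular_nbhd e)"
proof -
  have "triangular_nbhd e \<subseteq> cball (mat 1) e"
    by (auto simp: triangular_nbhd_def dist_norm norm_minus_commute)
  then show ?thesis
    using closed_triangular_nbhd bounded_cball bounded_subset compact_eq_bounded_closed by blast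
qed

lemma triangular_nbhd_diagonal:
  assumes "C \<in> triangular_nbhd e" shows "1 - e \<le> C $ a $ a"
proof -
  have "\<bar>(C - mat 1) $ a $ a\<bar> \<le> e"
    using component_le_norm_matrix[of "C - mat 1" a a] assms
    unfolding triangular_nbhd_def by (auto intro: order_trans)
  then show ?thesis by (simp add: mat_1_nth)
qed

lemma norm_near_identity:
  fixes C :: "real^'n^'n"
  assumes "norm (C - mat 1) \<le> e"
  shows "(1 - e) * norm y \<le> norm (C *v y)" "norm (C *v y) \<le> (1 + e) * norm y"
    "norm (C *v y - y) \<le> e * norm y"
proof -
  have "C *v y - y = (C - mat 1) *v y" by (simp add: matrix_vector_mult_diff_rdistrib)
  then show *: "norm (C *v y - y) \<le> e * norm y"
    using norm_matrix_vector_mult_le[of "C - mat 1" y] assms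
    by (metis mult_right_mono norm_ge_zero order_trans)
  show "(1 - e) * norm y \<le> norm (C *v y)" "norm (C *v y) \<le> (1 + e) * norm y"
    using * norm_triangle_ineq2[of y "C *v y"] norm_triangle_ineq2[of "C *v y" y]
    by (auto simp: norm_minus_commute algebra_simps)
qed

text \<open>Up to a factor, the negative log-likelihood of the angular central Gaussian law with
  concentration matrix \<open>transpose C ** C\<close>; Tyler's equation is its critical equation. Signs in place
  of the observations change it by a constant and make it vanish at the identity.\<close>

definition tyler_objective ::
    "nat \<Rightarrow> (nat \<Rightarrow> real^'k::{finite,wellorder}) \<Rightarrow>
     real^'k::{finite,wellorder}^'k::{finite,wellorder} \<Rightarrow> real" where
  "tyler_objective n z C = avg n (\<lambda>y. ln ((norm (C *v sgn y))\<^sup>2)) z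
     - 2 / real CARD('k) * (\<Sum>a\<in>UNIV. ln (C $ a $ a))"

lemma continuous_on_tyler_objective:
  fixes z :: "nat \<Rightarrow> real^'k::{finite,wellorder}"
  assumes e: "e < 1" and nz: "\<And>t. t \<in> {1..n} \<Longrightarrow> z t \<noteq> 0"
  shows "continuous_on (triangular_nbhd e) (tyler_objective n z)"
proof -
  have "continuous_on (triangular_nbhd e) (\<lambda>C. ln ((norm (C *v sgn (z t)))\<^sup>2))"
    if "t \<in> {1..n}" for t
  proof (rule continuous_on_ln)
    show "continuous_on (triangular_nbhd e) (\<lambda>C. (norm (C *v sgn (z t)))\<^sup>2)"
      unfolding matrix_vector_mult_def by (intro continuous_intros)
    show "\<forall>C\<in>triangular_nbhd e. (norm (C *v sgn (z t)))\<^sup>2 \<noteq> 0"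
    proof
      fix C :: "real^'k::{finite,wellorder}^'k::{finite,wellorder}" assume C: "C \<in> triangular_nbhd e"
      have "(1 - e) * norm (sgn (z t)) \<le> norm (C *v sgn (z t))"
        using C by (intro norm_near_identity) (simp add: triangular_nbhd_def)
      then show "(norm (C *v sgn (z t)))\<^sup>2 \<noteq> 0"
        using e nz[OF that] by (auto simp: norm_sgn)
    qed
  qed
  moreover have "continuous_on (triangular_nbhd e)
      (\<lambda>C :: real^'k::{finite,wellorder}^'k::{finite,wellorder}. ln (C $ a $ a))" for a
    using triangular_nbhd_diagonal[of _ e a] e
    by (intro continuous_on_ln continuous_intros) force
  ultimately show ?thesis
    unfolding tyler_objective_def avg_def divide_inverse
    by (intro continuous_on_diff continuous_on_mult continuous_on_sum continuous_on_const) auto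
qed

lemma norm_single_entry_matrix:
  "norm ((\<chi> i j. if i = a \<and> j = b then 1 else 0) :: real^'n^'m) = 1" (is "norm ?E = 1")
proof -
  have "(norm ?E)\<^sup>2 = (\<Sum>i\<in>UNIV. \<Sum>j\<in>UNIV. if j = b then if i = a then 1 else 0 else 0)"
    unfolding norm_matrix_sq by (intro sum.cong) auto
  also have "\<dots> = 1" by simp
  finally show ?thesis by (metis abs_norm_cancel real_sqrt_abs real_sqrt_one)
qed

text \<open>Criticality in the directions above the diagonal says that \<open>C\<close> times the weighted second
  moment matrix of the observations is lower triangular, and then so is the second moment
  matrix of the transformed signs, which is symmetric. The direction excluded by the normalization
  is recovered from the trace.\<close>

lemma tyler_solution_of_interior_minimum:
  fixes z :: "nat \<Rightarrow> real^'k::{finite,wellorder}"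
  assumes n: "1 \<le> n" and nz: "\<And>t. t \<in> {1..n} \<Longrightarrow> z t \<noteq> 0" and e: "e < 1"
    and C: "C \<in> triangular_nbhd e" "norm (C - mat 1) < e"
    and min: "\<And>C'. C' \<in> triangular_nbhd e \<Longrightarrow> tyler_objective n z C \<le> tyler_objective n z C'"
  shows "tyler_solution n z C"
proof -
  let ?k = "real CARD('k)"
  let ?\<kappa> = "first_index :: 'k"
  have up: "C $ a $ b = 0" if "b < a" for a b
    using C that by (simp add: triangular_nbhd_def upper_triangular_def)
  have diag: "0 < C $ a $ a" for a
    using triangular_nbhd_diagonal[OF C(1), of a] e by simp
  have C1: "C $ ?\<kappa> $ ?\<kappa> = 1" using C by (simp add: triangular_nbhd_def)
  have pC: "pos_triangular C" using C diag by (simp add: triangular_nbhd_def pos_triangular_def)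
  define u where "u y = sgn y" for y :: "real^'k::{finite,wellorder}"
  have Cu: "0 < norm (C *v u (z t))" if "t \<in> {1..n}" for t
  proof -
    have "(1 - e) * norm (u (z t)) \<le> norm (C *v u (z t))"
      using C by (intro norm_near_identity) simp
    then show ?thesis using e nz[OF that] by (auto simp: norm_sgn u_def)
  qed
  \<comment> \<open>The derivative of the objective along the single entry matrix at \<open>(a, b)\<close> vanishes.\<close>
  have crit: "avg n (\<lambda>y. (C *v u y) $ a * u y $ b / (norm (C *v u y))\<^sup>2) z =
      (if a = b then 1 / (?k * C $ a $ a) else 0)"
    if ab: "a \<le> b" "(a, b) \<noteq> (?\<kappa>, ?\<kappa>)" for a b
  proof -
    define E :: "real^'k::{finite,wellorder}^'k::{finite,wellorder}" where
      "E = (\<chi> i j. if i = a \<and> j = b then 1 else 0)"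
    have nE: "norm E = 1" unfolding E_def by (rule norm_single_entry_matrix)
    have Ey: "E *v y = y $ b *\<^sub>R axis a 1" for y
      unfolding vec_eq_iff matrix_vector_mult_nth
    proof
      fix i
      have "(\<Sum>j\<in>UNIV. E $ i $ j * y $ j) = (\<Sum>j\<in>UNIV. if j = b then if i = a then y $ b else 0 else 0)"
        by (intro sum.cong) (auto simp: E_def)
      then show "(\<Sum>j\<in>UNIV. E $ i $ j * y $ j) = (y $ b *\<^sub>R axis a 1) $ i"
        by (simp add: axis_def)
    qed
    have sq: "(norm ((C + s *\<^sub>R E) *v y))\<^sup>2 =
        (norm (C *v y))\<^sup>2 + 2 * s * (y $ b * (C *v y) $ a) + s\<^sup>2 * (y $ b)\<^sup>2" for s y
      unfolding matrix_vector_mult_add_rdistrib scaleR_matrix_vector_assoc[symmetric] norm_add_scaleR_sq Ey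
      by (simp add: power_mult_distrib norm_axis_1 inner_axis)
    define g where "g s = tyler_objective n z (C + s *\<^sub>R E)" for s
    have "(g has_real_derivative
        (\<Sum>t=1..n. (2 * (u (z t) $ b * (C *v u (z t)) $ a)) / (norm (C *v u (z t)))\<^sup>2) / real n -
        2 / ?k * (\<Sum>c\<in>UNIV. E $ c $ c / C $ c $ c)) (at 0)"
      unfolding g_def tyler_objective_def avg_def sq u_def[symmetric]
    proof (rule DERIV_diff)
      have "((\<lambda>s. ln ((norm (C *v u (z t)))\<^sup>2 + 2 * s * (u (z t) $ b * (C *v u (z t)) $ a) +
              s\<^sup>2 * (u (z t) $ b)\<^sup>2)) has_real_derivative
             (2 * (u (z t) $ b * (C *v u (z t)) $ a)) / (norm (C *v u (z t)))\<^sup>2) (at 0)"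
        if "t \<in> {1..n}" for t
        using Cu[OF that] by - (rule derivative_eq_intros refl | simp)+
      then show "((\<lambda>s. (\<Sum>t=1..n. ln ((norm (C *v u (z t)))\<^sup>2 +
            2 * s * (u (z t) $ b * (C *v u (z t)) $ a) + s\<^sup>2 * (u (z t) $ b)\<^sup>2)) / real n)
          has_real_derivative
          (\<Sum>t=1..n. (2 * (u (z t) $ b * (C *v u (z t)) $ a)) / (norm (C *v u (z t)))\<^sup>2) / real n) (at 0)"
        by (intro DERIV_cdivide DERIV_sum) auto
      have "((\<lambda>s. ln ((C + s *\<^sub>R E) $ c $ c)) has_real_derivative E $ c $ c / C $ c $ c) (at 0)" for c
        using diag[of c] by simp (rule derivative_eq_intros refl | simp)+
      then show "((\<lambda>s. 2 / ?k * (\<Sum>c\<in>UNIV. ln ((C + s *\<^sub>R E) $ c $ c)))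
          has_real_derivative 2 / ?k * (\<Sum>c\<in>UNIV. E $ c $ c / C $ c $ c)) (at 0)"
        by (intro DERIV_cmult DERIV_sum) auto
    qed
    moreover have "g 0 \<le> g s" if "\<bar>0 - s\<bar> < e - norm (C - mat 1)" for s
    proof -
      have "C + s *\<^sub>R E \<in> triangular_nbhd e"
        unfolding triangular_nbhd_def mem_Collect_eq
      proof (intro conjI)
        show "upper_triangular (C + s *\<^sub>R E)"
          using up ab by (auto simp: upper_triangular_def E_def)
        show "(C + s *\<^sub>R E) $ ?\<kappa> $ ?\<kappa> = 1"
          using ab C1 by (auto simp: E_def)
        have "norm (C + s *\<^sub>R E - mat 1) \<le> norm (C - mat 1) + norm (s *\<^sub>R E)"
          by (metis add_diff_eq add.commute norm_triangle_ineq)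
        then show "norm (C + s *\<^sub>R E - mat 1) \<le> e" using that nE by simp
      qed
      then show ?thesis using min by (simp add: g_def)
    qed
    ultimately have "(\<Sum>t=1..n. (2 * (u (z t) $ b * (C *v u (z t)) $ a)) / (norm (C *v u (z t)))\<^sup>2) / real n -
        2 / ?k * (\<Sum>c\<in>UNIV. E $ c $ c / C $ c $ c) = 0"
      using C(2) by (intro DERIV_local_min[where f = g and x = 0 and d = "e - norm (C - mat 1)"]) auto
    moreover have "(\<Sum>t=1..n. (2 * (u (z t) $ b * (C *v u (z t)) $ a)) / (norm (C *v u (z t)))\<^sup>2) / real n
        = 2 * avg n (\<lambda>y. (C *v u y) $ a * u y $ b / (norm (C *v u y))\<^sup>2) z"
      by (simp add: avg_def sum_distrib_left mult_ac)
    moreover have "2 / ?k * (\<Sum>c\<in>UNIV. E $ c $ c / C $ c $ c) =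
        2 * (if a = b then 1 / (?k * C $ a $ a) else 0)"
    proof -
      have "(\<Sum>c\<in>UNIV. E $ c $ c / C $ c $ c) =
          (\<Sum>c\<in>UNIV. if c = a then if a = b then 1 / C $ a $ a else 0 else 0)"
        by (intro sum.cong) (auto simp: E_def)
      then show ?thesis by simp
    qed
    ultimately show ?thesis by linarith
  qed
  define G where "G a b = avg n (\<lambda>y. sgn (C *v y) $ a * sgn (C *v y) $ b) z" for a b
  have G: "G a b = avg n (\<lambda>y. (C *v u y) $ a * (C *v u y) $ b / (norm (C *v u y))\<^sup>2) z" for a b
  proof -
    have "sgn (C *v y) = (C *v u y) /\<^sub>R norm (C *v u y)" for y
      unfolding u_def sgn_div_norm[symmetric] by (rule sgn_matrix_vector_sgn[symmetric])
    then show ?thesis unfolding G_def by (simp add: power2_eq_square divide_inverse mult_ac)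
  qed
  have Gle: "G a b = (if a = b then 1 / ?k else 0)" if ab: "a \<le> b" "(a, b) \<noteq> (?\<kappa>, ?\<kappa>)" for a b
  proof -
    have "G a b = avg n (\<lambda>y. \<Sum>c\<in>UNIV. C $ b $ c * ((C *v u y) $ a * u y $ c / (norm (C *v u y))\<^sup>2)) z"
      unfolding G by (simp add: matrix_vector_mult_nth[of C _ b] sum_distrib_left sum_divide_distrib mult_ac)
    also have "\<dots> = (\<Sum>c\<in>UNIV. C $ b $ c * avg n (\<lambda>y. (C *v u y) $ a * u y $ c / (norm (C *v u y))\<^sup>2) z)"
      by (simp only: avg_sum avg_cmult)
    also have "\<dots> = (\<Sum>c\<in>UNIV. if c = a then if a = b then 1 / ?k else 0 else 0)"
    proof (intro sum.cong refl)
      fix c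
      show "C $ b $ c * avg n (\<lambda>y. (C *v u y) $ a * u y $ c / (norm (C *v u y))\<^sup>2) z =
          (if c = a then if a = b then 1 / ?k else 0 else 0)"
      proof (cases "c < b")
        case True
        then show ?thesis using up[OF True] by auto
      next
        case False
        then have "a \<le> c" using ab by auto
        moreover have "(a, c) \<noteq> (?\<kappa>, ?\<kappa>)"
          using ab False first_index_le[of b] by auto
        ultimately show ?thesis using crit[of a c] diag[of a] False ab by auto
      qed
    qed
    finally show ?thesis by simp
  qed
  have Gk: "G ?\<kappa> ?\<kappa> = 1 / ?k"
  proof -
    have "(\<Sum>a\<in>UNIV. G a a) = avg n (\<lambda>y. \<Sum>a\<in>UNIV. (sgn (C *v y) $ a)\<^sup>2) z"
      unfolding G_def avg_sum by (simp add: power2_eq_square)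
    also have "\<dots> = avg n (\<lambda>y. 1) z"
    proof (rule avg_cong)
      fix t assume "t \<in> {1..n}"
      then have "sgn (C *v z t) = sgn (C *v u (z t))" "C *v u (z t) \<noteq> 0"
        using Cu[of t] by (auto simp: u_def sgn_matrix_vector_sgn)
      then have "(norm (sgn (C *v z t)))\<^sup>2 = 1" by (simp add: norm_sgn)
      then show "(\<Sum>a\<in>UNIV. (sgn (C *v z t) $ a)\<^sup>2) = 1" by (simp add: norm_real_vec_sq)
    qed
    also have "\<dots> = 1" using n by (rule avg_const)
    finally have "G ?\<kappa> ?\<kappa> + (\<Sum>a\<in>UNIV - {?\<kappa>}. G a a) = 1" by (simp add: sum.remove[of UNIV ?\<kappa>])
    moreover have "(\<Sum>a\<in>UNIV - {?\<kappa>}. G a a) = (\<Sum>a\<in>UNIV - {?\<kappa>}. 1 / ?k)"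
      by (intro sum.cong) (auto simp: Gle)
    ultimately show ?thesis by (simp add: card_Diff_singleton of_nat_diff divide_simps)
  qed
  have "G a b = (if a = b then 1 / ?k else 0)" for a b
  proof (cases "(a, b) = (?\<kappa>, ?\<kappa>)")
    case False
    have "G b a = G a b" by (simp add: G_def mult.commute)
    then show ?thesis using Gle[of a b] Gle[of b a] False by (cases "a \<le> b") auto
  qed (use Gk in auto)
  then show ?thesis using pC C1 by (simp add: tyler_solution_def G_def)
qed

section \<open>Consistency of Tyler's matrix\<close>

text \<open>Entries of the outer product of a sign with itself, indexed by pairs so that they form a single
  finite family of bounded functions for the law of large numbers.\<close>

definition sign_product :: "'k \<times> 'k \<Rightarrow> real^'k \<Rightarrow> real" where
  "sign_product p y = sgn y $ fst p * sgn y $ snd p"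

definition sign_form :: "real^'k^'k \<Rightarrow> real^'k \<Rightarrow> real" where
  "sign_form E y = sgn y \<bullet> (E *v sgn y)"

lemma sign_form_expand: "sign_form E y = (\<Sum>p\<in>UNIV. E $ fst p $ snd p * sign_product p y)"
proof -
  have "sign_form E y = (\<Sum>a\<in>UNIV. \<Sum>b\<in>UNIV. E $ a $ b * (sgn y $ a * sgn y $ b))"
    by (simp add: sign_form_def inner_vec_def matrix_vector_mult_nth sum_distrib_left mult_ac)
  then show ?thesis
    by (simp add: sign_product_def sum.cartesian_product case_prod_beta)
qed

lemma sign_form_square_expand:
  "(sign_form E y)\<^sup>2 = (\<Sum>p\<in>UNIV. \<Sum>q\<in>UNIV. E $ fst p $ snd p * E $ fst q $ snd q *
     (sign_product p y * sign_product q y))"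
  unfolding sign_form_expand power2_eq_square sum_product by (intro sum.cong) (auto simp: mult_ac)

lemma norm_sgn_le: "norm (sgn y) \<le> 1" for y :: "'a::real_normed_vector"
  by (simp add: norm_sgn)

lemma abs_sgn_nth_le: "\<bar>sgn y $ a\<bar> \<le> 1" for y :: "real^'k"
  using component_le_norm_cart[of "sgn y" a] norm_sgn_le[of y] by linarith

lemma abs_sign_product_le: "\<bar>sign_product p y\<bar> \<le> 1"
  unfolding sign_product_def abs_mult by (intro mult_le_one abs_sgn_nth_le) auto

lemma measurable_sgn_nth [measurable]: "(\<lambda>y :: real^'k. sgn y $ a) \<in> borel_measurable borel"
  by (simp add: sgn_div_norm)

lemma measurable_sign_product [measurable]: "sign_product p \<in> borel_measurable borel"
  unfolding sign_product_def[abs_def] by measurable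

lemma outer_prod_vector: "outer_prod a b *v x = (b \<bullet> x) *\<^sub>R a"
  by (simp add: vec_eq_iff matrix_vector_mult_nth outer_prod_def inner_vec_def sum_distrib_left mult_ac)

lemma norm_outer_prod: "norm (outer_prod a b) = norm a * norm b"
proof -
  have "(norm (outer_prod a b))\<^sup>2 = (norm a * norm b)\<^sup>2"
    unfolding norm_matrix_sq power_mult_distrib norm_real_vec_sq sum_product outer_prod_def
    by (simp add: power_mult_distrib)
  then show ?thesis by (simp add: power2_eq_iff_nonneg)
qed

lemma sign_form_outer: "sign_form (outer_prod a b) y = (a \<bullet> sgn y) * (b \<bullet> sgn y)"
  by (simp add: sign_form_def outer_prod_vector inner_commute)

lemma sign_form_scaleR: "sign_form (s *\<^sub>R E) y = s * sign_form E y"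
  by (simp add: sign_form_def scaleR_matrix_vector_assoc[symmetric])

lemma sign_form_gram: "sign_form (transpose E ** E) y = (norm (E *v sgn y))\<^sup>2"
  by (simp add: sign_form_def power2_norm_eq_inner matrix_vector_mul_assoc[symmetric])
    (metis dot_lmul_matrix inner_commute)

lemma trace_gram: "(\<Sum>a\<in>UNIV. (transpose H ** H) $ a $ a) = (norm (H :: real^'n^'n))\<^sup>2"
  unfolding norm_matrix_sq using sum.swap[of "\<lambda>a b. (H $ b $ a)\<^sup>2" UNIV UNIV]
  by (simp add: matrix_mult_nth transpose_def power2_eq_square)

text \<open>What consistency of Tyler's matrix requires of the law of an observation. Isotropic second moments
  of the sign make the identity the solution in the limit, and the mass of open sets makes the second
  order expansion of the objective positive definite there.\<close>

locale isotropic_law = prob_space N for N :: "(real^'k::{finite,wellorder}) measure" +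
  assumes sets_N [measurable_cong]: "sets N = sets borel"
    and second_moment:
      "(\<integral>y. sgn y $ a * sgn y $ b \<partial>N) = (if a = b then 1 / real CARD('k) else 0)"
    and charges_open: "open U \<Longrightarrow> U \<noteq> {} \<Longrightarrow> 0 < measure N U"
begin

lemma integrable_sign_product [intro, simp]: "integrable N (sign_product p)"
  by (rule integrable_const_bound[where B = 1]) (auto simp: abs_sign_product_le)

lemma integrable_sign_product_mult [intro, simp]:
  "integrable N (\<lambda>y. sign_product p y * sign_product q y)"
  by (rule integrable_const_bound[where B = 1])
    (auto simp: abs_mult intro!: mult_le_one abs_sign_product_le)

lemma integrable_sign_form [intro, simp]: "integrable N (sign_form E)"
  unfolding sign_form_expand[abs_def] by auto

lemma integrable_sign_form_square [intro, simp]: "integrable N (\<lambda>y. (sign_form E y)\<^sup>2)"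
  unfolding sign_form_square_expand by auto

definition fourth_moment :: "real^'k::{finite,wellorder}^'k::{finite,wellorder} \<Rightarrow> real" where
  "fourth_moment E = (\<integral>y. (sign_form E y)\<^sup>2 \<partial>N)"

lemma integral_sign_form: "(\<integral>y. sign_form E y \<partial>N) = (\<Sum>a\<in>UNIV. E $ a $ a) / real CARD('k)"
proof -
  have "(\<integral>y. sign_form E y \<partial>N) = (\<Sum>p\<in>UNIV. E $ fst p $ snd p * (\<integral>y. sign_product p y \<partial>N))"
    unfolding sign_form_expand by simp
  also have "\<dots> = (\<Sum>a\<in>UNIV. \<Sum>b\<in>UNIV. E $ a $ b * (if a = b then 1 / real CARD('k) else 0))"
    by (simp add: sum.cartesian_product sign_product_def[abs_def] second_moment case_prod_beta)
  also have "\<dots> = (\<Sum>a\<in>UNIV. E $ a $ a) / real CARD('k)"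
    by (simp add: if_distrib sum_divide_distrib cong: if_cong)
  finally show ?thesis .
qed

lemma fourth_moment_expand: "fourth_moment E =
    (\<Sum>p\<in>UNIV. \<Sum>q\<in>UNIV. E $ fst p $ snd p * E $ fst q $ snd q *
      (\<integral>y. sign_product p y * sign_product q y \<partial>N))"
  unfolding fourth_moment_def sign_form_square_expand by simp

lemma continuous_fourth_moment: "continuous_on S fourth_moment"
  unfolding fourth_moment_expand[abs_def] by (intro continuous_intros)

lemma fourth_moment_scaleR: "fourth_moment (s *\<^sub>R E) = s\<^sup>2 * fourth_moment E"
  by (simp add: fourth_moment_def sign_form_scaleR power_mult_distrib)

lemma integral_pos_of_open:
  fixes g :: "real^'k::{finite,wellorder} \<Rightarrow> real"
  assumes int: "integrable N g" and nonneg: "\<And>y. 0 \<le> g y"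
    and U: "open U" "U \<noteq> {}" "\<And>y. y \<in> U \<Longrightarrow> 0 < g y"
  shows "0 < (\<integral>y. g y \<partial>N)"
proof (rule ccontr)
  assume "\<not> 0 < (\<integral>y. g y \<partial>N)"
  then have "(\<integral>y. g y \<partial>N) = 0" using nonneg by (intro antisym integral_nonneg_AE) auto
  then have "AE y in N. g y = 0" using integral_nonneg_eq_0_iff_AE[OF int] nonneg by auto
  then have "AE y in N. y \<notin> U" by eventually_elim (use U(3) in force)
  moreover have "U \<in> sets N" using U(1) by (simp add: sets_N)
  ultimately have "measure N U = 0" by (simp add: prob_eq_0)
  then show False using charges_open[OF U(1,2)] by simp
qed

text \<open>With \<open>H\<close> the symmetric part of \<open>E\<close>, the gap is twice the mean of
  \<open>\<bar>H u\<bar>\<^sup>2 - (u \<bullet> H u)\<^sup>2\<close> over the signs \<open>u\<close>, which vanishes only if all vectors are eigenvectors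
  of \<open>H\<close>. Then \<open>H\<close> is a multiple of the identity, and zero because of its first diagonal entry.\<close>

lemma second_order_gap_pos:
  assumes up: "upper_triangular E" and E0: "E $ first_index $ first_index = 0" and ne: "E \<noteq> 0"
  shows "2 * fourth_moment E < ((norm E)\<^sup>2 + (\<Sum>a\<in>UNIV. (E $ a $ a)\<^sup>2)) / real CARD('k)"
proof -
  define H :: "real^'k::{finite,wellorder}^'k::{finite,wellorder}" where
    "H = (\<chi> a b. (E $ a $ b + E $ b $ a) / 2)"
  have zero: "E $ a $ b * E $ b $ a = (if b = a then (E $ a $ a)\<^sup>2 else 0)" for a b
    using up by (cases a b rule: linorder_cases) (auto simp: upper_triangular_def power2_eq_square)
  have "4 * (norm H)\<^sup>2 = (\<Sum>a\<in>UNIV. \<Sum>b\<in>UNIV. (E $ a $ b)\<^sup>2 + (E $ b $ a)\<^sup>2 + 2 * (E $ a $ b * E $ b $ a))"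
    unfolding norm_matrix_sq sum_distrib_left
    by (intro sum.cong refl) (simp add: H_def power2_eq_square field_simps)
  also have "\<dots> = 2 * (norm E)\<^sup>2 + 2 * (\<Sum>a\<in>UNIV. (E $ a $ a)\<^sup>2)"
    unfolding zero norm_matrix_sq sum.distrib
    using sum.swap[of "\<lambda>a b. (E $ b $ a)\<^sup>2" UNIV UNIV]
    by (simp add: sum_distrib_left if_distrib cong: if_cong)
  finally have nH: "(norm E)\<^sup>2 + (\<Sum>a\<in>UNIV. (E $ a $ a)\<^sup>2) = 2 * (norm H)\<^sup>2" by simp
  have EH: "sign_form E y = sign_form H y" for y
  proof -
    have "sign_form H y = (\<Sum>a\<in>UNIV. \<Sum>b\<in>UNIV. (E $ a $ b * (sgn y $ a * sgn y $ b)) / 2) +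
        (\<Sum>a\<in>UNIV. \<Sum>b\<in>UNIV. (E $ b $ a * (sgn y $ b * sgn y $ a)) / 2)"
      unfolding sign_form_def inner_vec_def matrix_vector_mult_nth sum.distrib[symmetric]
      by (simp add: H_def sum_distrib_left add_divide_distrib algebra_simps)
    also have "(\<Sum>a\<in>UNIV. \<Sum>b\<in>UNIV. (E $ b $ a * (sgn y $ b * sgn y $ a)) / 2) =
        (\<Sum>a\<in>UNIV. \<Sum>b\<in>UNIV. (E $ a $ b * (sgn y $ a * sgn y $ b)) / 2)"
      by (rule sum.swap)
    also have "(\<Sum>a\<in>UNIV. \<Sum>b\<in>UNIV. (E $ a $ b * (sgn y $ a * sgn y $ b)) / 2) +
        (\<Sum>a\<in>UNIV. \<Sum>b\<in>UNIV. (E $ a $ b * (sgn y $ a * sgn y $ b)) / 2) = sign_form E y"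
      unfolding sum.distrib[symmetric]
      by (simp add: sign_form_def inner_vec_def matrix_vector_mult_nth sum_distrib_left mult_ac)
    finally show ?thesis by simp
  qed
  define g where "g y = sign_form (transpose H ** H) y - (sign_form H y)\<^sup>2" for y
  have g: "g y = (norm (H *v sgn y))\<^sup>2 - (sgn y \<bullet> (H *v sgn y))\<^sup>2" for y
    unfolding g_def sign_form_gram by (simp add: sign_form_def)
  have int: "integrable N g" unfolding g_def by auto
  have Ig: "(\<integral>y. g y \<partial>N) = (norm H)\<^sup>2 / real CARD('k) - fourth_moment E"
    unfolding g_def fourth_moment_def EH by (simp add: integral_sign_form trace_gram)
  have nonneg: "0 \<le> g y" for y
  proof -
    have "\<bar>sgn y \<bullet> (H *v sgn y)\<bar> \<le> norm (sgn y) * norm (H *v sgn y)" by (rule Cauchy_Schwarz_ineq2)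
    also have "\<dots> \<le> 1 * norm (H *v sgn y)" by (intro mult_right_mono norm_sgn_le) auto
    finally have "(sgn y \<bullet> (H *v sgn y))\<^sup>2 \<le> (norm (H *v sgn y))\<^sup>2"
      by (metis abs_le_square_iff abs_norm_cancel mult_1)
    then show ?thesis by (simp add: g)
  qed
  define U where "U = {y. (y \<bullet> (H *v y))\<^sup>2 < (norm (H *v y))\<^sup>2 * (norm y)\<^sup>2}"
  have "open U"
    unfolding U_def matrix_vector_mult_def by (intro open_Collect_less continuous_intros)
  moreover have "0 < g y" if "y \<in> U" for y
  proof -
    have "y \<noteq> 0" using that by (auto simp: U_def)
    have "sgn y = (1 / norm y) *\<^sub>R y" by (simp add: sgn_div_norm divide_inverse)
    then have "g y = (norm (H *v y) / norm y)\<^sup>2 - ((y \<bullet> (H *v y)) / (norm y * norm y))\<^sup>2"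
      unfolding g by (simp add: matrix_vector_mult_scaleR)
    also have "\<dots> = ((norm (H *v y))\<^sup>2 * (norm y)\<^sup>2 - (y \<bullet> (H *v y))\<^sup>2) / (norm y * norm y)\<^sup>2"
      using \<open>y \<noteq> 0\<close> by (simp add: power_divide diff_divide_distrib power_mult_distrib)
        (simp add: eval_nat_numeral)
    finally have "g y = ((norm (H *v y))\<^sup>2 * (norm y)\<^sup>2 - (y \<bullet> (H *v y))\<^sup>2) / (norm y * norm y)\<^sup>2" .
    then show ?thesis using that \<open>y \<noteq> 0\<close> by (simp add: U_def)
  qed
  moreover have "U \<noteq> {}"
  proof
    assume "U = {}"
    then have eq: "(y \<bullet> (H *v y))\<^sup>2 = (norm (H *v y))\<^sup>2 * (norm y)\<^sup>2" for y
      using Cauchy_Schwarz_ineq[of y "H *v y"]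
      by (auto simp: U_def power2_norm_eq_inner not_less mult.commute intro: antisym)
    have Hax: "H *v axis a 1 = (\<chi> c. H $ c $ a)" for a
      by (simp add: vec_eq_iff matrix_vector_mult_nth axis_def if_distrib cong: if_cong)
    have diag: "H $ b $ a = 0" if "b \<noteq> a" for a b
    proof -
      have "(H $ a $ a)\<^sup>2 = (\<Sum>c\<in>UNIV. (H $ c $ a)\<^sup>2)"
        using eq[of "axis a 1"] by (simp add: Hax norm_axis_1 inner_axis' norm_real_vec_sq)
      also have "\<dots> = (H $ a $ a)\<^sup>2 + (\<Sum>c\<in>UNIV - {a}. (H $ c $ a)\<^sup>2)"
        by (simp add: sum.remove[of UNIV a])
      finally have "(\<Sum>c\<in>UNIV - {a}. (H $ c $ a)\<^sup>2) = 0" by simp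
      then show ?thesis using that by (simp add: sum_nonneg_eq_0_iff)
    qed
    have H0: "H $ first_index $ first_index = 0" using E0 by (simp add: H_def)
    have dz: "H $ a $ a = 0" for a
    proof (cases "a = first_index")
      case False
      \<comment> \<open>A sum of two coordinate vectors is an eigenvector only if their diagonal entries agree.\<close>
      define y :: "real^'k::{finite,wellorder}" where "y = axis a 1 + axis first_index 1"
      have "H *v y = H $ a $ a *\<^sub>R axis a 1"
      proof -
        have "H $ b $ first_index = 0" for b
          using diag[of b first_index] H0 by (cases "b = first_index") auto
        then show ?thesis
          using diag unfolding y_def matrix_vector_right_distrib Hax
          by (auto simp: vec_eq_iff axis_def)
      qed
      moreover have "y \<bullet> axis a 1 = 1" using False by (simp add: y_def inner_add_left inner_axis_axis)
      moreover have "(norm y)\<^sup>2 = 2"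
        using False by (simp add: y_def power2_norm_eq_inner inner_add_left inner_add_right inner_axis_axis)
      ultimately show ?thesis using eq[of y] by (simp add: norm_axis_1)
    qed (use H0 in simp)
    have "H = 0" using diag dz by (metis vec_eq_iff zero_index)
    then have "(norm E)\<^sup>2 + (\<Sum>a\<in>UNIV. (E $ a $ a)\<^sup>2) = 0" using nH by simp
    moreover have "0 \<le> (\<Sum>a\<in>UNIV. (E $ a $ a)\<^sup>2)" by (intro sum_nonneg) auto
    ultimately have "(norm E)\<^sup>2 \<le> 0" by linarith
    then show False using ne by simp
  qed
  ultimately have "0 < (\<integral>y. g y \<partial>N)" using integral_pos_of_open[OF int nonneg] by blast
  then show ?thesis using Ig nH by (simp add: field_simps)
qed

text \<open>The strict inequality for each direction becomes uniform by compactness of the unit sphere and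
  homogeneity.\<close>

lemma second_order_gap:
  obtains c where "0 < c"
    "\<And>E. upper_triangular E \<Longrightarrow> E $ first_index $ first_index = 0 \<Longrightarrow>
      2 * fourth_moment E + c * (norm E)\<^sup>2 \<le> ((norm E)\<^sup>2 + (\<Sum>a\<in>UNIV. (E $ a $ a)\<^sup>2)) / real CARD('k)"
proof -
  define S :: "(real^'k::{finite,wellorder}^'k::{finite,wellorder}) set" where
    "S = {E. upper_triangular E \<and> E $ first_index $ first_index = 0} \<inter> sphere 0 1"
  define gap where "gap E = ((norm E)\<^sup>2 + (\<Sum>a\<in>UNIV. (E $ a $ a)\<^sup>2)) / real CARD('k) - 2 * fourth_moment E"
    for E :: "real^'k::{finite,wellorder}^'k::{finite,wellorder}"
  have scale: "gap (s *\<^sub>R E) = s\<^sup>2 * gap E" for s E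
    by (simp add: gap_def fourth_moment_scaleR power_mult_distrib sum_distrib_left algebra_simps add_divide_distrib)
  have "closed {E :: real^'k::{finite,wellorder}^'k::{finite,wellorder}. upper_triangular E \<and> E $ first_index $ first_index = 0}"
    unfolding upper_triangular_def
    by (intro closed_Collect_conj closed_Collect_all closed_Collect_imp closed_Collect_eq
        open_Collect_const continuous_intros)
  then have "compact S" unfolding S_def by (simp add: closed_Int_compact)
  moreover have "continuous_on S gap"
    unfolding gap_def by (intro continuous_intros continuous_fourth_moment) auto
  ultimately obtain c where c: "0 < c" "\<And>E. E \<in> S \<Longrightarrow> c \<le> gap E"
  proof (cases "S = {}")
    case False
    then obtain E0 where "E0 \<in> S" "\<And>E. E \<in> S \<Longrightarrow> gap E0 \<le> gap E"
      using continuous_attains_inf[OF \<open>compact S\<close> False \<open>continuous_on S gap\<close>] by auto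
    moreover have "0 < gap E0"
    proof -
      have "upper_triangular E0" "E0 $ first_index $ first_index = 0" "E0 \<noteq> 0"
        using \<open>E0 \<in> S\<close> by (auto simp: S_def)
      then show ?thesis using second_order_gap_pos[of E0] by (simp add: gap_def)
    qed
    ultimately show ?thesis using that by blast
  qed (use that[of 1] in auto)
  have "c * (norm E)\<^sup>2 \<le> gap E"
    if "upper_triangular E" "E $ first_index $ first_index = 0" for E
  proof (cases "E = 0")
    case False
    have "(1 / norm E) *\<^sub>R E \<in> S" using that False by (auto simp: S_def upper_triangular_def)
    from c(2)[OF this] show ?thesis using False by (simp add: scale field_simps power2_eq_square)
  qed (simp add: gap_def fourth_moment_def sign_form_def)
  then show ?thesis using that[OF c(1)] by (force simp: gap_def)
qed

text \<open>The mean of \<open>(a \<bullet> u)\<^sup>2 (b \<bullet> u)\<^sup>2\<close> over the signs \<open>u\<close> is positive on the compact product of two unit spheres,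
  since two hyperplanes do not cover the space.\<close>

lemma fourth_moment_outer_lower:
  obtains c where "0 < c" "\<And>a b. c * (norm a)\<^sup>2 * (norm b)\<^sup>2 \<le> fourth_moment (outer_prod a b)"
proof -
  define S where "S = sphere (0 :: real^'k::{finite,wellorder}) 1 \<times> sphere (0 :: real^'k::{finite,wellorder}) 1"
  define F where "F q = fourth_moment (outer_prod (fst q) (snd q))" for q
  have "compact S" by (simp add: S_def compact_Times)
  moreover have "S \<noteq> {}"
    using norm_axis_1[of "first_index :: 'k"] by (force simp: S_def)
  moreover have "continuous_on S F"
    unfolding F_def outer_prod_def
    by (rule continuous_on_compose2[OF continuous_fourth_moment[of UNIV]]) (auto intro!: continuous_intros)
  ultimately obtain q where q: "q \<in> S" "\<And>q'. q' \<in> S \<Longrightarrow> F q \<le> F q'"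
    using continuous_attains_inf by metis
  obtain a0 b0 where ab: "q = (a0, b0)" "norm a0 = 1" "norm b0 = 1" using q(1) by (auto simp: S_def)
  define U where "U = {y. (a0 \<bullet> y) * (b0 \<bullet> y) \<noteq> 0}"
  have "open U" unfolding U_def by (intro open_Collect_neq continuous_intros)
  moreover have "U \<noteq> {}"
  proof
    assume "U = {}"
    then have *: "(a0 \<bullet> y) * (b0 \<bullet> y) = 0" for y by (auto simp: U_def)
    have "a0 \<bullet> a0 = 1" "b0 \<bullet> b0 = 1" using ab by (simp_all flip: power2_norm_eq_inner)
    then show False using *[of a0] *[of "a0 + b0"] by (simp add: inner_add_right inner_commute)
  qed
  moreover have "0 < (sign_form (outer_prod a0 b0) y)\<^sup>2" if "y \<in> U" for y
    using that unfolding sign_form_outer sgn_div_norm U_def by auto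
  ultimately have pos: "0 < F q"
    unfolding F_def fourth_moment_def ab fst_conv snd_conv
    by (intro integral_pos_of_open) auto
  have "F q * (norm a)\<^sup>2 * (norm b)\<^sup>2 \<le> fourth_moment (outer_prod a b)" for a b
  proof (cases "a = 0 \<or> b = 0")
    case True
    have "0 \<le> fourth_moment (outer_prod a b)" unfolding fourth_moment_def by (intro integral_nonneg_AE) auto
    then show ?thesis using True by auto
  next
    case False
    have "F q \<le> F (sgn a, sgn b)" using False by (intro q) (auto simp: S_def norm_sgn)
    moreover have "outer_prod a b = (norm a * norm b) *\<^sub>R outer_prod (sgn a) (sgn b)"
    proof -
      have "norm a \<noteq> 0" "norm b \<noteq> 0" using False by auto
      then have "a $ i * b $ j = norm a * norm b * (sgn a $ i * sgn b $ j)" for i j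
        by (simp add: sgn_div_norm field_simps)
      then show ?thesis unfolding vec_eq_iff by (simp add: outer_prod_def)
    qed
    ultimately have "fourth_moment (outer_prod a b) = (norm a * norm b)\<^sup>2 * F (sgn a, sgn b)"
      by (simp add: fourth_moment_scaleR F_def)
    moreover have "(norm a * norm b)\<^sup>2 * F q \<le> (norm a * norm b)\<^sup>2 * F (sgn a, sgn b)"
      using \<open>F q \<le> F (sgn a, sgn b)\<close> by (intro mult_left_mono) auto
    ultimately show ?thesis by (simp add: power_mult_distrib mult_ac)
  qed
  then show ?thesis using that pos by blast
qed

text \<open>Second and fourth moments of the sign are all that enters the second order expansion of the
  objective.\<close>

definition moments_close :: "nat \<Rightarrow> (nat \<Rightarrow> real^'k::{finite,wellorder}) \<Rightarrow> real \<Rightarrow> bool" where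
  "moments_close n z \<eta> \<longleftrightarrow>
     (\<forall>p. \<bar>avg n (sign_product p) z - (\<integral>y. sign_product p y \<partial>N)\<bar> \<le> \<eta>) \<and>
     (\<forall>p q. \<bar>avg n (\<lambda>y. sign_product p y * sign_product q y) z -
        (\<integral>y. sign_product p y * sign_product q y \<partial>N)\<bar> \<le> \<eta>)"

lemma avg_sign_form_close:
  assumes "moments_close n z \<eta>"
  shows "\<bar>avg n (sign_form E) z - (\<integral>y. sign_form E y \<partial>N)\<bar> \<le> \<eta> * ((real CARD('k))\<^sup>2 * norm E)"
proof -
  have "avg n (sign_form E) z - (\<integral>y. sign_form E y \<partial>N) =
      (\<Sum>p\<in>UNIV. E $ fst p $ snd p * (avg n (sign_product p) z - (\<integral>y. sign_product p y \<partial>N)))"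
    unfolding sign_form_expand[abs_def] avg_sum avg_cmult by (simp add: right_diff_distrib sum_subtractf)
  also have "\<bar>\<dots>\<bar> \<le> (\<Sum>p\<in>(UNIV :: ('k \<times> 'k) set). norm E * \<eta>)"
    unfolding abs_mult using assms unfolding moments_close_def
    by (intro order_trans[OF sum_abs] sum_mono)
      (auto simp only: abs_mult intro!: mult_mono component_le_norm_matrix mult_nonneg_nonneg norm_ge_zero abs_ge_zero)
  finally show ?thesis by (simp add: card_UNIV power2_eq_square mult_ac flip: UNIV_Times_UNIV)
qed

lemma avg_sign_form_square_close:
  assumes "moments_close n z \<eta>"
  shows "\<bar>avg n (\<lambda>y. (sign_form E y)\<^sup>2) z - fourth_moment E\<bar> \<le> \<eta> * (real CARD('k) ^ 4 * (norm E)\<^sup>2)"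
proof -
  have "avg n (\<lambda>y. (sign_form E y)\<^sup>2) z - fourth_moment E =
      (\<Sum>p\<in>UNIV. \<Sum>q\<in>UNIV. E $ fst p $ snd p * E $ fst q $ snd q *
        (avg n (\<lambda>y. sign_product p y * sign_product q y) z -
          (\<integral>y. sign_product p y * sign_product q y \<partial>N)))"
    unfolding sign_form_square_expand fourth_moment_expand avg_sum avg_cmult
    by (simp add: right_diff_distrib sum_subtractf)
  also have "\<bar>\<dots>\<bar> \<le> (\<Sum>p\<in>(UNIV :: ('k \<times> 'k) set). \<Sum>q\<in>(UNIV :: ('k \<times> 'k) set). norm E * norm E * \<eta>)"
  proof (rule order_trans[OF sum_abs sum_mono])
    fix p :: "'k \<times> 'k"
    show "\<bar>\<Sum>q\<in>UNIV. E $ fst p $ snd p * E $ fst q $ snd q *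
        (avg n (\<lambda>y. sign_product p y * sign_product q y) z -
          (\<integral>y. sign_product p y * sign_product q y \<partial>N))\<bar>
      \<le> (\<Sum>q\<in>(UNIV :: ('k \<times> 'k) set). norm E * norm E * \<eta>)"
      using assms unfolding moments_close_def
      by (intro order_trans[OF sum_abs] sum_mono)
        (auto simp only: abs_mult intro!: mult_mono component_le_norm_matrix mult_nonneg_nonneg norm_ge_zero abs_ge_zero)
  qed
  finally show ?thesis
    by (simp add: card_UNIV power2_eq_square power4_eq_xxxx mult_ac flip: UNIV_Times_UNIV)
qed

text \<open>The squared norm is \<open>1 + x\<close> with \<open>x\<close> the sum of a linear and a quadratic term in \<open>E\<close>. Of the constant 30,
  27 comes from the cubic term of the logarithm and 3 from the cubic parts of \<open>x\<^sup>2\<close>.\<close>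

lemma ln_norm_sq_lower:
  fixes E :: "real^'k::{finite,wellorder}^'k::{finite,wellorder}"
  assumes y: "y \<noteq> 0" and e: "norm E = e" "e \<le> 1/8"
  shows "2 * sign_form E y + sign_form (transpose E ** E) y - 2 * (sign_form E y)\<^sup>2 - 30 * e ^ 3
    \<le> ln ((norm ((mat 1 + E) *v sgn y))\<^sup>2)"
proof -
  define p where "p = sign_form E y"
  define r where "r = sign_form (transpose E ** E) y"
  have e0: "0 \<le> e" using e by auto
  have n1: "norm (sgn y) = 1" using y by (simp add: norm_sgn)
  have Ee: "norm (E *v sgn y) \<le> e"
    using norm_matrix_vector_mult_le[of E "sgn y"] n1 e by simp
  have p: "\<bar>p\<bar> \<le> e"
    using Cauchy_Schwarz_ineq2[of "sgn y" "E *v sgn y"] n1 Ee by (simp add: p_def sign_form_def)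
  have r: "0 \<le> r" "r \<le> e\<^sup>2"
    using Ee by (auto simp: r_def sign_form_gram intro!: power_mono)
  have "e\<^sup>2 \<le> e * (1/8)" unfolding power2_eq_square using e e0 by (intro mult_left_mono) auto
  then have e2: "e\<^sup>2 \<le> e / 8" by simp
  define x where "x = 2 * p + r"
  have x: "\<bar>x\<bar> \<le> 3 * e" using p r e2 e0 by (auto simp: x_def)
  have nrm: "(norm ((mat 1 + E) *v sgn y))\<^sup>2 = 1 + x"
  proof -
    have "(norm (sgn y + 1 *\<^sub>R (E *v sgn y)))\<^sup>2 = 1 + x"
      unfolding norm_add_scaleR_sq n1 x_def p_def r_def sign_form_gram by (simp add: sign_form_def)
    then show ?thesis by (simp add: matrix_vector_mult_add_rdistrib)
  qed
  have "x - x\<^sup>2 / 2 - \<bar>x\<bar> ^ 3 \<le> ln (1 + x)" using x e by (intro ln_one_plus_lower) linarith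
  moreover have "\<bar>x\<bar> ^ 3 \<le> 27 * e ^ 3"
    using power_mono[OF x, of 3] by (simp add: power_mult_distrib)
  moreover have "x\<^sup>2 / 2 \<le> 2 * p\<^sup>2 + 3 * e ^ 3"
  proof -
    have "p * r \<le> e * e\<^sup>2" using p r e0 by (intro mult_mono) auto
    moreover have "r\<^sup>2 \<le> e\<^sup>2 * e"
    proof -
      have "r * r \<le> e\<^sup>2 * e" using r e2 e0 by (intro mult_mono) auto
      then show ?thesis by (simp add: power2_eq_square)
    qed
    moreover have "x\<^sup>2 / 2 = 2 * p\<^sup>2 + 2 * (p * r) + r\<^sup>2 / 2"
      by (simp add: x_def power2_eq_square algebra_simps)
    moreover have "e * e\<^sup>2 = e ^ 3" "e\<^sup>2 * e = e ^ 3" "0 \<le> e ^ 3"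
      using e0 by (simp_all add: power2_eq_square power3_eq_cube)
    ultimately show ?thesis by linarith
  qed
  ultimately show ?thesis unfolding nrm p_def[symmetric] r_def[symmetric] using x_def by linarith
qed

text \<open>The linear terms cancel between the logarithmic norms, whose means are close to the trace of \<open>E\<close>
  divided by the dimension, and the logarithm of the determinant.\<close>

lemma tyler_objective_boundary:
  assumes n: "1 \<le> n" and nz: "\<And>t. t \<in> {1..n} \<Longrightarrow> z t \<noteq> 0" and mc: "moments_close n z \<eta>"
    and E: "norm E = e" "e \<le> 1/8"
    and gap: "2 * fourth_moment E + c * (norm E)\<^sup>2 \<le>
      ((norm E)\<^sup>2 + (\<Sum>a\<in>UNIV. (E $ a $ a)\<^sup>2)) / real CARD('k)"
  shows "c * e\<^sup>2 - 32 * e ^ 3 - \<eta> * (2 * (real CARD('k))\<^sup>2 * e + (real CARD('k))\<^sup>2 * e\<^sup>2 +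
      2 * real CARD('k) ^ 4 * e\<^sup>2) \<le> tyler_objective n z (mat 1 + E)"
proof -
  let ?k = "real CARD('k)"
  have \<eta>0: "0 \<le> \<eta>" using mc unfolding moments_close_def by (meson abs_ge_zero order_trans)
  let ?tr = "(\<Sum>a\<in>UNIV. E $ a $ a)" and ?sq = "(\<Sum>a\<in>UNIV. (E $ a $ a)\<^sup>2)"
  have "avg n (\<lambda>y. 2 * sign_form E y + sign_form (transpose E ** E) y - 2 * (sign_form E y)\<^sup>2 - 30 * e ^ 3) z
      \<le> avg n (\<lambda>y. ln ((norm ((mat 1 + E) *v sgn y))\<^sup>2)) z"
    using nz E by (intro avg_mono ln_norm_sq_lower) auto
  then have A: "2 * avg n (sign_form E) z + avg n (sign_form (transpose E ** E)) z
      - 2 * avg n (\<lambda>y. (sign_form E y)\<^sup>2) z - 30 * e ^ 3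
      \<le> avg n (\<lambda>y. ln ((norm ((mat 1 + E) *v sgn y))\<^sup>2)) z"
    unfolding avg_diff avg_add avg_cmult avg_const[OF n] .
  have B: "?tr / ?k - \<eta> * (?k\<^sup>2 * e) \<le> avg n (sign_form E) z"
    using avg_sign_form_close[OF mc, of E] E by (simp add: integral_sign_form abs_le_iff)
  have "norm (transpose E ** E) \<le> e * e"
    using norm_matrix_mult_le[of "transpose E" E] E by (simp add: norm_transpose)
  then have "\<eta> * (?k\<^sup>2 * norm (transpose E ** E)) \<le> \<eta> * (?k\<^sup>2 * e\<^sup>2)"
    using \<eta>0 by (intro mult_left_mono) (auto simp: power2_eq_square)
  then have D: "e\<^sup>2 / ?k - \<eta> * (?k\<^sup>2 * e\<^sup>2) \<le> avg n (sign_form (transpose E ** E)) z"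
    using avg_sign_form_close[OF mc, of "transpose E ** E"] E
    by (simp add: integral_sign_form trace_gram abs_le_iff)
  have F: "avg n (\<lambda>y. (sign_form E y)\<^sup>2) z \<le> fourth_moment E + \<eta> * (?k ^ 4 * e\<^sup>2)"
    using avg_sign_form_square_close[OF mc, of E] E by (simp add: abs_le_iff)
  have "(\<Sum>a\<in>UNIV. ln ((mat 1 + E) $ a $ a)) \<le> (\<Sum>a\<in>UNIV. E $ a $ a - (E $ a $ a)\<^sup>2 / 2 + e ^ 3)"
  proof (rule sum_mono)
    fix a :: 'k
    have ea: "\<bar>E $ a $ a\<bar> \<le> e" using component_le_norm_matrix[of E a a] E by simp
    then have "\<bar>E $ a $ a\<bar> ^ 3 \<le> e ^ 3" by (intro power_mono) auto
    moreover have "ln (1 + E $ a $ a) \<le> E $ a $ a - (E $ a $ a)\<^sup>2 / 2 + \<bar>E $ a $ a\<bar> ^ 3"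
      using ea E by (intro ln_one_plus_upper) linarith
    ultimately show "ln ((mat 1 + E) $ a $ a) \<le> E $ a $ a - (E $ a $ a)\<^sup>2 / 2 + e ^ 3"
      by (simp add: mat_1_nth)
  qed
  also have "\<dots> = ?tr - ?sq / 2 + ?k * e ^ 3"
    by (simp add: sum.distrib sum_subtractf sum_divide_distrib)
  finally have "2 / ?k * (\<Sum>a\<in>UNIV. ln ((mat 1 + E) $ a $ a)) \<le> 2 / ?k * (?tr - ?sq / 2 + ?k * e ^ 3)"
    by (intro mult_left_mono) auto
  also have "\<dots> = 2 * (?tr / ?k) - ?sq / ?k + 2 * e ^ 3"
    by (simp add: field_simps)
  finally have G: "2 / ?k * (\<Sum>a\<in>UNIV. ln ((mat 1 + E) $ a $ a)) \<le> 2 * (?tr / ?k) - ?sq / ?k + 2 * e ^ 3" .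
  have H: "2 * fourth_moment E + c * e\<^sup>2 \<le> e\<^sup>2 / ?k + ?sq / ?k"
    using gap E by (simp add: add_divide_distrib)
  have "\<eta> * (2 * ?k\<^sup>2 * e + ?k\<^sup>2 * e\<^sup>2 + 2 * ?k ^ 4 * e\<^sup>2) =
      2 * (\<eta> * (?k\<^sup>2 * e)) + \<eta> * (?k\<^sup>2 * e\<^sup>2) + 2 * (\<eta> * (?k ^ 4 * e\<^sup>2))"
    by (simp add: algebra_simps)
  then show ?thesis
    unfolding tyler_objective_def using A B D F G H by linarith
qed

text \<open>On the boundary of a small neighbourhood of the identity the empirical objective is positive,
  by its second order expansion, whereas it vanishes at the identity. So its minimum over the
  neighbourhood is interior and solves Tyler's equation. Closeness of the fourth moments also
  excludes that the observations lie in two hyperplanes, hence the solution is unique.\<close>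

theorem tyler_solution_near_identity:
  assumes \<delta>: "0 < \<delta>"
  obtains \<eta> where "0 < \<eta>"
    "\<And>n z. 1 \<le> n \<Longrightarrow> (\<And>t. t \<in> {1..n} \<Longrightarrow> z t \<noteq> 0) \<Longrightarrow> moments_close n z \<eta> \<Longrightarrow>
      \<exists>C\<in>triangular_nbhd \<delta>. tyler_solution n z C \<and> (\<forall>C'. tyler_solution n z C' \<longrightarrow> C' = C)"
proof -
  let ?k = "real CARD('k)"
  obtain c where c: "0 < c"
    "\<And>E. upper_triangular E \<Longrightarrow> E $ first_index $ first_index = 0 \<Longrightarrow>
      2 * fourth_moment E + c * (norm E)\<^sup>2 \<le> ((norm E)\<^sup>2 + (\<Sum>a\<in>UNIV. (E $ a $ a)\<^sup>2)) / ?k"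
    using second_order_gap by blast
  obtain c2 where c2: "0 < c2"
    "\<And>a b. c2 * (norm a)\<^sup>2 * (norm b)\<^sup>2 \<le> fourth_moment (outer_prod a b)"
    using fourth_moment_outer_lower by blast
  \<comment> \<open>The bound \<open>c / 128\<close> makes the cubic remainder at most a quarter of the quadratic gain \<open>c * e\<^sup>2\<close>, and \<open>\<eta>\<close> below makes the sampling error at most half of it.\<close>
  define e where "e = min \<delta> (min (1/8) (c / 128))"
  have e: "0 < e" "e \<le> \<delta>" "e \<le> 1/8" "e \<le> c / 128" using \<delta> c(1) by (auto simp: e_def)
  define K where "K = 2 * ?k\<^sup>2 * e + ?k\<^sup>2 * e\<^sup>2 + 2 * ?k ^ 4 * e\<^sup>2"
  have K: "0 < K" unfolding K_def using e by (intro add_pos_nonneg) auto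
  define \<eta> where "\<eta> = min (c * e\<^sup>2 / (2 * K)) (c2 / (2 * ?k ^ 4))"
  have \<eta>: "0 < \<eta>" using c(1) c2(1) e(1) K by (simp add: \<eta>_def)
  have \<eta>K: "\<eta> * K \<le> c * e\<^sup>2 / 2"
  proof -
    have "\<eta> * K \<le> c * e\<^sup>2 / (2 * K) * K" using K by (intro mult_right_mono) (auto simp: \<eta>_def)
    then show ?thesis using K by simp
  qed
  have \<eta>k: "\<eta> * ?k ^ 4 \<le> c2 / 2"
  proof -
    have "\<eta> * ?k ^ 4 \<le> c2 / (2 * ?k ^ 4) * ?k ^ 4" by (intro mult_right_mono) (auto simp: \<eta>_def)
    then show ?thesis by simp
  qed
  have "\<exists>C\<in>triangular_nbhd \<delta>. tyler_solution n z C \<and> (\<forall>C'. tyler_solution n z C' \<longrightarrow> C' = C)"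
    if n: "1 \<le> n" and nz: "\<And>t. t \<in> {1..n} \<Longrightarrow> z t \<noteq> 0" and mc: "moments_close n z \<eta>" for n z
  proof -
    have I: "mat 1 \<in> triangular_nbhd e"
      using e by (simp add: triangular_nbhd_def upper_triangular_def mat_1_nth)
    have objI: "tyler_objective n z (mat 1) = 0"
    proof -
      have "avg n (\<lambda>y. ln ((norm (mat 1 *v sgn y))\<^sup>2)) z = avg n (\<lambda>y. 0) z"
        using nz by (intro avg_cong) (simp add: norm_sgn)
      then show ?thesis by (simp add: tyler_objective_def avg_def mat_1_nth)
    qed
    have "continuous_on (triangular_nbhd e) (tyler_objective n z)"
      using e nz by (intro continuous_on_tyler_objective) auto
    then obtain C where C: "C \<in> triangular_nbhd e"
      "\<And>C'. C' \<in> triangular_nbhd e \<Longrightarrow> tyler_objective n z C \<le> tyler_objective n z C'"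
      using continuous_attains_inf[OF compact_triangular_nbhd] I by (metis empty_iff)
    have "norm (C - mat 1) \<noteq> e"
    proof
      assume bd: "norm (C - mat 1) = e"
      have "upper_triangular (C - mat 1)" "(C - mat 1) $ first_index $ first_index = 0"
        using C(1) by (auto simp: triangular_nbhd_def upper_triangular_def mat_1_nth)
      then have "c * e\<^sup>2 - 32 * e ^ 3 - \<eta> * K \<le> tyler_objective n z (mat 1 + (C - mat 1))"
        unfolding K_def by (intro tyler_objective_boundary n nz mc bd e c(2))
      also have "mat 1 + (C - mat 1) = C" by simp
      also have "tyler_objective n z C \<le> 0" using C(2)[OF I] objI by simp
      finally have "c * e\<^sup>2 / 2 \<le> 32 * e ^ 3" using \<eta>K by linarith
      also have "\<dots> = 32 * e * e\<^sup>2" by (simp add: power3_eq_cube power2_eq_square)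
      also have "\<dots> \<le> (c / 4) * e\<^sup>2" using e by (intro mult_right_mono) auto
      finally have "c * e\<^sup>2 \<le> 0" by linarith
      then show False using c(1) e(1) by (simp add: mult_le_0_iff)
    qed
    then have "norm (C - mat 1) < e" using C(1) by (auto simp: triangular_nbhd_def)
    then have sol: "tyler_solution n z C"
      using e by (intro tyler_solution_of_interior_minimum[OF n nz _ C(1) _ C(2)]) auto
    have "C' = C" if "tyler_solution n z C'" for C'
    proof (rule tyler_solution_unique[OF n sol that nz])
      fix a b :: "real^'k::{finite,wellorder}" assume ab: "a \<noteq> 0" "b \<noteq> 0"
      show "\<exists>t\<in>{1..n}. (a \<bullet> z t) * (b \<bullet> z t) \<noteq> 0"
      proof (rule ccontr)
        assume "\<not> ?thesis"
        then have "avg n (\<lambda>y. (sign_form (outer_prod a b) y)\<^sup>2) z = avg n (\<lambda>y. 0) z"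
          by (intro avg_cong) (auto simp: sign_form_outer sgn_div_norm)
        also have "\<dots> = 0" by (simp add: avg_def)
        finally have z0: "avg n (\<lambda>y. (sign_form (outer_prod a b) y)\<^sup>2) z = 0" .
        then have "fourth_moment (outer_prod a b) \<le> \<eta> * (?k ^ 4 * (norm (outer_prod a b))\<^sup>2)"
          using avg_sign_form_square_close[OF mc, of "outer_prod a b"] by (simp add: z0 abs_le_iff)
        also have "\<dots> = (\<eta> * ?k ^ 4) * ((norm a)\<^sup>2 * (norm b)\<^sup>2)"
          by (simp add: norm_outer_prod power_mult_distrib)
        also have "\<dots> \<le> (c2 / 2) * ((norm a)\<^sup>2 * (norm b)\<^sup>2)"
          using \<eta>k by (intro mult_right_mono) auto
        finally have "c2 * ((norm a)\<^sup>2 * (norm b)\<^sup>2) \<le> (c2 / 2) * ((norm a)\<^sup>2 * (norm b)\<^sup>2)"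
          using c2(2)[of a b] by (simp add: mult_ac)
        then show False using c2(1) ab by (simp add: mult_le_cancel_right)
      qed
    qed
    moreover have "C \<in> triangular_nbhd \<delta>" using C(1) e(2) by (auto simp: triangular_nbhd_def)
    ultimately show ?thesis using sol by blast
  qed
  then show ?thesis using that \<eta> by blast
qed

end

section \<open>Samples from a symmetric law\<close>

text \<open>Symmetry of the law about 0 makes summands of the statistics orthogonal. Absolute continuity
  excludes ties and makes the distribution function of the norm continuous.\<close>

locale spherical_law = isotropic_law N for N :: "(real^'k::{finite,wellorder}) measure" +
  assumes abs_cont: "A \<in> null_sets lborel \<Longrightarrow> A \<in> null_sets N"
    and symmetric: "distr N N uminus = N"
begin

sublocale coords: product_prob_space "\<lambda>_ :: nat. N" UNIV
  by unfold_locales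

definition sample_law :: "nat \<Rightarrow> (nat \<Rightarrow> real^'k::{finite,wellorder}) measure" where
  "sample_law n = PiM {1..n} (\<lambda>_. N)"

lemma prob_space_sample: "prob_space (sample_law n)"
  unfolding sample_law_def by (intro prob_space_PiM prob_space_axioms)

lemma space_N [simp]: "space N = UNIV"
  using sets_eq_imp_space_eq[OF sets_N] by simp

lemma measurable_coordinate [measurable]:
  "t \<in> {1..n} \<Longrightarrow> (\<lambda>y. y t) \<in> borel_measurable (sample_law n)"
  unfolding sample_law_def
  using measurable_component_singleton[of t "{1..n}" "\<lambda>_. N"] by (simp add: measurable_cong_sets[OF refl sets_N])

lemma distr_coordinate:
  assumes "t \<in> {1..n}" shows "distr (sample_law n) borel (\<lambda>y. y t) = N"
proof -
  have "distr (sample_law n) borel (\<lambda>y. y t) = distr (sample_law n) N (\<lambda>y. y t)"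
    by (rule distr_cong) (auto simp: sets_N)
  also have "\<dots> = N"
    unfolding sample_law_def by (intro distr_PiM_component prob_space_axioms assms)
  finally show ?thesis .
qed

lemma indep_coordinates:
  assumes n: "1 \<le> n"
  shows "prob_space.indep_vars (sample_law n) (\<lambda>_. borel) (\<lambda>t y. y t) {1..n}"
proof -
  interpret P: prob_space "sample_law n" by (rule prob_space_sample)
  have "distr (sample_law n) (\<Pi>\<^sub>M t\<in>{1..n}. borel) (\<lambda>y. \<lambda>t\<in>{1..n}. y t) =
      distr (sample_law n) (sample_law n) (\<lambda>y. y)"
  proof (rule distr_cong)
    show "sets (\<Pi>\<^sub>M t\<in>{1..n}. borel) = sets (sample_law n)"
      unfolding sample_law_def by (rule sets_PiM_cong) (auto simp: sets_N)
    show "(\<lambda>t\<in>{1..n}. y t) = y" if "y \<in> space (sample_law n)" for y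
      using that by (auto simp: sample_law_def space_PiM PiE_def extensional_restrict)
  qed simp
  also have "\<dots> = sample_law n" by (rule distr_id)
  also have "\<dots> = (\<Pi>\<^sub>M t\<in>{1..n}. distr (sample_law n) borel (\<lambda>y. y t))"
    unfolding sample_law_def[of n, symmetric] by (subst sample_law_def, rule PiM_cong) (auto simp: distr_coordinate)
  finally show ?thesis
    using n by (subst P.indep_vars_iff_distr_eq_PiM') auto
qed

lemma measurable_flip [measurable]:
  assumes s: "s \<in> {1..n}"
  shows "(\<lambda>y. y(s := - y s)) \<in> measurable (sample_law n) (sample_law n)"
  unfolding sample_law_def
proof (rule measurable_fun_upd[where J = "{1..n}"])
  show "{1..n} = {1..n} \<union> {s}" using s by auto
  have "(\<lambda>y. - y s) \<in> borel_measurable (sample_law n)" using s by measurable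
  then show "(\<lambda>y. - y s) \<in> measurable (Pi\<^sub>M {1..n} (\<lambda>_. N)) N"
    by (simp add: sample_law_def measurable_cong_sets[OF refl sets_N])
qed simp

lemma distr_flip:
  assumes s: "s \<in> {1..n}"
  shows "distr (sample_law n) (sample_law n) (\<lambda>y. y(s := - y s)) = sample_law n"
proof -
  note meas = measurable_flip[OF s]
  show ?thesis
    unfolding sample_law_def
  proof (rule coords.PiM_eqI)
    fix A assume A: "\<And>i. i \<in> {1..n} \<Longrightarrow> A i \<in> sets N"
    define B where "B i = (if i = s then uminus -` A s else A i)" for i
    have us: "uminus -` A s \<in> sets N"
      using A[OF s] measurable_sets[of uminus borel borel "A s"] by (simp add: sets_N)
    have B: "B i \<in> sets N" if "i \<in> {1..n}" for i using A[OF that] us by (simp add: B_def)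
    have "emeasure N (A s) = emeasure (distr N N uminus) (A s)" by (simp add: symmetric)
    also have "\<dots> = emeasure N (uminus -` A s)"
      using A[OF s] by (subst emeasure_distr) (auto simp: measurable_cong_sets[OF sets_N sets_N])
    finally have eqB: "emeasure N (B i) = emeasure N (A i)" for i by (simp add: B_def)
    have PA: "Pi\<^sub>E {1..n} A \<in> sets (sample_law n)"
      unfolding sample_law_def using A by (intro sets_PiM_I_finite) auto
    have "(\<lambda>y. y(s := - y s)) -` Pi\<^sub>E {1..n} A \<inter> space (sample_law n) = Pi\<^sub>E {1..n} B"
      using s by (auto simp: sample_law_def space_PiM B_def PiE_def Pi_def extensional_def split: if_splits)
    then show "emeasure (distr (Pi\<^sub>M {1..n} (\<lambda>_. N)) (Pi\<^sub>M {1..n} (\<lambda>_. N)) (\<lambda>y. y(s := - y s))) (Pi\<^sub>E {1..n} A) =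
        (\<Prod>i\<in>{1..n}. emeasure N (A i))"
      using meas PA coords.emeasure_PiM[of "{1..n}" B] B
      by (simp add: emeasure_distr sample_law_def eqB)
  qed auto
qed

text \<open>Restriction to \<open>{1..n}\<close> keeps the transposed sample in the space of the product measure, whose elements
  are undefined elsewhere.\<close>

definition swap :: "nat \<Rightarrow> nat \<Rightarrow> nat \<Rightarrow> (nat \<Rightarrow> 'b) \<Rightarrow> nat \<Rightarrow> 'b" where
  "swap n s s' y = (\<lambda>t\<in>{1..n}. y (Transposition.transpose s s' t))"

lemma transpose_in: "s \<in> {1..n} \<Longrightarrow> s' \<in> {1..n} \<Longrightarrow> t \<in> {1..n} \<Longrightarrow> Transposition.transpose s s' t \<in> {1..n}"
  by (auto simp: Transposition.transpose_def)

lemma distr_swap: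
  assumes "s \<in> {1..n}" "s' \<in> {1..n}"
  shows "distr (sample_law n) (sample_law n) (swap n s s') = sample_law n"
  unfolding sample_law_def swap_def
  by (intro distr_PiM_reindex prob_space_axioms inj_onI Pi_I transpose_in assms)
    (metis transpose_involutory)

lemma measurable_swap [measurable]:
  assumes "s \<in> {1..n}" "s' \<in> {1..n}"
  shows "swap n s s' \<in> measurable (sample_law n) (sample_law n)"
  unfolding sample_law_def swap_def
  using assms by (intro measurable_restrict measurable_component_singleton) (rule transpose_in)

lemma swap_in_space:
  assumes "s \<in> {1..n}" "s' \<in> {1..n}" "y \<in> space (sample_law n)"
  shows "swap n s s' y \<in> space (sample_law n)"
  by (rule measurable_space[OF measurable_swap]) (use assms in auto)

text \<open>The law of large numbers, from Hoeffding's inequality.\<close>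

lemma avg_concentration:
  assumes \<phi> [measurable]: "\<phi> \<in> borel_measurable borel" and bd: "\<And>y. \<bar>\<phi> y\<bar> \<le> 1" and \<eta>: "0 < \<eta>"
  shows "(\<lambda>n. measure (sample_law n) {y\<in>space (sample_law n). \<eta> < \<bar>avg n \<phi> y - (\<integral>x. \<phi> x \<partial>N)\<bar>}) \<longlonglongrightarrow> 0"
proof (rule tendsto_sandwich[where f = "\<lambda>_. 0" and h = "\<lambda>n. 2 * exp (- (\<eta>\<^sup>2 / 2)) ^ n"])
  show "\<forall>\<^sub>F n in sequentially. measure (sample_law n)
      {y\<in>space (sample_law n). \<eta> < \<bar>avg n \<phi> y - (\<integral>x. \<phi> x \<partial>N)\<bar>} \<le> 2 * exp (- (\<eta>\<^sup>2 / 2)) ^ n"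
  proof (rule eventually_sequentiallyI[of 1])
    fix n :: nat assume n: "1 \<le> n"
    interpret P: prob_space "sample_law n" by (rule prob_space_sample)
    have distr_phi: "distr (sample_law n) borel (\<lambda>y. \<phi> (y t)) = distr N borel \<phi>" if "t \<in> {1..n}" for t
      using distr_distr[OF \<phi> measurable_coordinate[OF that]]
      unfolding distr_coordinate[OF that] by (simp add: comp_def)
    interpret H: Hoeffding_ineq_iid "sample_law n" "{1..n}" "\<lambda>t y. \<phi> (y t)" "\<lambda>y. \<phi> (y 1)" "-1" 1
        "P.expectation (\<lambda>y. \<phi> (y 1))"
    proof unfold_locales
      show "P.indep_vars (\<lambda>_. borel) (\<lambda>t y. \<phi> (y t)) {1..n}"
        by (rule P.indep_vars_compose2[OF indep_coordinates[OF n]]) simp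
      show "distr (sample_law n) borel (\<lambda>y. \<phi> (y t)) = distr (sample_law n) borel (\<lambda>y. \<phi> (y 1))"
        if "t \<in> {1..n}" for t
        using distr_phi[OF that] distr_phi[of 1] n by simp
      show "P.random_variable borel (\<lambda>y. \<phi> (y 1))"
        using n by (intro measurable_compose[OF measurable_coordinate \<phi>]) auto
      have "\<phi> x \<in> {- 1..1}" for x using bd[of x] by auto
      then show "AE y in sample_law n. \<phi> (y 1) \<in> {- 1..1}" by (rule AE_I2)
    qed (rule finite_atLeastAtMost | rule reflexive)+
    have mean: "P.expectation (\<lambda>y. \<phi> (y 1)) = (\<integral>x. \<phi> x \<partial>N)"
    proof -
      have 1: "1 \<in> {1..n}" using n by simp
      show ?thesis
        using integral_distr[OF measurable_coordinate[OF 1] \<phi>] unfolding distr_coordinate[OF 1]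
        by (rule sym)
    qed
    have "{y\<in>space (sample_law n). \<eta> < \<bar>avg n \<phi> y - (\<integral>x. \<phi> x \<partial>N)\<bar>} \<subseteq>
        {y\<in>space (sample_law n). real n * \<eta> \<le> \<bar>(\<Sum>t\<in>{1..n}. \<phi> (y t)) - real (card {1..n}) * (\<integral>x. \<phi> x \<partial>N)\<bar>}"
    proof safe
      fix y assume "\<eta> < \<bar>avg n \<phi> y - (\<integral>x. \<phi> x \<partial>N)\<bar>"
      then have "real n * \<eta> \<le> real n * \<bar>avg n \<phi> y - (\<integral>x. \<phi> x \<partial>N)\<bar>" by (intro mult_left_mono) auto
      also have "\<dots> = \<bar>real n * avg n \<phi> y - real n * (\<integral>x. \<phi> x \<partial>N)\<bar>"
        by (simp add: abs_mult right_diff_distrib[symmetric])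
      also have "real n * avg n \<phi> y = (\<Sum>t\<in>{1..n}. \<phi> (y t))" using n by (simp add: avg_def)
      finally show "real n * \<eta> \<le> \<bar>(\<Sum>t\<in>{1..n}. \<phi> (y t)) - real (card {1..n}) * (\<integral>x. \<phi> x \<partial>N)\<bar>" by simp
    qed
    then have "P.prob {y\<in>space (sample_law n). \<eta> < \<bar>avg n \<phi> y - (\<integral>x. \<phi> x \<partial>N)\<bar>} \<le>
        P.prob {y\<in>space (sample_law n). real n * \<eta> \<le> \<bar>(\<Sum>t\<in>{1..n}. \<phi> (y t)) - real (card {1..n}) * (\<integral>x. \<phi> x \<partial>N)\<bar>}"
      by (intro P.finite_measure_mono) measurable
    also have "\<dots> \<le> 2 * exp (- 2 * (real n * \<eta>)\<^sup>2 / (real n * (1 - - 1)\<^sup>2))"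
      using H.Hoeffding_ineq_abs_ge[of "real n * \<eta>"] n \<eta> unfolding mean by simp
    also have "- 2 * (real n * \<eta>)\<^sup>2 / (real n * (1 - - 1)\<^sup>2) = real n * (- (\<eta>\<^sup>2 / 2))"
      using n by (simp add: power2_eq_square)
    finally show "P.prob {y\<in>space (sample_law n). \<eta> < \<bar>avg n \<phi> y - (\<integral>x. \<phi> x \<partial>N)\<bar>} \<le> 2 * exp (- (\<eta>\<^sup>2 / 2)) ^ n"
      by (simp only: exp_of_nat_mult)
  qed
  have "(\<lambda>n. 2 * exp (- (\<eta>\<^sup>2 / 2)) ^ n) \<longlonglongrightarrow> 2 * 0"
    using \<eta> by (intro tendsto_mult tendsto_const LIMSEQ_realpow_zero) auto
  then show "(\<lambda>n. 2 * exp (- (\<eta>\<^sup>2 / 2)) ^ n) \<longlonglongrightarrow> 0" by simp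
qed auto

text \<open>Dilates of a set that meets each ray from the origin at most once are disjoint, so such a set is
  a Lebesgue null set. Here this applies to the sections of \<open>T\<close> in the coordinate \<open>s\<close>.\<close>

lemma null_of_rays:
  assumes s: "s \<in> {1..n}" and T: "T \<in> sets (sample_law n)"
    and ray: "\<And>y x c. y(s := x) \<in> T \<Longrightarrow> y(s := c *\<^sub>R x) \<in> T \<Longrightarrow> 0 \<le> c \<Longrightarrow> c = 1"
  shows "T \<in> null_sets (sample_law n)"
proof -
  define I where "I = {1..n} - {s}"
  have I: "insert s I = {1..n}" "s \<notin> I" "finite I" using s by (auto simp: I_def)
  have T': "T \<in> sets (PiM (insert s I) (\<lambda>_. N))" using T by (simp add: I sample_law_def)
  have "emeasure (sample_law n) T = (\<integral>\<^sup>+ y. indicator T y \<partial>PiM (insert s I) (\<lambda>_. N))"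
    using T' by (simp add: I sample_law_def)
  also have "\<dots> = (\<integral>\<^sup>+ y. (\<integral>\<^sup>+ x. indicator T (y(s := x)) \<partial>N) \<partial>PiM I (\<lambda>_. N))"
    using T' I by (intro coords.product_nn_integral_insert) auto
  also have "\<dots> = (\<integral>\<^sup>+ y. 0 \<partial>PiM I (\<lambda>_. N))"
  proof (rule nn_integral_cong)
    fix y assume y: "y \<in> space (PiM I (\<lambda>_. N))"
    define S where "S = {x. y(s := x) \<in> T}"
    have "(\<lambda>x. y(s := x)) \<in> measurable N (PiM (insert s I) (\<lambda>_. N))"
      using y I by (intro measurable_component_update)
    from measurable_sets[OF this T'] have S: "S \<in> sets borel"
      by (simp add: S_def vimage_def sets_N)
    have "S \<inter> cball 0 (real m) \<in> null_sets lborel" for m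
    proof -
      have B: "S \<inter> cball 0 (real m) \<in> sets borel" using S by auto
      have "S \<inter> cball 0 (real m) \<in> null_sets lebesgue"
      proof (rule starlike_negligible_bounded_gmeasurable)
        show "S \<inter> cball 0 (real m) \<in> sets lebesgue"
          using B by (metis sets_completionI_sets sets_lborel)
        fix c x assume "c *\<^sub>R x \<in> S \<inter> cball 0 (real m)" "0 \<le> c" "x \<in> S \<inter> cball 0 (real m)"
        then show "c = 1" using ray[of y x c] by (auto simp: S_def)
      qed (simp add: bounded_Int)
      then show ?thesis using B null_sets_completion_iff[of "S \<inter> cball 0 (real m)" lborel] by simp
    qed
    then have "(\<Union>m. S \<inter> cball 0 (real m)) \<in> null_sets lborel" by (intro null_sets_UN)
    moreover have "(\<Union>m. S \<inter> cball 0 (real m)) = S"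
      by (auto simp: real_arch_simple)
    ultimately have "emeasure N S = 0" using abs_cont by auto
    moreover have "(\<integral>\<^sup>+ x. indicator T (y(s := x)) \<partial>N) = (\<integral>\<^sup>+ x. indicator S x \<partial>N)"
      by (intro nn_integral_cong) (simp add: S_def indicator_def)
    ultimately show "(\<integral>\<^sup>+ x. indicator T (y(s := x)) \<partial>N) = 0" using S by (simp add: sets_N)
  qed
  finally have "emeasure (sample_law n) T = 0" by simp
  then show ?thesis using T by (simp add: null_sets_def)
qed

section \<open>Measurability of Tyler's matrix\<close>

text \<open>For suitable \<open>\<eta>\<close>, on this event Tyler's equation has a unique solution, and it is near the identity.\<close>

definition moment_event :: "nat \<Rightarrow> real \<Rightarrow> (nat \<Rightarrow> real^'k::{finite,wellorder}) set" where
  "moment_event n \<eta> = {y \<in> space (sample_law n). (\<forall>t\<in>{1..n}. y t \<noteq> 0) \<and> moments_close n y \<eta>}"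

lemma measurable_avg [measurable]:
  "\<phi> \<in> borel_measurable borel \<Longrightarrow> avg n \<phi> \<in> borel_measurable (sample_law n)"
  unfolding avg_def[abs_def]
  by (intro borel_measurable_divide borel_measurable_sum borel_measurable_const
      measurable_compose[OF measurable_coordinate])

lemma sets_moment_event [measurable]: "moment_event n \<eta> \<in> sets (sample_law n)"
  unfolding moment_event_def moments_close_def by measurable

definition tyler_defect ::
    "nat \<Rightarrow> (nat \<Rightarrow> real^'k::{finite,wellorder}) \<Rightarrow> real^'k::{finite,wellorder}^'k::{finite,wellorder} \<Rightarrow> real" where
  "tyler_defect n y C = (\<Sum>a\<in>UNIV. \<Sum>b\<in>UNIV.
     \<bar>avg n (\<lambda>y. sgn (C *v y) $ a * sgn (C *v y) $ b) y - (if a = b then 1 / real CARD('k) else 0)\<bar>)"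

lemma tyler_defect_nonneg: "0 \<le> tyler_defect n y C"
  unfolding tyler_defect_def by (intro sum_nonneg) auto

lemma tyler_defect_eq_0:
  assumes "C \<in> triangular_nbhd e" "e < 1"
  shows "tyler_defect n y C = 0 \<longleftrightarrow> tyler_solution n y C"
proof -
  have "pos_triangular C" "C $ first_index $ first_index = 1"
    using assms triangular_nbhd_diagonal[OF assms(1)]
    by (auto simp: pos_triangular_def triangular_nbhd_def) (smt (verit))
  then show ?thesis
    unfolding tyler_defect_def tyler_solution_def by (simp add: sum_nonneg_eq_0_iff sum_nonneg)
qed

lemma measurable_tyler_defect [measurable]: "(\<lambda>y. tyler_defect n y C) \<in> borel_measurable (sample_law n)"
proof -
  have "(\<lambda>y. sgn (C *v y) $ a * sgn (C *v y) $ b) \<in> borel_measurable borel" for a b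
  proof -
    have [measurable]: "(\<lambda>y. C *v y) \<in> borel_measurable borel"
      by (intro borel_measurable_continuous_onI linear_continuous_on matrix_vector_mul_bounded_linear)
    show ?thesis by measurable
  qed
  note [measurable] = this
  show ?thesis unfolding tyler_defect_def by measurable
qed

lemma continuous_on_tyler_defect:
  assumes nz: "\<forall>t\<in>{1..n}. y t \<noteq> 0" and e: "e < 1"
  shows "continuous_on (triangular_nbhd e) (tyler_defect n y)"
proof -
  have "continuous_on (triangular_nbhd e) (\<lambda>C. sgn (C *v y t) $ a)" if "t \<in> {1..n}" for t a
  proof -
    have "C *v y t \<noteq> 0" if C: "C \<in> triangular_nbhd e" for C
    proof -
      have "(1 - e) * norm (y t) \<le> norm (C *v y t)"
        using C by (intro norm_near_identity) (simp add: triangular_nbhd_def)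
      moreover have "0 < (1 - e) * norm (y t)" using nz e \<open>t \<in> {1..n}\<close> by simp
      ultimately show ?thesis by auto
    qed
    moreover have "continuous_on (triangular_nbhd e) (\<lambda>C. C *v y t)"
      unfolding matrix_vector_mult_def by (intro continuous_intros)
    ultimately show ?thesis by (intro continuous_intros continuous_on_sgn) auto
  qed
  then show ?thesis
    unfolding tyler_defect_def[abs_def] avg_def divide_inverse
    by (intro continuous_on_sum continuous_on_rabs continuous_on_diff continuous_on_mult continuous_on_const) auto
qed

text \<open>The solution lies in a closed set \<open>A\<close> if and only if the defect gets arbitrarily small on a
  countable dense subset of the part of \<open>A\<close> in the neighbourhood. That part is compact, so a minimizer of
  the defect is then a zero of it, and the solution is its only zero. For each matrix of the countable set the
  defect is a measurable function of the sample.\<close>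

lemma measurable_tyler:
  assumes e: "e < 1"
    and sol: "\<And>y. y \<in> moment_event n \<eta> \<Longrightarrow>
      \<exists>C\<in>triangular_nbhd e. tyler_solution n y C \<and> (\<forall>C'. tyler_solution n y C' \<longrightarrow> C' = C)"
  shows "(\<lambda>y. if y \<in> moment_event n \<eta> then tyler_matrix n y else mat 1) \<in> borel_measurable (sample_law n)"
proof -
  have sol': "tyler_matrix n y \<in> triangular_nbhd e" "tyler_solution n y (tyler_matrix n y)"
    "tyler_solution n y C' \<Longrightarrow> C' = tyler_matrix n y" if y: "y \<in> moment_event n \<eta>" for y C'
  proof -
    obtain C where C: "C \<in> triangular_nbhd e" "tyler_solution n y C"
      "\<And>C'. tyler_solution n y C' \<Longrightarrow> C' = C"
      using sol[OF y] by blast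
    have eq: "tyler_matrix n y = C" by (rule tyler_matrixI[OF C(2,3)])
    show "tyler_matrix n y \<in> triangular_nbhd e" unfolding eq by (rule C(1))
    show "tyler_solution n y (tyler_matrix n y)" unfolding eq by (rule C(2))
    show "tyler_solution n y C' \<Longrightarrow> C' = tyler_matrix n y" unfolding eq by (rule C(3))
  qed
  have closed_sets: "{y \<in> moment_event n \<eta>. tyler_matrix n y \<in> A} \<in> sets (sample_law n)" if A: "closed A" for A
  proof -
    define K where "K = A \<inter> triangular_nbhd e"
    have "compact K" unfolding K_def using A compact_triangular_nbhd by (intro closed_Int_compact)
    obtain Q where Q: "countable Q" "Q \<subseteq> K" "K \<subseteq> closure Q" by (rule separable)
    have "{y \<in> moment_event n \<eta>. tyler_matrix n y \<in> A} =
        moment_event n \<eta> \<inter> (\<Inter>m::nat. \<Union>C\<in>Q. {y \<in> space (sample_law n). tyler_defect n y C < 1 / real (Suc m)})"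
      (is "?L = moment_event n \<eta> \<inter> ?R")
    proof (intro equalityI subsetI)
      fix y assume y: "y \<in> ?L"
      let ?D = "tyler_matrix n y"
      have yG: "y \<in> moment_event n \<eta>" using y by simp
      have DK: "?D \<in> K" using y sol'(1)[OF yG] by (simp add: K_def)
      have cont: "continuous_on K (tyler_defect n y)"
        by (rule continuous_on_subset[OF continuous_on_tyler_defect[OF _ e]])
          (use yG in \<open>auto simp: K_def moment_event_def\<close>)
      have D0: "tyler_defect n y ?D = 0" using tyler_defect_eq_0[OF sol'(1)[OF yG] e] sol'(2)[OF yG] by simp
      have "\<exists>C\<in>Q. tyler_defect n y C < 1 / real (Suc m)" for m
      proof -
        have "0 < 1 / real (Suc m)" by simp
        with cont DK obtain d where d: "0 < d"
          "\<forall>C\<in>K. dist C ?D < d \<longrightarrow> dist (tyler_defect n y C) (tyler_defect n y ?D) < 1 / real (Suc m)"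
          unfolding continuous_on_iff by blast
        obtain C where "C \<in> Q" "dist C ?D < d" using Q(3) DK d(1) by (meson closure_approachable subsetD)
        then show ?thesis using d(2) Q(2) D0 by (force simp: dist_real_def)
      qed
      then show "y \<in> moment_event n \<eta> \<inter> ?R" using yG by (auto simp: moment_event_def)
    next
      fix y assume "y \<in> moment_event n \<eta> \<inter> ?R"
      then have yG: "y \<in> moment_event n \<eta>"
        and small: "\<And>m. \<exists>C\<in>Q. tyler_defect n y C < 1 / real (Suc m)" by auto
      have cont: "continuous_on K (tyler_defect n y)"
        by (rule continuous_on_subset[OF continuous_on_tyler_defect[OF _ e]])
          (use yG in \<open>auto simp: K_def moment_event_def\<close>)
      have "K \<noteq> {}" using small[of 0] Q(2) by auto
      then obtain C where C: "C \<in> K" "\<And>C'. C' \<in> K \<Longrightarrow> tyler_defect n y C \<le> tyler_defect n y C'"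
        using continuous_attains_inf[OF \<open>compact K\<close> _ cont] by auto
      have "tyler_defect n y C \<le> 0"
      proof (rule ccontr)
        assume "\<not> ?thesis"
        then obtain m where "1 / real (Suc m) < tyler_defect n y C"
          using nat_approx_posE[of "tyler_defect n y C"] by auto
        moreover obtain C' where "C' \<in> Q" "tyler_defect n y C' < 1 / real (Suc m)" using small by blast
        ultimately show False using C(2)[of C'] Q(2) by auto
      qed
      then have "tyler_solution n y C"
        using tyler_defect_nonneg[of n y C] tyler_defect_eq_0[of C e] C(1) e by (simp add: K_def)
      then have "C = tyler_matrix n y" by (rule sol'(3)[OF yG])
      then show "y \<in> ?L" using C(1) yG by (simp add: K_def)
    qed
    also have "\<dots> = (\<Inter>m::nat. moment_event n \<eta> \<inter>
        (\<Union>C\<in>Q. {y \<in> space (sample_law n). tyler_defect n y C < 1 / real (Suc m)}))" by auto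
    also have "\<dots> \<in> sets (sample_law n)"
    proof (rule sets.countable_INT, rule image_subsetI)
      fix m :: nat
      show "moment_event n \<eta> \<inter>
          (\<Union>C\<in>Q. {y \<in> space (sample_law n). tyler_defect n y C < 1 / real (Suc m)}) \<in> sets (sample_law n)"
        by (intro sets.Int sets_moment_event sets.countable_UN'' Q(1)
            borel_measurable_less measurable_tyler_defect borel_measurable_const)
    qed simp
    finally show ?thesis .
  qed
  show ?thesis
  proof (rule borel_measurableI)
    fix S :: "(real^'k::{finite,wellorder}^'k::{finite,wellorder}) set" assume "open S"
    then have "{y \<in> moment_event n \<eta>. tyler_matrix n y \<in> - S} \<in> sets (sample_law n)"
      by (intro closed_sets) auto
    then have *: "moment_event n \<eta> - {y \<in> moment_event n \<eta>. tyler_matrix n y \<in> - S} \<in> sets (sample_law n)"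
      by (intro sets.Diff sets_moment_event)
    have "(\<lambda>y. if y \<in> moment_event n \<eta> then tyler_matrix n y else mat 1) -` S \<inter> space (sample_law n) =
        (moment_event n \<eta> - {y \<in> moment_event n \<eta>. tyler_matrix n y \<in> - S}) \<union>
        (if mat 1 \<in> S then space (sample_law n) - moment_event n \<eta> else {})"
      using sets.sets_into_space[OF sets_moment_event] by (auto split: if_splits)
    also have "\<dots> \<in> sets (sample_law n)" using * by auto
    finally show "(\<lambda>y. if y \<in> moment_event n \<eta> then tyler_matrix n y else mat 1) -` S \<inter> space (sample_law n)
        \<in> sets (sample_law n)" .
  qed
qed

end

section \<open>Approximation of score functions\<close>

text \<open>A nonnegative function whose value at the right (\<open>s = 0\<close>) or left (\<open>s = 1\<close>) end of each
  mesh interval is a lower bound there has Riemann sums below its integral.\<close>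

lemma riemann_sum_le:
  fixes h :: "real \<Rightarrow> real"
  assumes s: "s \<le> (1 :: nat)" and nonneg: "\<And>u. u \<in> {0<..<1} \<Longrightarrow> 0 \<le> h u"
    and le: "\<And>r u. r \<in> {1..n} \<Longrightarrow>
      u \<in> {(real r + real s - 1) / (real n + 1) <..< (real r + real s) / (real n + 1)} \<Longrightarrow>
      h (real r / (real n + 1)) \<le> h u"
  shows "ennreal ((\<Sum>r=1..n. h (real r / (real n + 1))) / (real n + 1)) \<le>
    (\<integral>\<^sup>+ u. ennreal (h u) * indicator {0<..<1} u \<partial>lborel)"
proof -
  define I where "I r = {(real r + real s - 1) / (real n + 1) <..< (real r + real s) / (real n + 1)}" for r
  have pt: "real r / (real n + 1) \<in> {0<..<1}" if "r \<in> {1..n}" for r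
    using that by (auto simp: field_simps)
  \<comment> \<open>The mesh intervals are disjoint subsets of the unit interval of equal length.\<close>
  have disj: "r = r'" if "u \<in> I r" "u \<in> I r'" for u and r r' :: nat
  proof -
    have "real r + real s - 1 < u * (real n + 1)" "u * (real n + 1) < real r + real s"
      "real r' + real s - 1 < u * (real n + 1)" "u * (real n + 1) < real r' + real s"
      using that by (auto simp: I_def divide_less_eq less_divide_eq)
    then have "real r < real r' + 1" "real r' < real r + 1" by linarith+
    then show ?thesis by linarith
  qed
  have sub: "I r \<subseteq> {0<..<1}" if "r \<in> {1..n}" for r
  proof
    fix u assume "u \<in> I r"
    then have "real r + real s - 1 < u * (real n + 1)" "u * (real n + 1) < real r + real s"
      by (auto simp: I_def divide_less_eq less_divide_eq)
    moreover have "1 \<le> real r" "real r \<le> real n" "0 \<le> real s" "real s \<le> 1" using that s by auto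
    ultimately have "0 < u * (real n + 1)" "u * (real n + 1) < real n + 1" by linarith+
    then have "0 < u * (real n + 1)" "u * (real n + 1) < 1 * (real n + 1)" by simp_all
    then show "u \<in> {0<..<1}" by (simp add: zero_less_mult_iff mult_less_cancel_right)
  qed
  have len: "emeasure lborel (I r) = ennreal (1 / (real n + 1))" for r
  proof -
    have "(real r + real s) / (real n + 1) - (real r + real s - 1) / (real n + 1) = 1 / (real n + 1)"
      by (simp add: diff_divide_distrib[symmetric])
    moreover have "(real r + real s - 1) / (real n + 1) \<le> (real r + real s) / (real n + 1)"
      by (intro divide_right_mono) auto
    ultimately show ?thesis by (simp add: I_def)
  qed
  have "ennreal ((\<Sum>r=1..n. h (real r / (real n + 1))) / (real n + 1)) =
      (\<Sum>r=1..n. ennreal (h (real r / (real n + 1))) * ennreal (1 / (real n + 1)))"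
  proof -
    have "ennreal ((\<Sum>r=1..n. h (real r / (real n + 1))) / (real n + 1)) =
        (\<Sum>r=1..n. ennreal (h (real r / (real n + 1)) / (real n + 1)))"
      unfolding sum_divide_distrib by (rule sum_ennreal[symmetric]) (use pt nonneg in auto)
    also have "\<dots> = (\<Sum>r=1..n. ennreal (h (real r / (real n + 1))) * ennreal (1 / (real n + 1)))"
      using pt nonneg by (intro sum.cong refl) (simp flip: ennreal_mult)
    finally show ?thesis .
  qed
  also have "\<dots> = (\<integral>\<^sup>+ u. (\<Sum>r=1..n. ennreal (h (real r / (real n + 1))) * indicator (I r) u) \<partial>lborel)"
  proof -
    have "I r \<in> sets lborel" for r by (simp add: I_def)
    then show ?thesis by (subst nn_integral_sum) (auto simp: nn_integral_cmult_indicator len)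
  qed
  also have "\<dots> \<le> (\<integral>\<^sup>+ u. ennreal (h u) * indicator {0<..<1} u \<partial>lborel)"
  proof (rule nn_integral_mono)
    fix u
    show "(\<Sum>r=1..n. ennreal (h (real r / (real n + 1))) * indicator (I r) u) \<le>
        ennreal (h u) * indicator {0<..<1} u"
    proof (cases "\<exists>r0\<in>{1..n}. u \<in> I r0")
      case True
      then obtain r0 where r0: "r0 \<in> {1..n}" "u \<in> I r0" by blast
      have "(\<Sum>r=1..n. ennreal (h (real r / (real n + 1))) * indicator (I r) u) =
          (\<Sum>r=1..n. if r = r0 then ennreal (h (real r0 / (real n + 1))) else 0)"
      proof (rule sum.cong)
        fix r
        show "ennreal (h (real r / (real n + 1))) * indicator (I r) u =
            (if r = r0 then ennreal (h (real r0 / (real n + 1))) else 0)"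
          using r0(2) disj[OF _ r0(2), of r] by (cases "u \<in> I r") auto
      qed simp
      also have "\<dots> = ennreal (h (real r0 / (real n + 1)))" using r0(1) by simp
      also have "\<dots> \<le> ennreal (h u)" using le[OF r0(1)] r0(2) by (intro ennreal_leI) (simp add: I_def)
      finally show ?thesis using sub[OF r0(1)] r0(2) by (auto simp: indicator_def)
    next
      case False
      then have "(\<Sum>r=1..n. ennreal (h (real r / (real n + 1))) * indicator (I r) u) = 0"
        by (intro sum.neutral) (auto simp: indicator_def)
      then show ?thesis by simp
    qed
  qed
  finally show ?thesis .
qed

text \<open>A score function composed with this map is bounded and uniformly continuous, and differs from the
  score function near 0 and 1 only.\<close>

definition clamp_tails :: "real \<Rightarrow> real \<Rightarrow> real" where
  "clamp_tails \<tau> u = max \<tau> (min (1 - \<tau>) u)"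

lemma clamp_tails_lipschitz: "\<bar>clamp_tails \<tau> u - clamp_tails \<tau> v\<bar> \<le> \<bar>u - v\<bar>"
  by (simp add: clamp_tails_def)

lemma clamp_tails_in: "\<tau> \<le> 1/2 \<Longrightarrow> clamp_tails \<tau> u \<in> {\<tau>..1 - \<tau>}"
  by (auto simp: clamp_tails_def)

text \<open>The difference of \<open>G\<close> and its clamped version is monotone on each tail and vanishes in between, so
  the bound on Riemann sums applies to each tail separately. This is where monotonicity of the parts
  of a score function is needed: it controls the values on the grid of ranks by an integral.\<close>

lemma mono_clamp_riemann:
  fixes G :: "real \<Rightarrow> real"
  assumes G: "mono_on {0<..<1} G" and \<tau>: "0 < \<tau>" "\<tau> < 1/2"
  shows "ennreal ((\<Sum>r=1..n. (G (real r / (real n + 1)) - G (clamp_tails \<tau> (real r / (real n + 1))))\<^sup>2) / (real n + 1))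
    \<le> (\<integral>\<^sup>+ u. ennreal ((G u - G (clamp_tails \<tau> u))\<^sup>2) * indicator {0<..<1} u \<partial>lborel)"
proof -
  define L where "L u = (G \<tau> - G (min u \<tau>))\<^sup>2" for u
  define R where "R u = (G (max u (1 - \<tau>)) - G (1 - \<tau>))\<^sup>2" for u
  have mono: "G u \<le> G v" if "0 < u" "u \<le> v" "v < 1" for u v
    using G that by (auto simp: mono_on_def)
  have LR: "(G u - G (clamp_tails \<tau> u))\<^sup>2 = L u + R u" for u
    using \<tau> by (cases "u < \<tau>"; cases "1 - \<tau> < u")
      (auto simp: L_def R_def clamp_tails_def max_def min_def power2_commute)
  have meas: "(\<lambda>u. ennreal (L u) * indicator {0<..<1} u) \<in> borel_measurable borel"
    "(\<lambda>u. ennreal (R u) * indicator {0<..<1} u) \<in> borel_measurable borel"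
  proof -
    have m1: "mono_on {0<..<1} (\<lambda>u. G (min u \<tau>))" "mono_on {0<..<1} (\<lambda>u. G (max u (1 - \<tau>)))"
      using \<tau> by (auto intro!: mono_onI mono simp: min_def max_def)
    have "(\<lambda>u. G (min u \<tau>)) \<in> borel_measurable (restrict_space borel {0<..<1})"
      "(\<lambda>u. G (max u (1 - \<tau>))) \<in> borel_measurable (restrict_space borel {0<..<1})"
      by (intro borel_measurable_mono_on_fnc m1)+
    then have "L \<in> borel_measurable (restrict_space borel {0<..<1})"
      "R \<in> borel_measurable (restrict_space borel {0<..<1})"
      unfolding L_def[abs_def] R_def[abs_def] by measurable
    then show "(\<lambda>u. ennreal (L u) * indicator {0<..<1} u) \<in> borel_measurable borel"
      "(\<lambda>u. ennreal (R u) * indicator {0<..<1} u) \<in> borel_measurable borel"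
      by (auto intro!: borel_measurable_restrict_space_iff_ennreal[of "{0<..<1::real}" borel, THEN iffD1])
  qed
  have "ennreal ((\<Sum>r=1..n. L (real r / (real n + 1))) / (real n + 1)) \<le>
      (\<integral>\<^sup>+ u. ennreal (L u) * indicator {0<..<1} u \<partial>lborel)"
  proof (rule riemann_sum_le[where s = 0])
    fix r u assume r: "r \<in> {1..n}"
      and u: "u \<in> {(real r + real 0 - 1) / (real n + 1) <..< (real r + real 0) / (real n + 1)}"
    have "0 \<le> (real r - 1) / (real n + 1)" using r by auto
    then have "0 < u" using u by auto
    then have "G (min u \<tau>) \<le> G (min (real r / (real n + 1)) \<tau>)"
      "G (min (real r / (real n + 1)) \<tau>) \<le> G \<tau>"
      using u \<tau> r by (auto intro!: mono simp: min_def)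
    then show "L (real r / (real n + 1)) \<le> L u" unfolding L_def by (intro power_mono) auto
  qed (auto simp: L_def)
  moreover have "ennreal ((\<Sum>r=1..n. R (real r / (real n + 1))) / (real n + 1)) \<le>
      (\<integral>\<^sup>+ u. ennreal (R u) * indicator {0<..<1} u \<partial>lborel)"
  proof (rule riemann_sum_le[where s = 1])
    fix r u assume r: "r \<in> {1..n}"
      and u: "u \<in> {(real r + real 1 - 1) / (real n + 1) <..< (real r + real 1) / (real n + 1)}"
    have "u < (real r + 1) / (real n + 1)" using u by simp
    also have "\<dots> \<le> 1" using r by auto
    finally have "u < 1" .
    moreover have "0 < real r / (real n + 1)" using r by auto
    ultimately have "G (max (real r / (real n + 1)) (1 - \<tau>)) \<le> G (max u (1 - \<tau>))"
      "G (1 - \<tau>) \<le> G (max (real r / (real n + 1)) (1 - \<tau>))"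
      using u \<tau> r by (auto intro!: mono simp: max_def)
    then show "R (real r / (real n + 1)) \<le> R u" unfolding R_def by (intro power_mono) auto
  qed (auto simp: R_def)
  ultimately have "ennreal ((\<Sum>r=1..n. L (real r / (real n + 1))) / (real n + 1)) +
      ennreal ((\<Sum>r=1..n. R (real r / (real n + 1))) / (real n + 1)) \<le>
      (\<integral>\<^sup>+ u. ennreal (L u) * indicator {0<..<1} u \<partial>lborel) +
      (\<integral>\<^sup>+ u. ennreal (R u) * indicator {0<..<1} u \<partial>lborel)"
    by (rule add_mono)
  also have "\<dots> = (\<integral>\<^sup>+ u. ennreal (L u) * indicator {0<..<1} u + ennreal (R u) * indicator {0<..<1} u \<partial>lborel)"
    using meas by (intro nn_integral_add[symmetric]) auto
  also have "\<dots> = (\<integral>\<^sup>+ u. ennreal ((G u - G (clamp_tails \<tau> u))\<^sup>2) * indicator {0<..<1} u \<partial>lborel)"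
    unfolding LR by (intro nn_integral_cong) (simp add: L_def R_def distrib_right ennreal_plus)
  also have "ennreal ((\<Sum>r=1..n. L (real r / (real n + 1))) / (real n + 1)) +
      ennreal ((\<Sum>r=1..n. R (real r / (real n + 1))) / (real n + 1)) =
      ennreal ((\<Sum>r=1..n. (G (real r / (real n + 1)) - G (clamp_tails \<tau> (real r / (real n + 1))))\<^sup>2) / (real n + 1))"
    unfolding LR sum.distrib add_divide_distrib
    by (intro ennreal_plus[symmetric] divide_nonneg_nonneg sum_nonneg) (auto simp: L_def R_def)
  finally show ?thesis .
qed

text \<open>On the tails, \<open>G\<close> and its clamped value lie on the same side of \<open>G (1/2)\<close>, so their difference is
  at most that of \<open>G\<close> and \<open>G (1/2)\<close>. It is square integrable and lives on shrinking sets.\<close>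

lemma mono_clamp_integral:
  fixes G :: "real \<Rightarrow> real"
  assumes G: "mono_on {0<..<1} G" and int: "set_integrable lborel {0<..<1} (\<lambda>u. (G u)\<^sup>2)" and \<kappa>: "0 < \<kappa>"
  obtains \<tau>0 where "0 < \<tau>0" "\<tau>0 < 1/2"
    "\<And>\<tau>. 0 < \<tau> \<Longrightarrow> \<tau> \<le> \<tau>0 \<Longrightarrow>
      (\<integral>\<^sup>+ u. ennreal ((G u - G (clamp_tails \<tau> u))\<^sup>2) * indicator {0<..<1} u \<partial>lborel) \<le> ennreal \<kappa>"
proof -
  define w where "w u = indicator {0<..<1} u * (2 * (G (1/2))\<^sup>2 + 2 * (G u)\<^sup>2)" for u :: real
  \<comment> \<open>The offset 3 keeps the two tails disjoint.\<close>
  define A where "A m = {u. u < 1 / (real (m + 3)) \<or> 1 - 1 / (real (m + 3)) < u}" for m :: nat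
  have A [measurable]: "A m \<in> sets borel" for m
    unfolding A_def by measurable
  have "integrable lborel (\<lambda>u. indicator {0<..<1::real} u *\<^sub>R (2 * (G (1/2))\<^sup>2) + 2 * (indicator {0<..<1} u *\<^sub>R (G u)\<^sup>2))"
    using int unfolding set_integrable_def real_scaleR_def
    by (intro Bochner_Integration.integrable_add integrable_mult_right integrable_mult_left
        integrable_real_indicator) auto
  then have w: "integrable lborel w"
    by (rule Bochner_Integration.integrable_cong[THEN iffD1, rotated -1]) (auto simp: w_def indicator_def)
  have w0: "0 \<le> w u" for u by (simp add: w_def)
  have "(\<lambda>m. \<integral>u. indicator (A m) u * w u \<partial>lborel) \<longlonglongrightarrow> integral\<^sup>L lborel (\<lambda>u::real. 0)"
  proof (rule integral_dominated_convergence[where w = w])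
    show "AE u in lborel. (\<lambda>m. indicator (A m) u * w u) \<longlonglongrightarrow> 0"
    proof (rule AE_I2)
      fix u :: real
      have "\<forall>\<^sub>F m in sequentially. indicator (A m) u * w u = 0"
      proof (cases "u \<in> {0<..<1}")
        case True
        have "(\<lambda>m. 1 / (real (m + 3))) \<longlonglongrightarrow> 0" by (rule LIMSEQ_ignore_initial_segment[OF lim_1_over_n])
        then have "\<forall>\<^sub>F m in sequentially. 1 / (real (m + 3)) < min u (1 - u)"
          using True by (intro order_tendstoD) auto
        then show ?thesis by eventually_elim (auto simp: A_def)
      qed (simp add: w_def)
      then show "(\<lambda>m. indicator (A m) u * w u) \<longlonglongrightarrow> 0"
        by (rule tendsto_eventually)
    qed
  qed (use w w0 in \<open>auto simp: indicator_def\<close>)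
  then have "\<forall>\<^sub>F m in sequentially. (\<integral>u. indicator (A m) u * w u \<partial>lborel) < \<kappa>"
    using \<kappa> by (intro order_tendstoD) auto
  then obtain m where m: "(\<integral>u. indicator (A m) u * w u \<partial>lborel) < \<kappa>"
    by (auto simp: eventually_sequentially)
  define \<tau>0 where "\<tau>0 = 1 / (real (m + 3))"
  have \<tau>0: "0 < \<tau>0" "\<tau>0 < 1/2" by (auto simp: \<tau>0_def field_simps)
  have mono: "G u \<le> G v" if "0 < u" "u \<le> v" "v < 1" for u v
    using G that by (auto simp: mono_on_def)
  have "(\<integral>\<^sup>+ u. ennreal ((G u - G (clamp_tails \<tau> u))\<^sup>2) * indicator {0<..<1} u \<partial>lborel) \<le> ennreal \<kappa>"
    if \<tau>: "0 < \<tau>" "\<tau> \<le> \<tau>0" for \<tau>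
  proof -
    have "(G u - G (clamp_tails \<tau> u))\<^sup>2 * indicator {0<..<1} u \<le> indicator (A m) u * w u" for u
    proof (cases "u \<in> {0<..<1} \<and> clamp_tails \<tau> u \<noteq> u")
      case True
      then have u: "0 < u" "u < 1" "u < \<tau> \<or> 1 - \<tau> < u"
        by (auto simp: clamp_tails_def max_def min_def split: if_splits)
      then have "u \<in> A m" using \<tau> by (auto simp: A_def \<tau>0_def)
      have "\<bar>G u - G (clamp_tails \<tau> u)\<bar> \<le> \<bar>G (1/2) - G u\<bar>"
      proof (cases "u < \<tau>")
        case True
        then have "clamp_tails \<tau> u = \<tau>" using \<tau> \<tau>0 by (auto simp: clamp_tails_def)
        moreover have "G u \<le> G \<tau>" "G \<tau> \<le> G (1/2)" using \<tau> \<tau>0 True u by (auto intro!: mono)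
        ultimately show ?thesis by simp
      next
        case False
        then have "clamp_tails \<tau> u = 1 - \<tau>" using \<tau> \<tau>0 u by (auto simp: clamp_tails_def)
        moreover have "G (1 - \<tau>) \<le> G u" "G (1/2) \<le> G (1 - \<tau>)" using \<tau> \<tau>0 False u by (auto intro!: mono)
        ultimately show ?thesis by simp
      qed
      then have "(G u - G (clamp_tails \<tau> u))\<^sup>2 \<le> (G (1/2) - G u)\<^sup>2" by (simp add: abs_le_square_iff)
      also have "\<dots> \<le> 2 * (G (1/2))\<^sup>2 + 2 * (G u)\<^sup>2"
        using zero_le_power2[of "G (1/2) + G u"] by (simp add: power2_eq_square algebra_simps)
      finally show ?thesis using u \<open>u \<in> A m\<close> by (simp add: w_def)
    next
      case False
      then show ?thesis using w0[of u] by (auto simp: indicator_def)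
    qed
    then have "(\<integral>\<^sup>+ u. ennreal ((G u - G (clamp_tails \<tau> u))\<^sup>2) * indicator {0<..<1} u \<partial>lborel) \<le>
        (\<integral>\<^sup>+ u. ennreal (indicator (A m) u * w u) \<partial>lborel)"
      by (intro nn_integral_mono) (metis ennreal_indicator ennreal_leI ennreal_mult' indicator_pos_le ennreal_mult'' zero_le_power2)
    also have "\<dots> = ennreal (\<integral>u. indicator (A m) u * w u \<partial>lborel)"
      using w0 by (intro nn_integral_eq_integral integrable_real_mult_indicator[of "A m" lborel w, unfolded mult.commute[of "w _"]] w) auto
    also have "\<dots> \<le> ennreal \<kappa>" using m by (intro ennreal_leI) simp
    finally show ?thesis .
  qed
  then show ?thesis using that \<tau>0 by blast
qed

text \<open>Closeness in mean square on the grid of normalized ranks, uniformly in the sample size, and for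
  the uniform distribution on the unit interval. The former is what scores of ranks see, the latter what
  scores of the radial distribution function see.\<close>

definition score_approx :: "(real \<Rightarrow> real) \<Rightarrow> (real \<Rightarrow> real) \<Rightarrow> real \<Rightarrow> bool" where
  "score_approx K J \<kappa> \<longleftrightarrow>
     (\<forall>n\<ge>1. (\<Sum>r=1..n. (K (real r / (real n + 1)) - J (real r / (real n + 1)))\<^sup>2) \<le> \<kappa> * real n) \<and>
     (\<integral>\<^sup>+ u. ennreal ((K u - J u)\<^sup>2) * indicator {0<..<1} u \<partial>lborel) \<le> ennreal \<kappa>"

text \<open>Clamp the argument of \<open>K\<close>. The tails of the two monotone parts of \<open>K\<close> contribute little to either
  mean square.\<close>

lemma score_approximation:
  assumes K: "assumption_C K" and \<kappa>: "0 < \<kappa>"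
  obtains J B where "uniformly_continuous_on UNIV J" "\<And>u. \<bar>J u\<bar> \<le> B" "score_approx K J \<kappa>"
proof -
  obtain G H where G: "mono_on {0<..<1} G" "set_integrable lborel {0<..<1} (\<lambda>u. (G u)\<^sup>2)"
    and H: "mono_on {0<..<1} H" "set_integrable lborel {0<..<1} (\<lambda>u. (H u)\<^sup>2)"
    and KGH: "\<And>u. u \<in> {0<..<1} \<Longrightarrow> K u = G u - H u" and cont: "continuous_on {0<..<1} K"
    using K unfolding assumption_C_def by blast
  obtain \<tau>1 where \<tau>1: "0 < \<tau>1" "\<tau>1 < 1/2" "\<And>\<tau>. 0 < \<tau> \<Longrightarrow> \<tau> \<le> \<tau>1 \<Longrightarrow>
      (\<integral>\<^sup>+ u. ennreal ((G u - G (clamp_tails \<tau> u))\<^sup>2) * indicator {0<..<1} u \<partial>lborel) \<le> ennreal (\<kappa> / 8)"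
    using mono_clamp_integral[OF G, of "\<kappa> / 8"] \<kappa> by auto
  obtain \<tau>2 where \<tau>2: "0 < \<tau>2" "\<tau>2 < 1/2" "\<And>\<tau>. 0 < \<tau> \<Longrightarrow> \<tau> \<le> \<tau>2 \<Longrightarrow>
      (\<integral>\<^sup>+ u. ennreal ((H u - H (clamp_tails \<tau> u))\<^sup>2) * indicator {0<..<1} u \<partial>lborel) \<le> ennreal (\<kappa> / 8)"
    using mono_clamp_integral[OF H, of "\<kappa> / 8"] \<kappa> by auto
  define \<tau> where "\<tau> = min \<tau>1 \<tau>2"
  have \<tau>: "0 < \<tau>" "\<tau> < 1/2" "\<tau> \<le> \<tau>1" "\<tau> \<le> \<tau>2" using \<tau>1 \<tau>2 by (auto simp: \<tau>_def)
  define J where "J u = K (clamp_tails \<tau> u)" for u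
  define DG where "DG u = (G u - G (clamp_tails \<tau> u))\<^sup>2" for u
  define DH where "DH u = (H u - H (clamp_tails \<tau> u))\<^sup>2" for u
  have cin: "clamp_tails \<tau> u \<in> {\<tau>..1 - \<tau>}" "clamp_tails \<tau> u \<in> {0<..<1}" for u
    using clamp_tails_in[of \<tau> u] \<tau> by auto
  have KJ: "(K u - J u)\<^sup>2 \<le> 2 * DG u + 2 * DH u" if "u \<in> {0<..<1}" for u
  proof -
    have "K u - J u = (G u - G (clamp_tails \<tau> u)) - (H u - H (clamp_tails \<tau> u))"
      using KGH[OF that] KGH[OF cin(2)[of u]] by (simp add: J_def)
    moreover have "(p - q)\<^sup>2 \<le> 2 * p\<^sup>2 + 2 * q\<^sup>2" for p q :: real
      using zero_le_power2[of "p + q"] by (simp add: power2_eq_square algebra_simps)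
    ultimately show ?thesis by (simp only: DG_def DH_def)
  qed
  have IG: "(\<integral>\<^sup>+ u. ennreal (DG u) * indicator {0<..<1} u \<partial>lborel) \<le> ennreal (\<kappa> / 8)"
    and IH: "(\<integral>\<^sup>+ u. ennreal (DH u) * indicator {0<..<1} u \<partial>lborel) \<le> ennreal (\<kappa> / 8)"
    using \<tau>1(3) \<tau>2(3) \<tau> by (auto simp: DG_def DH_def)
  have unif: "uniformly_continuous_on {\<tau>..1 - \<tau>} K"
    using \<tau> by (intro compact_uniformly_continuous continuous_on_subset[OF cont]) auto
  have "uniformly_continuous_on UNIV J"
    unfolding uniformly_continuous_on_def
  proof (intro allI impI)
    fix e :: real assume "0 < e"
    then obtain d where d: "0 < d" "\<And>x x'. x \<in> {\<tau>..1 - \<tau>} \<Longrightarrow> x' \<in> {\<tau>..1 - \<tau>} \<Longrightarrow> dist x' x < d \<Longrightarrow> dist (K x') (K x) < e"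
      using unif unfolding uniformly_continuous_on_def by meson
    have "dist (J x') (J x) < e" if "dist x' x < d" for x x'
      unfolding J_def using clamp_tails_lipschitz[of \<tau> x' x] that
      by (intro d(2) cin) (simp add: dist_real_def)
    then show "\<exists>d>0. \<forall>x\<in>UNIV. \<forall>x'\<in>UNIV. dist x' x < d \<longrightarrow> dist (J x') (J x) < e" using d(1) by blast
  qed
  moreover obtain B where "\<And>u. \<bar>J u\<bar> \<le> B"
  proof -
    have "compact (K ` {\<tau>..1 - \<tau>})"
      using \<tau> by (intro compact_continuous_image continuous_on_subset[OF cont]) auto
    then obtain B where "\<forall>x\<in>K ` {\<tau>..1 - \<tau>}. norm x \<le> B"
      using compact_imp_bounded bounded_iff by blast
    then show ?thesis using that cin by (force simp: J_def)
  qed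
  moreover have "score_approx K J \<kappa>"
    unfolding score_approx_def
  proof (intro conjI allI impI)
    fix n :: nat assume n: "1 \<le> n"
    have "ennreal ((\<Sum>r=1..n. DG (real r / (real n + 1))) / (real n + 1)) \<le> ennreal (\<kappa> / 8)"
      "ennreal ((\<Sum>r=1..n. DH (real r / (real n + 1))) / (real n + 1)) \<le> ennreal (\<kappa> / 8)"
      using mono_clamp_riemann[OF G(1) \<tau>(1,2), of n] mono_clamp_riemann[OF H(1) \<tau>(1,2), of n] IG IH
      unfolding DG_def DH_def by (auto intro: order_trans)
    then have "(\<Sum>r=1..n. DG (real r / (real n + 1))) \<le> \<kappa> / 8 * (real n + 1)"
      "(\<Sum>r=1..n. DH (real r / (real n + 1))) \<le> \<kappa> / 8 * (real n + 1)"
      using \<kappa> by (simp_all add: ennreal_le_iff divide_le_eq)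
    moreover have "(\<Sum>r=1..n. (K (real r / (real n + 1)) - J (real r / (real n + 1)))\<^sup>2) \<le>
        (\<Sum>r=1..n. 2 * DG (real r / (real n + 1)) + 2 * DH (real r / (real n + 1)))"
      by (intro sum_mono KJ) (auto simp: field_simps)
    ultimately have "(\<Sum>r=1..n. (K (real r / (real n + 1)) - J (real r / (real n + 1)))\<^sup>2) \<le> \<kappa> / 2 * (real n + 1)"
      by (simp add: sum.distrib sum_distrib_left[symmetric] algebra_simps)
    also have "\<dots> \<le> \<kappa> / 2 * (2 * real n)" using \<kappa> n by (intro mult_left_mono) auto
    finally show "(\<Sum>r=1..n. (K (real r / (real n + 1)) - J (real r / (real n + 1)))\<^sup>2) \<le> \<kappa> * real n" by simp
  next
    have meas: "(\<lambda>u. ennreal (DG u) * indicator {0<..<1} u) \<in> borel_measurable borel"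
      "(\<lambda>u. ennreal (DH u) * indicator {0<..<1} u) \<in> borel_measurable borel"
    proof -
      have mG: "f \<in> borel_measurable (restrict_space borel {0<..<1})"
        "(\<lambda>u. f (clamp_tails \<tau> u)) \<in> borel_measurable (restrict_space borel {0<..<1})"
        if "mono_on {0<..<1} f" for f :: "real \<Rightarrow> real"
      proof -
        have "mono_on {0<..<1} (\<lambda>u. f (clamp_tails \<tau> u))"
          using that cin(2) by (intro mono_onI mono_onD[OF that]) (auto simp: clamp_tails_def)
        then show "f \<in> borel_measurable (restrict_space borel {0<..<1})"
          "(\<lambda>u. f (clamp_tails \<tau> u)) \<in> borel_measurable (restrict_space borel {0<..<1})"
          using that by (auto intro: borel_measurable_mono_on_fnc)
      qed
      note [measurable] = mG[OF G(1)] mG[OF H(1)]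
      have "DG \<in> borel_measurable (restrict_space borel {0<..<1})"
        "DH \<in> borel_measurable (restrict_space borel {0<..<1})"
        unfolding DG_def[abs_def] DH_def[abs_def] by measurable
      then show "(\<lambda>u. ennreal (DG u) * indicator {0<..<1} u) \<in> borel_measurable borel"
        "(\<lambda>u. ennreal (DH u) * indicator {0<..<1} u) \<in> borel_measurable borel"
        by (auto intro!: borel_measurable_restrict_space_iff_ennreal[of "{0<..<1::real}" borel, THEN iffD1])
    qed
    have "(\<integral>\<^sup>+ u. ennreal ((K u - J u)\<^sup>2) * indicator {0<..<1} u \<partial>lborel) \<le>
        (\<integral>\<^sup>+ u. ennreal 2 * (ennreal (DG u) * indicator {0<..<1} u) + ennreal 2 * (ennreal (DH u) * indicator {0<..<1} u) \<partial>lborel)"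
    proof (rule nn_integral_mono)
      fix u
      show "ennreal ((K u - J u)\<^sup>2) * indicator {0<..<1} u \<le>
          ennreal 2 * (ennreal (DG u) * indicator {0<..<1} u) + ennreal 2 * (ennreal (DH u) * indicator {0<..<1} u)"
      proof (cases "u \<in> {0<..<1}")
        case True
        have "ennreal ((K u - J u)\<^sup>2) \<le> ennreal (2 * DG u + 2 * DH u)" using KJ[OF True] by (rule ennreal_leI)
        also have "\<dots> = ennreal 2 * ennreal (DG u) + ennreal 2 * ennreal (DH u)"
          by (simp only: ennreal_plus ennreal_mult DG_def DH_def zero_le_power2 mult_nonneg_nonneg zero_le_numeral)
        finally show ?thesis using True by simp
      qed simp
    qed
    also have "\<dots> = ennreal 2 * (\<integral>\<^sup>+ u. ennreal (DG u) * indicator {0<..<1} u \<partial>lborel) +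
        ennreal 2 * (\<integral>\<^sup>+ u. ennreal (DH u) * indicator {0<..<1} u \<partial>lborel)"
      using meas by (subst nn_integral_add) (auto simp: nn_integral_cmult)
    also have "\<dots> \<le> ennreal 2 * ennreal (\<kappa> / 8) + ennreal 2 * ennreal (\<kappa> / 8)"
      using IG IH by (intro add_mono mult_left_mono) auto
    also have "\<dots> = ennreal (\<kappa> / 2)"
    proof -
      have "ennreal 2 * ennreal (\<kappa> / 8) = ennreal (\<kappa> / 4)"
        using \<kappa> by (subst ennreal_mult[symmetric]) auto
      then show ?thesis using \<kappa> by (simp only:) (subst ennreal_plus[symmetric], auto)
    qed
    also have "\<dots> \<le> ennreal \<kappa>" using \<kappa> by (intro ennreal_leI) auto
    finally show "(\<integral>\<^sup>+ u. ennreal ((K u - J u)\<^sup>2) * indicator {0<..<1} u \<partial>lborel) \<le> ennreal \<kappa>" .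
  qed
  ultimately show ?thesis using that by blast
qed

section \<open>Radial distribution function and ranks\<close>

context spherical_law
begin

definition radial_F :: "real \<Rightarrow> real" where
  "radial_F x = measure N {y. norm y \<le> x}"

lemma measurable_norm_N [measurable]: "norm \<in> borel_measurable N"
  by (simp add: measurable_cong_sets[OF sets_N refl])

lemma real_distribution_norm: "real_distribution (distr N borel norm)"
  by (rule real_distribution_distr) simp

lemma radial_F_eq_cdf: "radial_F = cdf (distr N borel norm)"
  by (rule ext) (simp add: radial_F_def cdf_def measure_distr vimage_def)

lemma radial_F_mono: "x \<le> x' \<Longrightarrow> radial_F x \<le> radial_F x'"
proof -
  interpret R: real_distribution "distr N borel norm" by (rule real_distribution_norm)
  show "x \<le> x' \<Longrightarrow> radial_F x \<le> radial_F x'"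
    unfolding radial_F_eq_cdf by (rule R.cdf_nondecreasing)
qed

lemma radial_F_bounds: "0 \<le> radial_F x" "radial_F x \<le> 1"
  by (auto simp: radial_F_def)

lemma isCont_radial_F: "isCont radial_F x"
proof -
  interpret R: real_distribution "distr N borel norm" by (rule real_distribution_norm)
  have "sphere (0 :: real^'k::{finite,wellorder}) x \<in> null_sets lebesgue"
    using negligible_sphere negligible_iff_null_sets by blast
  then have "sphere (0 :: real^'k::{finite,wellorder}) x \<in> null_sets lborel"
    by (subst (asm) null_sets_completion_iff) auto
  then have "measure N (sphere 0 x) = 0" using abs_cont by (simp add: measure_eq_0_null_sets)
  moreover have "norm -` {x} \<inter> space N = sphere 0 x" by auto
  ultimately have "measure (distr N borel norm) {x} = 0" by (simp add: measure_distr)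
  then show ?thesis unfolding radial_F_eq_cdf by (simp add: R.isCont_cdf)
qed

lemma continuous_radial_F: "continuous_on S radial_F"
  using isCont_radial_F by (simp add: continuous_at_imp_continuous_on)

lemma measurable_radial_F [measurable]: "radial_F \<in> borel_measurable borel"
  by (rule borel_measurable_continuous_onI[OF continuous_radial_F])

lemma radial_F_at_top: "(radial_F \<longlongrightarrow> 1) at_top"
proof -
  interpret R: real_distribution "distr N borel norm" by (rule real_distribution_norm)
  show ?thesis unfolding radial_F_eq_cdf by (rule R.cdf_lim_at_top_prob)
qed

lemma radial_F_neg: "x < 0 \<Longrightarrow> radial_F x = 0"
proof -
  assume "x < 0"
  then have "{y :: real^'k::{finite,wellorder}. norm y \<le> x} = {}"
    using less_le_trans[OF _ norm_ge_zero] by (auto simp: not_le)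
  then show ?thesis by (simp add: radial_F_def)
qed

lemma radial_F_hits:
  assumes "0 < v" "v < 1" obtains x where "radial_F x = v"
proof -
  have "\<forall>\<^sub>F x in at_top. v < radial_F x" using radial_F_at_top assms by (intro order_tendstoD)
  then obtain X where X: "\<And>x. X \<le> x \<Longrightarrow> v < radial_F x" by (auto simp: eventually_at_top_linorder)
  have "\<exists>x. - 1 \<le> x \<and> x \<le> max 0 X \<and> radial_F x = v"
  proof (rule IVT)
    show "radial_F (- 1) \<le> v" using assms by (simp add: radial_F_neg)
    show "v \<le> radial_F (max 0 X)" using X[of "max 0 X"] by simp
  qed (auto simp: isCont_radial_F)
  then show ?thesis using that by blast
qed

text \<open>The probability integral transform; every level strictly between 0 and 1 is attained because the
  distribution function is continuous.\<close>

lemma distr_radial_F: "distr N borel (\<lambda>y. radial_F (norm y)) = uniform_measure lborel {0<..<1}"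
proof (rule cdf_unique)
  let ?U = "uniform_measure lborel {0<..<1::real}"
  have mF: "(\<lambda>y. radial_F (norm y)) \<in> borel_measurable N" by measurable
  show "real_distribution (distr N borel (\<lambda>y. radial_F (norm y)))"
    by (rule real_distribution_distr[OF mF])
  have "prob_space ?U" by (rule prob_space_uniform_measure) auto
  then show "real_distribution ?U" by (simp add: real_distribution_def real_distribution_axioms_def)
  show "cdf (distr N borel (\<lambda>y. radial_F (norm y))) = cdf ?U"
  proof
    fix u :: real
    have lhs: "cdf (distr N borel (\<lambda>y. radial_F (norm y))) u = measure N {y. radial_F (norm y) \<le> u}"
      using mF by (simp add: cdf_def measure_distr vimage_def)
    have rhs: "cdf ?U u = measure lborel ({0<..<1} \<inter> {..u})"
      by (simp add: cdf_def measure_uniform_measure)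
    have sets: "{y. radial_F (norm y) \<le> u} \<in> sets N" "{y. norm y \<le> x} \<in> sets N" for u x
    proof -
      have "{y \<in> space N. radial_F (norm y) \<le> u} \<in> sets N" "{y \<in> space N. norm y \<le> x} \<in> sets N"
        by measurable
      then show "{y. radial_F (norm y) \<le> u} \<in> sets N" "{y. norm y \<le> x} \<in> sets N" by simp_all
    qed
    have up: "measure N {y. radial_F (norm y) \<le> u} \<le> v" if uv: "u < v" "0 < v" "v < 1" for v
    proof -
      obtain x where x: "radial_F x = v" by (metis radial_F_hits uv(2,3))
      have "norm y \<le> x" if "radial_F (norm y) \<le> u" for y
        using radial_F_mono[of x "norm y"] that x \<open>u < v\<close> by (cases "norm y \<le> x") auto
      then have "measure N {y. radial_F (norm y) \<le> u} \<le> measure N {y. norm y \<le> x}"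
        using sets by (intro finite_measure_mono) auto
      then show ?thesis using x by (simp add: radial_F_def)
    qed
    consider "1 \<le> u" | "0 < u" "u < 1" | "u \<le> 0" by linarith
    then show "cdf (distr N borel (\<lambda>y. radial_F (norm y))) u = cdf ?U u"
    proof cases
      case 1
      then have e1: "{y. radial_F (norm y) \<le> u} = space N"
        using radial_F_bounds by (auto intro: order_trans)
      have e2: "{0<..<1} \<inter> {..u} = {0<..<1}" using 1 by auto
      show ?thesis unfolding lhs rhs e1 e2 prob_space by simp
    next
      case 2
      obtain x where x: "radial_F x = u" by (metis radial_F_hits 2)
      have "measure N {y. norm y \<le> x} \<le> measure N {y. radial_F (norm y) \<le> u}"
        using radial_F_mono[of _ x] x by (intro finite_measure_mono sets) auto
      then have "u \<le> measure N {y. radial_F (norm y) \<le> u}" using x by (simp add: radial_F_def)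
      moreover have "measure N {y. radial_F (norm y) \<le> u} \<le> u"
        using up 2 by (intro dense_ge_bounded[of u 1]) auto
      moreover have "{0<..<1} \<inter> {..u} = {0<..u}" using 2 by auto
      ultimately show ?thesis unfolding lhs rhs using 2 by simp
    next
      case 3
      have "measure N {y. radial_F (norm y) \<le> u} \<le> 0"
        using up 3 by (intro dense_ge_bounded[of 0 1]) auto
      then have "measure N {y. radial_F (norm y) \<le> u} = 0" by (simp add: measure_le_0_iff)
      moreover have "{0<..<1} \<inter> {..u} = {}" using 3 by auto
      ultimately show ?thesis unfolding lhs rhs by simp
    qed
  qed
qed

lemma nn_integral_radial_F:
  assumes [measurable]: "g \<in> borel_measurable borel"
  shows "(\<integral>\<^sup>+ y. g (radial_F (norm y)) \<partial>N) = (\<integral>\<^sup>+ u. g u * indicator {0<..<1} u \<partial>lborel)"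
proof -
  have "(\<integral>\<^sup>+ y. g (radial_F (norm y)) \<partial>N) = (\<integral>\<^sup>+ u. g u \<partial>distr N borel (\<lambda>y. radial_F (norm y)))"
    by (subst nn_integral_distr) auto
  also have "\<dots> = (\<integral>\<^sup>+ u. g u * indicator {0<..<1} u \<partial>lborel)"
    unfolding distr_radial_F by (subst nn_integral_uniform_measure) (auto simp: divide_ennreal_def)
  finally show ?thesis .
qed

lemma nn_integral_two_coordinates:
  fixes g h :: "real^'k::{finite,wellorder} \<Rightarrow> ennreal"
  assumes t: "t \<in> {1..n}" "t' \<in> {1..n}" "t \<noteq> t'"
    and g [measurable]: "g \<in> borel_measurable borel" and h [measurable]: "h \<in> borel_measurable borel"
  shows "(\<integral>\<^sup>+ y. g (y t) * h (y t') \<partial>sample_law n) = (\<integral>\<^sup>+ x. g x \<partial>N) * (\<integral>\<^sup>+ x. h x \<partial>N)"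
proof -
  define f where "f j = (if j = t then g else if j = t' then h else (\<lambda>_. 1))" for j
  have prod_eq: "(\<Prod>j\<in>{1..n}. c j) = c t * c t'" if "\<And>j. j \<noteq> t \<Longrightarrow> j \<noteq> t' \<Longrightarrow> c j = 1" for c :: "nat \<Rightarrow> ennreal"
  proof -
    have "(\<Prod>j\<in>{1..n}. c j) = (\<Prod>j\<in>{t, t'}. c j)"
      using t that by (intro prod.mono_neutral_right) auto
    then show ?thesis using t(3) by simp
  qed
  have "(\<integral>\<^sup>+ y. g (y t) * h (y t') \<partial>sample_law n) = (\<integral>\<^sup>+ y. (\<Prod>j\<in>{1..n}. f j (y j)) \<partial>PiM {1..n} (\<lambda>_. N))"
    unfolding sample_law_def using t(3) by (subst prod_eq) (auto simp: f_def)
  also have "\<dots> = (\<Prod>j\<in>{1..n}. \<integral>\<^sup>+ x. f j x \<partial>N)"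
    by (intro coords.product_nn_integral_prod) (auto simp: f_def measurable_cong_sets[OF sets_N refl])
  also have "\<dots> = (\<integral>\<^sup>+ x. g x \<partial>N) * (\<integral>\<^sup>+ x. h x \<partial>N)"
    using t(3) by (subst prod_eq) (use emeasure_space_1 in \<open>auto simp: f_def\<close>)
  finally show ?thesis .
qed

definition ball_ind :: "real \<Rightarrow> real^'k::{finite,wellorder} \<Rightarrow> real" where
  "ball_ind x y = (if norm y \<le> x then 1 else 0)"

lemma measurable_ball_ind [measurable]: "ball_ind x \<in> borel_measurable borel"
  unfolding ball_ind_def[abs_def] by measurable

lemma integral_ball_ind: "(\<integral>y. ball_ind x y \<partial>N) = radial_F x"
proof -
  have "(\<integral>y. ball_ind x y \<partial>N) = (\<integral>y. indicator {y. norm y \<le> x} y \<partial>N)"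
    by (intro Bochner_Integration.integral_cong) (auto simp: ball_ind_def)
  then show ?thesis by (simp add: radial_F_def)
qed

definition radially_close :: "nat \<Rightarrow> (nat \<Rightarrow> real^'k::{finite,wellorder}) \<Rightarrow> real \<Rightarrow> bool" where
  "radially_close n y \<zeta> \<longleftrightarrow> (\<forall>x. \<bar>avg n (ball_ind x) y - radial_F x\<bar> \<le> \<zeta>)"

lemma avg_ball_ind_bounds: "0 \<le> avg n (ball_ind x) y" "avg n (ball_ind x) y \<le> 1"
proof -
  show "0 \<le> avg n (ball_ind x) y"
    unfolding avg_def by (intro divide_nonneg_nonneg sum_nonneg) (auto simp: ball_ind_def)
  have "(\<Sum>t=1..n. ball_ind x (y t)) \<le> (\<Sum>t=1..n. 1)" by (intro sum_mono) (auto simp: ball_ind_def)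
  then show "avg n (ball_ind x) y \<le> 1" by (cases "n = 0") (simp_all add: avg_def divide_le_eq_1)
qed

lemma avg_ball_ind_mono: "x \<le> x' \<Longrightarrow> avg n (ball_ind x) y \<le> avg n (ball_ind x') y"
  by (rule avg_mono) (auto simp: ball_ind_def)

text \<open>The Glivenko-Cantelli argument: take the quantiles of the orders \<open>j / m\<close>. Both distribution
  functions are monotone, so in between they cannot differ by more than at the neighbouring
  quantiles plus \<open>2 / m\<close>.\<close>

lemma radially_close_of_quantiles:
  assumes \<zeta>: "0 < \<zeta>"
  obtains X \<eta> where "finite X" "0 < \<eta>"
    "\<And>n y. (\<And>x. x \<in> X \<Longrightarrow> \<bar>avg n (ball_ind x) y - (\<integral>y. ball_ind x y \<partial>N)\<bar> \<le> \<eta>) \<Longrightarrow> radially_close n y \<zeta>"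
proof -
  obtain m :: nat where m: "4 / \<zeta> < real m" using reals_Archimedean2 by blast
  then have m0: "0 < real m" using \<zeta> by (meson divide_pos_pos less_trans zero_less_numeral)
  have m2: "2 / real m \<le> \<zeta> / 2" using m m0 \<zeta> by (simp add: field_simps)
  have "\<forall>j\<in>{1..<m}. \<exists>x. radial_F x = real j / real m"
  proof
    fix j assume "j \<in> {1..<m}"
    then have "0 < real j / real m" "real j / real m < 1" using m0 by auto
    then show "\<exists>x. radial_F x = real j / real m" by (metis radial_F_hits)
  qed
  then obtain q where q: "\<And>j. j \<in> {1..<m} \<Longrightarrow> radial_F (q j) = real j / real m" by metis
  have "radially_close n y \<zeta>"
    if cl: "\<And>x. x \<in> q ` {1..<m} \<Longrightarrow> \<bar>avg n (ball_ind x) y - (\<integral>y. ball_ind x y \<partial>N)\<bar> \<le> \<zeta> / 2" for n y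
    unfolding radially_close_def
  proof
    fix x
    have cl': "\<bar>avg n (ball_ind (q j)) y - real j / real m\<bar> \<le> \<zeta> / 2" if "j \<in> {1..<m}" for j
      using cl[of "q j"] that by (simp add: integral_ball_ind q)
    define j where "j = nat \<lfloor>real m * radial_F x\<rfloor>"
    have "0 \<le> real m * radial_F x" using m0 radial_F_bounds by simp
    then have j: "real j \<le> real m * radial_F x" "real m * radial_F x < real j + 1"
      unfolding j_def by linarith+
    have jF: "real j / real m \<le> radial_F x" "radial_F x < (real j + 1) / real m"
      using j m0 by (simp_all add: divide_le_eq less_divide_eq mult.commute)
    have up: "avg n (ball_ind x) y \<le> (real j + 1) / real m + \<zeta> / 2"
    proof (cases "j + 1 < m")
      case True
      have "radial_F x < radial_F (q (j + 1))" using jF True q[of "j + 1"] by (simp add: add.commute)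
      then have "x \<le> q (j + 1)" using radial_F_mono[of "q (j + 1)" x] by linarith
      then have "avg n (ball_ind x) y \<le> avg n (ball_ind (q (j + 1))) y" by (rule avg_ball_ind_mono)
      moreover have "\<bar>avg n (ball_ind (q (j + 1))) y - real (j + 1) / real m\<bar> \<le> \<zeta> / 2"
        using True by (intro cl') auto
      moreover have "real (j + 1) / real m = (real j + 1) / real m" by simp
      ultimately show ?thesis by linarith
    next
      case False
      then have "1 \<le> (real j + 1) / real m" using m0 by (simp add: le_divide_eq)
      then show ?thesis using avg_ball_ind_bounds(2)[of n x y] \<zeta> by linarith
    qed
    have lo: "(real j - 1) / real m - \<zeta> / 2 \<le> avg n (ball_ind x) y"
    proof (cases "2 \<le> j")
      case True
      have "real j \<le> real m * 1"
        using j(1) radial_F_bounds(2)[of x] m0 by (meson mult_left_mono less_imp_le order_trans)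
      then have in_m: "j - 1 \<in> {1..<m}" using True by auto
      have "radial_F (q (j - 1)) < radial_F x"
      proof -
        have "(real j - 1) / real m < real j / real m" using m0 by (intro divide_strict_right_mono) auto
        then show ?thesis using q[OF in_m] jF(1) True by (simp add: of_nat_diff)
      qed
      then have "q (j - 1) \<le> x" using radial_F_mono[of x "q (j - 1)"] by linarith
      then have "avg n (ball_ind (q (j - 1))) y \<le> avg n (ball_ind x) y" by (rule avg_ball_ind_mono)
      moreover have "real (j - 1) = real j - 1" using True by simp
      ultimately show ?thesis using cl'[OF in_m] by (simp only:)
    next
      case False
      then have "(real j - 1) / real m \<le> 0" using m0 by (intro divide_nonpos_pos) auto
      then show ?thesis using avg_ball_ind_bounds(1)[of n x y] \<zeta> by linarith
    qed
    define a b where "a = real j / real m" and "b = 1 / real m"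
    have e: "(real j + 1) / real m = a + b" "(real j - 1) / real m = a - b" "real j / real m = a"
      by (simp_all add: a_def b_def add_divide_distrib diff_divide_distrib)
    have "2 * b \<le> \<zeta> / 2" "0 \<le> b" using m2 by (simp_all add: b_def)
    with up lo jF show "\<bar>avg n (ball_ind x) y - radial_F x\<bar> \<le> \<zeta>" unfolding e by linarith
  qed
  then show ?thesis using that[of "q ` {1..<m}" "\<zeta> / 2"] \<zeta> by auto
qed

text \<open>Uniform continuity deals with bounded arguments. Beyond a large bound \<open>X\<close> the distribution function
  is already close to 1.\<close>

lemma radial_F_dilation:
  assumes \<zeta>: "0 < \<zeta>"
  obtains \<delta> where "0 < \<delta>" "\<delta> < 1/2"
    "\<And>\<rho> x. 1 \<le> \<rho> \<Longrightarrow> \<rho> \<le> (1 + \<delta>) / (1 - \<delta>) \<Longrightarrow> 0 \<le> x \<Longrightarrow> radial_F (\<rho> * x) \<le> radial_F x + \<zeta>"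
proof -
  have "\<forall>\<^sub>F x in at_top. 1 - \<zeta> < radial_F x" using radial_F_at_top \<zeta> by (intro order_tendstoD) auto
  then obtain X0 where X0: "\<And>x. X0 \<le> x \<Longrightarrow> 1 - \<zeta> < radial_F x" by (auto simp: eventually_at_top_linorder)
  define X where "X = max 1 X0"
  have "uniformly_continuous_on {0..3 * X} radial_F"
    by (intro compact_uniformly_continuous continuous_radial_F compact_Icc)
  then obtain d where d: "0 < d" "\<And>x x'. x \<in> {0..3 * X} \<Longrightarrow> x' \<in> {0..3 * X} \<Longrightarrow> dist x' x < d \<Longrightarrow> dist (radial_F x') (radial_F x) < \<zeta>"
    using \<zeta> unfolding uniformly_continuous_on_def by metis
  \<comment> \<open>A dilation factor exceeds 1 by at most \<open>4 * \<delta>\<close>, which moves points below \<open>X\<close> by at most \<open>d / 2\<close>.\<close>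
  define \<delta> where "\<delta> = min (1/4) (d / (8 * X))"
  have X: "1 \<le> X" by (simp add: X_def)
  have \<delta>: "0 < \<delta>" "\<delta> \<le> 1/4" "8 * \<delta> * X \<le> d"
    using d(1) X by (auto simp: \<delta>_def min_def field_simps split: if_splits)
  have "radial_F (\<rho> * x) \<le> radial_F x + \<zeta>" if \<rho>: "1 \<le> \<rho>" "\<rho> \<le> (1 + \<delta>) / (1 - \<delta>)" and x: "0 \<le> x" for \<rho> x
  proof (cases "X \<le> x")
    case True
    then have "1 - \<zeta> < radial_F x" by (intro X0) (simp add: X_def)
    then show ?thesis using radial_F_bounds(2)[of "\<rho> * x"] by linarith
  next
    case False
    have "\<rho> * (1 - \<delta>) \<le> 1 + \<delta>" using \<rho>(2) \<delta> by (simp add: le_divide_eq)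
    moreover have "\<rho> \<le> 3"
    proof -
      have "(1 + \<delta>) / (1 - \<delta>) \<le> 3" using \<delta> by (simp add: divide_le_eq)
      then show ?thesis using \<rho> by linarith
    qed
    moreover from this have "\<rho> * \<delta> \<le> 3 * \<delta>" using \<delta> by (intro mult_right_mono) auto
    ultimately have r: "\<rho> - 1 \<le> 4 * \<delta>" by (simp add: algebra_simps)
    have "\<rho> * x - x = (\<rho> - 1) * x" by (simp add: algebra_simps)
    also have "\<dots> \<le> 4 * \<delta> * X" using r False x \<rho> \<delta> by (intro mult_mono) auto
    also have "\<dots> < d" 
    proof -
      have "0 < \<delta> * X" using \<delta> X by (intro mult_pos_pos) auto
      moreover have "8 * \<delta> * X = 8 * (\<delta> * X)" "4 * \<delta> * X = 4 * (\<delta> * X)" by simp_all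
      ultimately show ?thesis using \<delta>(3) by linarith
    qed
    finally have "\<rho> * x - x < d" .
    moreover have "x \<le> \<rho> * x" using \<rho>(1) x by (simp add: mult_le_cancel_right1)
    moreover have "\<rho> * x \<le> 3 * X" using \<open>\<rho> \<le> 3\<close> False x \<rho> by (intro mult_mono) auto
    ultimately have "dist (radial_F (\<rho> * x)) (radial_F x) < \<zeta>"
      using x False X by (intro d(2)) (auto simp: dist_real_def)
    then show ?thesis by (simp add: dist_real_def)
  qed
  then show ?thesis using that[of \<delta>] \<delta> by auto
qed

text \<open>The norm of an observation changes under \<open>C\<close> by a factor between \<open>1 - \<delta>\<close> and \<open>1 + \<delta>\<close>. Hence the rank of
  observation \<open>t\<close> lies between the numbers of observations in the balls of radii \<open>\<bar>y t\<bar> / \<rho>\<close> and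
  \<open>\<rho> \<bar>y t\<bar>\<close>.\<close>

lemma rank_close:
  assumes n: "1 \<le> n" and C: "norm (C - mat 1) \<le> \<delta>" and \<delta>: "0 < \<delta>" "\<delta> < 1/2"
    and dil: "\<And>\<rho> x. 1 \<le> \<rho> \<Longrightarrow> \<rho> \<le> (1 + \<delta>) / (1 - \<delta>) \<Longrightarrow> 0 \<le> x \<Longrightarrow> radial_F (\<rho> * x) \<le> radial_F x + \<zeta>"
    and rc: "radially_close n y \<zeta>"
  shows "\<bar>real (rank_among n (\<lambda>s. norm (C *v y s)) t) / (real n + 1) - radial_F (norm (y t))\<bar> \<le> 2 * \<zeta> + 1 / real n"
proof -
  define \<rho> where "\<rho> = (1 + \<delta>) / (1 - \<delta>)"
  have \<rho>: "1 \<le> \<rho>" using \<delta> by (simp add: \<rho>_def)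
  define R where "R = real (rank_among n (\<lambda>s. norm (C *v y s)) t)"
  have cnt: "real n * avg n (ball_ind x) y = real (card {s \<in> {1..n}. norm (y s) \<le> x})" for x
  proof -
    have "{1..n} \<inter> {t. norm (y t) \<le> x} = {s \<in> {1..n}. norm (y s) \<le> x}" by auto
    then show ?thesis using n by (simp add: avg_def ball_ind_def sum.If_cases)
  qed
  have nb: "(1 - \<delta>) * norm v \<le> norm (C *v v)" "norm (C *v v) \<le> (1 + \<delta>) * norm v" for v
    using norm_near_identity[OF C] by auto
  have "R \<le> real (card {s \<in> {1..n}. norm (y s) \<le> \<rho> * norm (y t)})"
    unfolding R_def rank_among_def of_nat_le_iff
  proof (intro card_mono subsetI, simp)
    fix s assume s: "s \<in> {s \<in> {1..n}. norm (C *v y s) \<le> norm (C *v y t)}"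
    then have "(1 - \<delta>) * norm (y s) \<le> (1 + \<delta>) * norm (y t)" using nb(1)[of "y s"] nb(2)[of "y t"] by auto
    then have "norm (y s) \<le> \<rho> * norm (y t)" using \<delta> by (simp add: \<rho>_def field_simps)
    then show "s \<in> {s \<in> {1..n}. norm (y s) \<le> \<rho> * norm (y t)}" using s by auto
  qed
  also have "\<dots> = real n * avg n (ball_ind (\<rho> * norm (y t))) y" by (rule cnt[symmetric])
  also have "\<dots> \<le> real n * (radial_F (norm (y t)) + 2 * \<zeta>)"
    using rc[unfolded radially_close_def, rule_format, of "\<rho> * norm (y t)"] dil[of \<rho> "norm (y t)"] \<rho>
    by (intro mult_left_mono) (auto simp: \<rho>_def[symmetric])
  finally have up: "R \<le> real n * (radial_F (norm (y t)) + 2 * \<zeta>)" .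
  have "real n * (radial_F (norm (y t)) - 2 * \<zeta>) \<le> real n * avg n (ball_ind (norm (y t) / \<rho>)) y"
    using rc[unfolded radially_close_def, rule_format, of "norm (y t) / \<rho>"] dil[of \<rho> "norm (y t) / \<rho>"] \<rho>
    by (intro mult_left_mono) (auto simp: \<rho>_def[symmetric])
  also have "\<dots> = real (card {s \<in> {1..n}. norm (y s) \<le> norm (y t) / \<rho>})" by (rule cnt)
  also have "\<dots> \<le> R"
    unfolding R_def rank_among_def of_nat_le_iff
  proof (intro card_mono subsetI, simp)
    fix s assume s: "s \<in> {s \<in> {1..n}. norm (y s) \<le> norm (y t) / \<rho>}"
    then have "(1 + \<delta>) * norm (y s) \<le> (1 - \<delta>) * norm (y t)" using \<delta> by (simp add: \<rho>_def field_simps)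
    then have "norm (C *v y s) \<le> norm (C *v y t)" using nb(2)[of "y s"] nb(1)[of "y t"] by linarith
    then show "s \<in> {s \<in> {1..n}. norm (C *v y s) \<le> norm (C *v y t)}" using s by auto
  qed
  finally have lo: "real n * (radial_F (norm (y t)) - 2 * \<zeta>) \<le> R" .
  have n0: "0 < real n" using n by simp
  have "R \<le> real n" unfolding R_def rank_among_def of_nat_le_iff
    by (rule order_trans[OF card_mono[of "{1..n}"]]) auto
  have "\<bar>R / real n - radial_F (norm (y t))\<bar> \<le> 2 * \<zeta>"
    using up lo n0 by (simp add: abs_le_iff field_simps)
  moreover have "\<bar>R / (real n + 1) - R / real n\<bar> \<le> 1 / real n"
  proof -
    have "R / real n - R / (real n + 1) = (R / real n) * (1 / (real n + 1))"
      using n0 by (simp add: divide_simps) (simp add: algebra_simps)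
    moreover have "0 \<le> R / real n" "R / real n \<le> 1" using \<open>R \<le> real n\<close> n0 by (auto simp: R_def)
    moreover have "0 \<le> 1 / (real n + 1)" "1 / (real n + 1) \<le> 1 / real n" using n0 by (auto simp: frac_le)
    ultimately show ?thesis
      using mult_mono[of "R / real n" 1 "1 / (real n + 1)" "1 / real n"] mult_nonneg_nonneg[of "R / real n" "1 / (real n + 1)"] by linarith
  qed
  ultimately show ?thesis unfolding R_def[symmetric] by linarith
qed

end

lemma rank_among_bij:
  assumes inj: "inj_on d {1..n}"
  shows "bij_betw (rank_among n d) {1..n} {1..n}"
proof -
  have less: "rank_among n d s < rank_among n d t" if "s \<in> {1..n}" "t \<in> {1..n}" "d s < d t" for s t
    unfolding rank_among_def
  proof (rule psubset_card_mono)
    have "t \<in> {r \<in> {1..n}. d r \<le> d t}" "t \<notin> {r \<in> {1..n}. d r \<le> d s}" using that by auto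
    moreover have "{r \<in> {1..n}. d r \<le> d s} \<subseteq> {r \<in> {1..n}. d r \<le> d t}" using that by auto
    ultimately show "{r \<in> {1..n}. d r \<le> d s} \<subset> {r \<in> {1..n}. d r \<le> d t}" by blast
  qed simp
  have "inj_on (rank_among n d) {1..n}"
  proof (rule inj_onI)
    fix s t assume st: "s \<in> {1..n}" "t \<in> {1..n}" "rank_among n d s = rank_among n d t"
    then have "d s = d t" using less[of s t] less[of t s] by (cases "d s" "d t" rule: linorder_cases) auto
    then show "s = t" using inj st by (auto dest: inj_onD)
  qed
  moreover have "rank_among n d ` {1..n} \<subseteq> {1..n}"
  proof safe
    fix t assume t: "t \<in> {1..n}"
    have "t \<in> {s \<in> {1..n}. d s \<le> d t}" using t by simp
    then have "1 \<le> rank_among n d t" unfolding rank_among_def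
      using card_gt_0_iff[of "{s \<in> {1..n}. d s \<le> d t}"] by auto
    moreover have "rank_among n d t \<le> n" unfolding rank_among_def
      by (rule order_trans[OF card_mono[of "{1..n}"]]) auto
    ultimately show "rank_among n d t \<in> {1..n}" by simp
  qed
  ultimately show ?thesis
    by (simp add: bij_betw_def endo_inj_surj)
qed

section \<open>Score bounds\<close>

lemma sq_add_le: "(p + q)\<^sup>2 \<le> 2 * p\<^sup>2 + 2 * q\<^sup>2" for p q :: real
  using zero_le_power2[of "p - q"] by (simp add: power2_eq_square algebra_simps)

lemma score_approx_sym: "score_approx K J \<kappa> \<Longrightarrow> score_approx J K \<kappa>"
  by (simp add: score_approx_def power2_commute)

lemma score_approx_trans:
  assumes [measurable]: "K \<in> borel_measurable borel" "J \<in> borel_measurable borel" "L \<in> borel_measurable borel"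
    and KJ: "score_approx K J \<kappa>" and JL: "score_approx J L \<nu>" and nonneg: "0 \<le> \<kappa>" "0 \<le> \<nu>"
  shows "score_approx K L (2 * \<kappa> + 2 * \<nu>)"
  unfolding score_approx_def
proof (intro conjI allI impI)
  have le: "(K u - L u)\<^sup>2 \<le> 2 * (K u - J u)\<^sup>2 + 2 * (J u - L u)\<^sup>2" for u
    using sq_add_le[of "K u - J u" "J u - L u"] by simp
  show "(\<Sum>r=1..n. (K (real r / (real n + 1)) - L (real r / (real n + 1)))\<^sup>2) \<le> (2 * \<kappa> + 2 * \<nu>) * real n"
    if "1 \<le> n" for n
  proof -
    have "(\<Sum>r=1..n. (K (real r / (real n + 1)) - L (real r / (real n + 1)))\<^sup>2) \<le>
        2 * (\<Sum>r=1..n. (K (real r / (real n + 1)) - J (real r / (real n + 1)))\<^sup>2) +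
        2 * (\<Sum>r=1..n. (J (real r / (real n + 1)) - L (real r / (real n + 1)))\<^sup>2)"
      unfolding sum_distrib_left sum.distrib[symmetric] by (intro sum_mono le)
    also have "\<dots> \<le> 2 * (\<kappa> * real n) + 2 * (\<nu> * real n)"
      using KJ JL that unfolding score_approx_def by (intro add_mono mult_left_mono) auto
    finally show ?thesis by (simp add: algebra_simps)
  qed
  have "(\<integral>\<^sup>+ u. ennreal ((K u - L u)\<^sup>2) * indicator {0<..<1} u \<partial>lborel) \<le>
      (\<integral>\<^sup>+ u. ennreal 2 * (ennreal ((K u - J u)\<^sup>2) * indicator {0<..<1} u) +
        ennreal 2 * (ennreal ((J u - L u)\<^sup>2) * indicator {0<..<1} u) \<partial>lborel)"
  proof (rule nn_integral_mono)
    fix u :: real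
    have "ennreal ((K u - L u)\<^sup>2) \<le> ennreal (2 * (K u - J u)\<^sup>2 + 2 * (J u - L u)\<^sup>2)"
      using le by (rule ennreal_leI)
    also have "\<dots> = ennreal 2 * ennreal ((K u - J u)\<^sup>2) + ennreal 2 * ennreal ((J u - L u)\<^sup>2)"
      by (simp only: ennreal_plus ennreal_mult zero_le_power2 mult_nonneg_nonneg zero_le_numeral)
    finally show "ennreal ((K u - L u)\<^sup>2) * indicator {0<..<1} u \<le>
        ennreal 2 * (ennreal ((K u - J u)\<^sup>2) * indicator {0<..<1} u) +
        ennreal 2 * (ennreal ((J u - L u)\<^sup>2) * indicator {0<..<1} u)"
      by (cases "u \<in> {0<..<1}") simp_all
  qed
  also have "\<dots> = ennreal 2 * (\<integral>\<^sup>+ u. ennreal ((K u - J u)\<^sup>2) * indicator {0<..<1} u \<partial>lborel) +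
      ennreal 2 * (\<integral>\<^sup>+ u. ennreal ((J u - L u)\<^sup>2) * indicator {0<..<1} u \<partial>lborel)"
    by (subst nn_integral_add) (auto simp: nn_integral_cmult)
  also have "\<dots> \<le> ennreal 2 * ennreal \<kappa> + ennreal 2 * ennreal \<nu>"
    using KJ JL unfolding score_approx_def by (intro add_mono mult_left_mono) auto
  also have "\<dots> = ennreal (2 * \<kappa> + 2 * \<nu>)"
    using nonneg by (simp only: ennreal_plus ennreal_mult mult_nonneg_nonneg zero_le_numeral)
  finally show "(\<integral>\<^sup>+ u. ennreal ((K u - L u)\<^sup>2) * indicator {0<..<1} u \<partial>lborel) \<le> ennreal (2 * \<kappa> + 2 * \<nu>)" .
qed

lemma score_approx_bounded:
  assumes B: "\<And>u. \<bar>J u\<bar> \<le> B" shows "score_approx J (\<lambda>_. 0) (B\<^sup>2)"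
  unfolding score_approx_def
proof (intro conjI allI impI)
  have B0: "0 \<le> B" using B[of 0] by linarith
  have le: "(J u - 0)\<^sup>2 \<le> B\<^sup>2" for u using B[of u] B0 by (simp add: abs_le_square_iff[symmetric])
  show "(\<Sum>r=1..n. (J (real r / (real n + 1)) - 0)\<^sup>2) \<le> B\<^sup>2 * real n" for n
    using sum_mono[of "{1..n}" "\<lambda>r. (J (real r / (real n + 1)) - 0)\<^sup>2" "\<lambda>_. B\<^sup>2"] le by (simp add: mult.commute)
  have "(\<integral>\<^sup>+ u. ennreal ((J u - 0)\<^sup>2) * indicator {0<..<1} u \<partial>lborel) \<le>
      (\<integral>\<^sup>+ u. ennreal (B\<^sup>2) * indicator {0<..<1::real} u \<partial>lborel)"
    by (intro nn_integral_mono mult_right_mono ennreal_leI le) simp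
  also have "\<dots> = ennreal (B\<^sup>2)" by (simp add: nn_integral_cmult_indicator)
  finally show "(\<integral>\<^sup>+ u. ennreal ((J u - 0)\<^sup>2) * indicator {0<..<1} u \<partial>lborel) \<le> ennreal (B\<^sup>2)" .
qed

lemma score_bound:
  assumes K: "assumption_C K" and m: "K \<in> borel_measurable borel"
  obtains A where "0 < A" "score_approx K (\<lambda>_. 0) A"
proof -
  obtain J B where J: "uniformly_continuous_on UNIV J" "\<And>u. \<bar>J u\<bar> \<le> B" "score_approx K J 1"
    using score_approximation[OF K, of 1] by auto
  have "J \<in> borel_measurable borel"
    using J(1) by (intro borel_measurable_continuous_onI uniformly_continuous_imp_continuous)
  then have "score_approx K (\<lambda>_. 0) (2 * 1 + 2 * B\<^sup>2)"
    using m J score_approx_bounded[OF J(2)] by (intro score_approx_trans[of K J]) auto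
  moreover have "0 < 2 * 1 + 2 * B\<^sup>2" by (simp add: add_pos_nonneg)
  ultimately show ?thesis using that by blast
qed

section \<open>Orthogonality from sign symmetry\<close>

context spherical_law
begin

text \<open>Reflecting the latest observation involved in a product of two summands changes the sign of
  that product and not the law of the sample.\<close>

lemma orthogonal_tail_bound:
  fixes q :: "nat \<Rightarrow> (nat \<Rightarrow> real^'k::{finite,wellorder}) \<Rightarrow> real"
  assumes T: "T \<subseteq> {1..n}"
    and meas: "\<And>t. t \<in> T \<Longrightarrow> q t \<in> borel_measurable (sample_law n)"
    and sq: "\<And>t. t \<in> T \<Longrightarrow> (\<integral>\<^sup>+ y. ennreal ((q t y)\<^sup>2) \<partial>sample_law n) \<le> ennreal \<beta>" and \<beta>: "0 \<le> \<beta>"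
    and odd: "\<And>t y. t \<in> T \<Longrightarrow> y \<in> space (sample_law n) \<Longrightarrow> q t (y(t := - y t)) = - q t y"
    and even: "\<And>t t' y. t \<in> T \<Longrightarrow> t' \<in> T \<Longrightarrow> t < t' \<Longrightarrow> y \<in> space (sample_law n) \<Longrightarrow>
      q t (y(t' := - y t')) = q t y"
    and c: "0 < c"
  shows "measure (sample_law n) {y \<in> space (sample_law n). c \<le> \<bar>\<Sum>t\<in>T. q t y\<bar>} \<le> real n * \<beta> / c\<^sup>2"
proof -
  interpret P: prob_space "sample_law n" by (rule prob_space_sample)
  have fin: "finite T" using T finite_subset by blast
  note [measurable] = meas
  have int2: "integrable (sample_law n) (\<lambda>y. (q t y)\<^sup>2)" if "t \<in> T" for t
    using that le_less_trans[OF sq[OF that] ennreal_less_top] by (intro integrableI_nonneg) auto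
  have I2: "(\<integral>y. (q t y)\<^sup>2 \<partial>sample_law n) \<le> \<beta>" if "t \<in> T" for t
    using sq[OF that] \<beta> that by (subst integral_eq_nn_integral) (auto intro: enn2real_leI)
  have int: "integrable (sample_law n) (\<lambda>y. q t y * q t' y)" if t: "t \<in> T" "t' \<in> T" for t t'
  proof (rule Bochner_Integration.integrable_bound)
    show "integrable (sample_law n) (\<lambda>y. (q t y)\<^sup>2 + (q t' y)\<^sup>2)"
      by (intro Bochner_Integration.integrable_add int2 t)
    show "(\<lambda>y. q t y * q t' y) \<in> borel_measurable (sample_law n)"
      by (intro borel_measurable_times meas t)
    have "\<bar>a * b\<bar> \<le> a\<^sup>2 + b\<^sup>2" for a b :: real
    proof -
      have "2 * (\<bar>a\<bar> * \<bar>b\<bar>) \<le> a\<^sup>2 + b\<^sup>2"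
        using zero_le_power2[of "\<bar>a\<bar> - \<bar>b\<bar>"] by (simp add: power2_diff)
      moreover have "0 \<le> \<bar>a\<bar> * \<bar>b\<bar>" by simp
      ultimately show ?thesis unfolding abs_mult by linarith
    qed
    then show "AE y in sample_law n. norm (q t y * q t' y) \<le> norm ((q t y)\<^sup>2 + (q t' y)\<^sup>2)"
      by (simp add: abs_of_nonneg)
  qed
  have zero: "(\<integral>y. q t y * q t' y \<partial>sample_law n) = 0" if t: "t \<in> T" "t' \<in> T" "t < t'" for t t'
  proof -
    have t': "t' \<in> {1..n}" using t T by auto
    have "(\<integral>y. q t y * q t' y \<partial>sample_law n) =
        (\<integral>y. q t y * q t' y \<partial>distr (sample_law n) (sample_law n) (\<lambda>y. y(t' := - y t')))"
      by (simp only: distr_flip[OF t'])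
    also have "\<dots> = (\<integral>y. q t (y(t' := - y t')) * q t' (y(t' := - y t')) \<partial>sample_law n)"
      by (intro integral_distr measurable_flip[OF t'] borel_measurable_times meas t)
    also have "\<dots> = (\<integral>y. - (q t y * q t' y) \<partial>sample_law n)"
      by (intro Bochner_Integration.integral_cong refl) (simp add: odd[OF t(2)] even[OF t])
    finally show ?thesis by simp
  qed
  have zero': "(\<integral>y. q t y * q t' y \<partial>sample_law n) = 0" if "t \<in> T" "t' \<in> T" "t \<noteq> t'" for t t'
    using zero[of t t'] zero[of t' t] that by (cases t t' rule: linorder_cases) (auto simp: mult.commute)
  have S2: "(\<Sum>t\<in>T. q t y)\<^sup>2 = (\<Sum>t\<in>T. \<Sum>t'\<in>T. q t y * q t' y)" for y
    by (simp add: power2_eq_square sum_product)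
  have intS: "integrable (sample_law n) (\<lambda>y. (\<Sum>t\<in>T. q t y)\<^sup>2)"
    unfolding S2 by (intro Bochner_Integration.integrable_sum int)
  have "(\<integral>y. (\<Sum>t\<in>T. q t y)\<^sup>2 \<partial>sample_law n) = (\<Sum>t\<in>T. \<Sum>t'\<in>T. \<integral>y. q t y * q t' y \<partial>sample_law n)"
    unfolding S2 by (simp add: int Bochner_Integration.integral_sum Bochner_Integration.integrable_sum)
  also have "\<dots> = (\<Sum>t\<in>T. \<Sum>t'\<in>T. if t' = t then \<integral>y. (q t y)\<^sup>2 \<partial>sample_law n else 0)"
    by (intro sum.cong refl) (auto simp: zero' power2_eq_square)
  also have "\<dots> = (\<Sum>t\<in>T. \<integral>y. (q t y)\<^sup>2 \<partial>sample_law n)" using fin by simp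
  also have "\<dots> \<le> (\<Sum>t\<in>T. \<beta>)" by (intro sum_mono I2)
  also have "\<dots> \<le> real n * \<beta>"
    using card_mono[OF finite_atLeastAtMost T] \<beta> by (simp add: mult_right_mono)
  finally have bound: "(\<integral>y. (\<Sum>t\<in>T. q t y)\<^sup>2 \<partial>sample_law n) \<le> real n * \<beta>" .
  have "{y \<in> space (sample_law n). c \<le> \<bar>\<Sum>t\<in>T. q t y\<bar>} = {y \<in> space (sample_law n). c\<^sup>2 \<le> (\<Sum>t\<in>T. q t y)\<^sup>2}"
    using c abs_le_square_iff[of c] by auto
  also have "measure (sample_law n) \<dots> \<le> (\<integral>y. (\<Sum>t\<in>T. q t y)\<^sup>2 \<partial>sample_law n) / c\<^sup>2"
    using c by (intro integral_Markov_inequality_measure[where A = "{}"] intS) auto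
  also have "\<dots> \<le> real n * \<beta> / c\<^sup>2" using bound by (intro divide_right_mono) auto
  finally show ?thesis .
qed

section \<open>Symmetries of Tyler's matrix and of the ranks\<close>

lemma avg_flip:
  assumes even: "\<And>x. \<phi> (- x) = \<phi> x"
  shows "avg n \<phi> (y(s := - y s)) = avg n \<phi> y"
  unfolding avg_def by (intro arg_cong2[where f = "(/)"] sum.cong refl) (simp add: even)

lemma avg_swap:
  assumes s: "s \<in> {1..n}" "s' \<in> {1..n}"
  shows "avg n \<phi> (swap n s s' y) = avg n \<phi> y"
proof -
  have "(\<Sum>t=1..n. \<phi> (swap n s s' y t)) = (\<Sum>t=1..n. \<phi> (y (Transposition.transpose s s' t)))"
    by (intro sum.cong) (auto simp: swap_def)
  also have "\<dots> = (\<Sum>t=1..n. \<phi> (y t))"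
    using sum.permute[OF permutes_swap_id[OF s], of "\<lambda>t. \<phi> (y t)"] by (simp add: comp_def)
  finally show ?thesis by (simp add: avg_def)
qed

lemma sgn_minus_vec: "sgn (- x) = - sgn (x :: real^'n)"
  by (simp add: sgn_div_norm)

lemma matrix_vector_mult_minus: "A *v (- x) = - (A *v x)" for A :: "real^'n^'m"
  by (metis matrix_vector_mult_scaleR scaleR_minus1_left)

lemma sign_product_even: "sign_product p (- x) = sign_product p x"
  by (simp add: sign_product_def sgn_minus_vec)

lemma tyler_solution_flip: "tyler_solution n (y(s := - y s)) C \<longleftrightarrow> tyler_solution n y C"
  unfolding tyler_solution_def
  by (subst avg_flip) (simp_all add: matrix_vector_mult_minus sgn_minus_vec)

lemma tyler_solution_swap:
  "s \<in> {1..n} \<Longrightarrow> s' \<in> {1..n} \<Longrightarrow> tyler_solution n (swap n s s' y) C \<longleftrightarrow> tyler_solution n y C"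
  unfolding tyler_solution_def by (simp only: avg_swap)

lemma avg_scale:
  assumes "\<And>x. \<phi> (c *\<^sub>R x) = \<phi> x"
  shows "avg n \<phi> (y(s := c *\<^sub>R x)) = avg n \<phi> (y(s := x))"
  unfolding avg_def by (intro arg_cong2[where f = "(/)"] sum.cong refl) (simp add: assms)

lemma tyler_solution_scale:
  assumes "0 < c"
  shows "tyler_solution n (y(s := c *\<^sub>R x)) C \<longleftrightarrow> tyler_solution n (y(s := x)) C"
  unfolding tyler_solution_def
  using assms by (subst avg_scale) (simp_all add: matrix_vector_mult_scaleR sgn_scaleR)

end

text \<open>A fixed sample size, with a radius \<open>\<delta>\<close> for Tyler's matrix, a distance \<open>\<zeta>\<close> for distribution functions
  and a tolerance \<open>\<eta>\<close> for finitely many empirical averages, such that averages within the tolerance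
  ensure the other two. The existence of such \<open>\<eta>\<close> and \<open>X\<close> for given \<open>\<delta>\<close> and \<open>\<zeta>\<close> has been shown.\<close>

locale good_sample = spherical_law N for N :: "(real^'k::{finite,wellorder}) measure" +
  fixes n :: nat and \<delta> \<eta> \<zeta> :: real and X :: "real set"
  assumes n: "1 \<le> n" and \<delta>: "0 < \<delta>" "\<delta> < 1/2"
    and solvable: "\<And>y. y \<in> moment_event n \<eta> \<Longrightarrow>
      \<exists>C\<in>triangular_nbhd \<delta>. tyler_solution n y C \<and> (\<forall>C'. tyler_solution n y C' \<longrightarrow> C' = C)"
    and finite_X: "finite X"
    and quantiles: "\<And>y. (\<And>x. x \<in> X \<Longrightarrow> \<bar>avg n (ball_ind x) y - (\<integral>y. ball_ind x y \<partial>N)\<bar> \<le> \<eta>) \<Longrightarrow>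
      radially_close n y \<zeta>"
    and dilation: "\<And>\<rho> x. 1 \<le> \<rho> \<Longrightarrow> \<rho> \<le> (1 + \<delta>) / (1 - \<delta>) \<Longrightarrow> 0 \<le> x \<Longrightarrow> radial_F (\<rho> * x) \<le> radial_F x + \<zeta>"
begin

text \<open>Tyler's matrix, with a default value that makes it measurable and near the identity for all
  samples.\<close>

definition D :: "(nat \<Rightarrow> real^'k::{finite,wellorder}) \<Rightarrow> real^'k::{finite,wellorder}^'k::{finite,wellorder}" where
  "D y = (if y \<in> moment_event n \<eta> then tyler_matrix n y else mat 1)"

definition R :: "(nat \<Rightarrow> real^'k::{finite,wellorder}) \<Rightarrow> nat \<Rightarrow> nat" where
  "R y = rank_among n (\<lambda>s. norm (D y *v y s))"

text \<open>Without ties the ranks are a permutation. The event is invariant under reflections and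
  transpositions of observations, so that its indicator preserves the symmetries of the summands.\<close>

definition good :: "(nat \<Rightarrow> real^'k::{finite,wellorder}) set" where
  "good = {y \<in> moment_event n \<eta>. (\<forall>x\<in>X. \<bar>avg n (ball_ind x) y - (\<integral>y. ball_ind x y \<partial>N)\<bar> \<le> \<eta>) \<and>
     inj_on (\<lambda>s. norm (D y *v y s)) {1..n}}"

lemma D_solution:
  assumes "y \<in> moment_event n \<eta>"
  shows "D y \<in> triangular_nbhd \<delta>" "tyler_solution n y (D y)" "tyler_solution n y C \<Longrightarrow> C = D y"
proof -
  obtain C0 where C: "C0 \<in> triangular_nbhd \<delta>" "tyler_solution n y C0"
    "\<And>C'. tyler_solution n y C' \<Longrightarrow> C' = C0"
    using solvable[OF assms] by blast
  have eq: "D y = C0" using assms tyler_matrixI[OF C(2,3)] by (simp add: D_def)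
  show "D y \<in> triangular_nbhd \<delta>" unfolding eq by (rule C(1))
  show "tyler_solution n y (D y)" unfolding eq by (rule C(2))
  show "tyler_solution n y C \<Longrightarrow> C = D y" unfolding eq by (rule C(3))
qed

lemma D_near: "norm (D y - mat 1) \<le> \<delta>"
  using D_solution(1)[of y] \<delta> by (cases "y \<in> moment_event n \<eta>") (auto simp: triangular_nbhd_def D_def)

lemma measurable_D [measurable]: "D \<in> borel_measurable (sample_law n)"
  unfolding D_def[abs_def] using \<delta> solvable by (intro measurable_tyler[where e = \<delta>]) auto

lemma D_nonzero:
  assumes "v \<noteq> 0" shows "D y *v v \<noteq> 0"
proof -
  have "0 < (1 - \<delta>) * norm v" using assms \<delta> by simp
  then show ?thesis using norm_near_identity(1)[OF D_near[of y], of v] by auto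
qed

lemma D_eqI:
  assumes "y \<in> moment_event n \<eta> \<longleftrightarrow> y' \<in> moment_event n \<eta>"
    and "\<And>C. tyler_solution n y' C \<longleftrightarrow> tyler_solution n y C"
  shows "D y' = D y"
  using assms by (simp add: D_def tyler_matrix_eq)

lemma flip_in_space:
  "s \<in> {1..n} \<Longrightarrow> y \<in> space (sample_law n) \<Longrightarrow> y(s := - y s) \<in> space (sample_law n)"
  by (rule measurable_space[OF measurable_flip])

lemma moment_event_flip:
  assumes "s \<in> {1..n}" "y \<in> space (sample_law n)"
  shows "y(s := - y s) \<in> moment_event n \<eta> \<longleftrightarrow> y \<in> moment_event n \<eta>"
proof -
  have "moments_close n (y(s := - y s)) \<eta> \<longleftrightarrow> moments_close n y \<eta>"
    unfolding moments_close_def by (simp add: avg_flip sign_product_even)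
  moreover have "(\<forall>t\<in>{1..n}. (y(s := - y s)) t \<noteq> 0) \<longleftrightarrow> (\<forall>t\<in>{1..n}. y t \<noteq> 0)" by auto
  ultimately show ?thesis using assms flip_in_space unfolding moment_event_def by blast
qed

lemma D_flip:
  assumes "s \<in> {1..n}" "y \<in> space (sample_law n)"
  shows "D (y(s := - y s)) = D y"
  using moment_event_flip[OF assms] by (intro D_eqI) (auto simp: tyler_solution_flip)

lemma norm_D_flip:
  assumes "s \<in> {1..n}" "y \<in> space (sample_law n)"
  shows "(\<lambda>t. norm (D (y(s := - y s)) *v (y(s := - y s)) t)) = (\<lambda>t. norm (D y *v y t))"
  by (rule ext) (simp add: D_flip[OF assms] matrix_vector_mult_minus)

lemma R_flip:
  assumes "s \<in> {1..n}" "y \<in> space (sample_law n)"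
  shows "R (y(s := - y s)) = R y"
  unfolding R_def norm_D_flip[OF assms] by (rule refl)

lemma good_flip:
  assumes "s \<in> {1..n}" "y \<in> space (sample_law n)"
  shows "y(s := - y s) \<in> good \<longleftrightarrow> y \<in> good"
proof -
  have "avg n (ball_ind x) (y(s := - y s)) = avg n (ball_ind x) y" for x
    by (rule avg_flip) (simp add: ball_ind_def)
  then show ?thesis
    unfolding good_def mem_Collect_eq norm_D_flip[OF assms] moment_event_flip[OF assms] by simp
qed

lemma moment_event_swap:
  assumes "s \<in> {1..n}" "s' \<in> {1..n}" "y \<in> space (sample_law n)"
  shows "swap n s s' y \<in> moment_event n \<eta> \<longleftrightarrow> y \<in> moment_event n \<eta>"
proof -
  have "moments_close n (swap n s s' y) \<eta> \<longleftrightarrow> moments_close n y \<eta>"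
    unfolding moments_close_def avg_swap[OF assms(1,2)] by (rule refl)
  moreover have "(\<forall>t\<in>{1..n}. swap n s s' y t \<noteq> 0) \<longleftrightarrow> (\<forall>t\<in>{1..n}. y t \<noteq> 0)"
  proof -
    have "(\<forall>t\<in>{1..n}. swap n s s' y t \<noteq> 0) \<longleftrightarrow>
        (\<forall>r\<in>Transposition.transpose s s' ` {1..n}. y r \<noteq> 0)"
      by (simp add: swap_def)
    then show ?thesis unfolding permutes_image[OF permutes_swap_id[OF assms(1,2)]] .
  qed
  ultimately show ?thesis using assms swap_in_space unfolding moment_event_def by blast
qed

lemma D_swap:
  assumes "s \<in> {1..n}" "s' \<in> {1..n}" "y \<in> space (sample_law n)"
  shows "D (swap n s s' y) = D y"
  using moment_event_swap[OF assms] assms by (intro D_eqI) (auto simp: tyler_solution_swap)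

lemma R_swap:
  assumes "s \<in> {1..n}" "s' \<in> {1..n}" "y \<in> space (sample_law n)" "t \<in> {1..n}"
  shows "R (swap n s s' y) t = R y (Transposition.transpose s s' t)"
proof -
  let ?\<tau> = "Transposition.transpose s s'"
  have sw: "swap n s s' y r = y (?\<tau> r)" if "r \<in> {1..n}" for r using that by (simp add: swap_def)
  have "R (swap n s s' y) t = card {r \<in> {1..n}. norm (D y *v y (?\<tau> r)) \<le> norm (D y *v y (?\<tau> t))}"
    unfolding R_def rank_among_def D_swap[OF assms(1-3)]
    using sw assms(4) by (intro arg_cong[where f = card]) auto
  also have "\<dots> = card (?\<tau> ` {r \<in> {1..n}. norm (D y *v y r) \<le> norm (D y *v y (?\<tau> t))})"
  proof (rule arg_cong[where f = card], intro equalityI subsetI)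
    fix r assume r: "r \<in> {r \<in> {1..n}. norm (D y *v y (?\<tau> r)) \<le> norm (D y *v y (?\<tau> t))}"
    show "r \<in> ?\<tau> ` {r \<in> {1..n}. norm (D y *v y r) \<le> norm (D y *v y (?\<tau> t))}"
    proof (rule image_eqI)
      show "r = ?\<tau> (?\<tau> r)" by simp
      show "?\<tau> r \<in> {r \<in> {1..n}. norm (D y *v y r) \<le> norm (D y *v y (?\<tau> t))}"
        using r transpose_in[OF assms(1,2), of r] by blast
    qed
  next
    fix r assume "r \<in> ?\<tau> ` {r \<in> {1..n}. norm (D y *v y r) \<le> norm (D y *v y (?\<tau> t))}"
    then obtain r' where r': "r = ?\<tau> r'" "r' \<in> {1..n}" "norm (D y *v y r') \<le> norm (D y *v y (?\<tau> t))" by blast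
    then have "?\<tau> r = r'" by simp
    then show "r \<in> {r \<in> {1..n}. norm (D y *v y (?\<tau> r)) \<le> norm (D y *v y (?\<tau> t))}"
      using r' transpose_in[OF assms(1,2) r'(2)] by (metis (mono_tags, lifting) mem_Collect_eq)
  qed
  also have "\<dots> = R y (?\<tau> t)"
    unfolding R_def rank_among_def by (rule card_image) (rule inj_on_subset[OF inj_transpose], simp)
  finally show ?thesis .
qed

lemma good_swap:
  assumes "s \<in> {1..n}" "s' \<in> {1..n}" "y \<in> space (sample_law n)"
  shows "swap n s s' y \<in> good \<longleftrightarrow> y \<in> good"
proof -
  let ?\<tau> = "Transposition.transpose s s'"
  have "inj_on (\<lambda>t. norm (D y *v swap n s s' y t)) {1..n} \<longleftrightarrow> inj_on (\<lambda>t. norm (D y *v y t)) {1..n}"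
  proof -
    have "inj_on (\<lambda>t. norm (D y *v swap n s s' y t)) {1..n} \<longleftrightarrow>
        inj_on ((\<lambda>t. norm (D y *v y t)) \<circ> ?\<tau>) {1..n}"
      by (rule inj_on_cong) (simp add: swap_def)
    also have "\<dots> \<longleftrightarrow> inj_on (\<lambda>t. norm (D y *v y t)) (?\<tau> ` {1..n})"
      by (rule comp_inj_on_iff[symmetric]) (rule inj_on_subset[OF inj_transpose], simp)
    also have "?\<tau> ` {1..n} = {1..n}"
      by (rule permutes_image[OF permutes_swap_id[OF assms(1,2)]])
    finally show ?thesis .
  qed
  then show ?thesis
    unfolding good_def mem_Collect_eq D_swap[OF assms] moment_event_swap[OF assms] avg_swap[OF assms(1,2)] by simp
qed

lemma measurable_D_vec [measurable]:
  assumes "s \<in> {1..n}"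
  shows "(\<lambda>y. D y *v y s) \<in> borel_measurable (sample_law n)"
proof (rule borel_measurable_continuous_Pair[OF measurable_D measurable_coordinate[OF assms]])
  show "continuous_on UNIV (\<lambda>x :: (real^'k::{finite,wellorder}^'k::{finite,wellorder}) \<times> (real^'k::{finite,wellorder}). fst x *v snd x)"
    unfolding matrix_vector_mult_def by (intro continuous_intros)
qed

lemma sets_good [measurable]: "good \<in> sets (sample_law n)"
proof -
  define far where "far x = {y \<in> space (sample_law n). \<eta> < \<bar>avg n (ball_ind x) y - (\<integral>y. ball_ind x y \<partial>N)\<bar>}" for x
  define tie where "tie s s' = {y \<in> space (sample_law n). norm (D y *v y s) = norm (D y *v y s')}" for s s'
  have "far x \<in> sets (sample_law n)" for x unfolding far_def by measurable
  moreover have "tie s s' \<in> sets (sample_law n)" if "s \<in> {1..n}" "s' \<in> {1..n}" for s s'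
    unfolding tie_def using that by measurable
  ultimately have "moment_event n \<eta> - ((\<Union>x\<in>X. far x) \<union> (\<Union>s\<in>{1..n}. \<Union>s'\<in>{1..n} - {s}. tie s s')) \<in> sets (sample_law n)"
    using finite_X by (intro sets.Diff sets.Un sets.finite_UN sets_moment_event) auto
  also have "moment_event n \<eta> - ((\<Union>x\<in>X. far x) \<union> (\<Union>s\<in>{1..n}. \<Union>s'\<in>{1..n} - {s}. tie s s')) = good"
    unfolding good_def inj_on_def moment_event_def far_def tie_def by (auto simp: not_less)
  finally show ?thesis .
qed

lemma measurable_R [measurable]:
  assumes t: "t \<in> {1..n}"
  shows "(\<lambda>y. R y t) \<in> measurable (sample_law n) (count_space UNIV)"
proof -
  have eq: "real (R y t) = (\<Sum>s=1..n. if norm (D y *v y s) \<le> norm (D y *v y t) then 1 else 0)" for y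
    unfolding R_def rank_among_def by (simp add: sum.If_cases Int_def)
  have m: "(\<lambda>y. real (R y t)) \<in> borel_measurable (sample_law n)"
    unfolding eq using t by measurable
  show ?thesis
    unfolding measurable_count_space_eq2_countable
  proof (intro conjI ballI)
    fix r :: nat
    have "(\<lambda>y. R y t) -` {r} \<inter> space (sample_law n) = {y \<in> space (sample_law n). real (R y t) = real r}" by auto
    also have "\<dots> \<in> sets (sample_law n)" using m by measurable
    finally show "(\<lambda>y. R y t) -` {r} \<inter> space (sample_law n) \<in> sets (sample_law n)" .
  qed simp
qed

text \<open>Rescaling an observation does not change Tyler's matrix, which depends on signs only, but it does
  change the norm of that observation. So a tie occurs at one point of each ray at most.\<close>

lemma ties_null:
  assumes s: "s \<in> {1..n}" "s' \<in> {1..n}" "s \<noteq> s'"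
  shows "{y \<in> moment_event n \<eta>. norm (D y *v y s) = norm (D y *v y s')} \<in> null_sets (sample_law n)"
    (is "?T \<in> _")
proof (rule null_of_rays[OF s(1)])
  have "?T = moment_event n \<eta> \<inter> {y \<in> space (sample_law n). norm (D y *v y s) = norm (D y *v y s')}"
    by (auto simp: moment_event_def)
  also have "\<dots> \<in> sets (sample_law n)" using s by measurable
  finally show "?T \<in> sets (sample_law n)" .
  fix y :: "nat \<Rightarrow> real^'k::{finite,wellorder}" and x and c :: real
  assume x: "y(s := x) \<in> ?T" and cx: "y(s := c *\<^sub>R x) \<in> ?T" and "0 \<le> c"
  have "(y(s := c *\<^sub>R x)) s \<noteq> 0" "(y(s := x)) s \<noteq> 0"
    using x cx s(1) unfolding moment_event_def by blast+
  then have c: "0 < c" "x \<noteq> 0" using \<open>0 \<le> c\<close> by auto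
  have "D (y(s := c *\<^sub>R x)) = D (y(s := x))"
    using x cx c by (intro D_eqI) (auto simp: tyler_solution_scale)
  then have "c * norm (D (y(s := x)) *v x) = norm (D (y(s := x)) *v x)"
    using x cx s(3) c by (simp add: matrix_vector_mult_scaleR)
  then show "c = 1" using D_nonzero[OF c(2)] by simp
qed

lemma good_complement:
  "measure (sample_law n) (space (sample_law n) - good) \<le>
    (\<Sum>\<phi>\<in>range sign_product \<union> range (\<lambda>(p, q) y. sign_product p y * sign_product q y) \<union> ball_ind ` X.
      measure (sample_law n) {y\<in>space (sample_law n). \<eta> < \<bar>avg n \<phi> y - (\<integral>x. \<phi> x \<partial>N)\<bar>})"
  (is "_ \<le> (\<Sum>\<phi>\<in>?\<Phi>. measure _ (?B \<phi>))")
proof -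
  interpret P: prob_space "sample_law n" by (rule prob_space_sample)
  have fin: "finite ?\<Phi>" using finite_X by simp
  have m\<Phi>: "\<phi> \<in> borel_measurable borel" if "\<phi> \<in> ?\<Phi>" for \<phi> using that by auto
  have mB: "?B \<phi> \<in> sets (sample_law n)" if "\<phi> \<in> ?\<Phi>" for \<phi>
  proof -
    note [measurable] = m\<Phi>[OF that]
    show ?thesis by measurable
  qed
  define T where "T = (\<Union>(s, s')\<in>{(s, s'). s \<in> {1..n} \<and> s' \<in> {1..n} \<and> s \<noteq> s'}.
    {y \<in> moment_event n \<eta>. norm (D y *v y s) = norm (D y *v y s')})"
  have finp: "finite {(s, s'). s \<in> {1..n} \<and> s' \<in> {1..n} \<and> s \<noteq> s'}"
    by (rule finite_subset[of _ "{1..n} \<times> {1..n}"]) auto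
  have T: "T \<in> null_sets (sample_law n)"
    unfolding T_def using ties_null finp by (intro null_sets_UN' countable_finite) auto
  define Z where "Z = (\<Union>t\<in>{1..n}. {y \<in> space (sample_law n). y t = 0})"
  have Z: "Z \<in> null_sets (sample_law n)"
    unfolding Z_def
  proof (intro null_sets_UN' countable_finite finite_atLeastAtMost)
    fix t assume t: "t \<in> {1..n}"
    have "{0 :: real^'k::{finite,wellorder}} \<in> null_sets lborel"
      by (rule null_setsI) auto
    then have "emeasure N {0} = 0" using abs_cont by blast
    then have "emeasure (distr (sample_law n) borel (\<lambda>y. y t)) {0} = 0"
      by (simp only: distr_coordinate[OF t])
    then have "emeasure (sample_law n) ((\<lambda>y. y t) -` {0} \<inter> space (sample_law n)) = 0"
      using t by (subst (asm) emeasure_distr) auto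
    moreover have "(\<lambda>y. y t) -` {0} \<inter> space (sample_law n) = {y \<in> space (sample_law n). y t = 0}" by auto
    moreover have "{y \<in> space (sample_law n). y t = 0} \<in> sets (sample_law n)" using t by measurable
    ultimately show "{y \<in> space (sample_law n). y t = 0} \<in> null_sets (sample_law n)" by auto
  qed
  have "space (sample_law n) - good \<subseteq> (\<Union>\<phi>\<in>?\<Phi>. ?B \<phi>) \<union> (T \<union> Z)"
  proof
    fix y assume y: "y \<in> space (sample_law n) - good"
    show "y \<in> (\<Union>\<phi>\<in>?\<Phi>. ?B \<phi>) \<union> (T \<union> Z)"
    proof (rule ccontr)
      assume not: "y \<notin> (\<Union>\<phi>\<in>?\<Phi>. ?B \<phi>) \<union> (T \<union> Z)"
      then have close: "\<bar>avg n \<phi> y - (\<integral>x. \<phi> x \<partial>N)\<bar> \<le> \<eta>" if "\<phi> \<in> ?\<Phi>" for \<phi>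
        using that y by (force simp: not_less)
      have "moments_close n y \<eta>"
        unfolding moments_close_def
      proof (intro conjI allI)
        fix p q
        show "\<bar>avg n (sign_product p) y - (\<integral>y. sign_product p y \<partial>N)\<bar> \<le> \<eta>" by (rule close) blast
        show "\<bar>avg n (\<lambda>y. sign_product p y * sign_product q y) y - (\<integral>y. sign_product p y * sign_product q y \<partial>N)\<bar> \<le> \<eta>"
          by (rule close) (auto intro!: image_eqI[of _ _ "(p, q)"])
      qed
      then have me: "y \<in> moment_event n \<eta>" using y not by (auto simp: moment_event_def Z_def)
      moreover have "inj_on (\<lambda>s. norm (D y *v y s)) {1..n}"
      proof (rule inj_onI, rule ccontr)
        fix s s' assume "s \<in> {1..n}" "s' \<in> {1..n}" "norm (D y *v y s) = norm (D y *v y s')" "s \<noteq> s'"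
        then have "y \<in> T" unfolding T_def using me by blast
        then show False using not by simp
      qed
      moreover have "\<forall>x\<in>X. \<bar>avg n (ball_ind x) y - (\<integral>y. ball_ind x y \<partial>N)\<bar> \<le> \<eta>"
        using close by blast
      ultimately show False using y by (simp add: good_def)
    qed
  qed
  then have "measure (sample_law n) (space (sample_law n) - good) \<le> measure (sample_law n) ((\<Union>\<phi>\<in>?\<Phi>. ?B \<phi>) \<union> (T \<union> Z))"
    using mB fin T Z by (intro P.finite_measure_mono sets.Un sets.finite_UN) auto
  also have "\<dots> = measure (sample_law n) (\<Union>\<phi>\<in>?\<Phi>. ?B \<phi>)"
    using mB fin T Z by (intro measure_Un_null_set sets.finite_UN null_sets.Un) auto
  also have "\<dots> \<le> (\<Sum>\<phi>\<in>?\<Phi>. measure (sample_law n) (?B \<phi>))"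
    using mB fin by (intro measure_UNION_le) auto
  finally show ?thesis .
qed

end

section \<open>Mean square approximation of the summands\<close>

lemma abs_mult_diff_le:
  fixes p q r s :: real
  assumes "\<bar>q\<bar> \<le> 1" "\<bar>r\<bar> \<le> 1" "\<bar>p - r\<bar> \<le> e" "\<bar>q - s\<bar> \<le> e"
  shows "\<bar>p * q - r * s\<bar> \<le> 2 * e"
proof -
  have "p * q - r * s = (p - r) * q + r * (q - s)" by (simp add: algebra_simps)
  also have "\<bar>\<dots>\<bar> \<le> \<bar>p - r\<bar> * \<bar>q\<bar> + \<bar>r\<bar> * \<bar>q - s\<bar>"
    using abs_triangle_ineq[of "(p - r) * q" "r * (q - s)"] by (simp add: abs_mult)
  also have "\<dots> \<le> e * 1 + 1 * e" using assms by (intro add_mono mult_mono) auto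
  finally show ?thesis by simp
qed

lemma norm_sgn_diff_le:
  fixes C :: "real^'n^'n"
  assumes C: "norm (C - mat 1) \<le> e" and y: "y \<noteq> 0"
  shows "norm (sgn (C *v y) - sgn y) \<le> 2 * e"
proof -
  define u where "u = sgn y"
  have u: "norm u = 1" using y by (simp add: u_def norm_sgn)
  have near: "norm (C *v u - u) \<le> e" using norm_near_identity(3)[OF C, of u] u by simp
  have "norm (sgn v - v) \<le> \<bar>norm v - 1\<bar>" for v :: "real^'n"
  proof (cases "v = 0")
    case False
    have "sgn v - v = (1 / norm v - 1) *\<^sub>R v" by (simp add: sgn_div_norm divide_inverse algebra_simps)
    then have "norm (sgn v - v) = \<bar>(1 / norm v - 1) * norm v\<bar>" by (simp add: abs_mult)
    also have "\<dots> = \<bar>1 - norm v\<bar>" using False by (simp add: left_diff_distrib)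
    finally show ?thesis by simp
  qed simp
  from this[of "C *v u"] have "norm (sgn (C *v u) - C *v u) \<le> \<bar>norm (C *v u) - 1\<bar>" .
  also have "\<dots> \<le> norm (C *v u - u)" using norm_triangle_ineq3[of "C *v u" u] u by simp
  finally have "norm (sgn (C *v u) - C *v u) \<le> e" using near by simp
  then have "norm (sgn (C *v u) - u) \<le> e + e"
    using norm_triangle_ineq[of "sgn (C *v u) - C *v u" "C *v u - u"] near by simp
  then show ?thesis unfolding u_def sgn_matrix_vector_sgn by simp
qed

context good_sample
begin

definition radial_score :: "(nat \<Rightarrow> real^'k::{finite,wellorder}) \<Rightarrow> nat \<Rightarrow> real" where
  "radial_score y t = radial_F (norm (y t))"

definition rank_score :: "(nat \<Rightarrow> real^'k::{finite,wellorder}) \<Rightarrow> nat \<Rightarrow> real" where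
  "rank_score y t = real (R y t) / (real n + 1)"

lemma measurable_function_of_rank [measurable]:
  "t \<in> {1..n} \<Longrightarrow> (\<lambda>y. g (R y t)) \<in> borel_measurable (sample_law n)"
  by (rule measurable_compose[OF measurable_R]) auto

lemma measurable_rank_score [measurable]:
  "t \<in> {1..n} \<Longrightarrow> (\<lambda>y. p (rank_score y t)) \<in> borel_measurable (sample_law n)"
  unfolding rank_score_def by (rule measurable_function_of_rank)

lemma measurable_radial_score [measurable]:
  assumes "t \<in> {1..n}" "p \<in> borel_measurable borel"
  shows "(\<lambda>y. p (radial_score y t)) \<in> borel_measurable (sample_law n)"
proof -
  have "(\<lambda>y. radial_F (norm (y t))) \<in> borel_measurable (sample_law n)"
    using measurable_coordinate[OF assms(1)] by measurable
  then show ?thesis unfolding radial_score_def by (rule measurable_compose[OF _ assms(2)])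
qed

lemma sum_over_ranks:
  assumes "y \<in> good"
  shows "(\<Sum>t=1..n. g (R y t)) = (\<Sum>r=1..n. g r)"
  unfolding R_def
  using assms by (intro sum.reindex_bij_betw rank_among_bij) (simp add: good_def)

text \<open>The sample is exchangeable and so is the good event. Hence the mean over two ranks is the
  average over all pairs of observations, for which the ranks run through all values once.\<close>

lemma exchange_bound:
  fixes g h :: "nat \<Rightarrow> ennreal"
  assumes t: "t \<in> {1..n}" "t' \<in> {1..n}" "t \<noteq> t'"
  shows "of_nat (n * (n - 1)) * (\<integral>\<^sup>+ y. indicator good y * (g (R y t) * h (R y t')) \<partial>sample_law n) \<le>
    (\<Sum>r=1..n. g r) * (\<Sum>r=1..n. h r)"
proof -
  interpret P: prob_space "sample_law n" by (rule prob_space_sample)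
  define J where "J t t' = (\<integral>\<^sup>+ y. indicator good y * (g (R y t) * h (R y t')) \<partial>sample_law n)" for t t'
  have meas: "(\<lambda>y. indicator good y * (g (R y t) * h (R y t'))) \<in> borel_measurable (sample_law n)"
    if "t \<in> {1..n}" "t' \<in> {1..n}" for t t'
    using that by (intro borel_measurable_times_ennreal borel_measurable_indicator sets_good measurable_function_of_rank)
  have J_swap: "J (Transposition.transpose s s' t) (Transposition.transpose s s' t') = J t t'"
    if s: "s \<in> {1..n}" "s' \<in> {1..n}" and t: "t \<in> {1..n}" "t' \<in> {1..n}" for s s' t t'
  proof -
    have "J t t' = (\<integral>\<^sup>+ y. indicator good y * (g (R y t) * h (R y t')) \<partial>distr (sample_law n) (sample_law n) (swap n s s'))"
      unfolding J_def by (simp only: distr_swap[OF s])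
    also have "\<dots> = (\<integral>\<^sup>+ y. indicator good (swap n s s' y) *
        (g (R (swap n s s' y) t) * h (R (swap n s s' y) t')) \<partial>sample_law n)"
      by (intro nn_integral_distr measurable_swap s) (simp add: meas[OF t] measurable_distr_eq1)
    also have "\<dots> = J (Transposition.transpose s s' t) (Transposition.transpose s s' t')"
      unfolding J_def
      by (intro nn_integral_cong) (simp only: R_swap[OF s _ t(1)] R_swap[OF s _ t(2)] indicator_def good_swap[OF s])
    finally show ?thesis by simp
  qed
  have J_const: "J u u' = J t t'" if u: "u \<in> {1..n}" "u' \<in> {1..n}" "u \<noteq> u'" for u u'
  proof -
    define v where "v = Transposition.transpose t u t'"
    \<comment> \<open>Two transpositions carry \<open>(t, t')\<close> to \<open>(u, u')\<close>: the first moves \<open>t\<close> to \<open>u\<close> and \<open>t'\<close> to some \<open>v\<close>, the second moves \<open>v\<close> to \<open>u'\<close>.\<close>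
    have v: "v \<in> {1..n}" unfolding v_def by (rule transpose_in[OF t(1) u(1) t(2)])
    have vu: "v \<noteq> u" unfolding v_def using t(3) by (metis transpose_apply_first transpose_involutory)
    have "J t t' = J (Transposition.transpose t u t) (Transposition.transpose t u t')"
      by (rule J_swap[OF t(1) u(1) t(1,2), symmetric])
    also have "\<dots> = J u v" by (simp add: v_def)
    also have "\<dots> = J (Transposition.transpose v u' u) (Transposition.transpose v u' v)"
      by (rule J_swap[OF v u(2) u(1) v, symmetric])
    also have "\<dots> = J u u'" using vu u(3) by simp
    finally show ?thesis by simp
  qed
  have "of_nat (n * (n - 1)) * J t t' = (\<Sum>u\<in>{1..n}. \<Sum>u'\<in>{1..n} - {u}. J t t')"
    by (simp add: mult.assoc)
  also have "\<dots> = (\<Sum>u\<in>{1..n}. \<Sum>u'\<in>{1..n} - {u}. J u u')"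
    by (intro sum.cong refl J_const[symmetric]) auto
  also have "\<dots> \<le> (\<Sum>u\<in>{1..n}. \<Sum>u'\<in>{1..n}. J u u')"
    by (intro sum_mono sum_mono2) auto
  also have "\<dots> = (\<integral>\<^sup>+ y. (\<Sum>u\<in>{1..n}. \<Sum>u'\<in>{1..n}. indicator good y * (g (R y u) * h (R y u'))) \<partial>sample_law n)"
  proof -
    have "(\<Sum>u\<in>{1..n}. \<Sum>u'\<in>{1..n}. J u u') =
        (\<Sum>u\<in>{1..n}. \<integral>\<^sup>+ y. (\<Sum>u'\<in>{1..n}. indicator good y * (g (R y u) * h (R y u'))) \<partial>sample_law n)"
      unfolding J_def by (intro sum.cong refl nn_integral_sum[symmetric] meas)
    also have "\<dots> = (\<integral>\<^sup>+ y. (\<Sum>u\<in>{1..n}. \<Sum>u'\<in>{1..n}. indicator good y * (g (R y u) * h (R y u'))) \<partial>sample_law n)"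
      by (intro nn_integral_sum[symmetric] borel_measurable_sum meas)
    finally show ?thesis .
  qed
  also have "\<dots> \<le> (\<integral>\<^sup>+ y. (\<Sum>r=1..n. g r) * (\<Sum>r=1..n. h r) \<partial>sample_law n)"
  proof (rule nn_integral_mono)
    fix y
    show "(\<Sum>u\<in>{1..n}. \<Sum>u'\<in>{1..n}. indicator good y * (g (R y u) * h (R y u'))) \<le>
        (\<Sum>r=1..n. g r) * (\<Sum>r=1..n. h r)"
    proof (cases "y \<in> good")
      case True
      then have "(\<Sum>u\<in>{1..n}. \<Sum>u'\<in>{1..n}. indicator good y * (g (R y u) * h (R y u'))) =
          (\<Sum>u\<in>{1..n}. g (R y u)) * (\<Sum>u'\<in>{1..n}. h (R y u'))"
        by (simp add: sum_product)
      then show ?thesis unfolding sum_over_ranks[OF True] by simp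
    qed simp
  qed
  also have "\<dots> = (\<Sum>r=1..n. g r) * (\<Sum>r=1..n. h r)" by (simp add: P.emeasure_space_1)
  finally show ?thesis unfolding J_def .
qed

text \<open>By exchangeability the mean is at most the product of the sums over the grid, divided by the number of
  pairs. The factor 2 bounds \<open>n / (n - 1)\<close>.\<close>

lemma rank_product_bound:
  assumes t: "t \<in> {1..n}" "t' \<in> {1..n}" "t \<noteq> t'"
    and p: "score_approx p (\<lambda>_. 0) a" and q: "score_approx q (\<lambda>_. 0) b" and nonneg: "0 \<le> a" "0 \<le> b"
  shows "(\<integral>\<^sup>+ y. indicator good y * ennreal ((p (rank_score y t) * q (rank_score y t'))\<^sup>2) \<partial>sample_law n)
    \<le> ennreal (2 * a * b)"
proof -
  define g where "g r = ennreal ((p (real r / (real n + 1)))\<^sup>2)" for r :: nat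
  define h where "h r = ennreal ((q (real r / (real n + 1)))\<^sup>2)" for r :: nat
  define J where "J = (\<integral>\<^sup>+ y. indicator good y * ennreal ((p (rank_score y t) * q (rank_score y t'))\<^sup>2) \<partial>sample_law n)"
  have J: "J = (\<integral>\<^sup>+ y. indicator good y * (g (R y t) * h (R y t')) \<partial>sample_law n)"
    unfolding J_def g_def h_def rank_score_def by (simp add: power_mult_distrib ennreal_mult)
  have n2: "2 \<le> n" using t by auto
  have "(\<Sum>r=1..n. (p (real r / (real n + 1)) - 0)\<^sup>2) \<le> a * real n"
    "(\<Sum>r=1..n. (q (real r / (real n + 1)) - 0)\<^sup>2) \<le> b * real n"
    using p q n by (simp_all only: score_approx_def)
  then have gh: "(\<Sum>r=1..n. g r) \<le> ennreal (a * real n)" "(\<Sum>r=1..n. h r) \<le> ennreal (b * real n)"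
    unfolding g_def h_def by (simp_all add: sum_ennreal ennreal_leI)
  have "of_nat (n * (n - 1)) * J \<le> (\<Sum>r=1..n. g r) * (\<Sum>r=1..n. h r)"
    unfolding J by (rule exchange_bound[OF t])
  also have "\<dots> \<le> ennreal (a * real n) * ennreal (b * real n)" by (intro mult_mono gh) auto
  also have "\<dots> = ennreal ((a * real n) * (b * real n))" using nonneg by (simp add: ennreal_mult)
  finally have le: "ennreal (real (n * (n - 1))) * J \<le> ennreal ((a * real n) * (b * real n))"
    by (simp add: ennreal_of_nat_eq_real_of_nat)
  have pos: "0 < real (n * (n - 1))" using n2 by simp
  show ?thesis unfolding J_def[symmetric]
  proof (cases J rule: ennreal_cases)
    case (real j)
    have "real (n * (n - 1)) * j \<le> (a * real n) * (b * real n)"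
      using le nonneg unfolding real(2) by (simp add: ennreal_mult[symmetric] real(1) del: of_nat_mult)
    then have "(real n - 1) * j \<le> a * b * real n"
      using n2 by (simp add: of_nat_diff mult_ac)
    moreover have "a * b * real n \<le> a * b * (2 * (real n - 1))" using nonneg n2 by (intro mult_left_mono) auto
    ultimately have "(real n - 1) * j \<le> (real n - 1) * (2 * a * b)" by (simp add: algebra_simps)
    then have "j \<le> 2 * a * b" using n2 by (simp add: mult_le_cancel_left)
    then show "J \<le> ennreal (2 * a * b)" unfolding real(2) by (rule ennreal_leI)
  next
    case top
    then show "J \<le> ennreal (2 * a * b)" using le pos by (simp add: ennreal_mult_top top_unique del: of_nat_mult)
  qed
qed

lemma radial_product_bound:
  assumes t: "t \<in> {1..n}" "t' \<in> {1..n}" "t \<noteq> t'"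
    and m [measurable]: "p \<in> borel_measurable borel" "q \<in> borel_measurable borel"
    and p: "score_approx p (\<lambda>_. 0) a" and q: "score_approx q (\<lambda>_. 0) b" and nonneg: "0 \<le> a" "0 \<le> b"
  shows "(\<integral>\<^sup>+ y. ennreal ((p (radial_score y t) * q (radial_score y t'))\<^sup>2) \<partial>sample_law n) \<le> ennreal (a * b)"
proof -
  have "(\<integral>\<^sup>+ y. ennreal ((p (radial_score y t) * q (radial_score y t'))\<^sup>2) \<partial>sample_law n) =
      (\<integral>\<^sup>+ y. ennreal ((p (radial_F (norm (y t))))\<^sup>2) * ennreal ((q (radial_F (norm (y t'))))\<^sup>2) \<partial>sample_law n)"
    unfolding radial_score_def by (simp add: power_mult_distrib ennreal_mult)
  also have "\<dots> = (\<integral>\<^sup>+ x. ennreal ((p (radial_F (norm x)))\<^sup>2) \<partial>N) * (\<integral>\<^sup>+ x. ennreal ((q (radial_F (norm x)))\<^sup>2) \<partial>N)"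
    by (rule nn_integral_two_coordinates[OF t]) measurable
  also have "\<dots> = (\<integral>\<^sup>+ u. ennreal ((p u)\<^sup>2) * indicator {0<..<1} u \<partial>lborel) *
      (\<integral>\<^sup>+ u. ennreal ((q u)\<^sup>2) * indicator {0<..<1} u \<partial>lborel)"
    using nn_integral_radial_F[of "\<lambda>u. ennreal ((p u)\<^sup>2)"] nn_integral_radial_F[of "\<lambda>u. ennreal ((q u)\<^sup>2)"]
    by simp
  also have "\<dots> \<le> ennreal a * ennreal b"
    using p q by (intro mult_mono) (auto simp: score_approx_def)
  finally show ?thesis using nonneg by (simp add: ennreal_mult)
qed

lemma score_approx_diff: "score_approx K J \<kappa> \<Longrightarrow> score_approx (\<lambda>u. K u - J u) (\<lambda>_. 0) \<kappa>"
  by (simp add: score_approx_def)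

text \<open>An entry of the difference of two corresponding summands of the rank based and the population
  cross-covariance, before conjugation by Tyler's matrix.\<close>

definition summand_gap ::
    "(real \<Rightarrow> real) \<Rightarrow> (real \<Rightarrow> real) \<Rightarrow> nat \<Rightarrow> 'k \<Rightarrow> 'k \<Rightarrow> nat \<Rightarrow> (nat \<Rightarrow> real^'k::{finite,wellorder}) \<Rightarrow> real" where
  "summand_gap K1 K2 i a b t y = indicator good y *
     (K1 (rank_score y t) * K2 (rank_score y (t - i)) * (sgn (D y *v y t) $ a * sgn (D y *v y (t - i)) $ b) -
      K1 (radial_score y t) * K2 (radial_score y (t - i)) * (sgn (y t) $ a * sgn (y (t - i)) $ b))"

text \<open>Signs change by at most \<open>2 \<delta>\<close>. For the scores, replace \<open>K1, K2\<close> by the uniformly continuous \<open>J1, J2\<close>,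
  one factor at a time, both at the ranks and at the radial distribution function. The replacement errors
  are small in mean square, and the remaining difference is small pointwise.\<close>

lemma summand_gap_mean_square:
  assumes t: "t \<in> {1..n}" "t - i \<in> {1..n}" "1 \<le> i" "i < t"
    and [measurable]: "K1 \<in> borel_measurable borel" "K2 \<in> borel_measurable borel"
      "J1 \<in> borel_measurable borel" "J2 \<in> borel_measurable borel"
    and A: "score_approx K1 (\<lambda>_. 0) A1" "score_approx K2 (\<lambda>_. 0) A2" "score_approx J1 (\<lambda>_. 0) B1"
      "0 \<le> A1" "0 \<le> A2" "0 \<le> B1"
    and \<kappa>: "score_approx K1 J1 \<kappa>" "score_approx K2 J2 \<kappa>" "0 \<le> \<kappa>"
    and \<gamma>: "\<And>u u' v v'. \<bar>u - v\<bar> \<le> 2 * \<zeta> + 1 / real n \<Longrightarrow> \<bar>u' - v'\<bar> \<le> 2 * \<zeta> + 1 / real n \<Longrightarrow>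
      \<bar>J1 u * J2 u' - J1 v * J2 v'\<bar> \<le> \<gamma>"
  shows "(\<integral>\<^sup>+ y. ennreal ((summand_gap K1 K2 i a b t y)\<^sup>2) \<partial>sample_law n) \<le>
    ennreal (64 * \<delta>\<^sup>2 * A1 * A2 + 36 * \<kappa> * (A2 + B1) + 6 * \<gamma>\<^sup>2)"
proof -
  interpret P: prob_space "sample_law n" by (rule prob_space_sample)
  let ?t' = "t - i"
  have tt: "t \<noteq> ?t'" using t by auto
  define d1 where "d1 u = K1 u - J1 u" for u
  define d2 where "d2 u = K2 u - J2 u" for u
  have [measurable]: "d1 \<in> borel_measurable borel" "d2 \<in> borel_measurable borel"
    unfolding d1_def[abs_def] d2_def[abs_def] by measurable
  have dk: "score_approx d1 (\<lambda>_. 0) \<kappa>" "score_approx d2 (\<lambda>_. 0) \<kappa>"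
    unfolding d1_def[abs_def] d2_def[abs_def] using \<kappa> by (auto intro: score_approx_diff)
  define FR where "FR p q y = indicator good y * ennreal ((p (rank_score y t) * q (rank_score y ?t'))\<^sup>2)" for p q y
  define FV where "FV p q y = ennreal ((p (radial_score y t) * q (radial_score y ?t'))\<^sup>2)" for p q y
  have mR [measurable]: "FR p q \<in> borel_measurable (sample_law n)" for p q
  proof -
    have "(\<lambda>y. (p (rank_score y t) * q (rank_score y ?t'))\<^sup>2) \<in> borel_measurable (sample_law n)"
      using measurable_rank_score[OF t(1), of p] measurable_rank_score[OF t(2), of q] by measurable
    then show ?thesis unfolding FR_def[abs_def] by measurable
  qed
  have mV: "FV p q \<in> borel_measurable (sample_law n)"
    if "p \<in> borel_measurable borel" "q \<in> borel_measurable borel" for p q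
  proof -
    have "(\<lambda>y. (p (radial_score y t) * q (radial_score y ?t'))\<^sup>2) \<in> borel_measurable (sample_law n)"
      using measurable_radial_score[OF t(1) that(1)] measurable_radial_score[OF t(2) that(2)] by measurable
    then show ?thesis unfolding FV_def[abs_def] by measurable
  qed
  note [measurable] = mV[of d1 K2] mV[of J1 d2]
  have pointwise: "ennreal ((summand_gap K1 K2 i a b t y)\<^sup>2) \<le>
      ennreal (32 * \<delta>\<^sup>2) * FR K1 K2 y + ennreal 12 * FR d1 K2 y + ennreal 12 * FR J1 d2 y +
      ennreal 12 * FV d1 K2 y + ennreal 12 * FV J1 d2 y + ennreal (6 * \<gamma>\<^sup>2)" for y
  proof (cases "y \<in> good")
    case True
    then have me: "y \<in> moment_event n \<eta>" by (simp add: good_def)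
    define r where "r = rank_score y t" define r' where "r' = rank_score y ?t'"
    define v where "v = radial_score y t" define v' where "v' = radial_score y ?t'"
    define w where "w = sgn (D y *v y t) $ a * sgn (D y *v y ?t') $ b"
    define u where "u = sgn (y t) $ a * sgn (y ?t') $ b"
    have "radially_close n y \<zeta>" using True by (intro quantiles) (simp add: good_def)
    then have rv: "\<bar>r - v\<bar> \<le> 2 * \<zeta> + 1 / real n" "\<bar>r' - v'\<bar> \<le> 2 * \<zeta> + 1 / real n"
      unfolding r_def r'_def v_def v'_def rank_score_def radial_score_def R_def
      using n \<delta> dilation by (auto intro!: rank_close D_near)
    have nz: "y t \<noteq> 0" "y ?t' \<noteq> 0" using me t by (auto simp: moment_event_def)
    have "\<bar>sgn (D y *v x) $ c - sgn x $ c\<bar> \<le> 2 * \<delta>" if "x \<noteq> 0" for x c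
      using component_le_norm_cart[of "sgn (D y *v x) - sgn x" c] norm_sgn_diff_le[OF D_near that, of y] by simp
    then have wu: "\<bar>w - u\<bar> \<le> 4 * \<delta>"
      unfolding w_def u_def
      using abs_mult_diff_le[of "sgn (D y *v y ?t') $ b" "sgn (y t) $ a" "sgn (D y *v y t) $ a" "2 * \<delta>" "sgn (y ?t') $ b"]
        nz by (simp add: abs_sgn_nth_le)
    have u1: "\<bar>u\<bar> \<le> 1" unfolding u_def abs_mult by (intro mult_le_one abs_sgn_nth_le) auto
    define e0 where "e0 = K1 r * K2 r'"
    define e1 where "e1 = d1 r * K2 r'" define e2 where "e2 = J1 r * d2 r'"
    define e3 where "e3 = J1 r * J2 r' - J1 v * J2 v'"
    define e4 where "e4 = d1 v * K2 v'" define e5 where "e5 = J1 v * d2 v'"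
    \<comment> \<open>Both factors are replaced in turn, at the ranks in \<open>e1, e2\<close> and at the radial scores in \<open>e4, e5\<close>.\<close>
    have dec: "K1 r * K2 r' - K1 v * K2 v' = e1 + e2 + e3 - e4 - e5"
      by (simp add: e1_def e2_def e3_def e4_def e5_def d1_def d2_def algebra_simps)
    have e3: "e3\<^sup>2 \<le> \<gamma>\<^sup>2"
    proof -
      have "\<bar>e3\<bar> \<le> \<gamma>" unfolding e3_def by (rule \<gamma>[OF rv])
      then show ?thesis by (metis abs_ge_zero power2_abs power_mono)
    qed
    have "(summand_gap K1 K2 i a b t y)\<^sup>2 = (e0 * (w - u) + (e1 + e2 + e3 - e4 - e5) * u)\<^sup>2"
      using True unfolding dec[symmetric] summand_gap_def e0_def w_def u_def r_def r'_def v_def v'_def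
      by (simp add: algebra_simps)
    also have "\<dots> \<le> 2 * (e0 * (w - u))\<^sup>2 + 2 * ((e1 + e2 + e3 - e4 - e5) * u)\<^sup>2" by (rule sq_add_le)
    also have "\<dots> \<le> 2 * (e0\<^sup>2 * (4 * \<delta>)\<^sup>2) + 2 * (e1 + e2 + e3 - e4 - e5)\<^sup>2"
    proof -
      have "(w - u)\<^sup>2 \<le> (4 * \<delta>)\<^sup>2" using wu \<delta> by (intro abs_le_square_iff[THEN iffD1]) simp
      then have "(e0 * (w - u))\<^sup>2 \<le> e0\<^sup>2 * (4 * \<delta>)\<^sup>2"
        unfolding power_mult_distrib[of e0] by (rule mult_left_mono) simp
      moreover have "u\<^sup>2 \<le> 1" using u1 by (simp add: abs_square_le_1)
      then have "((e1 + e2 + e3 - e4 - e5) * u)\<^sup>2 \<le> (e1 + e2 + e3 - e4 - e5)\<^sup>2 * 1"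
        unfolding power_mult_distrib by (intro mult_left_mono) auto
      ultimately show ?thesis by linarith
    qed
    also have "\<dots> \<le> 32 * \<delta>\<^sup>2 * e0\<^sup>2 + 12 * e1\<^sup>2 + 12 * e2\<^sup>2 + 12 * e4\<^sup>2 + 12 * e5\<^sup>2 + 6 * e3\<^sup>2"
    proof -
      have "(p + q + s)\<^sup>2 \<le> 3 * p\<^sup>2 + 3 * q\<^sup>2 + 3 * s\<^sup>2" for p q s :: real
        using zero_le_power2[of "p - q"] zero_le_power2[of "p - s"] zero_le_power2[of "q - s"]
        by (simp add: power2_eq_square algebra_simps)
      from this[of "e1 + e2" e3 "- e4 - e5"]
      have "(e1 + e2 + e3 - e4 - e5)\<^sup>2 \<le> 3 * (e1 + e2)\<^sup>2 + 3 * e3\<^sup>2 + 3 * (- e4 - e5)\<^sup>2"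
        by (simp add: algebra_simps)
      moreover have "(e1 + e2)\<^sup>2 \<le> 2 * e1\<^sup>2 + 2 * e2\<^sup>2" by (rule sq_add_le)
      moreover have "(- e4 - e5)\<^sup>2 \<le> 2 * e4\<^sup>2 + 2 * e5\<^sup>2" using sq_add_le[of "- e4" "- e5"] by simp
      ultimately show ?thesis by (simp add: power_mult_distrib)
    qed
    also have "\<dots> \<le> 32 * \<delta>\<^sup>2 * e0\<^sup>2 + 12 * e1\<^sup>2 + 12 * e2\<^sup>2 + 12 * e4\<^sup>2 + 12 * e5\<^sup>2 + 6 * \<gamma>\<^sup>2"
      using e3 by simp
    finally have "ennreal ((summand_gap K1 K2 i a b t y)\<^sup>2) \<le>
        ennreal (32 * \<delta>\<^sup>2 * e0\<^sup>2 + 12 * e1\<^sup>2 + 12 * e2\<^sup>2 + 12 * e4\<^sup>2 + 12 * e5\<^sup>2 + 6 * \<gamma>\<^sup>2)"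
      by (rule ennreal_leI)
    also have "\<dots> = ennreal (32 * \<delta>\<^sup>2) * ennreal (e0\<^sup>2) + ennreal 12 * ennreal (e1\<^sup>2) + ennreal 12 * ennreal (e2\<^sup>2) +
      ennreal 12 * ennreal (e4\<^sup>2) + ennreal 12 * ennreal (e5\<^sup>2) + ennreal (6 * \<gamma>\<^sup>2)"
      by (simp only: ennreal_plus ennreal_mult zero_le_power2 mult_nonneg_nonneg zero_le_numeral add_nonneg_nonneg)
    also have "\<dots> = ennreal (32 * \<delta>\<^sup>2) * FR K1 K2 y + ennreal 12 * FR d1 K2 y + ennreal 12 * FR J1 d2 y +
      ennreal 12 * FV d1 K2 y + ennreal 12 * FV J1 d2 y + ennreal (6 * \<gamma>\<^sup>2)"
      using True unfolding FR_def FV_def e0_def e1_def e2_def e4_def e5_def r_def r'_def v_def v'_def by simp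
    finally show ?thesis .
  qed (simp add: summand_gap_def)
  have "(\<integral>\<^sup>+ y. ennreal ((summand_gap K1 K2 i a b t y)\<^sup>2) \<partial>sample_law n) \<le>
      (\<integral>\<^sup>+ y. ennreal (32 * \<delta>\<^sup>2) * FR K1 K2 y + ennreal 12 * FR d1 K2 y + ennreal 12 * FR J1 d2 y +
      ennreal 12 * FV d1 K2 y + ennreal 12 * FV J1 d2 y + ennreal (6 * \<gamma>\<^sup>2) \<partial>sample_law n)"
    by (rule nn_integral_mono) (rule pointwise)
  also have "\<dots> = ennreal (32 * \<delta>\<^sup>2) * (\<integral>\<^sup>+ y. FR K1 K2 y \<partial>sample_law n) +
      ennreal 12 * (\<integral>\<^sup>+ y. FR d1 K2 y \<partial>sample_law n) + ennreal 12 * (\<integral>\<^sup>+ y. FR J1 d2 y \<partial>sample_law n) +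
      ennreal 12 * (\<integral>\<^sup>+ y. FV d1 K2 y \<partial>sample_law n) + ennreal 12 * (\<integral>\<^sup>+ y. FV J1 d2 y \<partial>sample_law n) +
      ennreal (6 * \<gamma>\<^sup>2)"
    by (simp add: nn_integral_add nn_integral_cmult P.emeasure_space_1)
  also have "\<dots> \<le> ennreal (32 * \<delta>\<^sup>2) * ennreal (2 * A1 * A2) +
      ennreal 12 * ennreal (2 * \<kappa> * A2) + ennreal 12 * ennreal (2 * B1 * \<kappa>) +
      ennreal 12 * ennreal (\<kappa> * A2) + ennreal 12 * ennreal (B1 * \<kappa>) + ennreal (6 * \<gamma>\<^sup>2)"
    unfolding FR_def FV_def
    by (intro add_mono mult_left_mono order_refl rank_product_bound radial_product_bound t tt A \<kappa> dk) auto
  also have "\<dots> = ennreal (32 * \<delta>\<^sup>2 * (2 * A1 * A2) + 12 * (2 * \<kappa> * A2) + 12 * (2 * B1 * \<kappa>) + 12 * (\<kappa> * A2) +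
      12 * (B1 * \<kappa>) + 6 * \<gamma>\<^sup>2)"
    using A(4-6) \<kappa>(3)
    by (simp only: ennreal_plus ennreal_mult zero_le_power2 mult_nonneg_nonneg zero_le_numeral add_nonneg_nonneg)
  also have "32 * \<delta>\<^sup>2 * (2 * A1 * A2) + 12 * (2 * \<kappa> * A2) + 12 * (2 * B1 * \<kappa>) + 12 * (\<kappa> * A2) +
      12 * (B1 * \<kappa>) + 6 * \<gamma>\<^sup>2 = 64 * \<delta>\<^sup>2 * A1 * A2 + 36 * \<kappa> * (A2 + B1) + 6 * \<gamma>\<^sup>2"
    by (simp add: algebra_simps)
  finally show ?thesis .
qed

end

section \<open>The spherical case\<close>

lemma norm_matrix_le_sum: "norm (A :: real^'n^'m) \<le> (\<Sum>a\<in>UNIV. \<Sum>b\<in>UNIV. \<bar>A $ a $ b\<bar>)"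
proof -
  have "norm A \<le> (\<Sum>a\<in>UNIV. norm (A $ a))" unfolding norm_vec_def by (rule L2_set_le_sum) auto
  also have "\<dots> \<le> (\<Sum>a\<in>UNIV. \<Sum>b\<in>UNIV. \<bar>A $ a $ b\<bar>)"
    by (intro sum_mono norm_le_l1_cart)
  finally show ?thesis .
qed

lemma norm_mat_1_le: "norm (mat 1 :: real^'n^'n) \<le> real CARD('n)"
proof -
  have "norm (mat 1 :: real^'n^'n) \<le> (\<Sum>a\<in>(UNIV :: 'n set). \<Sum>b\<in>(UNIV :: 'n set). \<bar>(mat 1 :: real^'n^'n) $ a $ b\<bar>)"
    by (rule norm_matrix_le_sum)
  also have "\<dots> = (\<Sum>a\<in>(UNIV :: 'n set). \<Sum>b\<in>UNIV. if b = a then 1 else 0)"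
    by (intro sum.cong refl) (auto simp: mat_1_nth)
  finally show ?thesis by simp
qed

lemma matrix_diff_mult: "(A - B) ** C = A ** C - B ** C" "C ** (A - B) = C ** A - C ** B"
  for A B C :: "real^'n^'n"
  by (simp_all add: vec_eq_iff matrix_mult_nth left_diff_distrib right_diff_distrib sum_subtractf)

text \<open>The difference is the commutator of \<open>P - 1\<close> with \<open>S\<close>, times \<open>E\<close>. The equation
  \<open>E = 1 - (P - 1) E\<close> bounds \<open>E\<close>, since the norm of the last term is at most half that of \<open>E\<close>.\<close>

lemma conjugation_near_identity:
  fixes P E S :: "real^'n^'n"
  assumes P: "norm (P - mat 1) \<le> \<delta>" "\<delta> \<le> 1/2" and inv: "P ** E = mat 1"
  shows "norm (P ** S ** E - S) \<le> 4 * real CARD('n) * \<delta> * norm S"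
proof -
  have d0: "0 \<le> \<delta>" using P norm_ge_zero order_trans by blast
  have "E = mat 1 - (P - mat 1) ** E"
    by (simp add: matrix_diff_mult inv)
  then have "norm E \<le> norm (mat 1 :: real^'n^'n) + norm ((P - mat 1) ** E)"
    by (metis norm_triangle_ineq4)
  also have "\<dots> \<le> real CARD('n) + (1/2) * norm E"
  proof (intro add_mono norm_mat_1_le)
    have "norm ((P - mat 1) ** E) \<le> norm (P - mat 1) * norm E" by (rule norm_matrix_mult_le)
    also have "\<dots> \<le> (1/2) * norm E" using P by (intro mult_right_mono) auto
    finally show "norm ((P - mat 1) ** E) \<le> (1/2) * norm E" .
  qed
  finally have E: "norm E \<le> 2 * real CARD('n)" by simp
  have "P ** S ** E - S = ((P - mat 1) ** S - S ** (P - mat 1)) ** E"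
    by (simp add: matrix_diff_mult matrix_mul_assoc[symmetric] inv)
  then have "norm (P ** S ** E - S) \<le> norm ((P - mat 1) ** S - S ** (P - mat 1)) * norm E"
    by (metis norm_matrix_mult_le)
  also have "\<dots> \<le> (2 * (\<delta> * norm S)) * (2 * real CARD('n))"
  proof (intro mult_mono E)
    have "norm ((P - mat 1) ** S) \<le> norm (P - mat 1) * norm S" "norm (S ** (P - mat 1)) \<le> norm S * norm (P - mat 1)"
      by (rule norm_matrix_mult_le)+
    moreover have "norm (P - mat 1) * norm S \<le> \<delta> * norm S" using P by (intro mult_right_mono) auto
    ultimately show "norm ((P - mat 1) ** S - S ** (P - mat 1)) \<le> 2 * (\<delta> * norm S)"
      using norm_triangle_ineq4[of "(P - mat 1) ** S" "S ** (P - mat 1)"] by (simp add: mult.commute)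
  qed (use d0 in auto)
  finally show ?thesis by (simp add: mult_ac)
qed

context spherical_law
begin

definition spherical_cross_cov ::
    "(real \<Rightarrow> real) \<Rightarrow> (real \<Rightarrow> real) \<Rightarrow> nat \<Rightarrow> nat \<Rightarrow> (nat \<Rightarrow> real^'k::{finite,wellorder}) \<Rightarrow>
     real^'k::{finite,wellorder}^'k::{finite,wellorder}" where
  "spherical_cross_cov K1 K2 i n y = (1 / (real n - real i)) *\<^sub>R (\<Sum>t=i+1..n.
     (K1 (radial_F (norm (y t))) * K2 (radial_F (norm (y (t - i))))) *\<^sub>R outer_prod (sgn (y t)) (sgn (y (t - i))))"

end

context good_sample
begin

definition score_summand :: "(real \<Rightarrow> real) \<Rightarrow> (real \<Rightarrow> real) \<Rightarrow> nat \<Rightarrow> 'k \<Rightarrow> 'k \<Rightarrow> nat \<Rightarrow> (nat \<Rightarrow> real^'k::{finite,wellorder}) \<Rightarrow> real" where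
  "score_summand K1 K2 i a b t y =
     K1 (radial_score y t) * K2 (radial_score y (t - i)) * (sgn (y t) $ a * sgn (y (t - i)) $ b)"

lemma measurable_score_summand:
  assumes t: "t \<in> {1..n}" "t - i \<in> {1..n}"
    and "K1 \<in> borel_measurable borel" "K2 \<in> borel_measurable borel"
  shows "score_summand K1 K2 i a b t \<in> borel_measurable (sample_law n)"
proof -
  have "(\<lambda>y. sgn (y s) $ c) \<in> borel_measurable (sample_law n)" if "s \<in> {1..n}" for s c
    by (rule measurable_compose[OF measurable_coordinate[OF that] measurable_sgn_nth])
  then show ?thesis
    unfolding score_summand_def[abs_def] using assms
    by (intro borel_measurable_times measurable_radial_score) auto
qed

lemma measurable_summand_gap:
  assumes t: "t \<in> {1..n}" "t - i \<in> {1..n}"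
    and "K1 \<in> borel_measurable borel" "K2 \<in> borel_measurable borel"
  shows "summand_gap K1 K2 i a b t \<in> borel_measurable (sample_law n)"
proof -
  have "(\<lambda>y. sgn (y s) $ c) \<in> borel_measurable (sample_law n)"
    "(\<lambda>y. sgn (D y *v y s) $ c) \<in> borel_measurable (sample_law n)"
    if "s \<in> {1..n}" for s c
    by (rule measurable_compose[OF measurable_coordinate[OF that] measurable_sgn_nth],
        rule measurable_compose[OF measurable_D_vec[OF that] measurable_sgn_nth])
  then show ?thesis
    unfolding summand_gap_def[abs_def] using assms
    by (intro borel_measurable_times borel_measurable_diff borel_measurable_indicator sets_good
        measurable_radial_score measurable_rank_score) auto
qed

text \<open>The sum in the population cross-covariance is of order \<open>sqrt n\<close>. This is needed because conjugation by
  Tyler's matrix multiplies it by a factor that is close to 1 only.\<close>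

lemma score_summand_tail:
  assumes i: "1 \<le> i" and [measurable]: "K1 \<in> borel_measurable borel" "K2 \<in> borel_measurable borel"
    and A: "score_approx K1 (\<lambda>_. 0) A1" "score_approx K2 (\<lambda>_. 0) A2" "0 \<le> A1" "0 \<le> A2" and L: "0 < L"
  shows "measure (sample_law n) {y \<in> space (sample_law n).
      L * sqrt (real n) \<le> \<bar>\<Sum>t\<in>{i+1..n}. score_summand K1 K2 i a b t y\<bar>} \<le> A1 * A2 / L\<^sup>2"
proof -
  have "measure (sample_law n) {y \<in> space (sample_law n).
      L * sqrt (real n) \<le> \<bar>\<Sum>t\<in>{i+1..n}. score_summand K1 K2 i a b t y\<bar>} \<le>
      real n * (A1 * A2) / (L * sqrt (real n))\<^sup>2"
  proof (rule orthogonal_tail_bound)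
    show "{i+1..n} \<subseteq> {1..n}" by auto
    fix t assume t: "t \<in> {i+1..n}"
    then have tt: "t \<in> {1..n}" "t - i \<in> {1..n}" "t \<noteq> t - i" using i by auto
    show "score_summand K1 K2 i a b t \<in> borel_measurable (sample_law n)"
      using tt by (intro measurable_score_summand) auto
    have "(\<integral>\<^sup>+ y. ennreal ((score_summand K1 K2 i a b t y)\<^sup>2) \<partial>sample_law n) \<le>
        (\<integral>\<^sup>+ y. ennreal ((K1 (radial_score y t) * K2 (radial_score y (t - i)))\<^sup>2) \<partial>sample_law n)"
    proof (intro nn_integral_mono ennreal_leI)
      fix y :: "nat \<Rightarrow> real^'k::{finite,wellorder}"
      have "\<bar>sgn (y t) $ a * sgn (y (t - i)) $ b\<bar> \<le> 1"
        unfolding abs_mult by (intro mult_le_one abs_sgn_nth_le) auto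
      then have "(sgn (y t) $ a * sgn (y (t - i)) $ b)\<^sup>2 \<le> 1" by (simp add: abs_square_le_1)
      then have "(K1 (radial_score y t) * K2 (radial_score y (t - i)))\<^sup>2 * (sgn (y t) $ a * sgn (y (t - i)) $ b)\<^sup>2 \<le>
          (K1 (radial_score y t) * K2 (radial_score y (t - i)))\<^sup>2 * 1"
        by (rule mult_left_mono) simp
      then show "(score_summand K1 K2 i a b t y)\<^sup>2 \<le> (K1 (radial_score y t) * K2 (radial_score y (t - i)))\<^sup>2"
        unfolding score_summand_def power_mult_distrib[of "_ * _" "sgn (y t) $ a * _"] by simp
    qed
    also have "\<dots> \<le> ennreal (A1 * A2)"
      by (rule radial_product_bound[OF tt _ _ A]) simp_all
    finally show "(\<integral>\<^sup>+ y. ennreal ((score_summand K1 K2 i a b t y)\<^sup>2) \<partial>sample_law n) \<le> ennreal (A1 * A2)" .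
    show "score_summand K1 K2 i a b t (y(t := - y t)) = - score_summand K1 K2 i a b t y"
      if "y \<in> space (sample_law n)" for y
      using tt(3) by (simp add: score_summand_def radial_score_def sgn_minus_vec)
  next
    fix t t' y assume "t \<in> {i+1..n}" "t' \<in> {i+1..n}" "t < t'"
    then have "t \<noteq> t'" "t - i \<noteq> t'" by auto
    then show "score_summand K1 K2 i a b t (y(t' := - y t')) = score_summand K1 K2 i a b t y"
      by (simp add: score_summand_def radial_score_def)
  qed (use A L n in auto)
  also have "\<dots> = A1 * A2 / L\<^sup>2" using n by (simp add: power_mult_distrib)
  finally show ?thesis .
qed

text \<open>Tyler's matrix, ranks and the good event do not change under reflections of observations. So the gap
  of index \<open>t\<close> is odd in observation \<open>t\<close> and even in the later ones.\<close>

lemma summand_gap_tail: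
  assumes i: "1 \<le> i" and [measurable]: "K1 \<in> borel_measurable borel" "K2 \<in> borel_measurable borel"
    and sq: "\<And>t. t \<in> {i+1..n} \<Longrightarrow>
      (\<integral>\<^sup>+ y. ennreal ((summand_gap K1 K2 i a b t y)\<^sup>2) \<partial>sample_law n) \<le> ennreal \<beta>"
    and \<beta>: "0 \<le> \<beta>" and c: "0 < c"
  shows "measure (sample_law n) {y \<in> space (sample_law n).
      c * sqrt (real n) \<le> \<bar>\<Sum>t\<in>{i+1..n}. summand_gap K1 K2 i a b t y\<bar>} \<le> \<beta> / c\<^sup>2"
proof -
  have "measure (sample_law n) {y \<in> space (sample_law n).
      c * sqrt (real n) \<le> \<bar>\<Sum>t\<in>{i+1..n}. summand_gap K1 K2 i a b t y\<bar>} \<le>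
      real n * \<beta> / (c * sqrt (real n))\<^sup>2"
  proof (rule orthogonal_tail_bound[OF _ _ sq \<beta>])
    show "{i+1..n} \<subseteq> {1..n}" by auto
    fix t assume t: "t \<in> {i+1..n}"
    then have tt: "t \<in> {1..n}" "t - i \<in> {1..n}" "t \<noteq> t - i" using i by auto
    show "summand_gap K1 K2 i a b t \<in> borel_measurable (sample_law n)"
      using tt by (intro measurable_summand_gap) auto
    show "summand_gap K1 K2 i a b t (y(t := - y t)) = - summand_gap K1 K2 i a b t y"
      if y: "y \<in> space (sample_law n)" for y
    proof -
      have "indicator good (y(t := - y t)) = (indicator good y :: real)"
        using good_flip[OF tt(1) y] by (simp add: indicator_def)
      then show ?thesis
        using tt(3) unfolding summand_gap_def rank_score_def R_flip[OF tt(1) y] D_flip[OF tt(1) y] radial_score_def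
        by (simp add: sgn_minus_vec matrix_vector_mult_minus algebra_simps)
    qed
  next
    fix t t' y assume t: "t \<in> {i+1..n}" "t' \<in> {i+1..n}" "t < t'" and y: "y \<in> space (sample_law n)"
    then have tt: "t \<noteq> t'" "t - i \<noteq> t'" "t' \<in> {1..n}" by auto
    have "indicator good (y(t' := - y t')) = (indicator good y :: real)"
      using good_flip[OF tt(3) y] by (simp add: indicator_def)
    then show "summand_gap K1 K2 i a b t (y(t' := - y t')) = summand_gap K1 K2 i a b t y"
      using tt unfolding summand_gap_def rank_score_def R_flip[OF tt(3) y] D_flip[OF tt(3) y] radial_score_def
      by simp
  qed (use c n in auto)
  also have "\<dots> = \<beta> / c\<^sup>2" using n by (simp add: power_mult_distrib)
  finally show ?thesis .
qed

text \<open>The deterministic part of the argument: the differences between the sums give the first term, and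
  conjugation of the rank based sum by Tyler's matrix gives the second. Lags up to half the sample size
  cost a factor 2 in the normalization.\<close>

lemma rank_cross_cov_close:
  assumes y: "y \<in> good" and i: "2 * i \<le> n"
    and gap: "\<And>a b. \<bar>\<Sum>t\<in>{i+1..n}. summand_gap K1 K2 i a b t y\<bar> < c * sqrt (real n)"
    and main: "\<And>a b. \<bar>\<Sum>t\<in>{i+1..n}. score_summand K1 K2 i a b t y\<bar> < L * sqrt (real n)"
  shows "norm (rank_cross_cov K1 K2 i n y - spherical_cross_cov K1 K2 i n y) \<le>
    (2 * (real CARD('k))\<^sup>2 * c + 8 * real CARD('k) ^ 3 * \<delta> * (c + L)) / sqrt (real n)"
proof -
  let ?k = "real CARD('k)"
  have me: "y \<in> moment_event n \<eta>" using y by (simp add: good_def)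
  have D: "tyler_matrix n y = D y" using me by (simp add: D_def)
  obtain E where E: "D y ** E = mat 1" "E ** D y = mat 1"
    using D_solution(2)[OF me] pos_triangular_inverse unfolding tyler_solution_def by metis
  have inv1: "transpose (D y) ** transpose E = mat 1" "transpose E ** transpose (D y) = mat 1"
    using E by (metis matrix_transpose_mul transpose_mat)+
  then have inv: "matrix_inv (transpose (D y)) = transpose E" by (rule matrix_inv_unique)
  define S where "S = spherical_cross_cov K1 K2 i n y"
  define S' where "S' = (1 / (real n - real i)) *\<^sub>R (\<Sum>t=i+1..n.
    (K1 (rank_score y t) * K2 (rank_score y (t - i))) *\<^sub>R outer_prod (sgn (D y *v y t)) (sgn (D y *v y (t - i))))"
  have rcc: "rank_cross_cov K1 K2 i n y = transpose (D y) ** S' ** transpose E"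
    unfolding rank_cross_cov_def Let_def D inv S'_def rank_score_def R_def by (rule refl)
  have n0: "0 < sqrt (real n)" using n by simp
  have half: "real n / 2 \<le> real n - real i" using i by linarith
  have scale: "\<bar>x / (real n - real i)\<bar> \<le> 2 * q / sqrt (real n)" if "\<bar>x\<bar> < q * sqrt (real n)" for x q
  proof -
    have pos: "0 < real n / 2" using n by simp
    have "\<bar>x / (real n - real i)\<bar> = \<bar>x\<bar> / (real n - real i)" using half pos by (simp add: abs_divide)
    also have "\<dots> \<le> (q * sqrt (real n)) / (real n / 2)"
      using that half pos by (intro frac_le) auto
    also have "\<dots> = 2 * q / sqrt (real n)"
    proof -
      define s where "s = sqrt (real n)"
      have "real n = s * s" by (simp add: s_def)
      then have "(q * s) / (real n / 2) = (q * s) / (s * (s / 2))" by simp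
      also have "\<dots> = 2 * q / s" using n0 unfolding s_def[symmetric] by (simp add: divide_simps)
      finally show ?thesis unfolding s_def .
    qed
    finally show ?thesis .
  qed
  have entS: "S $ a $ b = (\<Sum>t\<in>{i+1..n}. score_summand K1 K2 i a b t y) / (real n - real i)" for a b
    unfolding S_def spherical_cross_cov_def score_summand_def radial_score_def by (simp add: outer_prod_def)
  have ent: "(S' - S) $ a $ b = (\<Sum>t\<in>{i+1..n}. summand_gap K1 K2 i a b t y) / (real n - real i)" for a b
    unfolding S_def S'_def spherical_cross_cov_def summand_gap_def radial_score_def using y
    by (simp add: outer_prod_def sum_subtractf diff_divide_distrib)
  have "norm (S' - S) \<le> (\<Sum>a\<in>(UNIV :: 'k set). \<Sum>b\<in>(UNIV :: 'k set). 2 * c / sqrt (real n))"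
    unfolding ent[symmetric]
    by (rule order_trans[OF norm_matrix_le_sum]) (intro sum_mono, unfold ent, rule scale[OF gap])
  then have nd: "norm (S' - S) \<le> ?k\<^sup>2 * (2 * c / sqrt (real n))" by (simp add: power2_eq_square mult.assoc)
  have "norm S \<le> (\<Sum>a\<in>(UNIV :: 'k set). \<Sum>b\<in>(UNIV :: 'k set). 2 * L / sqrt (real n))"
    by (rule order_trans[OF norm_matrix_le_sum]) (intro sum_mono, unfold entS, rule scale[OF main])
  then have nS: "norm S \<le> ?k\<^sup>2 * (2 * L / sqrt (real n))" by (simp add: power2_eq_square mult.assoc)
  have nS': "norm S' \<le> ?k\<^sup>2 * (2 * (c + L) / sqrt (real n))"
  proof -
    have "norm S' \<le> norm (S' - S) + norm S" using norm_triangle_ineq[of "S' - S" S] by simp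
    also have "\<dots> \<le> ?k\<^sup>2 * (2 * c / sqrt (real n)) + ?k\<^sup>2 * (2 * L / sqrt (real n))" using nd nS by (rule add_mono)
    also have "\<dots> = ?k\<^sup>2 * (2 * (c + L) / sqrt (real n))" by (simp add: algebra_simps add_divide_distrib)
    finally show ?thesis .
  qed
  have "norm (transpose (D y) - mat 1) \<le> \<delta>"
  proof -
    have "transpose (D y) - mat 1 = transpose (D y - mat 1)"
      by (simp add: vec_eq_iff transpose_def mat_1_nth)
    then show ?thesis using D_near[of y] by (simp add: norm_transpose)
  qed
  then have "norm (rank_cross_cov K1 K2 i n y - S') \<le> 4 * ?k * \<delta> * norm S'"
    unfolding rcc using \<delta> inv1(1) by (intro conjugation_near_identity) auto
  also have "\<dots> \<le> 4 * ?k * \<delta> * (?k\<^sup>2 * (2 * (c + L) / sqrt (real n)))"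
    using \<delta> nS' by (intro mult_left_mono) auto
  finally have "norm (rank_cross_cov K1 K2 i n y - S) \<le>
      4 * ?k * \<delta> * (?k\<^sup>2 * (2 * (c + L) / sqrt (real n))) + ?k\<^sup>2 * (2 * c / sqrt (real n))"
    using nd norm_triangle_ineq[of "rank_cross_cov K1 K2 i n y - S'" "S' - S"] by simp
  also have "\<dots> = (2 * ?k\<^sup>2 * c + 8 * ?k ^ 3 * \<delta> * (c + L)) / sqrt (real n)"
    by (simp add: divide_inverse power2_eq_square power3_eq_cube algebra_simps)
  finally show ?thesis unfolding S_def .
qed

end

lemma product_modulus:
  fixes J1 J2 :: "real \<Rightarrow> real"
  assumes u: "uniformly_continuous_on UNIV J1" "uniformly_continuous_on UNIV J2"
    and b: "\<And>x. \<bar>J1 x\<bar> \<le> b1" "\<And>x. \<bar>J2 x\<bar> \<le> b2" and \<gamma>: "0 < \<gamma>"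
  obtains \<omega> where "0 < \<omega>"
    "\<And>x x' v v'. \<bar>x - v\<bar> \<le> \<omega> \<Longrightarrow> \<bar>x' - v'\<bar> \<le> \<omega> \<Longrightarrow> \<bar>J1 x * J2 x' - J1 v * J2 v'\<bar> \<le> \<gamma>"
proof -
  define B where "B = b1 + b2 + 1"
  have b0: "0 \<le> b1" "0 \<le> b2" using b[of 0] by linarith+
  have B: "0 < B" "b1 \<le> B" "b2 \<le> B" using b0 by (auto simp: B_def)
  have e: "0 < \<gamma> / (2 * B)" using \<gamma> B by simp
  obtain d1 where d1: "0 < d1" "\<And>x v. dist x v < d1 \<Longrightarrow> dist (J1 x) (J1 v) < \<gamma> / (2 * B)"
    using u(1) e unfolding uniformly_continuous_on_def by (metis UNIV_I)
  obtain d2 where d2: "0 < d2" "\<And>x v. dist x v < d2 \<Longrightarrow> dist (J2 x) (J2 v) < \<gamma> / (2 * B)"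
    using u(2) e unfolding uniformly_continuous_on_def by (metis UNIV_I)
  define \<omega> where "\<omega> = min d1 d2 / 2"
  have \<omega>: "0 < \<omega>" "\<omega> < d1" "\<omega> < d2" using d1 d2 by (auto simp: \<omega>_def)
  have "\<bar>J1 x * J2 x' - J1 v * J2 v'\<bar> \<le> \<gamma>" if x: "\<bar>x - v\<bar> \<le> \<omega>" "\<bar>x' - v'\<bar> \<le> \<omega>" for x x' v v'
  proof -
    have c: "\<bar>J1 x - J1 v\<bar> \<le> \<gamma> / (2 * B)" "\<bar>J2 x' - J2 v'\<bar> \<le> \<gamma> / (2 * B)"
      using d1(2)[of x v] d2(2)[of x' v'] x \<omega> by (auto simp: dist_real_def)
    have "J1 x * J2 x' - J1 v * J2 v' = (J1 x - J1 v) * J2 x' + J1 v * (J2 x' - J2 v')"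
      by (simp add: algebra_simps)
    also have "\<bar>\<dots>\<bar> \<le> \<bar>J1 x - J1 v\<bar> * \<bar>J2 x'\<bar> + \<bar>J1 v\<bar> * \<bar>J2 x' - J2 v'\<bar>"
      using abs_triangle_ineq[of "(J1 x - J1 v) * J2 x'" "J1 v * (J2 x' - J2 v')"] by (simp add: abs_mult)
    also have "\<dots> \<le> \<gamma> / (2 * B) * B + B * (\<gamma> / (2 * B))"
      using c b[of v] b(2)[of x'] B e by (intro add_mono mult_mono) auto
    also have "\<dots> = \<gamma>" using B by simp
    finally show ?thesis .
  qed
  then show ?thesis using that \<omega>(1) by blast
qed

lemma quotient_mono:
  fixes \<delta> \<delta>' :: real
  assumes "0 < \<delta>" "\<delta> \<le> \<delta>'" "\<delta>' < 1"
  shows "(1 + \<delta>) / (1 - \<delta>) \<le> (1 + \<delta>') / (1 - \<delta>')"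
  using assms by (intro frac_le) auto

context spherical_law
begin

lemma moments_close_mono: "moments_close n y \<eta> \<Longrightarrow> \<eta> \<le> \<eta>' \<Longrightarrow> moments_close n y \<eta>'"
  unfolding moments_close_def by (meson order_trans)

text \<open>The exceptional event is the union of the complement of the good event and of the events that one of the
  sums of gaps or of summands is large. Uniqueness of the solution is part of the conclusion since the
  passage to linearly transformed samples needs it.\<close>

theorem spherical_approximation:
  assumes C: "assumption_C K1" "assumption_C K2"
    and m: "K1 \<in> borel_measurable borel" "K2 \<in> borel_measurable borel"
    and i: "1 \<le> i" and \<epsilon>: "0 < \<epsilon>" and \<epsilon>1: "0 < \<epsilon>1"
  obtains n0 where "\<And>n. n0 \<le> n \<Longrightarrow> \<exists>B\<in>sets (sample_law n). measure (sample_law n) B \<le> \<epsilon>1 \<and>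
    (\<forall>y\<in>space (sample_law n) - B.
      (\<exists>C. tyler_solution n y C \<and> (\<forall>C'. tyler_solution n y C' \<longrightarrow> C' = C)) \<and>
      norm (rank_cross_cov K1 K2 i n y - spherical_cross_cov K1 K2 i n y) \<le> \<epsilon> / sqrt (real n))"
proof -
  let ?k = "real CARD('k)"
  have k: "1 \<le> ?k" by (simp add: Suc_le_eq)
  obtain A1 where A1: "0 < A1" "score_approx K1 (\<lambda>_. 0) A1" using score_bound[OF C(1) m(1)] by blast
  obtain A2 where A2: "0 < A2" "score_approx K2 (\<lambda>_. 0) A2" using score_bound[OF C(2) m(2)] by blast
  \<comment> \<open>The probability \<open>\<epsilon>1\<close> is split into three equal parts: the bad event, large sums of gaps (threshold \<open>c\<close>) and large sums of summands (threshold \<open>L\<close>), each of the latter two for \<open>k\<^sup>2\<close> entries.\<close>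
  define L where "L = sqrt (3 * ?k\<^sup>2 * A1 * A2 / \<epsilon>1)"
  have L: "0 < L" using A1 A2 \<epsilon>1 k by (simp add: L_def)
  have L2: "?k\<^sup>2 * (A1 * A2 / L\<^sup>2) = \<epsilon>1 / 3"
    using A1 A2 \<epsilon>1 k by (simp add: L_def)
  define c where "c = min 1 (\<epsilon> / (4 * ?k\<^sup>2))"
  have c: "0 < c" "c \<le> 1" using \<epsilon> k by (auto simp: c_def)
  have ck: "2 * ?k\<^sup>2 * c \<le> \<epsilon> / 2"
  proof -
    have "2 * ?k\<^sup>2 * c \<le> 2 * ?k\<^sup>2 * (\<epsilon> / (4 * ?k\<^sup>2))" by (intro mult_left_mono) (auto simp: c_def)
    then show ?thesis using k by simp
  qed
  \<comment> \<open>The mean square of a gap has to be at most \<open>\<beta>\<close>; its three parts, governed by \<open>\<delta>\<close>, \<open>\<kappa>\<close> and \<open>\<gamma>\<close>, get a third of it each.\<close>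
  define \<beta> where "\<beta> = \<epsilon>1 * c\<^sup>2 / (3 * ?k\<^sup>2)"
  have \<beta>: "0 < \<beta>" using \<epsilon>1 c k by (simp add: \<beta>_def)
  have \<beta>k: "?k\<^sup>2 * (\<beta> / c\<^sup>2) = \<epsilon>1 / 3" using c k by (simp add: \<beta>_def)
  define \<kappa> where "\<kappa> = min 1 (\<beta> / (108 * (A2 + (2 + 2 * A1))))"
  have \<kappa>: "0 < \<kappa>" "\<kappa> \<le> 1" using \<beta> A1 A2 by (auto simp: \<kappa>_def)
  define B1 where "B1 = 2 * \<kappa> + 2 * A1"
  have \<kappa>\<beta>: "36 * \<kappa> * (A2 + B1) \<le> \<beta> / 3"
  proof -
    have "36 * \<kappa> * (A2 + B1) \<le> 36 * (\<beta> / (108 * (A2 + (2 + 2 * A1)))) * (A2 + (2 + 2 * A1))"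
      using \<kappa> A1 A2 \<beta> by (intro mult_mono mult_nonneg_nonneg add_left_mono) (auto simp: \<kappa>_def B1_def)
    also have "\<dots> = \<beta> / 3" using A1 A2 by (simp add: field_simps)
    finally show ?thesis .
  qed
  define \<gamma> where "\<gamma> = sqrt (\<beta> / 18)"
  have \<gamma>: "0 < \<gamma>" "6 * \<gamma>\<^sup>2 = \<beta> / 3" using \<beta> by (auto simp: \<gamma>_def)
  obtain J1 b1 where J1: "uniformly_continuous_on UNIV J1" "\<And>u. \<bar>J1 u\<bar> \<le> b1" "score_approx K1 J1 \<kappa>"
    using score_approximation[OF C(1) \<kappa>(1)] by blast
  obtain J2 b2 where J2: "uniformly_continuous_on UNIV J2" "\<And>u. \<bar>J2 u\<bar> \<le> b2" "score_approx K2 J2 \<kappa>"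
    using score_approximation[OF C(2) \<kappa>(1)] by blast
  have mJ: "J1 \<in> borel_measurable borel" "J2 \<in> borel_measurable borel"
    using J1(1) J2(1) by (auto intro: borel_measurable_continuous_onI uniformly_continuous_imp_continuous)
  have J1B: "score_approx J1 (\<lambda>_. 0) B1"
    unfolding B1_def using m mJ A1 \<kappa> score_approx_sym[OF J1(3)] by (intro score_approx_trans[of J1 K1]) auto
  obtain \<omega> where \<omega>: "0 < \<omega>"
    "\<And>x x' v v'. \<bar>x - v\<bar> \<le> \<omega> \<Longrightarrow> \<bar>x' - v'\<bar> \<le> \<omega> \<Longrightarrow> \<bar>J1 x * J2 x' - J1 v * J2 v'\<bar> \<le> \<gamma>"
    using product_modulus[OF J1(1) J2(1) J1(2) J2(2) \<gamma>(1)] by blast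
  define \<zeta> where "\<zeta> = \<omega> / 4"
  have \<zeta>: "0 < \<zeta>" using \<omega> by (simp add: \<zeta>_def)
  obtain \<delta>0 where \<delta>0: "0 < \<delta>0" "\<delta>0 < 1/2"
    "\<And>\<rho> x. 1 \<le> \<rho> \<Longrightarrow> \<rho> \<le> (1 + \<delta>0) / (1 - \<delta>0) \<Longrightarrow> 0 \<le> x \<Longrightarrow> radial_F (\<rho> * x) \<le> radial_F x + \<zeta>"
    using radial_F_dilation[OF \<zeta>] by blast
  define \<delta> where "\<delta> = min \<delta>0 (min (\<epsilon> / (16 * ?k ^ 3 * (1 + L))) (sqrt (\<beta> / (192 * A1 * A2))))"
  have \<delta>: "0 < \<delta>" "\<delta> < 1/2" "\<delta> \<le> \<delta>0" using \<delta>0 \<epsilon> k L \<beta> A1 A2 by (auto simp: \<delta>_def)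
  have \<delta>\<epsilon>: "8 * ?k ^ 3 * \<delta> * (c + L) \<le> \<epsilon> / 2"
  proof -
    have "8 * ?k ^ 3 * \<delta> * (c + L) \<le> 8 * ?k ^ 3 * (\<epsilon> / (16 * ?k ^ 3 * (1 + L))) * (1 + L)"
      using \<delta> c L \<epsilon> k by (intro mult_mono mult_left_mono mult_nonneg_nonneg) (auto simp: \<delta>_def)
    also have "\<dots> = \<epsilon> / 2" using L k by (simp add: divide_simps)
    finally show ?thesis .
  qed
  have \<delta>\<beta>: "64 * \<delta>\<^sup>2 * A1 * A2 \<le> \<beta> / 3"
  proof -
    have "\<delta>\<^sup>2 \<le> (sqrt (\<beta> / (192 * A1 * A2)))\<^sup>2" using \<delta> by (intro power_mono) (auto simp: \<delta>_def)
    also have "\<dots> = \<beta> / (192 * A1 * A2)" using \<beta> A1 A2 by simp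
    finally have "64 * (A1 * A2) * \<delta>\<^sup>2 \<le> 64 * (A1 * A2) * (\<beta> / (192 * A1 * A2))"
      using A1 A2 by (intro mult_left_mono) auto
    also have "\<dots> = \<beta> / 3" using A1 A2 by simp
    finally show ?thesis by (simp add: mult_ac)
  qed
  have dil: "radial_F (\<rho> * x) \<le> radial_F x + \<zeta>" if "1 \<le> \<rho>" "\<rho> \<le> (1 + \<delta>) / (1 - \<delta>)" "0 \<le> x" for \<rho> x
    using that quotient_mono[of \<delta> \<delta>0] \<delta> \<delta>0(2) by (intro \<delta>0(3)) auto
  obtain X \<eta>1 where X: "finite X" "0 < \<eta>1"
    "\<And>n y. (\<And>x. x \<in> X \<Longrightarrow> \<bar>avg n (ball_ind x) y - (\<integral>y. ball_ind x y \<partial>N)\<bar> \<le> \<eta>1) \<Longrightarrow> radially_close n y \<zeta>"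
    using radially_close_of_quantiles[OF \<zeta>] by blast
  obtain \<eta>2 where \<eta>2: "0 < \<eta>2"
    "\<And>n z. 1 \<le> n \<Longrightarrow> (\<And>t. t \<in> {1..n} \<Longrightarrow> z t \<noteq> 0) \<Longrightarrow> moments_close n z \<eta>2 \<Longrightarrow>
      \<exists>C\<in>triangular_nbhd \<delta>. tyler_solution n z C \<and> (\<forall>C'. tyler_solution n z C' \<longrightarrow> C' = C)"
    using tyler_solution_near_identity[OF \<delta>(1)] by blast
  define \<eta> where "\<eta> = min \<eta>1 \<eta>2"
  have \<eta>: "0 < \<eta>" "\<eta> \<le> \<eta>1" "\<eta> \<le> \<eta>2" using X(2) \<eta>2(1) by (auto simp: \<eta>_def)
  define \<Phi> where "\<Phi> = range sign_product \<union> range (\<lambda>(p, q) y. sign_product p y * sign_product q y) \<union> ball_ind ` X"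
  have fin\<Phi>: "finite \<Phi>" using X(1) by (simp add: \<Phi>_def)
  have b\<Phi>: "\<phi> \<in> borel_measurable borel" "\<bar>\<phi> y\<bar> \<le> 1" if "\<phi> \<in> \<Phi>" for \<phi> y
    using that by (auto simp: \<Phi>_def abs_sign_product_le ball_ind_def abs_mult mult_le_one)
  have "(\<lambda>n. \<Sum>\<phi>\<in>\<Phi>. measure (sample_law n) {y\<in>space (sample_law n). \<eta> < \<bar>avg n \<phi> y - (\<integral>x. \<phi> x \<partial>N)\<bar>}) \<longlonglongrightarrow> 0"
    using b\<Phi> \<eta>(1) by (intro tendsto_null_sum avg_concentration) auto
  then have "\<forall>\<^sub>F n in sequentially. (\<Sum>\<phi>\<in>\<Phi>. measure (sample_law n)
      {y\<in>space (sample_law n). \<eta> < \<bar>avg n \<phi> y - (\<integral>x. \<phi> x \<partial>N)\<bar>}) < \<epsilon>1 / 3"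
    using \<epsilon>1 by (intro order_tendstoD) auto
  then obtain n1 where n1: "\<And>n. n1 \<le> n \<Longrightarrow> (\<Sum>\<phi>\<in>\<Phi>. measure (sample_law n)
      {y\<in>space (sample_law n). \<eta> < \<bar>avg n \<phi> y - (\<integral>x. \<phi> x \<partial>N)\<bar>}) < \<epsilon>1 / 3"
    by (auto simp: eventually_sequentially)
  obtain n2 :: nat where n2: "2 / \<omega> < real n2" using reals_Archimedean2 by blast
  define n0 where "n0 = max n1 (max n2 (2 * i))"
  have "\<exists>B\<in>sets (sample_law n). measure (sample_law n) B \<le> \<epsilon>1 \<and>
    (\<forall>y\<in>space (sample_law n) - B.
      (\<exists>C. tyler_solution n y C \<and> (\<forall>C'. tyler_solution n y C' \<longrightarrow> C' = C)) \<and>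
      norm (rank_cross_cov K1 K2 i n y - spherical_cross_cov K1 K2 i n y) \<le> \<epsilon> / sqrt (real n))"
    if n: "n0 \<le> n" for n
  proof -
    have n': "n1 \<le> n" "n2 \<le> n" "2 * i \<le> n" "1 \<le> n" using n i by (auto simp: n0_def)
    interpret P: prob_space "sample_law n" by (rule prob_space_sample)
    interpret G: good_sample N n \<delta> \<eta> \<zeta> X
    proof unfold_locales
      show "\<exists>C\<in>triangular_nbhd \<delta>. tyler_solution n y C \<and> (\<forall>C'. tyler_solution n y C' \<longrightarrow> C' = C)"
        if "y \<in> moment_event n \<eta>" for y
        using that \<eta>(3) n'(4) by (intro \<eta>2(2)) (auto simp: moment_event_def intro: moments_close_mono)
      show "radially_close n y \<zeta>"
        if "\<And>x. x \<in> X \<Longrightarrow> \<bar>avg n (ball_ind x) y - (\<integral>y. ball_ind x y \<partial>N)\<bar> \<le> \<eta>" for y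
        using that \<eta>(2) by (intro X(3)) (meson order_trans)
    qed (use n' \<delta> X(1) dil in auto)
    have n\<omega>: "2 * \<zeta> + 1 / real n \<le> \<omega>"
    proof -
      have "2 / \<omega> \<le> real n" using n2 n'(2) by linarith
      then have "1 / real n \<le> \<omega> / 2" using \<omega>(1) n'(4) by (simp add: field_simps)
      then show ?thesis by (simp add: \<zeta>_def)
    qed
    define far where "far p = {y \<in> space (sample_law n). c * sqrt (real n) \<le>
      \<bar>\<Sum>t\<in>{i+1..n}. G.summand_gap K1 K2 i (fst p) (snd p) t y\<bar>}" for p
    define big where "big p = {y \<in> space (sample_law n). L * sqrt (real n) \<le>
      \<bar>\<Sum>t\<in>{i+1..n}. G.score_summand K1 K2 i (fst p) (snd p) t y\<bar>}" for p
    have tt: "t \<in> {1..n} \<and> t - i \<in> {1..n}" if "t \<in> {i+1..n}" for t using that by auto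
    have mf: "far p \<in> sets (sample_law n)" for p
    proof -
      have "(\<lambda>y. \<Sum>t\<in>{i+1..n}. G.summand_gap K1 K2 i (fst p) (snd p) t y) \<in> borel_measurable (sample_law n)"
        using tt by (intro borel_measurable_sum G.measurable_summand_gap m) auto
      then show ?thesis unfolding far_def by measurable
    qed
    have mb: "big p \<in> sets (sample_law n)" for p
    proof -
      have "(\<lambda>y. \<Sum>t\<in>{i+1..n}. G.score_summand K1 K2 i (fst p) (snd p) t y) \<in> borel_measurable (sample_law n)"
        using tt by (intro borel_measurable_sum G.measurable_score_summand m) auto
      then show ?thesis unfolding big_def by measurable
    qed
    have Pf: "measure (sample_law n) (far p) \<le> \<beta> / c\<^sup>2" for p
      unfolding far_def
    proof (rule G.summand_gap_tail[OF i m _ _ c(1)])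
      fix t assume t: "t \<in> {i+1..n}"
      have "(\<integral>\<^sup>+ y. ennreal ((G.summand_gap K1 K2 i (fst p) (snd p) t y)\<^sup>2) \<partial>sample_law n) \<le>
          ennreal (64 * \<delta>\<^sup>2 * A1 * A2 + 36 * \<kappa> * (A2 + B1) + 6 * \<gamma>\<^sup>2)"
        using tt[OF t] t i A1 A2 J1B \<kappa> J1(3) J2(3) m mJ n\<omega>
        by (intro G.summand_gap_mean_square[where ?J1.0 = J1 and ?J2.0 = J2]) (auto intro!: \<omega>(2) simp: B1_def)
      also have "\<dots> \<le> ennreal \<beta>" using \<delta>\<beta> \<kappa>\<beta> \<gamma>(2) by (intro ennreal_leI) linarith
      finally show "(\<integral>\<^sup>+ y. ennreal ((G.summand_gap K1 K2 i (fst p) (snd p) t y)\<^sup>2) \<partial>sample_law n) \<le> ennreal \<beta>" .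
    qed (use \<beta> in auto)
    have Pb: "measure (sample_law n) (big p) \<le> A1 * A2 / L\<^sup>2" for p
      unfolding big_def using A1 A2 L by (intro G.score_summand_tail i m) auto
    have union: "measure (sample_law n) (\<Union>p. F p) \<le> ?k\<^sup>2 * x"
      if F: "\<And>p. F p \<in> sets (sample_law n)" "\<And>p. measure (sample_law n) (F p) \<le> x"
      for F :: "'k \<times> 'k \<Rightarrow> (nat \<Rightarrow> real^'k::{finite,wellorder}) set" and x
    proof -
      have "measure (sample_law n) (\<Union>p. F p) \<le> (\<Sum>p\<in>UNIV. measure (sample_law n) (F p))"
        using F by (intro measure_UNION_le) auto
      also have "\<dots> \<le> (\<Sum>p\<in>(UNIV :: ('k \<times> 'k) set). x)" by (intro sum_mono F)
      finally show ?thesis by (simp add: card_UNIV power2_eq_square flip: UNIV_Times_UNIV)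
    qed
    define B where "B = (space (sample_law n) - G.good) \<union> ((\<Union>p. far p) \<union> (\<Union>p. big p))"
    have mB: "B \<in> sets (sample_law n)"
      unfolding B_def using mf mb G.sets_good by (intro sets.Un sets.Diff sets.top sets.finite_UN) auto
    have "measure (sample_law n) B \<le> measure (sample_law n) (space (sample_law n) - G.good) +
        (measure (sample_law n) (\<Union>p. far p) + measure (sample_law n) (\<Union>p. big p))"
      unfolding B_def using mf mb G.sets_good
      by (intro order_trans[OF measure_Un_le] add_left_mono measure_Un_le sets.Un sets.Diff sets.top sets.finite_UN) auto
    also have "\<dots> \<le> \<epsilon>1 / 3 + (?k\<^sup>2 * (\<beta> / c\<^sup>2) + ?k\<^sup>2 * (A1 * A2 / L\<^sup>2))"
      using n1[OF n'(1)] G.good_complement unfolding \<Phi>_def[symmetric]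
      by (intro add_mono union mf mb Pf Pb) linarith
    also have "\<dots> = \<epsilon>1" unfolding \<beta>k L2 by simp
    finally have PB: "measure (sample_law n) B \<le> \<epsilon>1" .
    have "(\<exists>C. tyler_solution n y C \<and> (\<forall>C'. tyler_solution n y C' \<longrightarrow> C' = C)) \<and>
      norm (rank_cross_cov K1 K2 i n y - spherical_cross_cov K1 K2 i n y) \<le> \<epsilon> / sqrt (real n)"
      if y: "y \<in> space (sample_law n) - B" for y
    proof
      have yg: "y \<in> G.good" using y by (auto simp: B_def)
      then have me: "y \<in> moment_event n \<eta>" by (simp add: G.good_def)
      show "\<exists>C. tyler_solution n y C \<and> (\<forall>C'. tyler_solution n y C' \<longrightarrow> C' = C)"
        using G.solvable[OF me] by blast
      have "y \<notin> far (a, b)" "y \<notin> big (a, b)" for a b using y by (auto simp: B_def)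
      then have "\<bar>\<Sum>t\<in>{i+1..n}. G.summand_gap K1 K2 i a b t y\<bar> < c * sqrt (real n)"
        "\<bar>\<Sum>t\<in>{i+1..n}. G.score_summand K1 K2 i a b t y\<bar> < L * sqrt (real n)" for a b
        using y by (auto simp: far_def big_def not_le)
      then have "norm (rank_cross_cov K1 K2 i n y - spherical_cross_cov K1 K2 i n y) \<le>
          (2 * ?k\<^sup>2 * c + 8 * ?k ^ 3 * \<delta> * (c + L)) / sqrt (real n)"
        by (intro G.rank_cross_cov_close yg n')
      also have "\<dots> \<le> \<epsilon> / sqrt (real n)"
        using ck \<delta>\<epsilon> by (intro divide_right_mono) auto
      finally show "norm (rank_cross_cov K1 K2 i n y - spherical_cross_cov K1 K2 i n y) \<le> \<epsilon> / sqrt (real n)" .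
    qed
    then show ?thesis using mB PB by blast
  qed
  then show ?thesis using that by blast
qed

end

section \<open>Spherical densities\<close>

lemma nn_integral_linear_image:
  fixes f :: "real^'n::{finite,wellorder} \<Rightarrow> real^'n::{finite,wellorder}"
  assumes f: "linear f" and d: "det (matrix f) \<noteq> 0" and [measurable]: "h \<in> borel_measurable borel"
  shows "(\<integral>\<^sup>+ x. h (f x) \<partial>lborel) = ennreal (1 / \<bar>det (matrix f)\<bar>) * (\<integral>\<^sup>+ y. h y \<partial>lborel)"
proof -
  define c where "c = \<bar>det (matrix f)\<bar>"
  have c: "0 < c" using d by (simp add: c_def)
  have [measurable]: "f \<in> borel_measurable borel"
    using f by (intro borel_measurable_continuous_onI linear_continuous_on linear_conv_bounded_linear[THEN iffD1])
  obtain B where B: "matrix f ** B = mat 1" "B ** matrix f = mat 1"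
    using d by (auto simp: invertible_det_nz[symmetric] invertible_def)
  define b where "b = (*v) B"
  have fm: "f x = matrix f *v x" for x using matrix_vector_mul(2)[OF f] by metis
  have bf: "b (f x) = x" "f (b x) = x" for x
    by (simp_all add: b_def fm matrix_vector_mul_assoc B)
  have lb: "linear b" unfolding b_def by (rule matrix_vector_mul_linear)
  have detB: "\<bar>det (matrix b)\<bar> = 1 / c"
  proof -
    have "matrix b = B" unfolding b_def by (rule matrix_of_matrix_vector_mul)
    moreover have "det (matrix f) * det B = 1" using B(1) by (metis det_I det_mul)
    ultimately have "c * \<bar>det (matrix b)\<bar> = 1" by (simp add: c_def flip: abs_mult)
    then show ?thesis using c by (simp add: eq_divide_eq mult.commute)
  qed
  have "lborel = density (distr lborel borel f) (\<lambda>_. ennreal c)"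
  proof (rule lborel_eqI)
    fix l u :: "real^'n::{finite,wellorder}" assume lu: "\<And>b. b \<in> Basis \<Longrightarrow> l \<bullet> b \<le> u \<bullet> b"
    have pre: "f -` box l u \<inter> space lborel = b ` box l u"
      using bf by (auto simp: image_iff) metis
    have meas: "b ` box l u \<in> lmeasurable" "measure lebesgue (b ` box l u) = (1 / c) * measure lebesgue (box l u)"
      using measurable_linear_image[OF lb lmeasurable_box] measure_linear_image[OF lb lmeasurable_box] detB by auto
    have borel: "b ` box l u \<in> sets borel"
    proof -
      have "f -` box l u \<inter> space borel \<in> sets borel" by (intro measurable_sets[of f borel borel]) auto
      then show ?thesis using pre by simp
    qed
    have "emeasure lborel (b ` box l u) = emeasure lebesgue (b ` box l u)" using borel by simp
    also have "\<dots> = ennreal ((1 / c) * measure lebesgue (box l u))"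
      by (simp only: emeasure_eq_measure2[OF meas(1)] meas(2))
    finally have "emeasure lborel (b ` box l u) = ennreal (1 / c) * ennreal (measure lborel (box l u))"
      using c by (simp add: measure_completion flip: ennreal_mult)
    then have "emeasure (density (distr lborel borel f) (\<lambda>_. ennreal c)) (box l u) =
        ennreal c * (ennreal (1 / c) * ennreal (measure lborel (box l u)))"
      using pre by (simp add: emeasure_density nn_integral_cmult_indicator emeasure_distr)
    also have "\<dots> = ennreal (measure lborel (box l u))"
      using c by (simp add: mult.assoc[symmetric] flip: ennreal_mult)
    also have "\<dots> = ennreal (\<Prod>b\<in>Basis. (u - l) \<bullet> b)"
      using lu by (simp add: measure_lborel_box_eq) 
    finally show "emeasure (density (distr lborel borel f) (\<lambda>_. ennreal c)) (box l u) = (\<Prod>b\<in>Basis. (u - l) \<bullet> b)" .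
  qed simp
  then have "(\<integral>\<^sup>+ y. h y \<partial>lborel) = (\<integral>\<^sup>+ y. h y \<partial>density (distr lborel borel f) (\<lambda>_. ennreal c))"
    by (rule arg_cong)
  also have "\<dots> = ennreal c * (\<integral>\<^sup>+ x. h (f x) \<partial>lborel)"
    by (simp add: nn_integral_density nn_integral_distr nn_integral_cmult)
  finally have "ennreal (1 / c) * (\<integral>\<^sup>+ y. h y \<partial>lborel) = (\<integral>\<^sup>+ x. h (f x) \<partial>lborel)"
    using c by (simp add: mult.assoc[symmetric] flip: ennreal_mult)
  then show ?thesis by (simp add: c_def)
qed

text \<open>Polar coordinates for radial functions: the measure of \<open>{..x}\<close> on the left is the volume of a ball of
  radius \<open>x\<close>, whose derivative is the density on the right.\<close>

lemma distr_norm_lborel: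
  fixes k :: nat
  assumes k: "k = CARD('n::finite)"
  shows "distr lborel borel (norm :: real^'n \<Rightarrow> real) =
    density lborel (\<lambda>r. ennreal (if 0 < r then unit_ball_vol (real k) * (real k * r ^ (k - 1)) else 0))"
    (is "?L = density lborel (\<lambda>r. ennreal (?w r))")
proof (rule measure_eqI_generator_eq[where E = "range atMost" and \<Omega> = UNIV and A = "\<lambda>n. {..real n}"])
  define \<omega> where "\<omega> = unit_ball_vol (real k)"
  have \<omega>: "0 \<le> \<omega>" by (simp add: \<omega>_def)
  have k0: "0 < k" using k by simp
  have vol: "emeasure ?L {..x} = ennreal (if 0 \<le> x then \<omega> * x ^ k else 0)" for x
  proof -
    have "emeasure ?L {..x} = emeasure lborel (cball (0 :: real^'n) x)"
      by (subst emeasure_distr) (auto intro!: arg_cong[where f = "emeasure lborel"])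
    also have "\<dots> = ennreal (if 0 \<le> x then \<omega> * x ^ k else 0)"
      using k by (cases "0 \<le> x") (auto simp: emeasure_cball \<omega>_def not_le cball_empty)
    finally show ?thesis .
  qed
  have m: "?w \<in> borel_measurable borel" by measurable
  have int: "emeasure (density lborel (\<lambda>r. ennreal (?w r))) {..x} = ennreal (if 0 \<le> x then \<omega> * x ^ k else 0)" for x
  proof (cases "0 \<le> x")
    case False
    have "(\<integral>\<^sup>+ r. ennreal (?w r) * indicator {..x} r \<partial>lborel) = (\<integral>\<^sup>+ r. 0 \<partial>(lborel :: real measure))"
      using False by (intro nn_integral_cong) (auto simp: indicator_def)
    then show ?thesis using False m by (simp add: emeasure_density)
  next
    case True
    have "emeasure (density lborel (\<lambda>r. ennreal (?w r))) {..x} = (\<integral>\<^sup>+ r. ennreal (?w r) * indicator {..x} r \<partial>lborel)"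
      using m by (simp add: emeasure_density)
    also have "\<dots> = (\<integral>\<^sup>+ r. ennreal (\<omega> * (real k * r ^ (k - 1))) * indicator {0..x} r \<partial>lborel)"
    proof (rule nn_integral_cong_AE)
      have "AE r in lborel. r \<noteq> (0 :: real)" by (rule AE_lborel_singleton)
      then show "AE r in lborel. ennreal (?w r) * indicator {..x} r =
          ennreal (\<omega> * (real k * r ^ (k - 1))) * indicator {0..x} r"
        by eventually_elim (auto simp: indicator_def \<omega>_def)
    qed
    also have "\<dots> = ennreal (\<omega> * x ^ k - \<omega> * 0 ^ k)"
    proof (rule nn_integral_FTC_Icc)
      show "((\<lambda>r. \<omega> * r ^ k) has_real_derivative \<omega> * (real k * r ^ (k - 1))) (at r)" for r
        by (auto intro!: derivative_eq_intros)
      show "0 \<le> \<omega> * (real k * r ^ (k - 1))" if "r \<in> {0..x}" for r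
        using that \<omega> by (intro mult_nonneg_nonneg) auto
    qed (use True in auto)
    finally show ?thesis using True k0 by (simp add: zero_power)
  qed
  show "\<And>X. X \<in> range atMost \<Longrightarrow> emeasure ?L X = emeasure (density lborel (\<lambda>r. ennreal (?w r))) X"
    using vol int by auto
  show "Int_stable (range atMost :: real set set)"
    by (auto simp: Int_stable_def)
  show "sets ?L = sigma_sets UNIV (range atMost)" by (simp add: borel_eq_atMost)
  show "sets (density lborel (\<lambda>r. ennreal (?w r))) = sigma_sets UNIV (range atMost)"
    by (simp add: borel_eq_atMost)
  show "(\<Union>n. {..real n}) = UNIV" by (auto simp: real_arch_simple)
  show "emeasure ?L {..real n} \<noteq> \<infinity>" for n by (simp add: vol)
qed auto

lemma nn_integral_radial:
  fixes q :: "real \<Rightarrow> ennreal"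
  assumes k: "k = CARD('n::finite)" and [measurable]: "q \<in> borel_measurable borel"
  shows "(\<integral>\<^sup>+ y. q (norm (y :: real^'n)) \<partial>lborel) =
    (\<integral>\<^sup>+ r. ennreal (if 0 < r then unit_ball_vol (real k) * (real k * r ^ (k - 1)) else 0) * q r \<partial>lborel)"
proof -
  have "(\<integral>\<^sup>+ y. q (norm (y :: real^'n)) \<partial>lborel) = (\<integral>\<^sup>+ r. q r \<partial>distr lborel borel (norm :: real^'n \<Rightarrow> real))"
    by (subst nn_integral_distr) auto
  then show ?thesis unfolding distr_norm_lborel[OF k] by (simp add: nn_integral_density)
qed

text \<open>Innovations are whitened to this form. Absolute continuity and positivity of the density give all the
  properties of a spherical law.\<close>

locale spherical_density =
  fixes g :: "real \<Rightarrow> real" and c0 :: real and N :: "(real^'k::{finite,wellorder}) measure"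
  assumes N_def: "N = density lborel (\<lambda>y. ennreal (c0 * g (norm y)))"
    and prob: "prob_space N"
    and g_measurable [measurable]: "g \<in> borel_measurable borel"
    and g_pos: "AE r in lborel. 0 < r \<longrightarrow> 0 < g r"
    and c0_pos: "0 < c0"
begin

lemma density_orthogonal:
  assumes f: "orthogonal_transformation f"
  shows "distr N borel f = N"
proof (rule measure_eqI)
  have lin: "linear f" using f by (simp add: orthogonal_transformation)
  have nf: "norm (f y) = norm y" for y using f by (simp add: orthogonal_transformation)
  have [measurable]: "f \<in> borel_measurable borel"
    using lin by (intro borel_measurable_continuous_onI linear_continuous_on linear_conv_bounded_linear[THEN iffD1])
  have "orthogonal_matrix (matrix f)" using f by (simp add: orthogonal_transformation_matrix)
  then have d: "\<bar>det (matrix f)\<bar> = 1" using det_orthogonal_matrix by fastforce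
  fix A assume "A \<in> sets (distr N borel f)"
  then have A [measurable]: "A \<in> sets borel" by simp
  have "emeasure (distr N borel f) A = emeasure N (f -` A)"
    by (subst emeasure_distr) (auto simp: N_def)
  also have "\<dots> = (\<integral>\<^sup>+ y. ennreal (c0 * g (norm y)) * indicator (f -` A) y \<partial>lborel)"
  proof -
    have "f -` A \<inter> space borel \<in> sets borel" by (intro measurable_sets[of f borel borel] A) simp
    then show ?thesis unfolding N_def by (subst emeasure_density) auto
  qed
  also have "\<dots> = (\<integral>\<^sup>+ y. (\<lambda>x. ennreal (c0 * g (norm x)) * indicator A x) (f y) \<partial>lborel)"
    by (intro nn_integral_cong) (simp add: nf indicator_def)
  also have "\<dots> = (\<integral>\<^sup>+ x. ennreal (c0 * g (norm x)) * indicator A x \<partial>lborel)"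
    using d by (subst nn_integral_linear_image[OF lin]) auto
  also have "\<dots> = emeasure N A" unfolding N_def by (subst emeasure_density) auto
  finally show "emeasure (distr N borel f) A = emeasure N A" .
qed (simp add: N_def)

lemma integral_orthogonal:
  fixes h :: "real^'k::{finite,wellorder} \<Rightarrow> real"
  assumes f: "orthogonal_transformation f" and h: "h \<in> borel_measurable borel"
  shows "(\<integral>y. h (f y) \<partial>N) = (\<integral>y. h y \<partial>N)"
proof -
  have lin: "linear f" using f by (simp add: orthogonal_transformation)
  have "f \<in> borel_measurable borel"
    using lin by (intro borel_measurable_continuous_onI linear_continuous_on linear_conv_bounded_linear[THEN iffD1])
  then have "f \<in> measurable N borel" by (simp add: N_def)
  then have "(\<integral>y. h y \<partial>distr N borel f) = (\<integral>y. h (f y) \<partial>N)"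
    by (rule integral_distr[OF _ h])
  then show ?thesis unfolding density_orthogonal[OF f] by (rule sym)
qed

lemma AE_g_norm_pos: "AE y in (lborel :: (real^'k::{finite,wellorder}) measure). 0 < g (norm y)"
proof -
  have "AE r in distr lborel borel (norm :: real^'k::{finite,wellorder} \<Rightarrow> real). 0 < r \<longrightarrow> 0 < g r"
    unfolding distr_norm_lborel[OF refl] by (subst AE_density) (use g_pos in \<open>auto elim: eventually_mono\<close>)
  then have "AE y in (lborel :: (real^'k::{finite,wellorder}) measure). 0 < norm y \<longrightarrow> 0 < g (norm y)"
    by (subst (asm) AE_distr_iff) auto
  moreover have "AE y in (lborel :: (real^'k::{finite,wellorder}) measure). y \<noteq> 0" by (rule AE_lborel_singleton)
  ultimately show ?thesis by eventually_elim auto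
qed

lemma abs_continuous_N: "A \<in> null_sets lborel \<Longrightarrow> A \<in> null_sets N"
  using absolutely_continuousI_density[of "\<lambda>y. ennreal (c0 * g (norm y))" lborel]
  unfolding N_def absolutely_continuous_def by auto

lemma charges_open_N:
  assumes U: "open U" "U \<noteq> {}" shows "0 < measure N U"
proof -
  interpret prob_space N by (rule prob)
  have UN: "U \<in> sets borel" using U by auto
  obtain x r where xr: "0 < r" "ball x r \<subseteq> U" using U by (meson ex_in_conv open_contains_ball)
  have "measure N U \<noteq> 0"
  proof
    assume "measure N U = 0"
    then have "emeasure N U = 0" by (simp add: emeasure_eq_measure)
    then have "(\<integral>\<^sup>+ y. ennreal (c0 * g (norm y)) * indicator U y \<partial>lborel) = 0"
      unfolding N_def using UN by (subst (asm) emeasure_density) auto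
    then have "AE y in lborel. ennreal (c0 * g (norm y)) * indicator U y = 0"
      using UN by (subst (asm) nn_integral_0_iff_AE) auto
    with AE_g_norm_pos have "AE y in lborel. y \<notin> U"
      by eventually_elim (use c0_pos in \<open>auto simp: indicator_def ennreal_eq_0_iff mult_le_0_iff\<close>)
    then have "emeasure lborel U = 0" using UN by (subst (asm) AE_iff_measurable[OF _ refl]) auto
    then have "emeasure lborel (ball x r) = 0"
      using emeasure_mono[OF xr(2), of lborel] UN by simp
    then show False using xr(1) unit_ball_vol_pos[of "real CARD('k)"] by (simp add: emeasure_ball)
  qed
  then show ?thesis by (simp add: zero_less_measure_iff)
qed

text \<open>Reflections of a coordinate kill the mixed moments, transpositions of coordinates equate the others,
  and the trace is 1.\<close>

lemma second_moment_N:
  "(\<integral>y. sgn y $ a * sgn y $ b \<partial>N) = (if a = b then 1 / real CARD('k) else 0)"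
proof -
  interpret prob_space N by (rule prob)
  have mN: "h \<in> borel_measurable borel \<Longrightarrow> h \<in> borel_measurable N" for h :: "_ \<Rightarrow> real"
    by (simp add: N_def)
  have m: "(\<lambda>y :: real^'k::{finite,wellorder}. sgn y $ a * sgn y $ b) \<in> borel_measurable borel" for a b by measurable
  have neg: "(\<integral>y. sgn y $ a * sgn y $ b \<partial>N) = 0" if "a \<noteq> b" for a b
  proof -
    define f where "f y = (\<chi> j. if j = a then - y $ j else y $ j)" for y :: "real^'k::{finite,wellorder}"
    have "linear f" by (rule linearI) (auto simp: f_def vec_eq_iff)
    moreover have nf: "norm (f y) = norm y" for y
      unfolding norm_vec_def f_def by (intro L2_set_cong) auto
    ultimately have f: "orthogonal_transformation f" by (simp add: orthogonal_transformation)
    have "(\<integral>y. sgn y $ a * sgn y $ b \<partial>N) = (\<integral>y. sgn (f y) $ a * sgn (f y) $ b \<partial>N)"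
      by (rule integral_orthogonal[OF f m, symmetric])
    also have "\<dots> = (\<integral>y. - (sgn y $ a * sgn y $ b) \<partial>N)"
    proof (intro Bochner_Integration.integral_cong refl)
      fix y
      have "f y $ a = - y $ a" "f y $ b = y $ b" using that by (auto simp: f_def)
      then show "sgn (f y) $ a * sgn (f y) $ b = - (sgn y $ a * sgn y $ b)" by (simp add: sgn_div_norm nf)
    qed
    finally show ?thesis by simp
  qed
  have eq: "(\<integral>y. sgn y $ a * sgn y $ a \<partial>N) = (\<integral>y. sgn y $ b * sgn y $ b \<partial>N)" for a b
  proof -
    define f where "f y = (\<chi> j. y $ (Transposition.transpose a b j))" for y :: "real^'k::{finite,wellorder}"
    have "linear f" by (rule linearI) (auto simp: f_def vec_eq_iff)
    moreover have nf: "norm (f y) = norm y" for y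
    proof -
      have "(norm (f y))\<^sup>2 = (\<Sum>j\<in>UNIV. (y $ (Transposition.transpose a b j))\<^sup>2)"
        unfolding norm_real_vec_sq f_def by simp
      also have "\<dots> = (norm y)\<^sup>2"
        unfolding norm_real_vec_sq
        using sum.permute[OF permutes_swap_id[of a UNIV b], of "\<lambda>j. (y $ j)\<^sup>2"] by (simp add: comp_def)
      finally show ?thesis by (simp add: power2_eq_iff_nonneg)
    qed
    ultimately have f: "orthogonal_transformation f" by (simp add: orthogonal_transformation)
    have "(\<integral>y. sgn y $ a * sgn y $ a \<partial>N) = (\<integral>y. sgn (f y) $ a * sgn (f y) $ a \<partial>N)"
      by (rule integral_orthogonal[OF f m, symmetric])
    also have "\<dots> = (\<integral>y. sgn y $ b * sgn y $ b \<partial>N)"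
    proof (intro Bochner_Integration.integral_cong refl)
      fix y
      have "f y $ a = y $ b" by (simp add: f_def)
      then show "sgn (f y) $ a * sgn (f y) $ a = sgn y $ b * sgn y $ b" by (simp add: sgn_div_norm nf)
    qed
    finally show ?thesis .
  qed
  have int: "integrable N (\<lambda>y. sgn y $ a * sgn y $ a)" for a
  proof (rule integrable_const_bound[where B = 1])
    show "AE y in N. norm (sgn y $ a * sgn y $ a) \<le> 1"
      unfolding real_norm_def abs_mult by (intro AE_I2 mult_le_one abs_sgn_nth_le) auto
  qed (rule mN[OF m])
  have nz: "AE y in N. y \<noteq> 0"
  proof (rule AE_I')
    have "{0 :: real^'k::{finite,wellorder}} \<in> null_sets lborel" by (rule null_setsI) auto
    then show "{0 :: real^'k::{finite,wellorder}} \<in> null_sets N" by (rule abs_continuous_N)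
  qed auto
  have "(\<Sum>c\<in>UNIV. \<integral>y. sgn y $ c * sgn y $ c \<partial>N) = (\<integral>y. (\<Sum>c\<in>UNIV. sgn y $ c * sgn y $ c) \<partial>N)"
    by (rule Bochner_Integration.integral_sum[symmetric]) (rule int)
  also have "\<dots> = (\<integral>y. 1 \<partial>N)"
  proof (rule integral_cong_AE)
    show "AE y in N. (\<Sum>c\<in>UNIV. sgn y $ c * sgn y $ c) = 1"
      using nz
    proof eventually_elim
      case (elim y)
      have "(norm (sgn y))\<^sup>2 = 1" using elim by (simp add: norm_sgn)
      then show ?case by (simp only: norm_real_vec_sq) (simp only: power2_eq_square)
    qed
  qed (auto intro!: mN m borel_measurable_sum)
  finally have "(\<Sum>c\<in>UNIV. \<integral>y. sgn y $ c * sgn y $ c \<partial>N) = 1" by (simp add: prob_space)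
  moreover have "(\<Sum>c\<in>UNIV. \<integral>y. sgn y $ c * sgn y $ c \<partial>N) = (\<Sum>c\<in>(UNIV :: 'k set). \<integral>y. sgn y $ a * sgn y $ a \<partial>N)"
    by (intro sum.cong refl eq)
  ultimately have "(\<integral>y. sgn y $ a * sgn y $ a \<partial>N) = 1 / real CARD('k)"
    by (simp add: eq_divide_eq mult.commute)
  then show ?thesis using neg by auto
qed

lemma spherical_law_N: "spherical_law N"
proof -
  interpret prob_space N by (rule prob)
  have um: "orthogonal_transformation (uminus :: real^'k::{finite,wellorder} \<Rightarrow> _)"
    by (simp add: orthogonal_transformation linear_uminus)
  have "distr N N uminus = distr N borel uminus" by (rule distr_cong) (auto simp: N_def)
  then have sym: "distr N N uminus = N" by (simp add: density_orthogonal[OF um])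
  show ?thesis
  proof unfold_locales
    show "sets N = sets borel" by (simp add: N_def)
    show "(\<integral>y. sgn y $ a * sgn y $ b \<partial>N) = (if a = b then 1 / real CARD('k) else 0)" for a b
      by (rule second_moment_N)
    show "0 < measure N U" if "open U" "U \<noteq> {}" for U using that by (rule charges_open_N)
    show "A \<in> null_sets N" if "A \<in> null_sets lborel" for A using that by (rule abs_continuous_N)
    show "distr N N uminus = N" by (rule sym)
  qed
qed

end

section \<open>Linear transformations of the sample\<close>

lemma norm_vec_mat: "norm (vec_mat M) = norm M"
proof -
  have "(norm (vec_mat M))\<^sup>2 = (\<Sum>c\<in>UNIV. \<Sum>r\<in>UNIV. (M $ r $ c)\<^sup>2)"
    by (simp add: norm_real_vec_sq vec_mat_def sum.cartesian_product case_prod_beta)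
  also have "\<dots> = (norm M)\<^sup>2" unfolding norm_matrix_sq by (rule sum.swap)
  finally show ?thesis by (simp add: power2_eq_iff_nonneg)
qed

lemma sgn_scaleR_pos: "0 < s \<Longrightarrow> sgn (s *\<^sub>R x) = sgn x" for x :: "'a::real_normed_vector"
  by (simp add: sgn_scaleR)

lemma scaleR_matrix_vector: "(s *\<^sub>R A) *v x = s *\<^sub>R (A *v x)" for A :: "real^'n^'m"
  by (rule scaleR_matrix_vector_assoc[symmetric])

text \<open>The signs of \<open>C y\<close> and of \<open>C T z\<close> coincide; division by the first diagonal entry of \<open>T\<close> restores the
  normalization.\<close>

lemma tyler_solution_transform:
  assumes T: "pos_triangular T" and y: "\<And>t. t \<in> {1..n} \<Longrightarrow> y t = T *v z t"
    and C: "tyler_solution n y C"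
  shows "tyler_solution n z ((1 / T $ first_index $ first_index) *\<^sub>R (C ** T))"
proof -
  let ?s = "T $ first_index $ first_index"
  have s: "0 < ?s" using T by (simp add: pos_triangular_def)
  have sg: "sgn (((1 / ?s) *\<^sub>R (C ** T)) *v z t) = sgn (C *v y t)" if "t \<in> {1..n}" for t
    using s y[OF that] by (simp only: scaleR_matrix_vector sgn_scaleR_pos zero_less_divide_1_iff matrix_vector_mul_assoc)
  have pC: "pos_triangular C" using C by (simp add: tyler_solution_def)
  have "pos_triangular ((1 / ?s) *\<^sub>R (C ** T))"
    using s by (intro pos_triangular_scaleR pos_triangular_mult pC T) simp
  moreover have "((1 / ?s) *\<^sub>R (C ** T)) $ first_index $ first_index = 1"
  proof -
    have "(C ** T) $ first_index $ first_index = C $ first_index $ first_index * ?s"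
      using upper_triangular_mult(2)[of C T first_index] pC T by (simp add: pos_triangular_def)
    then show ?thesis using C less_imp_neq[OF s] by (simp add: tyler_solution_def)
  qed
  moreover have "avg n (\<lambda>x. sgn (((1 / ?s) *\<^sub>R (C ** T)) *v x) $ a * sgn (((1 / ?s) *\<^sub>R (C ** T)) *v x) $ b) z =
      avg n (\<lambda>x. sgn (C *v x) $ a * sgn (C *v x) $ b) y" for a b
    unfolding avg_def by (intro arg_cong2[where f = "(/)"] sum.cong refl) (simp only: sg)
  ultimately show ?thesis using C unfolding tyler_solution_def by simp
qed

lemma rank_among_cong:
  assumes "\<And>s. s \<in> {1..n} \<Longrightarrow> d s = c * d' s" "0 < c" "t \<in> {1..n}"
  shows "rank_among n d t = rank_among n d' t"
  unfolding rank_among_def using assms by (intro arg_cong[where f = card]) auto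

text \<open>Signs and ranks of the transformed observations are the same for both samples, as multiplication by
  the normalizing factor does not affect them. Only the conjugating matrix changes, and its scalar factor
  cancels.\<close>

lemma rank_cross_cov_transform:
  assumes T: "pos_triangular T" and N: "T ** N = mat 1" "N ** T = mat 1"
    and y: "\<And>t. t \<in> {1..n} \<Longrightarrow> y t = T *v z t"
    and C: "tyler_solution n y C" "\<And>C'. tyler_solution n y C' \<Longrightarrow> C' = C"
  shows "rank_cross_cov K1 K2 i n z = transpose T ** rank_cross_cov K1 K2 i n y ** transpose N"
proof -
  let ?\<kappa> = "first_index"
  define s where "s = T $ ?\<kappa> $ ?\<kappa>"
  have s: "0 < s" using T by (simp add: s_def pos_triangular_def)
  define C' where "C' = (1 / s) *\<^sub>R (C ** T)"
  have sol: "tyler_solution n z C'" unfolding C'_def s_def by (rule tyler_solution_transform[OF T y C(1)])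
  have pN: "pos_triangular N"
  proof -
    obtain N' where "pos_triangular N'" "T ** N' = mat 1" using pos_triangular_inverse[OF T] by blast
    moreover from this have "N = N'" by (metis N(2) matrix_mul_assoc matrix_mul_lid matrix_mul_rid)
    ultimately show ?thesis by simp
  qed
  have N1: "N $ ?\<kappa> $ ?\<kappa> = 1 / s"
  proof -
    have "T $ ?\<kappa> $ ?\<kappa> * N $ ?\<kappa> $ ?\<kappa> = (T ** N) $ ?\<kappa> $ ?\<kappa>"
      using upper_triangular_mult(2)[of T N ?\<kappa>] T pN by (simp add: pos_triangular_def)
    then show ?thesis using s unfolding N(1) mat_1_nth s_def by (simp add: eq_divide_eq mult.commute)
  qed
  have uniq: "C'' = C'" if "tyler_solution n z C''" for C''
  proof -
    have zy: "z t = N *v y t" if "t \<in> {1..n}" for t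
      using y[OF that] N by (simp add: matrix_vector_mul_assoc)
    have "tyler_solution n y ((1 / N $ ?\<kappa> $ ?\<kappa>) *\<^sub>R (C'' ** N))"
      by (rule tyler_solution_transform[OF pN zy that])
    then have "s *\<^sub>R (C'' ** N) = C" using C(2) N1 by simp
    then have "C' = (1 / s) *\<^sub>R ((s *\<^sub>R (C'' ** N)) ** T)" by (simp add: C'_def)
    also have "\<dots> = C'' ** (N ** T)" using s by (simp add: scaleR_matrix_mult matrix_mul_assoc)
    finally show ?thesis by (simp add: N)
  qed
  have tz: "tyler_matrix n z = C'" by (rule tyler_matrixI[OF sol uniq])
  have ty: "tyler_matrix n y = C" by (rule tyler_matrixI[OF C])
  have C'z: "C' *v z t = (1 / s) *\<^sub>R (C *v y t)" if "t \<in> {1..n}" for t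
    using y[OF that] by (simp add: C'_def scaleR_matrix_vector matrix_vector_mul_assoc)
  have sg: "sgn (C' *v z t) = sgn (C *v y t)" if "t \<in> {1..n}" for t
    using s by (simp only: C'z[OF that] sgn_scaleR_pos zero_less_divide_1_iff)
  have rk: "rank_among n (\<lambda>t. norm (C' *v z t)) t = rank_among n (\<lambda>t. norm (C *v y t)) t" if "t \<in> {1..n}" for t
    using s that by (intro rank_among_cong[where c = "1 / s"]) (auto simp: C'z)
  obtain E where E: "C ** E = mat 1" "E ** C = mat 1"
    using C(1) pos_triangular_inverse unfolding tyler_solution_def by metis
  have tE: "transpose C ** transpose E = mat 1" "transpose E ** transpose C = mat 1"
    using E by (metis matrix_transpose_mul transpose_mat)+
  have tN: "transpose T ** transpose N = mat 1" "transpose N ** transpose T = mat 1"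
    using N by (metis matrix_transpose_mul transpose_mat)+
  have invC: "matrix_inv (transpose C) = transpose E" using tE by (rule matrix_inv_unique)
  have trC': "transpose C' = (1 / s) *\<^sub>R (transpose T ** transpose C)"
    by (simp add: C'_def vec_eq_iff transpose_def matrix_mult_nth mult.commute)
  have invC': "matrix_inv (transpose C') = s *\<^sub>R (transpose E ** transpose N)"
  proof (rule matrix_inv_unique)
    show "transpose C' ** (s *\<^sub>R (transpose E ** transpose N)) = mat 1"
    proof -
      have "transpose C' ** (s *\<^sub>R (transpose E ** transpose N)) =
          (s * (1 / s)) *\<^sub>R (transpose T ** (transpose C ** transpose E) ** transpose N)"
        unfolding trC' by (simp only: scaleR_matrix_mult matrix_mult_scaleR scaleR_scaleR matrix_mul_assoc)
      then show ?thesis using s by (simp add: tE tN)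
    qed
    show "(s *\<^sub>R (transpose E ** transpose N)) ** transpose C' = mat 1"
    proof -
      have "(s *\<^sub>R (transpose E ** transpose N)) ** transpose C' =
          ((1 / s) * s) *\<^sub>R (transpose E ** (transpose N ** transpose T) ** transpose C)"
        unfolding trC' by (simp only: scaleR_matrix_mult matrix_mult_scaleR scaleR_scaleR matrix_mul_assoc)
      then show ?thesis using s by (simp add: tE tN)
    qed
  qed
  define S where "S = (1 / (real n - real i)) *\<^sub>R (\<Sum>t=i+1..n.
    (K1 (real (rank_among n (\<lambda>t. norm (C *v y t)) t) / (real n + 1)) *
     K2 (real (rank_among n (\<lambda>t. norm (C *v y t)) (t - i)) / (real n + 1))) *\<^sub>R
    outer_prod (sgn (C *v y t)) (sgn (C *v y (t - i))))"
  have Sz: "(1 / (real n - real i)) *\<^sub>R (\<Sum>t=i+1..n.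
    (K1 (real (rank_among n (\<lambda>t. norm (C' *v z t)) t) / (real n + 1)) *
     K2 (real (rank_among n (\<lambda>t. norm (C' *v z t)) (t - i)) / (real n + 1))) *\<^sub>R
    outer_prod (sgn (C' *v z t)) (sgn (C' *v z (t - i)))) = S"
    unfolding S_def
  proof (intro arg_cong[where f = "scaleR (1 / (real n - real i))"] sum.cong refl)
    fix t assume "t \<in> {i+1..n}"
    then have t: "t \<in> {1..n}" "t - i \<in> {1..n}" by auto
    show "(K1 (real (rank_among n (\<lambda>t. norm (C' *v z t)) t) / (real n + 1)) *
     K2 (real (rank_among n (\<lambda>t. norm (C' *v z t)) (t - i)) / (real n + 1))) *\<^sub>R
    outer_prod (sgn (C' *v z t)) (sgn (C' *v z (t - i))) =
    (K1 (real (rank_among n (\<lambda>t. norm (C *v y t)) t) / (real n + 1)) *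
     K2 (real (rank_among n (\<lambda>t. norm (C *v y t)) (t - i)) / (real n + 1))) *\<^sub>R
    outer_prod (sgn (C *v y t)) (sgn (C *v y (t - i)))"
      unfolding sg[OF t(1)] sg[OF t(2)] rk[OF t(1)] rk[OF t(2)] by (rule refl)
  qed
  have "rank_cross_cov K1 K2 i n z = transpose C' ** S ** (s *\<^sub>R (transpose E ** transpose N))"
    unfolding rank_cross_cov_def Let_def tz Sz invC' by (rule refl)
  also have "\<dots> = (s * (1 / s)) *\<^sub>R (transpose T ** (transpose C ** S ** transpose E) ** transpose N)"
    unfolding trC' by (simp only: scaleR_matrix_mult matrix_mult_scaleR scaleR_scaleR matrix_mul_assoc)
  also have "transpose C ** S ** transpose E = rank_cross_cov K1 K2 i n y"
    unfolding rank_cross_cov_def Let_def ty S_def invC by (rule refl)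
  finally show ?thesis using s by simp
qed

lemma rank_cross_cov_score_cong:
  assumes "\<And>u. u \<in> {0..1} \<Longrightarrow> K1 u = K1' u" "\<And>u. u \<in> {0..1} \<Longrightarrow> K2 u = K2' u"
  shows "rank_cross_cov K1 K2 i n z = rank_cross_cov K1' K2' i n z"
proof -
  have "rank_among n d t \<le> n" for d t
    unfolding rank_among_def by (rule order_trans[OF card_mono[of "{1..n}"]]) auto
  then have "real (rank_among n d t) / (real n + 1) \<in> {0..1}" for d t
    by (simp add: divide_le_eq_1 le_SucI) (metis add_increasing2 of_nat_le_iff zero_le_one)
  then show ?thesis unfolding rank_cross_cov_def Let_def by (simp only: assms)
qed

section \<open>Residuals are innovations\<close>

text \<open>With vanishing initial values the recursion for the residuals is the model equation solved for the
  innovation.\<close>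

lemma residual_eq_innovation:
  fixes A B :: "nat \<Rightarrow> real^'k^'k"
  assumes orders: "p0 \<le> p1" "q0 \<le> q1"
    and vanishing: "\<forall>l\<in>{p0<..p1}. A l = 0" "\<forall>l\<in>{q0<..q1}. B l = 0"
    and eq: "\<And>t. t \<in> {1..n} \<Longrightarrow> varma_equation p1 q1 A B e x t"
  shows "t \<in> {1..n} \<Longrightarrow> residual p0 q0 A B x t = e t"
proof (induction t rule: less_induct)
  case (less t)
  have split: "(\<Sum>l=1..p1. A l *v v l) = (\<Sum>l=1..p0. A l *v v l)"
    "(\<Sum>l=1..q1. B l *v v l) = (\<Sum>l=1..q0. B l *v v l)" for v
    using orders vanishing by (intro sum.mono_neutral_right; auto)+
  have ma: "(\<Sum>l\<in>{1..q0}. if l < t then B l *v residual p0 q0 A B x (t - l) else 0) =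
      (\<Sum>l\<in>{1..q0}. B l *v lagged e t l)"
  proof (rule sum.cong)
    fix l assume l: "l \<in> {1..q0}"
    show "(if l < t then B l *v residual p0 q0 A B x (t - l) else 0) = B l *v lagged e t l"
    proof (cases "l < t")
      case True
      then have "residual p0 q0 A B x (t - l) = e (t - l)" using l less.prems by (intro less.IH) auto
      then show ?thesis using True by (simp add: lagged_def)
    qed (simp add: lagged_def)
  qed simp
  have "residual p0 q0 A B x t = x t - (\<Sum>l=1..p0. A l *v lagged x t l) - (\<Sum>l\<in>{1..q0}. B l *v lagged e t l)"
    using less.prems by (subst residual.simps) (simp only: ma, simp)
  also have "\<dots> = e t" using eq[OF less.prems] unfolding varma_equation_def split by (simp add: algebra_simps)
  finally show ?case .
qed

section \<open>Elliptical innovations\<close>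

lemma inv_sqrt_mat_inverse:
  assumes S: "sym_pos_def S"
  shows "inv_sqrt_mat S ** sqrt_mat S = mat 1" "sqrt_mat S ** inv_sqrt_mat S = mat 1"
proof -
  obtain N where N: "inv_sqrt_mat S ** N = mat 1" "N ** inv_sqrt_mat S = mat 1"
    using pos_triangular_inverse[OF inv_sqrt_mat_properties(1)[OF S]] by blast
  have "sqrt_mat S = N" unfolding sqrt_mat_def by (rule matrix_inv_unique[OF N])
  then show "inv_sqrt_mat S ** sqrt_mat S = mat 1" "sqrt_mat S ** inv_sqrt_mat S = mat 1"
    using N by simp_all
qed

lemma det_inv_sqrt_mat:
  fixes S :: "real^'k::{finite,wellorder}^'k::{finite,wellorder}"
  assumes S: "sym_pos_def S"
  shows "det S powr (- 1 / 2) = det (inv_sqrt_mat S)"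
proof -
  let ?T = "inv_sqrt_mat S"
  have dT: "0 < det ?T" by (intro det_pos_triangular_pos inv_sqrt_mat_properties(1) S)
  obtain R :: "real^'k::{finite,wellorder}^'k::{finite,wellorder}" where R: "R ** S ** transpose R = mat 1" using cholesky_exists[OF S] by blast
  have "det R * det S * det R = 1"
    using arg_cong[OF R, of det] by (simp only: det_mul det_transpose det_I)
  then have "invertible S" by (auto simp: invertible_det_nz)
  then obtain B :: "real^'k::{finite,wellorder}^'k::{finite,wellorder}" where B: "S ** B = mat 1" "B ** S = mat 1" by (auto simp: invertible_def)
  have inv: "S ** (transpose ?T ** ?T) = mat 1"
    using B(1) unfolding matrix_inv_unique[OF B, symmetric] inv_sqrt_mat_properties(2)[OF S] .
  have "det S * (det ?T * det ?T) = 1"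
    using arg_cong[OF inv, of det] by (simp only: det_mul det_transpose det_I)
  then have "det S = (1 / det ?T)\<^sup>2" using dT by (simp add: power2_eq_square field_simps)
  moreover have "((1 / det ?T)\<^sup>2) powr (- 1 / 2) = det ?T"
  proof -
    have "((1 / det ?T)\<^sup>2) powr (- 1 / 2) = ((1 / det ?T) powr 2) powr (- 1 / 2)"
      using dT by simp
    also have "\<dots> = det ?T" using dT by (simp only: powr_powr) (simp add: powr_minus)
    finally show ?thesis .
  qed
  ultimately show ?thesis by simp
qed

lemma elliptical_density_eq:
  assumes S: "sym_pos_def S"
  shows "elliptical_density S f z = det (inv_sqrt_mat S) *
    (inverse (\<integral>y. f (norm (y :: real^'k::{finite,wellorder})) \<partial>lborel) *
     f (norm (inv_sqrt_mat S *v (z :: real^'k::{finite,wellorder}))))"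
proof -
  let ?T = "inv_sqrt_mat S"
  have "z \<bullet> (matrix_inv S *v z) = (?T *v z) \<bullet> (?T *v z)"
    unfolding inv_sqrt_mat_properties(2)[OF S]
    by (metis dot_lmul_matrix matrix_vector_mul_assoc vector_transpose_matrix)
  then show ?thesis
    unfolding elliptical_density_def det_inv_sqrt_mat[OF S] by (simp add: norm_eq_sqrt_inner mult_ac)
qed

text \<open>The values of a radial density at nonpositive arguments are arbitrary, so that it need not be
  measurable as a function on the real line.\<close>

definition on_pos_reals :: "(real \<Rightarrow> real) \<Rightarrow> real \<Rightarrow> real" where
  "on_pos_reals f r = (if 0 < r then f r else 0)"

lemma on_pos_reals_measurable:
  assumes "assumption_B1 k f" shows "on_pos_reals f \<in> borel_measurable borel"
proof -
  have [measurable]: "(\<lambda>r. indicator {0<..} r *\<^sub>R (r ^ (k - 1) * f r)) \<in> borel_measurable borel"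
    using assms borel_measurable_integrable[of lborel "\<lambda>r. indicator {0<..} r *\<^sub>R (r ^ (k - 1) * f r)"]
    by (simp add: assumption_B1_def set_integrable_def)
  have "on_pos_reals f = (\<lambda>r. indicator {0<..} r *\<^sub>R (r ^ (k - 1) * f r) / r ^ (k - 1))"
    by (auto simp: on_pos_reals_def fun_eq_iff)
  also have "\<dots> \<in> borel_measurable borel" by measurable
  finally show ?thesis .
qed

text \<open>Change of variables: the determinant in the elliptical density cancels against the Jacobian. At the
  origin, a null set, the two densities may differ.\<close>

lemma whitened_law:
  fixes S :: "real^'k::{finite,wellorder}^'k::{finite,wellorder}"
  assumes S: "sym_pos_def S" and B1: "assumption_B1 CARD('k) f"
    and D: "distributed M lborel e (\<lambda>z. ennreal (elliptical_density S f z))"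
  shows "distr M borel (\<lambda>\<omega>. inv_sqrt_mat S *v e \<omega>) = density lborel (\<lambda>y.
    ennreal (inverse (\<integral>y. f (norm (y :: real^'k::{finite,wellorder})) \<partial>lborel) * on_pos_reals f (norm y)))"
    (is "_ = density lborel ?\<phi>")
proof (rule measure_eqI)
  let ?T = "inv_sqrt_mat S"
  have dT: "0 < det ?T" by (intro det_pos_triangular_pos inv_sqrt_mat_properties(1) S)
  have [measurable]: "on_pos_reals f \<in> borel_measurable borel" by (rule on_pos_reals_measurable[OF B1])
  have e: "e \<in> borel_measurable M" using D by (simp add: distributed_def)
  have [measurable]: "(\<lambda>z. ?T *v z) \<in> borel_measurable borel"
    by (intro borel_measurable_continuous_onI continuous_intros)
  have Te: "(\<lambda>\<omega>. ?T *v e \<omega>) \<in> borel_measurable M" by (rule measurable_compose[OF e]) measurable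
  fix A assume "A \<in> sets (distr M borel (\<lambda>\<omega>. ?T *v e \<omega>))"
  then have A [measurable]: "A \<in> sets borel" by simp
  have mA: "(\<lambda>z. indicator A (?T *v z) :: ennreal) \<in> borel_measurable lborel"
    by measurable
  have "emeasure (distr M borel (\<lambda>\<omega>. ?T *v e \<omega>)) A = (\<integral>\<^sup>+ x. indicator A x \<partial>distr M borel (\<lambda>\<omega>. ?T *v e \<omega>))"
    by simp
  also have "\<dots> = (\<integral>\<^sup>+ \<omega>. indicator A (?T *v e \<omega>) \<partial>M)"
    by (rule nn_integral_distr[OF Te]) simp
  also have "\<dots> = (\<integral>\<^sup>+ z. ennreal (elliptical_density S f z) * indicator A (?T *v z) \<partial>lborel)"
    by (rule distributed_nn_integral[OF D mA, symmetric])
  also have "\<dots> = (\<integral>\<^sup>+ z. ennreal (det ?T) * (?\<phi> (?T *v z) * indicator A (?T *v z)) \<partial>lborel)"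
  proof (rule nn_integral_cong_AE)
    have "AE z in lborel. z \<noteq> (0 :: real^'k::{finite,wellorder})" by (rule AE_lborel_singleton)
    then show "AE z in lborel. ennreal (elliptical_density S f z) * indicator A (?T *v z) =
        ennreal (det ?T) * (?\<phi> (?T *v z) * indicator A (?T *v z))"
    proof eventually_elim
      case (elim z)
      have "?T *v z \<noteq> 0"
      proof
        assume "?T *v z = 0"
        then have "sqrt_mat S *v (?T *v z) = 0" by simp
        then show False using elim by (simp add: matrix_vector_mul_assoc inv_sqrt_mat_inverse[OF S])
      qed
      then show ?case using dT
        by (simp add: elliptical_density_eq[OF S] on_pos_reals_def ennreal_mult' mult.assoc)
    qed
  qed
  also have "\<dots> = ennreal (det ?T) * (\<integral>\<^sup>+ z. ?\<phi> (?T *v z) * indicator A (?T *v z) \<partial>lborel)"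
    by (rule nn_integral_cmult) measurable
  also have "\<dots> = ennreal (det ?T) * (ennreal (1 / det ?T) * (\<integral>\<^sup>+ y. ?\<phi> y * indicator A y \<partial>lborel))"
    using dT nn_integral_linear_image[OF matrix_vector_mul_linear[of ?T], of "\<lambda>y. ?\<phi> y * indicator A y"]
    by (simp add: matrix_of_matrix_vector_mul)
  also have "\<dots> = (\<integral>\<^sup>+ y. ?\<phi> y * indicator A y \<partial>lborel)"
    using dT by (simp add: mult.assoc[symmetric] flip: ennreal_mult)
  also have "\<dots> = emeasure (density lborel ?\<phi>) A"
    by (rule emeasure_density[symmetric]) measurable
  finally show "emeasure (distr M borel (\<lambda>\<omega>. ?T *v e \<omega>)) A = emeasure (density lborel ?\<phi>) A" .
qed simp

lemma whitened_spherical_density: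
  fixes N :: "(real^'k::{finite,wellorder}) measure"
  defines "c \<equiv> \<lambda>f. inverse (\<integral>y. f (norm (y :: real^'k::{finite,wellorder})) \<partial>lborel)"
  assumes B1: "assumption_B1 CARD('k) f" and prob: "prob_space N"
    and N: "N = density lborel (\<lambda>y. ennreal (c f * on_pos_reals f (norm y)))"
  shows "spherical_density (on_pos_reals f) (c f) N"
proof (rule spherical_density.intro)
  show gm: "on_pos_reals f \<in> borel_measurable borel" by (rule on_pos_reals_measurable[OF B1])
  show "AE r in lborel. 0 < r \<longrightarrow> 0 < on_pos_reals f r"
    using B1 unfolding assumption_B1_def on_pos_reals_def by simp
  have "AE y in lborel. 0 \<le> f (norm (y :: real^'k::{finite,wellorder}))"
    using AE_lborel_singleton[of "0 :: real^'k::{finite,wellorder}"]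
    by eventually_elim (use B1 in \<open>simp add: assumption_B1_def\<close>)
  then have "0 \<le> (\<integral>y. f (norm (y :: real^'k::{finite,wellorder})) \<partial>lborel)" by (rule integral_nonneg_AE)
  then have "0 \<le> c f" by (simp add: c_def)
  moreover have "c f \<noteq> 0"
  proof
    assume "c f = 0"
    then have "emeasure N UNIV = 0" unfolding N by (simp add: emeasure_density)
    moreover have "emeasure N UNIV = 1"
      using prob_space.emeasure_space_1[OF prob] by (simp add: N)
    ultimately show False by simp
  qed
  ultimately show "0 < c f" by simp
qed (rule N prob)+

text \<open>In polar coordinates the law of the norm has a density proportional to the radial one, and both have
  total mass 1.\<close>

lemma (in spherical_density) cdf_norm_eq_radial_cdf:
  assumes g: "g = on_pos_reals f" and B1: "assumption_B1 CARD('k) f"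
  shows "measure N {y. norm y \<le> x} = radial_cdf CARD('k) f x"
proof -
  interpret prob_space N by (rule prob)
  let ?k = "CARD('k)"
  define v where "v = unit_ball_vol (real ?k) * real ?k * c0"
  have v: "0 \<le> v" using c0_pos by (simp add: v_def)
  define \<rho> where "\<rho> r = r ^ (?k - 1) * g r" for r
  have \<rho>: "0 \<le> \<rho> r" for r using B1 by (auto simp: \<rho>_def g on_pos_reals_def assumption_B1_def)
  have [measurable]: "\<rho> \<in> borel_measurable borel" unfolding \<rho>_def by measurable
  have \<rho>_eq: "\<rho> r = indicator {0<..} r *\<^sub>R (r ^ (?k - 1) * f r)" for r
    by (simp add: \<rho>_def g on_pos_reals_def indicator_def)
  have int: "integrable lborel \<rho>" and mom: "(\<integral>r. \<rho> r \<partial>lborel) = radial_moment (?k - 1) f"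
    using B1 by (simp_all add: \<rho>_eq[abs_def] assumption_B1_def set_integrable_def
        radial_moment_def set_lebesgue_integral_def)
  have polar: "emeasure N {y. norm y \<in> A} = ennreal v * (\<integral>\<^sup>+ r. ennreal (\<rho> r) * indicator A r \<partial>lborel)"
    if A [measurable]: "A \<in> sets borel" for A
  proof -
    have "{y :: real^'k::{finite,wellorder}. norm y \<in> A} = norm -` A \<inter> space borel" by auto
    also have "\<dots> \<in> sets borel" by (rule measurable_sets[OF _ A]) simp
    finally have m: "{y :: real^'k::{finite,wellorder}. norm y \<in> A} \<in> sets lborel" by simp
    have "emeasure N {y. norm y \<in> A} =
        (\<integral>\<^sup>+ y. (\<lambda>r. ennreal (c0 * g r) * indicator A r) (norm y) \<partial>(lborel :: (real^'k::{finite,wellorder}) measure))"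
      unfolding N_def using m by (subst emeasure_density) (auto intro!: nn_integral_cong simp: indicator_def)
    also have "\<dots> = (\<integral>\<^sup>+ r. ennreal (if 0 < r then unit_ball_vol (real ?k) * (real ?k * r ^ (?k - 1)) else 0) *
        (ennreal (c0 * g r) * indicator A r) \<partial>lborel)"
      by (rule nn_integral_radial) auto
    also have "\<dots> = (\<integral>\<^sup>+ r. ennreal v * (ennreal (\<rho> r) * indicator A r) \<partial>lborel)"
    proof (rule nn_integral_cong)
      fix r :: real
      have "ennreal (unit_ball_vol (real ?k) * (real ?k * r ^ (?k - 1))) * ennreal (c0 * g r) = ennreal (v * \<rho> r)"
        if "0 < r" using that by (subst ennreal_mult'[symmetric]) (auto simp: v_def \<rho>_def mult_ac)
      then show "ennreal (if 0 < r then unit_ball_vol (real ?k) * (real ?k * r ^ (?k - 1)) else 0) *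
          (ennreal (c0 * g r) * indicator A r) = ennreal v * (ennreal (\<rho> r) * indicator A r)"
        using v by (cases "0 < r") (auto simp: \<rho>_eq mult.assoc[symmetric] ennreal_mult')
    qed
    also have "\<dots> = ennreal v * (\<integral>\<^sup>+ r. ennreal (\<rho> r) * indicator A r \<partial>lborel)"
      by (rule nn_integral_cmult) measurable
    finally show ?thesis .
  qed
  have "space N = UNIV" by (simp add: N_def)
  then have "1 = ennreal v * (\<integral>\<^sup>+ r. ennreal (\<rho> r) \<partial>lborel)"
    using polar[of UNIV] emeasure_space_1 by simp
  also have "\<dots> = ennreal (v * radial_moment (?k - 1) f)"
    using int \<rho> v by (simp add: nn_integral_eq_integral mom ennreal_mult')
  finally have total: "v * radial_moment (?k - 1) f = 1"
    by (metis ennreal_eq_1)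
  have dens: "ennreal (radial_density ?k f r) = ennreal v * ennreal (\<rho> r)" for r
  proof -
    have "radial_density ?k f r = v * \<rho> r"
      using total by (auto simp: radial_density_def \<rho>_def g on_pos_reals_def divide_eq_eq mult_ac)
    then show ?thesis using v by (simp add: ennreal_mult')
  qed
  have "emeasure (density lborel (\<lambda>r. ennreal (radial_density ?k f r))) {..x} =
      (\<integral>\<^sup>+ r. ennreal v * ennreal (\<rho> r) * indicator {..x} r \<partial>lborel)"
    unfolding dens by (rule emeasure_density) auto
  also have "\<dots> = emeasure N {y. norm y \<in> {..x}}"
    by (subst polar) (auto simp: nn_integral_cmult[symmetric] mult.assoc)
  finally show ?thesis by (simp add: radial_cdf_def cdf_def measure_def)
qed

lemma (in spherical_law) distr_sample:
  assumes P: "prob_space M" and n: "1 \<le> n"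
    and ind: "prob_space.indep_vars M (\<lambda>_. borel) Y {1..n}"
    and N: "\<And>t. t \<in> {1..n} \<Longrightarrow> distr M borel (Y t) = N"
  shows "(\<lambda>\<omega>. \<lambda>t\<in>{1..n}. Y t \<omega>) \<in> measurable M (sample_law n)"
    and "distr M (sample_law n) (\<lambda>\<omega>. \<lambda>t\<in>{1..n}. Y t \<omega>) = sample_law n"
proof -
  interpret M: prob_space M by (rule P)
  have Y: "Y t \<in> borel_measurable M" if "t \<in> {1..n}" for t
    using ind that by (simp add: M.indep_vars_def)
  have sets: "sets (\<Pi>\<^sub>M t\<in>{1..n}. (borel :: (real^'k::{finite,wellorder}) measure)) = sets (sample_law n)"
    unfolding sample_law_def by (rule sets_PiM_cong) (auto simp: sets_N)
  have "(\<lambda>\<omega>. \<lambda>t\<in>{1..n}. Y t \<omega>) \<in> measurable M (\<Pi>\<^sub>M t\<in>{1..n}. borel)"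
    by (intro measurable_restrict Y)
  then show "(\<lambda>\<omega>. \<lambda>t\<in>{1..n}. Y t \<omega>) \<in> measurable M (sample_law n)"
    by (simp only: measurable_cong_sets[OF refl sets])
  have "distr M (sample_law n) (\<lambda>\<omega>. \<lambda>t\<in>{1..n}. Y t \<omega>) =
      distr M (\<Pi>\<^sub>M t\<in>{1..n}. borel) (\<lambda>\<omega>. \<lambda>t\<in>{1..n}. Y t \<omega>)"
    by (rule distr_cong[OF refl sets[symmetric] refl])
  also have "\<dots> = (\<Pi>\<^sub>M t\<in>{1..n}. distr M borel (Y t))"
    using ind n Y by (subst (asm) M.indep_vars_iff_distr_eq_PiM') auto
  also have "\<dots> = sample_law n"
    unfolding sample_law_def by (rule PiM_cong) (auto simp: N)
  finally show "distr M (sample_law n) (\<lambda>\<omega>. \<lambda>t\<in>{1..n}. Y t \<omega>) = sample_law n" .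
qed

text \<open>Scores are evaluated on the closed unit interval, while their regularity is known on the open one
  only. Zero outside the closed interval makes them measurable, whatever their values at 0 and 1.\<close>

definition on_unit_interval :: "(real \<Rightarrow> real) \<Rightarrow> real \<Rightarrow> real" where
  "on_unit_interval K u = (if u \<in> {0..1} then K u else 0)"

lemma on_unit_interval_measurable:
  assumes "assumption_C K" shows "on_unit_interval K \<in> borel_measurable borel"
proof -
  have "continuous_on {0<..<1} K" using assms by (simp add: assumption_C_def)
  then have [measurable]: "(\<lambda>u. indicator {0<..<1} u *\<^sub>R K u) \<in> borel_measurable borel"
    by (intro borel_measurable_continuous_on_indicator) auto
  have "on_unit_interval K = (\<lambda>u. indicator {0<..<1} u *\<^sub>R K u + indicator {0} u * K 0 + indicator {1} u * K 1)"
    by (auto simp: on_unit_interval_def fun_eq_iff indicator_def)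
  also have "\<dots> \<in> borel_measurable borel" by measurable
  finally show ?thesis .
qed

lemma on_unit_interval_assumption_C:
  assumes "assumption_C K" shows "assumption_C (on_unit_interval K)"
proof -
  have eq: "on_unit_interval K u = K u" if "u \<in> {0<..<1}" for u
    using that by (simp add: on_unit_interval_def)
  have "continuous_on {0<..<1} (on_unit_interval K) \<longleftrightarrow> continuous_on {0<..<1} K"
    by (rule continuous_on_cong) (auto simp: eq)
  moreover have "set_integrable lborel {0<..<1} (\<lambda>u. (on_unit_interval K u)\<^sup>2) \<longleftrightarrow>
      set_integrable lborel {0<..<1} (\<lambda>u. (K u)\<^sup>2)"
    by (rule set_integrable_cong) (auto simp: eq)
  ultimately show ?thesis using assms unfolding assumption_C_def by (simp add: eq)
qed

lemma (in spherical_law) elliptical_cross_cov_transform: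
  assumes F: "\<And>x. radial_F x = radial_cdf CARD('k) f x"
    and y: "\<And>t. t \<in> {1..n} \<Longrightarrow> y t = inv_sqrt_mat S *v z t"
    and K: "\<And>u. u \<in> {0..1} \<Longrightarrow> K1 u = K1' u" "\<And>u. u \<in> {0..1} \<Longrightarrow> K2 u = K2' u"
  shows "elliptical_cross_cov K1 K2 S f i n z =
    transpose (inv_sqrt_mat S) ** spherical_cross_cov K1' K2' i n y ** transpose (sqrt_mat S)"
proof -
  have KF: "K1 (radial_F r) = K1' (radial_F r)" "K2 (radial_F r) = K2' (radial_F r)" for r
    using radial_F_bounds[of r] by (auto intro!: K)
  have "(\<Sum>t=i+1..n. (K1' (radial_F (norm (y t))) * K2' (radial_F (norm (y (t - i))))) *\<^sub>R
        outer_prod (sgn (y t)) (sgn (y (t - i)))) =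
      (\<Sum>t=i+1..n. (K1 (radial_cdf CARD('k) f (norm (inv_sqrt_mat S *v z t))) *
        K2 (radial_cdf CARD('k) f (norm (inv_sqrt_mat S *v z (t - i))))) *\<^sub>R
        outer_prod (sgn (inv_sqrt_mat S *v z t)) (sgn (inv_sqrt_mat S *v z (t - i))))"
  proof (rule sum.cong[OF refl])
    fix t assume "t \<in> {i+1..n}"
    then have t: "t \<in> {1..n}" "t - i \<in> {1..n}" by auto
    show "(K1' (radial_F (norm (y t))) * K2' (radial_F (norm (y (t - i))))) *\<^sub>R
        outer_prod (sgn (y t)) (sgn (y (t - i))) =
      (K1 (radial_cdf CARD('k) f (norm (inv_sqrt_mat S *v z t))) *
        K2 (radial_cdf CARD('k) f (norm (inv_sqrt_mat S *v z (t - i))))) *\<^sub>R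
        outer_prod (sgn (inv_sqrt_mat S *v z t)) (sgn (inv_sqrt_mat S *v z (t - i)))"
      unfolding F[symmetric] KF y[OF t(1)] y[OF t(2)] by (rule refl)
  qed
  then show ?thesis unfolding elliptical_cross_cov_def spherical_cross_cov_def Let_def by simp
qed

theorem proposition2:
  fixes p0 p1 q0 q1 i :: nat
    and A B :: "nat \<Rightarrow> real^'k::{finite,wellorder}^'k::{finite,wellorder}"
    and Sigma :: "real^'k::{finite,wellorder}^'k::{finite,wellorder}"
    and f K1 K2 :: "real \<Rightarrow> real"
    and M :: "nat \<Rightarrow> 'a measure"
    and X :: "nat \<Rightarrow> nat \<Rightarrow> 'a \<Rightarrow> real^'k::{finite,wellorder}"
  assumes orders: "p0 \<le> p1" "q0 \<le> q1"
    and vanishing: "\<forall>l\<in>{p0<..p1}. A l = 0" "\<forall>l\<in>{q0<..q1}. B l = 0"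
    and A: "assumption_A p0 q0 A B"
    and Sigma: "sym_pos_def Sigma"
    and B1: "assumption_B1 CARD('k) f"
    and C: "assumption_C K1" "assumption_C K2"
    and lag: "1 \<le> i"
    and hypothesis: "\<forall>n. varma_hypothesis p1 q1 A B Sigma f n (M n) (X n)"
  shows "small_o_prob M
    (\<lambda>n \<omega>. let Z = residual p0 q0 A B (\<lambda>t. X n t \<omega>) in
       vec_mat (rank_cross_cov K1 K2 i n Z - elliptical_cross_cov K1 K2 Sigma f i n Z))
    (\<lambda>n. real n powr (- 1 / 2))"
proof -
  define T where "T = inv_sqrt_mat Sigma"
  have T: "pos_triangular T" "T ** sqrt_mat Sigma = mat 1" "sqrt_mat Sigma ** T = mat 1"
    unfolding T_def using inv_sqrt_mat_properties(1) inv_sqrt_mat_inverse Sigma by blast+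
  have "\<forall>n. \<exists>e. prob_space.indep_vars (M n) (\<lambda>_. borel) e {1..n} \<and>
      (\<forall>t\<in>{1..n}. distributed (M n) lborel (e t) (\<lambda>z. ennreal (elliptical_density Sigma f z))) \<and>
      (\<forall>t\<in>{1..n}. \<forall>\<omega>\<in>space (M n). varma_equation p1 q1 A B (\<lambda>s. e s \<omega>) (\<lambda>s. X n s \<omega>) t)"
    using hypothesis unfolding varma_hypothesis_def by blast
  then obtain e where
    indep: "\<And>n. prob_space.indep_vars (M n) (\<lambda>_. borel) (e n) {1..n}"
    and dens: "\<And>n t. t \<in> {1..n} \<Longrightarrow>
      distributed (M n) lborel (e n t) (\<lambda>z. ennreal (elliptical_density Sigma f z))"
    and varma: "\<And>n t \<omega>. t \<in> {1..n} \<Longrightarrow> \<omega> \<in> space (M n) \<Longrightarrow>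
      varma_equation p1 q1 A B (\<lambda>s. e n s \<omega>) (\<lambda>s. X n s \<omega>) t"
    by metis
  have M: "prob_space (M n)" for n using hypothesis unfolding varma_hypothesis_def by blast
  define c0 where "c0 = inverse (\<integral>y. f (norm (y :: real^'k::{finite,wellorder})) \<partial>lborel)"
  define N where "N = density lborel (\<lambda>y :: real^'k::{finite,wellorder}. ennreal (c0 * on_pos_reals f (norm y)))"
  have T_meas: "(\<lambda>z. T *v z) \<in> borel_measurable borel"
    by (intro borel_measurable_continuous_onI continuous_intros)
  define Y where "Y n t \<omega> = T *v e n t \<omega>" for n t \<omega>
  have law: "distr (M n) borel (Y n t) = N" if "t \<in> {1..n}" for n t
    unfolding Y_def T_def N_def c0_def by (rule whitened_law[OF Sigma B1 dens[OF that]])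
  have N_prob: "prob_space N"
  proof -
    have "e 1 1 \<in> borel_measurable (M 1)" using dens[of 1 1] by (simp add: distributed_def)
    then have "Y 1 1 \<in> borel_measurable (M 1)"
      unfolding Y_def using T_meas by (rule measurable_compose)
    then have "prob_space (distr (M 1) borel (Y 1 1))"
      by (rule prob_space.prob_space_distr[OF M])
    moreover have "distr (M 1) borel (Y 1 1) = N" by (rule law) simp
    ultimately show ?thesis by (simp only:)
  qed
  interpret D: spherical_density "on_pos_reals f" c0 N
    unfolding c0_def by (rule whitened_spherical_density[OF B1 N_prob N_def[unfolded c0_def]])
  interpret spherical_law N by (rule D.spherical_law_N)
  have F: "radial_F x = radial_cdf CARD('k) f x" for x
    unfolding radial_F_def by (rule D.cdf_norm_eq_radial_cdf[OF refl B1])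
  let ?K1 = "on_unit_interval K1" and ?K2 = "on_unit_interval K2"
  have K: "K1 u = ?K1 u" "K2 u = ?K2 u" if "u \<in> {0..1}" for u
    using that by (simp_all add: on_unit_interval_def)
  define \<Delta> where "\<Delta> n \<omega> = (let Z = residual p0 q0 A B (\<lambda>t. X n t \<omega>) in
    vec_mat (rank_cross_cov K1 K2 i n Z - elliptical_cross_cov K1 K2 Sigma f i n Z))" for n \<omega>
  define smp where "smp n \<omega> = (\<lambda>t\<in>{1..n}. Y n t \<omega>)" for n \<omega>
  \<comment> \<open>Adding 1 makes the factor positive, whence one may divide by it.\<close>
  define b where "b = norm T * norm (sqrt_mat Sigma) + 1"
  have b: "0 < b" unfolding b_def by (intro add_nonneg_pos mult_nonneg_nonneg) auto
  have \<Delta>_le: "norm (\<Delta> n \<omega>) \<le> b * norm (rank_cross_cov ?K1 ?K2 i n (smp n \<omega>) -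
      spherical_cross_cov ?K1 ?K2 i n (smp n \<omega>))"
    if \<omega>: "\<omega> \<in> space (M n)" and sol: "tyler_solution n (smp n \<omega>) C"
      "\<And>C'. tyler_solution n (smp n \<omega>) C' \<Longrightarrow> C' = C" for n \<omega> C
  proof -
    define Z where "Z = residual p0 q0 A B (\<lambda>t. X n t \<omega>)"
    have Z: "Z t = e n t \<omega>" if "t \<in> {1..n}" for t
      unfolding Z_def using residual_eq_innovation[OF orders vanishing varma that] \<omega> by blast
    have y: "smp n \<omega> t = T *v Z t" if "t \<in> {1..n}" for t
      using that by (simp add: smp_def Y_def Z)
    let ?d = "rank_cross_cov ?K1 ?K2 i n (smp n \<omega>) - spherical_cross_cov ?K1 ?K2 i n (smp n \<omega>)"
    have "rank_cross_cov K1 K2 i n Z = rank_cross_cov ?K1 ?K2 i n Z"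
      by (rule rank_cross_cov_score_cong) (rule K; assumption)+
    also have "\<dots> = transpose T ** rank_cross_cov ?K1 ?K2 i n (smp n \<omega>) ** transpose (sqrt_mat Sigma)"
      by (rule rank_cross_cov_transform[OF T y sol])
    finally have "rank_cross_cov K1 K2 i n Z - elliptical_cross_cov K1 K2 Sigma f i n Z =
        transpose T ** ?d ** transpose (sqrt_mat Sigma)"
      using elliptical_cross_cov_transform[OF F y[unfolded T_def] K, where i = i]
      by (simp add: T_def matrix_diff_mult)
    then have "norm (\<Delta> n \<omega>) = norm (transpose T ** ?d ** transpose (sqrt_mat Sigma))"
      by (simp add: \<Delta>_def Z_def[symmetric] norm_vec_mat)
    also have "\<dots> \<le> norm (transpose T ** ?d) * norm (transpose (sqrt_mat Sigma))"
      by (rule norm_matrix_mult_le)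
    also have "\<dots> \<le> (norm (transpose T) * norm ?d) * norm (transpose (sqrt_mat Sigma))"
      by (intro mult_right_mono norm_matrix_mult_le) simp
    also have "\<dots> \<le> b * norm ?d" by (simp add: norm_transpose b_def distrib_right)
    finally show ?thesis .
  qed
  have "(\<lambda>n. outer_measure_of (M n) {\<omega> \<in> space (M n). \<epsilon> * real n powr (- 1 / 2) < norm (\<Delta> n \<omega>)}) \<longlonglongrightarrow> 0"
    if \<epsilon>: "0 < \<epsilon>" for \<epsilon>
  proof (rule tendsto_zero_ennreal)
    fix r :: real assume r: "0 < r"
    obtain n0 where n0: "\<And>n. n0 \<le> n \<Longrightarrow> \<exists>B\<in>sets (sample_law n). measure (sample_law n) B \<le> r / 2 \<and>
      (\<forall>y\<in>space (sample_law n) - B.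
        (\<exists>C. tyler_solution n y C \<and> (\<forall>C'. tyler_solution n y C' \<longrightarrow> C' = C)) \<and>
        norm (rank_cross_cov ?K1 ?K2 i n y - spherical_cross_cov ?K1 ?K2 i n y) \<le> (\<epsilon> / b) / sqrt (real n))"
    proof (rule spherical_approximation)
      show "assumption_C ?K1" "assumption_C ?K2" by (intro on_unit_interval_assumption_C C)+
      show "?K1 \<in> borel_measurable borel" "?K2 \<in> borel_measurable borel"
        by (intro on_unit_interval_measurable C)+
      show "1 \<le> i" by (rule lag)
      show "0 < \<epsilon> / b" using \<epsilon> b by simp
      show "0 < r / 2" using r by simp
    qed blast
    show "\<forall>\<^sub>F n in sequentially.
        outer_measure_of (M n) {\<omega> \<in> space (M n). \<epsilon> * real n powr (- 1 / 2) < norm (\<Delta> n \<omega>)} < ennreal r"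
    proof (rule eventually_sequentiallyI[of "max n0 1"])
      fix n assume "max n0 1 \<le> n"
      then have n: "n0 \<le> n" "1 \<le> n" by auto
      interpret S: prob_space "sample_law n" by (rule prob_space_sample)
      obtain E where E: "E \<in> sets (sample_law n)" "measure (sample_law n) E \<le> r / 2"
        and good: "\<And>y. y \<in> space (sample_law n) - E \<Longrightarrow>
          (\<exists>C. tyler_solution n y C \<and> (\<forall>C'. tyler_solution n y C' \<longrightarrow> C' = C)) \<and>
          norm (rank_cross_cov ?K1 ?K2 i n y - spherical_cross_cov ?K1 ?K2 i n y) \<le> (\<epsilon> / b) / sqrt (real n)"
        using n0[OF n(1)] by blast
      have ind: "prob_space.indep_vars (M n) (\<lambda>_. borel) (Y n) {1..n}"
        unfolding Y_def by (rule prob_space.indep_vars_compose2[OF M indep]) (rule T_meas)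
      have smp_meas: "smp n \<in> measurable (M n) (sample_law n)"
        and smp_distr: "distr (M n) (sample_law n) (smp n) = sample_law n"
        unfolding smp_def using distr_sample[OF M n(2) ind law] by auto
      have "{\<omega> \<in> space (M n). \<epsilon> * real n powr (- 1 / 2) < norm (\<Delta> n \<omega>)} \<subseteq> smp n -` E \<inter> space (M n)"
      proof safe
        fix \<omega> assume \<omega>: "\<omega> \<in> space (M n)" and big: "\<epsilon> * real n powr (- 1 / 2) < norm (\<Delta> n \<omega>)"
        show "\<omega> \<in> smp n -` E"
        proof (rule ccontr)
          assume "\<omega> \<notin> smp n -` E"
          then have "smp n \<omega> \<in> space (sample_law n) - E"
            using measurable_space[OF smp_meas \<omega>] by simp
          from good[OF this] obtain C where sol: "tyler_solution n (smp n \<omega>) C"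
              "\<And>C'. tyler_solution n (smp n \<omega>) C' \<Longrightarrow> C' = C"
            and close: "norm (rank_cross_cov ?K1 ?K2 i n (smp n \<omega>) - spherical_cross_cov ?K1 ?K2 i n (smp n \<omega>))
              \<le> (\<epsilon> / b) / sqrt (real n)" by blast
          have "norm (\<Delta> n \<omega>) \<le> b * ((\<epsilon> / b) / sqrt (real n))"
            using \<Delta>_le[OF \<omega> sol] mult_left_mono[OF close, of b] b by linarith
          also have "\<dots> = \<epsilon> * real n powr (- 1 / 2)"
            using b n by (simp add: powr_minus_divide powr_half_sqrt)
          finally show False using big by simp
        qed
      qed
      then have "outer_measure_of (M n) {\<omega> \<in> space (M n). \<epsilon> * real n powr (- 1 / 2) < norm (\<Delta> n \<omega>)}
          \<le> outer_measure_of (M n) (smp n -` E \<inter> space (M n))"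
        by (rule outer_measure_of_mono)
      also have "\<dots> = emeasure (M n) (smp n -` E \<inter> space (M n))"
        by (rule outer_measure_of_eq[OF measurable_sets[OF smp_meas E(1)]])
      also have "\<dots> = emeasure (distr (M n) (sample_law n) (smp n)) E"
        by (rule emeasure_distr[OF smp_meas E(1), symmetric])
      also have "\<dots> = ennreal (measure (sample_law n) E)" unfolding smp_distr by (rule S.emeasure_eq_measure)
      also have "\<dots> \<le> ennreal (r / 2)" by (rule ennreal_leI[OF E(2)])
      also have "\<dots> < ennreal r" using r by (simp add: ennreal_lessI)
      finally show "outer_measure_of (M n) {\<omega> \<in> space (M n). \<epsilon> * real n powr (- 1 / 2) < norm (\<Delta> n \<omega>)} < ennreal r" .
    qed
  qed
  then show ?thesis unfolding small_o_prob_def \<Delta>_def by blast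
qed

end
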